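(* Assume the standing setup, the moment assumption (M), assumption (Mix) with $\theta>\frac{4w}{w-2}$ (where $w$ is from (M)), and $\bar F=0$. Assume in addition that the limits $b(t,s)=\lim_{N\to\infty}\mathbb E[\mathcal S_N(t)\mathcal S_N(s)]$ exist for all $t,s\in[0,1]$. Then the random functions $\mathcal S_N:[0,1]\to\mathbb R$ converge in distribution (in the Skorokhod space $D[0,1]$) as $N\to\infty$ to a centered Gaussian process $\eta$ with $\mathbb E[\eta(t)\eta(s)]=b(t,s)$.
   Context: Standing setup. Let $(\Omega,\mathcal F,P)$ be a probability space, $\wp\ge1$, and $\{\xi_n\}_{n\ge0}$ a sequence of $\mathbb R^\wp$-valued random vectors on it. Let $\{\mathcal F_{k,l}:-\infty\le k\le l\le\infty\}$ be sub-$\sigma$-algebras of $\mathcal F$ with $\mathcal F_{k,l}\subset\mathcal F_{k',l'}$ whenever $k'\le k$ and $l\le l'$. For sub-$\sigma$-algebras $\mathcal G,\mathcal H$ put $\phi(\mathcal G,\mathcal H)=\sup\{|P(\Gamma\cap\Delta)/P(\Gamma)-P(\Delta)|:\Gamma\in\mathcal G,\Delta\in\mathcal H,P(\Gamma)>0\}$ and $\phi(n)=\sup_{k\in\mathbb Z}\phi(\mathcal F_{-\infty,k},\mathcal F_{k+n,\infty})$. For $q\ge1$, $r\ge0$ put $\beta_q(r)=\sup_{k\ge0}\|\xi_k-\mathbb E[\xi_k\mid\mathcal F_{k-r,k+r}]\|_{L^q}$. Stationarity: every $\xi_n$ has the same distribution $\mu$, and the joint distribution of $(\xi_n,\xi_m)$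 depends only on $m-n$. The function $F:(\mathbb R^\wp)^\ell\to\mathbb R$ satisfies, for some constants $K>0$, $\iota\ge0$, $\kappa\in(0,1]$ and all $x,z$: $|F(x)-F(z)|\le K[1+\sum_{i=1}^\ell(|x_i|^\iota+|z_i|^\iota)]\sum_{i=1}^\ell|x_i-z_i|^\kappa$ and $|F(x)|\le K[1+\sum_{i=1}^\ell|x_i|^\iota]$; $\bar F=\int F\,d\mu(x_1)\cdots d\mu(x_\ell)$. Moment assumption (M): there are $w>4$, $q\ge1$, $v>0$ with $\frac1w>\frac{\iota}{v}+\frac{\kappa}{q}$ and $\|\xi_0\|_{L^v},\|\xi_0\|_{L^w},\|\xi_0\|_{L^q}<\infty$. Assumption (Mix): there are $d\ge1$, $\theta>2$ with $\phi(n)+(\beta_q(n))^\kappa\le dn^{-\theta}$ for all $n\in\mathbb N$. Polynomials: $q_1,\dots,q_\ell$ are polynomials in $(n,N)$ with nonnegative integer coefficients, none depending only on $N$; the degree of $p(x,y)$ is the degree of $p(x,x)$; $\deg q_i\le\deg q_{i+1}$; $q_i-q_j$ is not constant for $i\neq j$; each linear $q_i$ has the form $q_i(n,N)=a_in+b_iN$ with integers $a_i,b_i$. Set $F_{n,N}=F(\xi_{q_1(n,N)},\dots,\xi_{q_\ell(n,N)})$ and $\mathcal S_N(t)=N^{-1/2}\sum_{n=1}^{[Nt]}F_{n,N}$, $t\in[0,1]$. *)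

theory Defs
  imports "HOL-Probability.Probability" "HOL-Computational_Algebra.Polynomial"
begin

text \<open>Real power with the convention x^0 = 1 (also for x = 0).\<close>
definition npow :: "real \<Rightarrow> real \<Rightarrow> real" where
  "npow x a = (if a = 0 then 1 else x powr a)"

definition Lp_norm :: "'a measure \<Rightarrow> real \<Rightarrow> ('a \<Rightarrow> 'b::real_normed_vector) \<Rightarrow> ereal" where
  "Lp_norm M p f =
     (let I = (\<integral>\<^sup>+ x. ennreal (norm (f x) powr p) \<partial>M)
      in if I = \<infinity> then \<infinity> else ereal (enn2real I powr (1 / p)))"

definition cond_exp_vec :: "'a measure \<Rightarrow> 'a measure \<Rightarrow> ('a \<Rightarrow> 'b::euclidean_space) \<Rightarrow> 'a \<Rightarrow> 'b" where
  "cond_exp_vec M G X = (\<lambda>\<omega>. \<Sum>b\<in>Basis. real_cond_exp M G (\<lambda>x. X x \<bullet> b) \<omega> *\<^sub>R b)"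

definition phi_coef :: "'a measure \<Rightarrow> 'a measure \<Rightarrow> 'a measure \<Rightarrow> real" where
  "phi_coef M G H = Sup {\<bar>measure M (\<Gamma> \<inter> \<Delta>) / measure M \<Gamma> - measure M \<Delta>\<bar> | \<Gamma> \<Delta>.
      \<Gamma> \<in> sets G \<and> \<Delta> \<in> sets H \<and> measure M \<Gamma> > 0}"

definition phi_mix :: "'a measure \<Rightarrow> (ereal \<Rightarrow> ereal \<Rightarrow> 'a measure) \<Rightarrow> nat \<Rightarrow> real" where
  "phi_mix M Fs n = Sup (range (\<lambda>k::int.
      phi_coef M (Fs (-\<infinity>) (ereal (real_of_int k))) (Fs (ereal (real_of_int k + real n)) \<infinity>)))"

definition beta_approx :: "'a measure \<Rightarrow> (ereal \<Rightarrow> ereal \<Rightarrow> 'a measure) \<Rightarrow> (nat \<Rightarrow> 'a \<Rightarrow> 'b::euclidean_space)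
    \<Rightarrow> real \<Rightarrow> nat \<Rightarrow> ereal" where
  "beta_approx M Fs \<xi> q r = (SUP k\<in>(UNIV::nat set).
      Lp_norm M q (\<lambda>\<omega>. \<xi> k \<omega> -
        cond_exp_vec M (Fs (ereal (real k - real r)) (ereal (real k + real r))) (\<xi> k) \<omega>))"

text \<open>A polynomial is given by its finitely supported coefficient function:
  c (a,b) is the coefficient of n^a N^b.\<close>
definition poly2 :: "(nat \<times> nat \<Rightarrow> nat) \<Rightarrow> nat \<Rightarrow> nat \<Rightarrow> nat" where
  "poly2 c n N = (\<Sum>p\<in>{p. c p \<noteq> 0}. c p * n ^ fst p * N ^ snd p)"

text \<open>The degree of p(x,y) is the degree of the one-variable polynomial p(x,x).\<close>
definition diag_poly :: "(nat \<times> nat \<Rightarrow> nat) \<Rightarrow> int poly" where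
  "diag_poly c = (\<Sum>p\<in>{p. c p \<noteq> 0}. monom (int (c p)) (fst p + snd p))"

definition deg2 :: "(nat \<times> nat \<Rightarrow> nat) \<Rightarrow> nat" where
  "deg2 c = degree (diag_poly c)"

definition cadlag01 :: "(real \<Rightarrow> real) \<Rightarrow> bool" where
  "cadlag01 f \<longleftrightarrow> (\<forall>t\<in>{0..<1}. (f \<longlongrightarrow> f t) (at_right t)) \<and>
                   (\<forall>t\<in>{0<..1}. \<exists>l. (f \<longlongrightarrow> l) (at_left t))"

definition Dspace :: "(real \<Rightarrow> real) set" where
  "Dspace = {f. cadlag01 f}"

definition time_changes :: "(real \<Rightarrow> real) set" where
  "time_changes = {la. strict_mono_on {0..1} la \<and> continuous_on {0..1} la \<and> la ` {0..1} = {0..1}}"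

definition skorokhod_dist :: "(real \<Rightarrow> real) \<Rightarrow> (real \<Rightarrow> real) \<Rightarrow> real" where
  "skorokhod_dist x y = Inf ((\<lambda>la. max (SUP t\<in>{0..1}. \<bar>la t - t\<bar>) (SUP t\<in>{0..1}. \<bar>x t - y (la t)\<bar>))
                               ` time_changes)"

definition bounded_cont_D :: "((real \<Rightarrow> real) \<Rightarrow> real) \<Rightarrow> bool" where
  "bounded_cont_D h \<longleftrightarrow> (\<exists>B. \<forall>f\<in>Dspace. \<bar>h f\<bar> \<le> B) \<and>
     (\<forall>f\<in>Dspace. \<forall>\<epsilon>>0. \<exists>\<delta>>0. \<forall>g\<in>Dspace. skorokhod_dist f g < \<delta> \<longrightarrow> \<bar>h g - h f\<bar> < \<epsilon>)"

definition gaussian_law :: "real measure \<Rightarrow> bool" where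
  "gaussian_law P \<longleftrightarrow> (\<exists>m \<sigma>. \<sigma> \<ge> 0 \<and>
      P = (if \<sigma> = 0 then return borel m else density lborel (normal_density m \<sigma>)))"

text \<open>Q is the law (on paths) of a centered Gaussian process indexed by [0,1],
  with paths in D[0,1] and covariance b; the process is the coordinate process.\<close>
definition centered_gaussian_D_law :: "(real \<Rightarrow> real) measure \<Rightarrow> (real \<Rightarrow> real \<Rightarrow> real) \<Rightarrow> bool" where
  "centered_gaussian_D_law Q b \<longleftrightarrow> prob_space Q \<and> space Q \<subseteq> Dspace \<and>
     (\<forall>t\<in>{0..1}. (\<lambda>f. f t) \<in> borel_measurable Q) \<and>
     (\<forall>k (ts::nat \<Rightarrow> real) (a::nat \<Rightarrow> real). (\<forall>i<k. ts i \<in> {0..1}) \<longrightarrow>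
         gaussian_law (distr Q borel (\<lambda>f. \<Sum>i<k. a i * f (ts i)))) \<and>
     (\<forall>t\<in>{0..1}. (\<integral>f. f t \<partial>Q) = 0) \<and>
     (\<forall>t\<in>{0..1}. \<forall>s\<in>{0..1}. (\<integral>f. f t * f s \<partial>Q) = b t s)"

definition conv_distr_D :: "'a measure \<Rightarrow> (nat \<Rightarrow> 'a \<Rightarrow> real \<Rightarrow> real) \<Rightarrow> (real \<Rightarrow> real) measure \<Rightarrow> bool" where
  "conv_distr_D M X Q \<longleftrightarrow> (\<forall>h. bounded_cont_D h \<longrightarrow> h \<in> borel_measurable Q \<and>
      ((\<lambda>N. \<integral>\<omega>. h (X N \<omega>) \<partial>M) \<longlonglongrightarrow> (\<integral>f. h f \<partial>Q)))"

definition S_N :: "((nat \<Rightarrow> 'b) \<Rightarrow> real) \<Rightarrow> (nat \<Rightarrow> 'a \<Rightarrow> 'b) \<Rightarrow> (nat \<Rightarrow> nat \<times> nat \<Rightarrow> nat)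
    \<Rightarrow> nat \<Rightarrow> real \<Rightarrow> 'a \<Rightarrow> real" where
  "S_N F \<xi> c N t \<omega> = (1 / sqrt (real N)) *
      (\<Sum>n\<in>{1..nat \<lfloor>real N * t\<rfloor>}. F (\<lambda>i. \<xi> (poly2 (c i) n N) \<omega>))"

end

theory Submission
  imports Defs "HOL-Real_Asymp.Real_Asymp"
begin

text \<open>
  Replacing each \<open>\<xi> k\<close> by its conditional expectation \<open>xr r k\<close> on a window of radius \<open>r\<close> makes
  \<open>F\<close> of the vectors at the positions \<open>q i (n, N)\<close> a functional that is nearly independent of the
  summands at all positions farther than \<open>2 * r\<close> away, and each summand has boundedly many neighbours because
  the positions are injective in \<open>n\<close>. Interlaced decoupling with the mixing coefficient and Davydov's inequality then
  bound covariances by the distance of positions, which yields third moments of order \<open>n powr (3 / 2)\<close> for partial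
  sums (hence tightness by dyadic chaining) and, through Stein's identity, Gaussian limits of trigonometric
  moments. The variance is never computed: only the assumed convergence of covariances enters. The limit
  process is built from a Cholesky factorisation and chaining, so no tightness theorem in the Skorokhod
  space is used.
\<close>

section \<open>Moment inequalities on a probability space\<close>

text \<open>Summands that are far apart in \<open>n\<close> may have neighbouring positions, and the
  positions of two summands may interleave in any order, so cutting the index range into blocks does
  not separate dependent summands. Dependence is therefore recorded as a neighbourhood relation
  between summands with balls and shells of controlled size, and the decoupling bound has to be one
  whose cost is governed by only one of the two groups of variables, because the other group is the
  whole rest of the array.

  The condition on \<open>\<theta>\<close> says \<open>\<theta> * (1 - 2 / w) > 4\<close>. In
  Stein's identity a neighbourhood of radius \<open>N powr h\<close> costs the order of
  \<open>N powr (2 * h - 1/2)\<close>, which forces \<open>h < 1/4\<close>, while the covariances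
  left outside must vanish after multiplication by \<open>N\<close>, which forces
  \<open>h * \<theta> * (1 - 2 / w) > 1\<close>. Such an \<open>h\<close> exists exactly under that
  condition.

  Third moments are enough for tightness, since chaining needs an exponent above 1 and they supply
  3/2.\<close>

lemma weighted_amgm3:
  fixes x y z a b c :: real
  assumes "x > 0" "y > 0" "z > 0" "a >= 0" "b >= 0" "c >= 0" "a + b + c <= 1"
  shows "x powr a * y powr b * z powr c <= a * x + b * y + c * z + (1 - a - b - c)"
proof -
  define T where "T = a * ln x + b * ln y + c * ln z"
  have eq: "x powr a * y powr b * z powr c = exp T"
    using assms(1-3) by (simp add: powr_def T_def exp_add)
  \<comment> \<open>Tangent line of \<open>exp\<close> at \<open>T\<close>, written in the variable
    \<open>ln u\<close>. As \<open>T\<close> is the average of \<open>ln x\<close>,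
    \<open>ln y\<close>, \<open>ln z\<close> and \<open>ln 1\<close> with weights \<open>a\<close>,
    \<open>b\<close>, \<open>c\<close> and the remainder, the linear terms cancel on summation; the
    fourth point 1 absorbs the missing weight.\<close>
  have tan: "u >= exp T * (1 + ln u - T)" if "u > 0" for u
  proof -
    have "1 + (ln u - T) <= exp (ln u - T)" by (rule exp_ge_add_one_self)
    then have "exp T * (1 + (ln u - T)) <= exp T * exp (ln u - T)" by simp
    also have "... = u" using that by (simp flip: exp_add)
    finally show ?thesis by (simp add: algebra_simps)
  qed
  have "exp T = a * (exp T * (1 + ln x - T)) + b * (exp T * (1 + ln y - T)) + c * (exp T * (1 + ln z - T))
      + (1 - a - b - c) * (exp T * (1 + ln 1 - T))"
    by (simp add: T_def algebra_simps)
  also have "... <= a * x + b * y + c * z + (1 - a - b - c) * 1"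
    by (intro add_mono mult_left_mono tan assms) (use assms in auto)
  finally show ?thesis using eq by simp
qed

section \<open>Three-factor Hoelder inequality and a calculus of L^p bounds\<close>

context prob_space begin

text \<open>Each factor is divided by its mean and the weighted arithmetic-geometric inequality is
  integrated. Exponents may sum to less than 1 because the total mass is 1. A vanishing mean cannot
  be divided by and is treated apart.\<close>

lemma holder3:
  fixes A B C :: "'a => real"
  assumes int: "integrable M A" "integrable M B" "integrable M C"
    and nn: "!!x. A x >= 0" "!!x. B x >= 0" "!!x. C x >= 0"
    and e: "a >= 0" "b >= 0" "c >= 0" "a + b + c <= 1"
  shows "integrable M (%x. A x powr a * B x powr b * C x powr c)"
    and "expectation (%x. A x powr a * B x powr b * C x powr c)
      <= expectation A powr a * expectation B powr b * expectation C powr c"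
proof -
  let ?f = "%x. A x powr a * B x powr b * C x powr c"
  have [measurable]: "A \<in> borel_measurable M" "B \<in> borel_measurable M" "C \<in> borel_measurable M"
    using int by auto
  have nnE: "expectation A >= 0" "expectation B >= 0" "expectation C >= 0" using nn by auto
  have "integrable M ?f \<and> expectation ?f <= expectation A powr a * expectation B powr b * expectation C powr c"
  proof (cases "expectation A = 0 \<or> expectation B = 0 \<or> expectation C = 0")
    case True
    then have "(AE x in M. A x = 0) \<or> (AE x in M. B x = 0) \<or> (AE x in M. C x = 0)"
      using integral_nonneg_eq_0_iff_AE[OF int(1)] integral_nonneg_eq_0_iff_AE[OF int(2)]
        integral_nonneg_eq_0_iff_AE[OF int(3)] nn by auto
    \<comment> \<open>The convention \<open>0 powr a = 0\<close> holds for \<open>a = 0\<close> as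
      well, so the product vanishes wherever one factor does.\<close>
    then have ae: "AE x in M. ?f x = 0" by (elim disjE) (auto elim!: eventually_mono)
    have "integrable M ?f \<longleftrightarrow> integrable M (%x. 0::real)"
      by (intro integrable_cong_AE) (use ae in auto)
    moreover have "expectation ?f = expectation (%x. 0)" by (intro integral_cong_AE) (use ae in auto)
    ultimately show ?thesis by simp
  next
    case False
    define EA EB EC where d: "EA = expectation A" "EB = expectation B" "EC = expectation C"
    have pos: "EA > 0" "EB > 0" "EC > 0" using False nnE by (auto simp: d)
    let ?P = "EA powr a * EB powr b * EC powr c"
    let ?g = "%x. ?P * (a * (A x / EA) + b * (B x / EB) + c * (C x / EC) + (1 - a - b - c))"
    have Ppos: "?P > 0" using pos by simp
    have le: "?f x <= ?g x" for x
    proof (cases "A x = 0 \<or> B x = 0 \<or> C x = 0")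
      case True
      then have "?f x = 0" by auto
      moreover have "?g x >= 0" using nn e pos by (intro mult_nonneg_nonneg add_nonneg_nonneg) auto
      ultimately show ?thesis by linarith
    next
      case False
      then have p: "A x > 0" "B x > 0" "C x > 0" using nn by (auto simp: less_le)
      have "?f x = ?P * ((A x / EA) powr a * (B x / EB) powr b * (C x / EC) powr c)"
        using pos p by (simp add: powr_divide)
      also have "... <= ?g x"
        by (intro mult_left_mono weighted_amgm3) (use pos p e in auto)
      finally show ?thesis .
    qed
    have ig: "integrable M ?g" using int by (intro integrable_mult_right) auto
    have intf: "integrable M ?f"
      by (rule Bochner_Integration.integrable_bound[OF ig]) (use le nn in \<open>auto simp: abs_of_nonneg intro!: order_trans[OF le] abs_ge_self\<close>)
    have "expectation ?f <= expectation ?g" by (intro integral_mono intf ig le)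
    also have "... = ?P * (a * (EA / EA) + b * (EB / EB) + c * (EC / EC) + (1 - a - b - c))"
      using int by (simp add: d prob_space)
    also have "... = ?P" using pos by simp
    finally show ?thesis using intf by (simp add: d)
  qed
  then show "integrable M ?f" "expectation ?f <= expectation A powr a * expectation B powr b * expectation C powr c"
    by auto
qed

text \<open>An upper bound \<open>A\<close> for the L^p norm, bundled with measurability and
  integrability. Only bounds are propagated, never norms themselves, so lossy constants are
  acceptable and every \<open>p > 0\<close> is allowed.\<close>

definition Lpb :: "real => real => ('a => real) => bool" where
  "Lpb p A X \<longleftrightarrow> X \<in> borel_measurable M \<and> A >= 0 \<and> integrable M (%x. \<bar>X x\<bar> powr p) \<and>
     expectation (%x. \<bar>X x\<bar> powr p) <= A powr p"

lemma Lpb_meas: "Lpb p A X ==> X \<in> borel_measurable M" by (simp add: Lpb_def)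

lemma powr_expand: "(x::real) >= 0 ==> p \<noteq> 0 ==> (x powr p) powr (r / p) = x powr r"
  by (simp add: powr_powr)

lemma Lpb_prod3_gen:
  assumes X: "Lpb p A X" and Y: "Lpb q B Y" and Z: "Lpb s C Z"
    and pos: "p > 0" "q > 0" "s > 0" and e: "x >= 0" "y >= 0" "z >= 0" "x / p + y / q + z / s <= 1"
  shows "integrable M (%w. \<bar>X w\<bar> powr x * \<bar>Y w\<bar> powr y * \<bar>Z w\<bar> powr z)"
    and "expectation (%w. \<bar>X w\<bar> powr x * \<bar>Y w\<bar> powr y * \<bar>Z w\<bar> powr z) <= A powr x * B powr y * C powr z"
proof -
  let ?X = "%w. \<bar>X w\<bar> powr p" and ?Y = "%w. \<bar>Y w\<bar> powr q" and ?Z = "%w. \<bar>Z w\<bar> powr s"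
  have i: "integrable M ?X" "integrable M ?Y" "integrable M ?Z"
    and l: "expectation ?X <= A powr p" "expectation ?Y <= B powr q" "expectation ?Z <= C powr s"
    and AB: "A >= 0" "B >= 0" "C >= 0"
    using X Y Z by (auto simp: Lpb_def)
  have E: "x / p >= 0" "y / q >= 0" "z / s >= 0" using pos e by auto
  note H = holder3[OF i _ _ _ E e(4)]
  have eq: "(\<bar>X w\<bar> powr p) powr (x/p) * (\<bar>Y w\<bar> powr q) powr (y/q) * (\<bar>Z w\<bar> powr s) powr (z/s)
    = \<bar>X w\<bar> powr x * \<bar>Y w\<bar> powr y * \<bar>Z w\<bar> powr z" for w
    using pos by (simp add: powr_expand)
  show "integrable M (%w. \<bar>X w\<bar> powr x * \<bar>Y w\<bar> powr y * \<bar>Z w\<bar> powr z)"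
    using H(1) unfolding eq by simp
  have "expectation (%w. \<bar>X w\<bar> powr x * \<bar>Y w\<bar> powr y * \<bar>Z w\<bar> powr z)
     <= expectation ?X powr (x/p) * expectation ?Y powr (y/q) * expectation ?Z powr (z/s)"
    using H(2) unfolding eq by simp
  also have "... <= (A powr p) powr (x/p) * (B powr q) powr (y/q) * (C powr s) powr (z/s)"
    by (intro mult_mono powr_mono2 l E mult_nonneg_nonneg) auto
  also have "... = A powr x * B powr y * C powr z" using pos AB by (simp add: powr_expand)
  finally show "expectation (%w. \<bar>X w\<bar> powr x * \<bar>Y w\<bar> powr y * \<bar>Z w\<bar> powr z) <= A powr x * B powr y * C powr z" .
qed

lemma Lpb_const: "p > 0 ==> Lpb p \<bar>c\<bar> (%_. c)"
  by (simp add: Lpb_def prob_space)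

lemma Lpb_prod3:
  assumes "Lpb p A X" "Lpb q B Y" "Lpb s C Z" "p > 0" "q > 0" "s > 0" "1 / p + 1 / q + 1 / s <= 1"
  shows "integrable M (%w. X w * Y w * Z w)" "expectation (%w. \<bar>X w * Y w * Z w\<bar>) <= A * B * C"
proof -
  have [measurable]: "X \<in> borel_measurable M" "Y \<in> borel_measurable M" "Z \<in> borel_measurable M"
    using assms by (auto dest: Lpb_meas)
  have AB: "A >= 0" "B >= 0" "C >= 0" using assms by (auto simp: Lpb_def)
  have eq: "\<bar>X w\<bar> powr 1 * \<bar>Y w\<bar> powr 1 * \<bar>Z w\<bar> powr 1 = \<bar>X w * Y w * Z w\<bar>" for w
    by (simp add: abs_mult)
  note L = Lpb_prod3_gen[OF assms(1-6), of 1 1 1, unfolded eq]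
  show "integrable M (%w. X w * Y w * Z w)"
    by (rule Bochner_Integration.integrable_bound[OF L(1)]) (use assms in auto)
  show "expectation (%w. \<bar>X w * Y w * Z w\<bar>) <= A * B * C" using L(2) assms AB by simp
qed

lemma Lpb_prod2:
  assumes "Lpb p A X" "Lpb q B Y" "p > 0" "q > 0" "1 / p + 1 / q <= 1"
  shows "integrable M (%w. X w * Y w)" "expectation (%w. \<bar>X w * Y w\<bar>) <= A * B"
proof -
  define s where "s = max 1 (1 / (1 - 1/p - 1/q))"
  show "integrable M (%w. X w * Y w)" "expectation (%w. \<bar>X w * Y w\<bar>) <= A * B"
  proof -
    have [measurable]: "X \<in> borel_measurable M" "Y \<in> borel_measurable M"
      using assms by (auto dest: Lpb_meas)
    have AB: "A >= 0" "B >= 0" using assms by (auto simp: Lpb_def)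
    have eq: "\<bar>X w\<bar> powr 1 * \<bar>Y w\<bar> powr 1 * \<bar>1\<bar> powr 0 = \<bar>X w * Y w\<bar>" for w
      by (simp add: abs_mult)
    note L = Lpb_prod3_gen[OF assms(1,2) Lpb_const[of 1 1] assms(3,4), of 1 1 0, simplified, folded abs_mult]
    show "integrable M (%w. X w * Y w)"
      by (rule Bochner_Integration.integrable_bound[OF L(1)]) (use assms in auto)
    show "expectation (%w. \<bar>X w * Y w\<bar>) <= A * B" using L(2) assms AB by simp
  qed
qed

lemma Lpb_1:
  assumes "Lpb p A X" "p >= 1"
  shows "integrable M X" "expectation (%w. \<bar>X w\<bar>) <= A" "\<bar>expectation X\<bar> <= A"
proof -
  have p: "p > 0" using assms by simp
  have c1: "Lpb p 1 (%_. 1)" using Lpb_const[OF p, of 1] by simp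
  have A: "A >= 0" and [measurable]: "X \<in> borel_measurable M" using assms by (auto simp: Lpb_def)
  note L = Lpb_prod3_gen[OF assms(1) c1 c1 p p p, of 1 0 0, simplified]
  have "1 / p <= 1" using assms by simp
  then have L1: "integrable M (%w. \<bar>X w\<bar>)" and L2: "expectation (%w. \<bar>X w\<bar>) <= A" using L A by auto
  show i: "integrable M X" by (rule Bochner_Integration.integrable_bound[OF L1]) auto
  show "expectation (%w. \<bar>X w\<bar>) <= A" by fact
  show "\<bar>expectation X\<bar> <= A" using integral_abs_bound[of M X] L2 by linarith
qed

lemma Lpb_lower:
  assumes "Lpb p A X" "0 < r" "r <= p" shows "Lpb r A X"
proof -
  have p: "p > 0" using assms by simp
  have c1: "Lpb p 1 (%_. 1)" using Lpb_const[OF p, of 1] by simp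
  note L = Lpb_prod3_gen[OF assms(1) c1 c1 p p p, of r 0 0, simplified]
  show ?thesis using L assms by (simp add: Lpb_def)
qed

lemma Lpb_mono:
  assumes "Lpb p A X" "Y \<in> borel_measurable M" "!!w. \<bar>Y w\<bar> <= \<bar>X w\<bar>" "p > 0" "A <= B"
  shows "Lpb p B Y"
proof -
  have [measurable]: "X \<in> borel_measurable M" using assms(1) by (rule Lpb_meas)
  have le: "\<bar>Y w\<bar> powr p <= \<bar>X w\<bar> powr p" for w using assms by (intro powr_mono2) auto
  have iX: "integrable M (%w. \<bar>X w\<bar> powr p)" using assms by (simp add: Lpb_def)
  have iY: "integrable M (%w. \<bar>Y w\<bar> powr p)"
    by (rule Bochner_Integration.integrable_bound[OF iX]) (use assms(2) le in auto)
  have "expectation (%w. \<bar>Y w\<bar> powr p) <= expectation (%w. \<bar>X w\<bar> powr p)"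
    by (intro integral_mono iX iY le)
  also have "... <= A powr p" using assms by (simp add: Lpb_def)
  also have "... <= B powr p" using assms by (intro powr_mono2) (auto simp: Lpb_def)
  finally show ?thesis using assms iY by (auto simp: Lpb_def)
qed

lemma Lpb_weaken: "Lpb p A X ==> p > 0 ==> A <= B ==> Lpb p B X"
  by (rule Lpb_mono[of p A X]) (auto simp: Lpb_def)

lemma Lpb_uminus: "Lpb p A X ==> Lpb p A (%w. - X w)"
  by (auto simp: Lpb_def)

lemma Lpb_scale:
  assumes "Lpb p A X" "p > 0" shows "Lpb p (\<bar>c\<bar> * A) (%w. c * X w)"
  using assms by (auto simp: Lpb_def abs_mult powr_mult intro!: mult_left_mono)

lemma powr_add_le: "(a::real) >= 0 ==> b >= 0 ==> p >= 1 ==> a powr p + b powr p <= (a + b) powr p"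
proof -
  assume a: "a >= 0" "b >= 0" "p >= 1"
  show ?thesis
  proof (cases "a + b = 0")
    case True then show ?thesis using a by (simp add: add_nonneg_eq_0_iff)
  next
    case False
    then have s: "a + b > 0" using a by simp
    have *: "x powr p <= x * (a + b) powr (p - 1)" if "0 <= x" "x <= a + b" for x
    proof (cases "x = 0")
      case False
      then have "x powr p = x * x powr (p - 1)" using that by (simp add: powr_mult_base)
      also have "... <= x * (a+b) powr (p - 1)" using that a by (intro mult_left_mono powr_mono2) auto
      finally show ?thesis .
    qed simp
    have "a powr p + b powr p <= a * (a + b) powr (p - 1) + b * (a + b) powr (p - 1)"
      by (intro add_mono *) (use a in auto)
    also have "... = (a + b) * (a + b) powr (p - 1)" by (simp add: algebra_simps)
    also have "... = (a + b) powr p" using s by (simp add: powr_mult_base)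
    finally show ?thesis .
  qed
qed

lemma abs_add_powr_le:
  fixes x y p :: real assumes "p >= 0"
  shows "\<bar>x + y\<bar> powr p <= 2 powr p * (\<bar>x\<bar> powr p + \<bar>y\<bar> powr p)"
proof -
  have "\<bar>x + y\<bar> powr p <= (2 * max \<bar>x\<bar> \<bar>y\<bar>) powr p" using assms by (intro powr_mono2) auto
  also have "... = 2 powr p * (max \<bar>x\<bar> \<bar>y\<bar>) powr p" by (simp add: powr_mult)
  also have "... <= 2 powr p * (\<bar>x\<bar> powr p + \<bar>y\<bar> powr p)"
    by (intro mult_left_mono) (auto simp: max_def)
  finally show ?thesis .
qed

text \<open>Bounding \<open>\<bar>x + y\<bar>\<close> by twice the larger of the two replaces
  Minkowski's inequality at the price of a factor 2. The factor is paid at every addition, so long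
  sums go through \<open>Lpb_sum\<close> or rely on geometric decay of the terms.\<close>

lemma Lpb_add:
  assumes X: "Lpb p A X" and Y: "Lpb p B Y" and p: "p >= 1"
  shows "Lpb p (2 * (A + B)) (%w. X w + Y w)"
proof -
  have [measurable]: "X \<in> borel_measurable M" "Y \<in> borel_measurable M"
    and i: "integrable M (%w. \<bar>X w\<bar> powr p)" "integrable M (%w. \<bar>Y w\<bar> powr p)"
    and l: "expectation (%w. \<bar>X w\<bar> powr p) <= A powr p" "expectation (%w. \<bar>Y w\<bar> powr p) <= B powr p"
    and AB: "A >= 0" "B >= 0"
    using X Y by (auto simp: Lpb_def)
  have le: "\<bar>X w + Y w\<bar> powr p <= 2 powr p * (\<bar>X w\<bar> powr p + \<bar>Y w\<bar> powr p)" for w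
    using p by (intro abs_add_powr_le) auto
  have ir: "integrable M (%w. 2 powr p * (\<bar>X w\<bar> powr p + \<bar>Y w\<bar> powr p))" using i by auto
  have il: "integrable M (%w. \<bar>X w + Y w\<bar> powr p)"
    by (rule Bochner_Integration.integrable_bound[OF ir]) (use le in auto)
  have "expectation (%w. \<bar>X w + Y w\<bar> powr p) <= expectation (%w. 2 powr p * (\<bar>X w\<bar> powr p + \<bar>Y w\<bar> powr p))"
    by (intro integral_mono il ir le)
  also have "... = 2 powr p * (expectation (%w. \<bar>X w\<bar> powr p) + expectation (%w. \<bar>Y w\<bar> powr p))"
    using i by simp
  also have "... <= 2 powr p * (A powr p + B powr p)" using l by (intro mult_left_mono add_mono) auto
  also have "... <= 2 powr p * (A + B) powr p" using powr_add_le AB p by (intro mult_left_mono) auto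
  also have "... = (2 * (A + B)) powr p" using AB by (subst powr_mult) auto
  finally show ?thesis using il AB by (auto simp: Lpb_def)
qed

lemma Lpb_diff:
  assumes "Lpb p A X" "Lpb p B Y" "p >= 1"
  shows "Lpb p (2 * (A + B)) (%w. X w - Y w)"
  using Lpb_add[OF assms(1) Lpb_uminus[OF assms(2)] assms(3)] by simp

lemma Lpb_center:
  assumes "Lpb p A X" "p >= 1"
  shows "Lpb p (4 * A) (%w. X w - expectation X)"
proof -
  have "Lpb p \<bar>expectation X\<bar> (%_. expectation X)" using assms by (intro Lpb_const) simp
  from Lpb_diff[OF assms(1) this assms(2)]
  show ?thesis by (rule Lpb_weaken) (use Lpb_1[OF assms] assms in auto)
qed

lemma Lpb_mult:
  assumes X: "Lpb p A X" and Y: "Lpb q B Y" and pos: "p > 0" "q > 0" "r > 0" and e: "1 / p + 1 / q <= 1 / r"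
  shows "Lpb r (A * B) (%w. X w * Y w)"
proof -
  have [measurable]: "X \<in> borel_measurable M" "Y \<in> borel_measurable M" and AB: "A >= 0" "B >= 0"
    using X Y by (auto simp: Lpb_def)
  have "r / p + r / q = r * (1 / p + 1 / q)" by (simp add: algebra_simps)
  also have "... <= r * (1 / r)" using pos e by (intro mult_left_mono) auto
  finally have e': "r / p + r / q <= 1" using pos by simp
  note L = Lpb_prod3_gen[OF X Y Lpb_const[of 1 1] pos(1,2), of r r 0, simplified]
  show ?thesis using L e' pos AB by (simp add: Lpb_def abs_mult powr_mult)
qed

lemma Lpb_setsum:
  assumes "!!i. i \<in> I ==> Lpb p A (X i)" "finite I" "p >= 1" "A >= 0"
  shows "\<exists>B. Lpb p B (%w. \<Sum>i\<in>I. X i w)"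
  using assms(2,1)
proof (induction I)
  case empty
  then show ?case using Lpb_const[of p 0] assms(3) by auto
next
  case (insert i I)
  then obtain B where "Lpb p B (%w. \<Sum>i\<in>I. X i w)" by auto
  from Lpb_add[OF _ this assms(3), of A "X i"] insert show ?case by auto
qed

end

section \<open>Decoupling under uniform mixing\<close>

context prob_space begin

text \<open>Let \<open>g\<close> be the conditional expectation of \<open>indicator A\<close> given
  \<open>H\<close> minus \<open>prob A\<close>. Its positive and negative parts live on two events
  of \<open>H\<close>, and on each of them the mixing hypothesis bounds its integral, so its L^1
  norm is at most \<open>2 * \<phi> * prob A\<close>. Keeping the factor \<open>prob A\<close> is
  the point: these bounds will be summed over a partition.\<close>

lemma phi_event_bound:
  assumes sub: "subalgebra M H" and A: "A \<in> events"
    and phi: "!!D. D \<in> sets H ==> \<bar>prob (A \<inter> D) - prob A * prob D\<bar> <= \<phi> * prob A"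
    and h: "h \<in> borel_measurable H" "!!x. \<bar>h x\<bar> <= c"
  shows "\<bar>expectation (%x. indicator A x * h x) - prob A * expectation h\<bar> <= 2 * \<phi> * c * prob A"
proof -
  interpret fs: finite_measure_subalgebra M H by standard (rule sub)
  have [measurable]: "A \<in> events" by fact
  have hM[measurable]: "h \<in> borel_measurable M" using measurable_from_subalg[OF sub h(1)] .
  have iA: "integrable M (indicator A :: 'a => real)" by (rule integrable_real_indicator) (use A in \<open>auto simp: emeasure_eq_measure\<close>)
  define f where "f = real_cond_exp M H (indicator A)"
  have fH[measurable]: "f \<in> borel_measurable H" by (simp add: f_def)
  have fM[measurable]: "f \<in> borel_measurable M" using measurable_from_subalg[OF sub fH] .
  have intf: "integrable M f" unfolding f_def by (rule fs.real_cond_exp_int(1)[OF iA])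
  have bint: "integrable M (%x. b x * k x)" if "b \<in> borel_measurable M" "!!x. \<bar>b x\<bar> <= d" "integrable M k" for b k :: "'a => real" and d
  proof -
    have i: "integrable M (%x. d * k x)" using that by simp
    have [measurable]: "k \<in> borel_measurable M" using that by auto
    show ?thesis by (rule Bochner_Integration.integrable_bound[OF i])
       (use that in \<open>auto simp: abs_mult intro!: AE_I2 mult_right_mono intro: order_trans[OF _ abs_ge_self]\<close>)
  qed
  have eqb: "expectation (%x. b x * f x) = expectation (%x. b x * indicator A x)"
    if "b \<in> borel_measurable H" "!!x. \<bar>b x\<bar> <= d" for b :: "'a => real" and d
    unfolding f_def
    by (rule fs.real_cond_exp_intg(2)) (use that bint[OF measurable_from_subalg[OF sub that(1)] that(2) iA] in auto)
  define g where "g = (%x. f x - prob A)"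
  have gH[measurable]: "g \<in> borel_measurable H" unfolding g_def by measurable
  have intg: "integrable M g" unfolding g_def using intf by auto
  define D where "D = {x \<in> space H. g x >= 0}"
  have DH: "D \<in> sets H" unfolding D_def by measurable
  have cDH: "space H - D \<in> sets H" using DH by auto
  have spH: "space H = space M" using sub by (simp add: subalgebra_def)
  have part: "\<bar>expectation (%x. indicator E x * g x)\<bar> <= \<phi> * prob A" if E: "E \<in> sets H" for E
  proof -
    have EM: "E \<in> events" using E sub by (auto simp: subalgebra_def)
    have "expectation (%x. indicator E x * g x) = expectation (%x. indicator E x * f x) - expectation (%x. indicator E x * prob A)"
      unfolding g_def right_diff_distrib
      by (rule Bochner_Integration.integral_diff) (intro bint[of _ 1] intf integrable_mult_left integrable_real_indicator borel_measurable_indicator EM; simp add: indicator_def EM emeasure_eq_measure)+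
    also have "expectation (%x. indicator E x * f x) = expectation (%x. indicator E x * indicator A x)"
      by (rule eqb[of _ 1]) (use E in \<open>auto simp: indicator_def\<close>)
    also have "... = expectation (indicator (A \<inter> E))"
      by (intro Bochner_Integration.integral_cong) (auto simp: indicator_def)
    also have "... = prob (A \<inter> E)" using EM A by (simp add: sets.Int_space_eq2)
    also have "expectation (%x. indicator E x * prob A) = prob E * prob A"
    proof -
      have "expectation (%x. indicator E x * prob A) = expectation (indicator E) * prob A"
        by (rule integral_mult_left_zero)
      then show ?thesis using EM by (simp add: sets.Int_space_eq2)
    qed
    finally show ?thesis using phi[OF E] by (simp add: mult.commute)
  qed
  have absg: "\<bar>g x\<bar> = indicator D x * g x - indicator (space H - D) x * g x" if "x \<in> space M" for x
    using that spH by (auto simp: D_def indicator_def)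
  have D'[measurable]: "D \<in> events" "space H - D \<in> events" using DH cDH sub by (auto simp: subalgebra_def)
  have "expectation (%x. \<bar>g x\<bar>) = expectation (%x. indicator D x * g x - indicator (space H - D) x * g x)"
    by (intro Bochner_Integration.integral_cong) (simp_all add: absg)
  also have "... = expectation (%x. indicator D x * g x) - expectation (%x. indicator (space H - D) x * g x)"
    by (intro Bochner_Integration.integral_diff bint[of _ 1] intg borel_measurable_indicator D') (simp_all add: indicator_def)
  also have "... <= 2 * (\<phi> * prob A)" using part[OF DH] part[OF cDH] by linarith
  finally have Eg: "expectation (%x. \<bar>g x\<bar>) <= 2 * (\<phi> * prob A)" .
  have c: "c >= 0" using h(2)[of undefined] by linarith
  have hg: "integrable M (%x. h x * g x)" by (rule bint[OF hM h(2) intg])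
  have ih: "integrable M h" using bint[OF hM h(2), of "%_. 1"] by simp
  have "expectation (%x. indicator A x * h x) - prob A * expectation h
      = expectation (%x. h x * f x) - expectation (%x. h x * prob A)"
    using eqb[OF h] by (simp add: mult.commute)
  also have "... = expectation (%x. h x * g x)"
    unfolding g_def right_diff_distrib
    by (rule Bochner_Integration.integral_diff[symmetric]) (use bint[OF hM h(2) intf] ih in auto)
  finally have "\<bar>expectation (%x. indicator A x * h x) - prob A * expectation h\<bar> <= expectation (%x. \<bar>h x * g x\<bar>)"
    using integral_abs_bound[of M "%x. h x * g x"] by simp
  also have "... <= expectation (%x. c * \<bar>g x\<bar>)"
    by (intro integral_mono integrable_abs hg) (use h(2) intg in \<open>auto simp: abs_mult intro!: mult_right_mono\<close>)
  also have "... = c * expectation (%x. \<bar>g x\<bar>)" by simp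
  also have "... <= c * (2 * (\<phi> * prob A))" using c Eg by (rule mult_left_mono[rotated])
  finally show ?thesis by (simp add: mult_ac)
qed

lemma integrable_bounded_by:
  fixes f :: "'a => real" assumes "f \<in> borel_measurable M" "!!x. \<bar>f x\<bar> <= c" shows "integrable M f"
  by (rule integrable_const_bound[where B=c]) (use assms in auto)

lemma expectation_abs_le:
  fixes f :: "'a => real" assumes "!!x. \<bar>f x\<bar> <= c" shows "\<bar>expectation f\<bar> <= c"
proof (cases "integrable M f")
  case True
  have "\<bar>expectation f\<bar> <= expectation (%x. \<bar>f x\<bar>)" by (rule integral_abs_bound)
  also have "... <= expectation (%_. c)" using True assms by (intro integral_mono) auto
  finally show ?thesis by (simp add: prob_space)
next
  case False
  moreover have "c >= 0" using assms[of undefined] by linarith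
  ultimately show ?thesis by (simp add: not_integrable_integral_eq)
qed

text \<open>The level sets of \<open>X\<close> have probabilities adding up to 1, so the errors of
  \<open>phi_event_bound\<close> add up to a bound that does not see how many values
  \<open>X\<close> takes. Without the factor \<open>prob C\<close> in the hypothesis the error would
  be multiplied by that number.\<close>

lemma decouple_simple:
  fixes X :: "'a => 'c"
  assumes subG: "subalgebra M G" and subH: "subalgebra M H"
    and X: "simple_function G X"
    and f: "!!x. f x \<in> borel_measurable H" "!!x w. \<bar>f x w\<bar> <= c"
    and phi: "!!C D. C \<in> sets G ==> D \<in> sets H ==> \<bar>prob (C \<inter> D) - prob C * prob D\<bar> <= \<phi> * prob C"
  shows "(%w. f (X w) w) \<in> borel_measurable M" "(%w. expectation (f (X w))) \<in> borel_measurable M"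
    "\<bar>expectation (%w. f (X w) w) - expectation (%w. expectation (f (X w)))\<bar> <= 2 * \<phi> * c"
proof -
  define S where "S = X ` space M"
  have spG: "space G = space M" using subG by (simp add: subalgebra_def)
  have fin: "finite S" using simple_functionD(1)[OF X] by (simp add: S_def spG)
  define E where "E = (%x. X -` {x} \<inter> space M)"
  have EG: "E x \<in> sets G" for x using simple_functionD(2)[OF X, of "{x}"] by (simp add: E_def spG)
  then have EM[measurable]: "E x \<in> events" for x using subG by (auto simp: subalgebra_def)
  have fM[measurable]: "f x \<in> borel_measurable M" for x using measurable_from_subalg[OF subH f(1)] .
  have rep: "k (X w) w = (\<Sum>x\<in>S. indicator (E x) w * k x w)" if "w \<in> space M" for w and k :: "'c => 'a => real"
  proof -
    have "(\<Sum>x\<in>S. indicator (E x) w * k x w) = (\<Sum>x\<in>S. if x = X w then k x w else 0)"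
      by (intro sum.cong) (use that in \<open>auto simp: E_def indicator_def\<close>)
    also have "... = k (X w) w" using fin that by (simp add: S_def)
    finally show ?thesis by simp
  qed
  have m1: "(%w. \<Sum>x\<in>S. indicator (E x) w * f x w) \<in> borel_measurable M" by measurable
  show "(%w. f (X w) w) \<in> borel_measurable M"
    using m1 by (subst measurable_cong[OF rep]) auto
  have m2: "(%w. \<Sum>x\<in>S. indicator (E x) w * expectation (f x)) \<in> borel_measurable M" by measurable
  show "(%w. expectation (f (X w))) \<in> borel_measurable M"
    using m2 by (subst measurable_cong[OF rep[of _ "%x w. expectation (f x)"]]) auto
  have i1: "integrable M (%w. indicator (E x) w * f x w)" for x
    by (rule integrable_bounded_by[where c=c]) (use f(2) in \<open>auto simp: indicator_def intro: order_trans[OF abs_ge_zero]\<close>)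
  have i2: "integrable M (%w. indicator (E x) w * expectation (f x))" for x
    by (intro integrable_mult_left integrable_real_indicator) (auto simp: emeasure_eq_measure)
  have "expectation (%w. f (X w) w) = expectation (%w. \<Sum>x\<in>S. indicator (E x) w * f x w)"
    by (intro Bochner_Integration.integral_cong) (simp_all add: rep)
  also have "... = (\<Sum>x\<in>S. expectation (%w. indicator (E x) w * f x w))"
    using i1 by (rule Bochner_Integration.integral_sum)
  finally have e1: "expectation (%w. f (X w) w) = (\<Sum>x\<in>S. expectation (%w. indicator (E x) w * f x w))" .
  have "expectation (%w. expectation (f (X w))) = expectation (%w. \<Sum>x\<in>S. indicator (E x) w * expectation (f x))"
    by (intro Bochner_Integration.integral_cong) (simp_all add: rep[of _ "%x w. expectation (f x)"])
  also have "... = (\<Sum>x\<in>S. expectation (%w. indicator (E x) w * expectation (f x)))"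
    using i2 by (rule Bochner_Integration.integral_sum)
  also have "... = (\<Sum>x\<in>S. prob (E x) * expectation (f x))" by (simp add: sets.Int_space_eq2)
  finally have e2: "expectation (%w. expectation (f (X w))) = (\<Sum>x\<in>S. prob (E x) * expectation (f x))" .
  have "(\<Sum>x\<in>S. prob (E x)) = prob (\<Union>x\<in>S. E x)"
    by (rule finite_measure_finite_Union[symmetric]) (use fin EM in \<open>auto simp: E_def disjoint_family_on_def\<close>)
  also have "(\<Union>x\<in>S. E x) = space M" by (auto simp: E_def S_def)
  finally have tot: "(\<Sum>x\<in>S. prob (E x)) = 1" by (simp add: prob_space)
  have "\<bar>expectation (%w. f (X w) w) - expectation (%w. expectation (f (X w)))\<bar>
      <= (\<Sum>x\<in>S. \<bar>expectation (%w. indicator (E x) w * f x w) - prob (E x) * expectation (f x)\<bar>)"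
    unfolding e1 e2 sum_subtractf[symmetric] by (rule sum_abs)
  also have "... <= (\<Sum>x\<in>S. 2 * \<phi> * c * prob (E x))"
    by (intro sum_mono phi_event_bound[OF subH] phi EG f) auto
  also have "... = 2 * \<phi> * c" by (simp add: sum_distrib_left[symmetric] tot)
  finally show "\<bar>expectation (%w. f (X w) w) - expectation (%w. expectation (f (X w)))\<bar> <= 2 * \<phi> * c" .
qed

text \<open>Simple functions converge pointwise to \<open>X\<close>, and continuity of
  \<open>f\<close> in its first argument together with boundedness carries the previous estimate to
  the limit. This is why the functionals below are required to be continuous.\<close>

lemma decouple_one:
  fixes X :: "'a => 'c::{metric_space,second_countable_topology}"
  assumes subG: "subalgebra M G" and subH: "subalgebra M H"
    and X: "X \<in> borel_measurable G"
    and f: "!!x. f x \<in> borel_measurable H" "!!x w. \<bar>f x w\<bar> <= c"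
    and cont: "!!w. continuous_on UNIV (%x. f x w)"
    and phi: "!!C D. C \<in> sets G ==> D \<in> sets H ==> \<bar>prob (C \<inter> D) - prob C * prob D\<bar> <= \<phi> * prob C"
  shows "(%w. f (X w) w) \<in> borel_measurable M" "(%w. expectation (f (X w))) \<in> borel_measurable M"
    "\<bar>expectation (%w. f (X w) w) - expectation (%w. expectation (f (X w)))\<bar> <= 2 * \<phi> * c"
proof -
  have spG: "space G = space M" using subG by (simp add: subalgebra_def)
  obtain s where s: "!!i. simple_function G (s i)" "!!x. x \<in> space M ==> (%i. s i x) \<longlonglongrightarrow> X x"
    using borel_measurable_implies_sequence_metric[OF X] spG by metis
  have D: "(%w. f (s i w) w) \<in> borel_measurable M" "(%w. expectation (f (s i w))) \<in> borel_measurable M"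
    "\<bar>expectation (%w. f (s i w) w) - expectation (%w. expectation (f (s i w)))\<bar> <= 2 * \<phi> * c" for i
    by (rule decouple_simple[OF subG subH s(1) f]; rule phi; assumption)+
  have fM[measurable]: "f x \<in> borel_measurable M" for x using measurable_from_subalg[OF subH f(1)] .
  have l1: "(%i. f (s i w) w) \<longlonglongrightarrow> f (X w) w" if "w \<in> space M" for w
    by (rule continuous_on_tendsto_compose[OF cont s(2)[OF that]]) auto
  show m1[measurable]: "(%w. f (X w) w) \<in> borel_measurable M"
    by (rule borel_measurable_LIMSEQ_real[OF l1 D(1)])
  have l2: "(%i. expectation (f (s i w))) \<longlonglongrightarrow> expectation (f (X w))" if w: "w \<in> space M" for w
  proof (rule integral_dominated_convergence[where w="%_. c"])
    show "AE x in M. (%i. f (s i w) x) \<longlonglongrightarrow> f (X w) x"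
      by (intro AE_I2 continuous_on_tendsto_compose[OF cont s(2)[OF w]]) auto
  qed (use f(2) in auto)
  show m2[measurable]: "(%w. expectation (f (X w))) \<in> borel_measurable M"
    by (rule borel_measurable_LIMSEQ_real[OF l2 D(2)])
  have L1: "(%i. expectation (%w. f (s i w) w)) \<longlonglongrightarrow> expectation (%w. f (X w) w)"
    by (rule integral_dominated_convergence[where w="%_. c"]) (use f(2) l1 D(1) in auto)
  have L2: "(%i. expectation (%w. expectation (f (s i w)))) \<longlonglongrightarrow> expectation (%w. expectation (f (X w)))"
    by (rule integral_dominated_convergence[where w="%_. c"]) (use expectation_abs_le[OF f(2)] l2 D(2) in auto)
  show "\<bar>expectation (%w. f (X w) w) - expectation (%w. expectation (f (X w)))\<bar> <= 2 * \<phi> * c"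
    by (rule LIMSEQ_le_const2[OF tendsto_rabs[OF tendsto_diff[OF L1 L2]]]) (use D(3) in auto)
qed

end

section \<open>Functionals of finitely many coordinates and the decoupling operation\<close>

definition dep :: "nat set => ((nat => 'c) => real) => bool" where
  "dep S u \<longleftrightarrow> (\<forall>x y. (\<forall>k\<in>S. x k = y k) --> u x = u y)"

text \<open>Splices two configurations: coordinates in \<open>S\<close> come from one copy of the
  path, all others from a second one. Integrating over the second copy is the elementary decoupling
  move.\<close>

definition mix :: "nat set => (nat => 'c) => (nat => 'c) => nat => 'c" where
  "mix S x y = (%k. if k \<in> S then x k else y k)"

lemma depD: "dep S u ==> (!!k. k \<in> S ==> x k = y k) ==> u x = u y"
  by (auto simp: dep_def)

lemma dep_mono: "dep S u ==> S \<subseteq> T ==> dep T u"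
  unfolding dep_def by blast

lemma continuous_on_mix: "continuous_on UNIV (%x. mix S x (y::nat => 'c::topological_space))"
proof (rule continuous_on_coordinatewise_then_product)
  fix k show "continuous_on UNIV (%x. mix S x y k)"
    by (cases "k \<in> S") (auto simp: mix_def intro!: continuous_on_product_coordinates)
qed

text \<open>\<open>Past a\<close> and \<open>Fut a\<close> are meant to be sigma-algebras already
  enlarged by the window radius, so that \<open>Y k\<close>, which looks a little ahead and behind,
  still belongs to them; \<open>g\<close> is the nominal gap at which the mixing bound
  \<open>\<phi>\<close> is available. Values in a general metric space allow two approximations of
  different radius to be treated as one field.\<close>

locale decoupled_field = prob_space M for M :: "'a measure" +
  fixes Y :: "nat => 'a => 'c::{metric_space,second_countable_topology}"
    and Past Fut :: "nat => 'a measure" and g :: nat and \<phi> :: real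
  assumes subP: "!!a. subalgebra M (Past a)" and subF: "!!a. subalgebra M (Fut a)"
    and YP: "!!k a. k <= a ==> Y k \<in> borel_measurable (Past a)"
    and YF: "!!k a. a <= k ==> Y k \<in> borel_measurable (Fut a)"
    and phi: "!!a C D. C \<in> sets (Past a) ==> D \<in> sets (Fut (a + g)) ==>
       \<bar>prob (C \<inter> D) - prob C * prob D\<bar> <= \<phi> * prob C"
begin

abbreviation path :: "'a => nat => 'c" where "path w \<equiv> (%k. Y k w)"

lemma phi_nonneg: "\<phi> >= 0"
proof -
  have "space M \<in> sets (Past 0)" using subP[of 0] by (metis sets.top subalgebra_def)
  from phi[OF this sets.empty_sets] show ?thesis by (simp add: prob_space)
qed

lemma Y_meas[measurable]: "Y k \<in> borel_measurable M"
  by (rule measurable_from_subalg[OF subP YP[OF order_refl]])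

lemma path_meas[measurable]: "path \<in> borel_measurable M"
  by (rule measurable_coordinatewise_then_product) simp

lemma u_path_meas:
  assumes "continuous_on UNIV u" shows "(%w. u (path w) :: real) \<in> borel_measurable M"
  using measurable_compose[OF path_meas borel_measurable_continuous_onI[OF assms]] .

lemma mix_path_meas:
  assumes "continuous_on UNIV u" shows "(%w. u (mix S x (path w)) :: real) \<in> borel_measurable M"
proof -
  have "(%w. mix S x (path w)) \<in> borel_measurable M"
    by (rule measurable_coordinatewise_then_product) (auto simp: mix_def)
  from measurable_compose[OF this borel_measurable_continuous_onI[OF assms]] show ?thesis .
qed

text \<open>The coordinates outside \<open>S\<close> are replaced by those of an independent copy of
  the path; among themselves they keep their joint law.\<close>

definition avg :: "nat set => ((nat => 'c) => real) => (nat => 'c) => real" where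
  "avg S u x = expectation (%w. u (mix S x (path w)))"

lemma avg_bound: "(!!x. \<bar>u x\<bar> <= c) ==> \<bar>avg S u x\<bar> <= c"
  unfolding avg_def by (rule expectation_abs_le)

lemma avg_cont:
  assumes "continuous_on UNIV u" "!!x. \<bar>u x\<bar> <= c" shows "continuous_on UNIV (avg S u)"
proof (rule continuous_on_sequentiallyI)
  fix z :: "nat => nat => 'c" and a assume z: "z \<longlonglongrightarrow> a"
  show "(%n. avg S u (z n)) \<longlonglongrightarrow> avg S u a"
    unfolding avg_def
  proof (rule integral_dominated_convergence[where w="%_. c"])
    show "AE w in M. (%i. u (mix S (z i) (path w))) \<longlonglongrightarrow> u (mix S a (path w))"
    proof (rule AE_I2)
      fix w
      have "(%i. mix S (z i) (path w)) \<longlonglongrightarrow> mix S a (path w)"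
        by (rule continuous_on_tendsto_compose[OF continuous_on_mix z]) auto
      then show "(%i. u (mix S (z i) (path w))) \<longlonglongrightarrow> u (mix S a (path w))"
        by (rule continuous_on_tendsto_compose[OF assms(1)]) auto
    qed
  qed (use assms mix_path_meas in auto)
qed

lemma avg_dep: "dep A u ==> dep (A \<inter> S) (avg S u)"
  unfolding dep_def[of "A \<inter> S"]
proof (intro allI impI)
  fix x y :: "nat => 'c" assume u: "dep A u" and e: "\<forall>k\<in>A \<inter> S. x k = y k"
  have "u (mix S x (path w)) = u (mix S y (path w))" for w
    by (rule depD[OF u]) (use e in \<open>auto simp: mix_def\<close>)
  then show "avg S u x = avg S u y" by (simp add: avg_def)
qed

text \<open>One use of \<open>decouple_one\<close>: the coordinates in \<open>S1\<close> form the
  past variable and those in \<open>S2\<close> enter through the random function. The cost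
  \<open>2 * \<phi> * c\<close> does not depend on the sizes of \<open>S1\<close> and
  \<open>S2\<close>.\<close>

lemma cut:
  assumes cont: "continuous_on UNIV u" and b: "!!x. \<bar>u x\<bar> <= c"
    and d: "dep (S1 \<union> S2) u" and S: "S1 \<subseteq> {..a}" "S2 \<subseteq> {a + g..}"
  shows "\<bar>expectation (%w. u (path w)) - expectation (%w. avg S1 u (path w))\<bar> <= 2 * \<phi> * c"
proof -
  \<comment> \<open>Coordinates that must not be seen are frozen at a fixed value, which gives
    measurability with respect to the past or the future alone; \<open>dep\<close> makes that value
    irrelevant.\<close>
  define X where "X = (%w. mix S1 (path w) (%_. undefined))"
  define f where "f = (%x w. u (mix S1 x (mix S2 (path w) (%_. undefined))))"
  have Xm: "X \<in> borel_measurable (Past a)"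
    unfolding X_def
  proof (rule measurable_coordinatewise_then_product)
    fix k show "(%w. mix S1 (path w) (%_. undefined) k) \<in> borel_measurable (Past a)"
      by (cases "k \<in> S1") (use S(1) in \<open>auto simp: mix_def intro!: YP\<close>)
  qed
  have fm: "f x \<in> borel_measurable (Fut (a + g))" for x
  proof -
    have "(%w. mix S1 x (mix S2 (path w) (%_. undefined))) \<in> borel_measurable (Fut (a + g))"
    proof (rule measurable_coordinatewise_then_product)
      fix k show "(%w. mix S1 x (mix S2 (path w) (%_. undefined)) k) \<in> borel_measurable (Fut (a + g))"
        by (cases "k \<in> S1"; cases "k \<in> S2") (use S(2) in \<open>auto simp: mix_def intro!: YF\<close>)
    qed
    from measurable_compose[OF this borel_measurable_continuous_onI[OF cont]] show ?thesis by (simp add: f_def)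
  qed
  have fb: "\<bar>f x w\<bar> <= c" for x w using b by (simp add: f_def)
  have fc: "continuous_on UNIV (%x. f x w)" for w
    unfolding f_def by (rule continuous_on_compose2[OF cont continuous_on_mix]) auto
  have D: "\<bar>expectation (%w. f (X w) w) - expectation (%w. expectation (f (X w)))\<bar> <= 2 * \<phi> * c"
    by (rule decouple_one(3)[OF subP[of a] subF[of "a+g"] Xm fm fb fc]) (rule phi)
  have e1: "f (X w) w = u (path w)" for w
    unfolding f_def X_def by (rule depD[OF d]) (auto simp: mix_def)
  have e2: "expectation (f (X w)) = avg S1 u (path w)" for w
    unfolding avg_def f_def X_def
    by (intro Bochner_Integration.integral_cong refl depD[OF d]) (auto simp: mix_def)
  show ?thesis using D unfolding e1 e2 .
qed

lemma prod_bound: "\<bar>x\<bar> <= 1 ==> \<bar>y\<bar> <= 1 ==> \<bar>x * y\<bar> <= (1::real)"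
  by (simp add: abs_mult mult_le_one)

text \<open>The two index sets may alternate. Working from the right, the part of \<open>B\<close>
  beyond \<open>Max A\<close> is replaced by an independent copy, once inside the product and once
  in \<open>v\<close> alone; then the same is done with the part of \<open>A\<close> beyond the last
  remaining point of \<open>B\<close>. A round removes at least the largest point of
  \<open>A\<close> and makes four cuts of cost \<open>2 * \<phi>\<close>. Hence the bound counts
  points of \<open>A\<close> only, and \<open>B\<close> may be arbitrarily large.\<close>

theorem covariance_interlaced:
  assumes "finite A" "finite B"
    and "!!a b. a \<in> A ==> b \<in> B ==> a + g <= b \<or> b + g <= a" and "g >= 1"
    and "continuous_on UNIV u" "!!x. \<bar>u x\<bar> <= 1" "dep A u"
    and "continuous_on UNIV v" "!!x. \<bar>v x\<bar> <= 1" "dep B v"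
  shows "\<bar>expectation (%w. u (path w) * v (path w)) - expectation (%w. u (path w)) * expectation (%w. v (path w))\<bar>
     <= 8 * card A * \<phi>"
  using assms
proof (induction "card A" arbitrary: A B u v rule: less_induct)
  case (less A B u v)
  note fin = less.prems(1,2) and sep = less.prems(3) and g1 = less.prems(4)
    and uc = less.prems(5) and ub = less.prems(6) and ud = less.prems(7)
    and vc = less.prems(8) and vb = less.prems(9) and vd = less.prems(10)
  show ?case
  proof (cases "A = {}")
    case True
    then have "u x = u y" for x y using ud by (auto simp: dep_def)
    then have *: "u (path w) = u (%_. undefined)" for w by blast
    show ?thesis unfolding * using phi_nonneg by (simp add: prob_space)
  next
    case False
    define k where "k = Max A"
    have kA: "k \<in> A" and kmax: "!!a. a \<in> A ==> a <= k" using fin False by (auto simp: k_def)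
    define B1 where "B1 = {b \<in> B. b < k}"
    define B2 where "B2 = {b \<in> B. b > k}"
    have B12: "B = B1 \<union> B2" using sep[OF kA] g1 by (fastforce simp: B1_def B2_def)
    have B2s: "B2 \<subseteq> {k + g..}" using sep[OF kA] by (fastforce simp: B2_def)
    define v' where "v' = avg B1 v"
    have v'c: "continuous_on UNIV v'" unfolding v'_def by (rule avg_cont[OF vc vb])
    have v'b: "\<bar>v' x\<bar> <= 1" for x unfolding v'_def by (rule avg_bound[OF vb])
    have v'd: "dep B1 v'" unfolding v'_def by (rule dep_mono[OF avg_dep[OF vd]]) auto
    have mu: "(%w. u (path w)) \<in> borel_measurable M" by (rule u_path_meas[OF uc])
    have e_avg1: "avg (A \<union> B1) (%x. u x * v x) x = u x * v' x" for x
    proof -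
      have "u (mix (A \<union> B1) x (path w)) = u x" for w by (rule depD[OF ud]) (auto simp: mix_def)
      moreover have "v (mix (A \<union> B1) x (path w)) = v (mix B1 x (path w))" for w
      proof (rule depD[OF vd])
        fix j assume j: "j \<in> B"
        then have "j \<notin> A" using sep[of j j] g1 by auto
        then show "mix (A \<union> B1) x (path w) j = mix B1 x (path w) j" by (auto simp: mix_def)
      qed
      ultimately show ?thesis by (simp add: avg_def v'_def)
    qed
    have s1: "\<bar>expectation (%w. u (path w) * v (path w)) - expectation (%w. u (path w) * v' (path w))\<bar> <= 2 * \<phi> * 1"
    proof -
      have "\<bar>expectation (%w. u (path w) * v (path w)) - expectation (%w. avg (A \<union> B1) (%x. u x * v x) (path w))\<bar> <= 2 * \<phi> * 1"
      proof (rule cut[where a=k and ?S2.0=B2])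
        show "dep (A \<union> B1 \<union> B2) (%x. u x * v x)"
        proof -
          have "dep (A \<union> B1 \<union> B2) u" by (rule dep_mono[OF ud]) auto
          moreover have "dep (A \<union> B1 \<union> B2) v" by (rule dep_mono[OF vd]) (use B12 in auto)
          ultimately show ?thesis unfolding dep_def by metis
        qed
      qed (use uc vc ub vb kmax B2s prod_bound in \<open>auto intro!: continuous_intros simp: B1_def\<close>)
      then show ?thesis by (simp add: e_avg1)
    qed
    have s2: "\<bar>expectation (%w. v (path w)) - expectation (%w. v' (path w))\<bar> <= 2 * \<phi> * 1"
      unfolding v'_def
    proof (rule cut[OF vc vb, where a=k and ?S2.0=B2])
      show "dep (B1 \<union> B2) v" using vd B12 by simp
      show "B1 \<subseteq> {..k}" by (auto simp: B1_def)
    qed (rule B2s)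
    have Eb: "\<bar>expectation (%w. u (path w))\<bar> <= 1" "\<bar>expectation (%w. v (path w))\<bar> <= 1" "\<bar>expectation (%w. v' (path w))\<bar> <= 1"
      by (rule expectation_abs_le, rule ub vb v'b)+
    \<comment> \<open>The bound holds \<open>4 * \<phi>\<close> in reserve for the two cuts in
      \<open>B\<close> already made, one in the product and one in the mean of
      \<open>v\<close>.\<close>
    have key: "\<bar>expectation (%w. u (path w) * v' (path w)) - expectation (%w. u (path w)) * expectation (%w. v' (path w))\<bar>
       <= (8 * real (card A) - 4) * \<phi>"
    proof (cases "B1 = {}")
      case True
      then have "v' x = v' y" for x y using v'd by (auto simp: dep_def)
      then have *: "v' (path w) = v' (%_. undefined)" for w by blast
      have "card A \<noteq> 0" using False fin(1) by simp
      then have "8 * real (card A) - 4 >= 0" by linarith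
      then show ?thesis unfolding * using phi_nonneg by (simp add: prob_space)
    next
      case B1ne: False
      have finB1: "finite B1" using fin by (auto simp: B1_def)
      define k' where "k' = Max B1"
      have k'B: "k' \<in> B1" and k'max: "!!b. b \<in> B1 ==> b <= k'" using finB1 B1ne by (auto simp: k'_def)
      have k'B': "k' \<in> B" "k' < k" using k'B by (auto simp: B1_def)
      define A1 where "A1 = {a \<in> A. a < k'}"
      define A2 where "A2 = {a \<in> A. a > k'}"
      have A12: "A = A1 \<union> A2" using sep[OF _ k'B'(1)] g1 by (fastforce simp: A1_def A2_def)
      have A2s: "A2 \<subseteq> {k' + g..}" using sep[OF _ k'B'(1)] by (fastforce simp: A2_def)
      have cl: "card A1 < card A"
      proof (rule psubset_card_mono[OF fin(1)])
        have "k \<notin> A1" "A1 \<subseteq> A" using k'B'(2) by (auto simp: A1_def)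
        then show "A1 \<subset> A" using kA by blast
      qed
      define u' where "u' = avg A1 u"
      have u'c: "continuous_on UNIV u'" unfolding u'_def by (rule avg_cont[OF uc ub])
      have u'b: "\<bar>u' x\<bar> <= 1" for x unfolding u'_def by (rule avg_bound[OF ub])
      have u'd: "dep A1 u'" unfolding u'_def by (rule dep_mono[OF avg_dep[OF ud]]) auto
      have e_avg2: "avg (A1 \<union> B1) (%x. u x * v' x) x = u' x * v' x" for x
      proof -
        have "v' (mix (A1 \<union> B1) x (path w)) = v' x" for w by (rule depD[OF v'd]) (auto simp: mix_def)
        moreover have "u (mix (A1 \<union> B1) x (path w)) = u (mix A1 x (path w))" for w
        proof (rule depD[OF ud])
          fix j assume j: "j \<in> A"
          then have "j \<notin> B1" using sep[of j j] g1 by (auto simp: B1_def)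
          then show "mix (A1 \<union> B1) x (path w) j = mix A1 x (path w) j" by (auto simp: mix_def)
        qed
        ultimately show ?thesis by (simp add: avg_def u'_def)
      qed
      have t1: "\<bar>expectation (%w. u (path w) * v' (path w)) - expectation (%w. u' (path w) * v' (path w))\<bar> <= 2 * \<phi> * 1"
      proof -
        have "\<bar>expectation (%w. u (path w) * v' (path w)) - expectation (%w. avg (A1 \<union> B1) (%x. u x * v' x) (path w))\<bar> <= 2 * \<phi> * 1"
        proof (rule cut[where a=k' and ?S2.0=A2])
          show "dep (A1 \<union> B1 \<union> A2) (%x. u x * v' x)"
          proof -
            have "dep (A1 \<union> B1 \<union> A2) u" by (rule dep_mono[OF ud]) (use A12 in auto)
            moreover have "dep (A1 \<union> B1 \<union> A2) v'" by (rule dep_mono[OF v'd]) auto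
            ultimately show ?thesis unfolding dep_def by metis
          qed
        qed (use uc v'c ub v'b k'max A2s prod_bound in \<open>auto intro!: continuous_intros simp: A1_def\<close>)
        then show ?thesis by (simp add: e_avg2)
      qed
      have t2: "\<bar>expectation (%w. u (path w)) - expectation (%w. u' (path w))\<bar> <= 2 * \<phi> * 1"
        unfolding u'_def
      proof (rule cut[OF uc ub, where a=k' and ?S2.0=A2])
        show "dep (A1 \<union> A2) u" using ud A12 by simp
        show "A1 \<subseteq> {..k'}" by (auto simp: A1_def)
      qed (rule A2s)
      have IH: "\<bar>expectation (%w. u' (path w) * v' (path w)) - expectation (%w. u' (path w)) * expectation (%w. v' (path w))\<bar>
          <= 8 * card A1 * \<phi>"
        by (rule less.hyps[OF cl _ finB1 _ g1 u'c u'b u'd v'c v'b v'd])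
           (use fin in \<open>simp add: A1_def\<close>, rule sep, simp_all add: A1_def B1_def)
      have t3: "\<bar>expectation (%w. u' (path w)) * expectation (%w. v' (path w)) - expectation (%w. u (path w)) * expectation (%w. v' (path w))\<bar> <= 2 * \<phi>"
      proof -
        have "\<bar>(expectation (%w. u' (path w)) - expectation (%w. u (path w))) * expectation (%w. v' (path w))\<bar> <= (2 * \<phi>) * 1"
          unfolding abs_mult by (intro mult_mono) (use t2 Eb phi_nonneg in \<open>auto simp: abs_minus_commute\<close>)
        then show ?thesis by (simp add: algebra_simps)
      qed
      have "8 * real (card A1) + 4 <= 8 * real (card A) - 4" using cl by linarith
      then have "(8 * real (card A1) + 4) * \<phi> <= (8 * real (card A) - 4) * \<phi>" by (intro mult_right_mono phi_nonneg)
      moreover have "\<bar>expectation (%w. u (path w) * v' (path w)) - expectation (%w. u (path w)) * expectation (%w. v' (path w))\<bar>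
          <= (8 * real (card A1) + 4) * \<phi>" using t1 IH t3 unfolding distrib_right by linarith
      ultimately show ?thesis by linarith
    qed
    have t4: "\<bar>expectation (%w. u (path w)) * expectation (%w. v' (path w)) - expectation (%w. u (path w)) * expectation (%w. v (path w))\<bar> <= 2 * \<phi>"
    proof -
      have "\<bar>expectation (%w. u (path w)) * (expectation (%w. v' (path w)) - expectation (%w. v (path w)))\<bar> <= 1 * (2 * \<phi>)"
        unfolding abs_mult by (intro mult_mono) (use s2 Eb phi_nonneg in \<open>auto simp: abs_minus_commute\<close>)
      then show ?thesis by (simp add: algebra_simps)
    qed
    show ?thesis using s1 key t4 unfolding left_diff_distrib by linarith
  qed
qed

text \<open>The largest remaining point of \<open>A\<close> is split off by one cut, and the rest
  follows by induction, until the joint law has become a product. This ties the mean of a summand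
  with well separated positions to an integral against independent copies, where the vanishing of
  the averaged functional can be used.\<close>

theorem independent_copies:
  assumes "finite A" "!!a b. a \<in> A ==> b \<in> A ==> a < b ==> a + g <= b"
    and "continuous_on UNIV u" "!!x. \<bar>u x\<bar> <= c" "dep A u"
  shows "\<bar>expectation (%w. u (path w)) - (\<integral>z. u (%k. if k \<in> A then Y k (z k) else undefined) \<partial>PiM A (%_. M))\<bar>
     <= 2 * card A * \<phi> * c"
  using assms
proof (induction "card A" arbitrary: A u rule: less_induct)
  case (less A u)
  note fin = less.prems(1) and sep = less.prems(2)
    and uc = less.prems(3) and ub = less.prems(4) and ud = less.prems(5)
  interpret PS: product_prob_space "%_::nat. M" UNIV by unfold_locales
  have c0: "c >= 0" using ub[of "%_. undefined"] by linarith
  show ?case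
  proof (cases "A = {}")
    case True
    then have "u x = u y" for x y using ud by (auto simp: dep_def)
    then have *: "u (path w) = u (%_. undefined)" for w by blast
    interpret PA: prob_space "PiM A (%_. M)" by (rule prob_space_PiM) (rule prob_space_axioms)
    show ?thesis unfolding * using True PA.prob_space by (simp add: prob_space)
  next
    case False
    define k where "k = Max A"
    have kA: "k \<in> A" and kmax: "!!a. a \<in> A ==> a <= k" using fin False by (auto simp: k_def)
    define A' where "A' = A - {k}"
    have A': "A = insert k A'" "k \<notin> A'" "finite A'" using kA fin by (auto simp: A'_def)
    have cA: "card A = Suc (card A')" using A' by simp
    define u' where "u' = avg A' u"
    have u'c: "continuous_on UNIV u'" unfolding u'_def by (rule avg_cont[OF uc ub])
    have u'b: "\<bar>u' x\<bar> <= c" for x unfolding u'_def by (rule avg_bound[OF ub])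
    have u'd: "dep A' u'" unfolding u'_def by (rule dep_mono[OF avg_dep[OF ud]]) auto
    have s1: "\<bar>expectation (%w. u (path w)) - expectation (%w. u' (path w))\<bar> <= 2 * \<phi> * c"
    proof (cases "A' = {}")
      case True
      then have "u' x = expectation (%w. u (path w))" for x by (simp add: u'_def avg_def mix_def)
      then show ?thesis using phi_nonneg c0 by (simp add: prob_space)
    next
      case ne: False
      define a where "a = Max A'"
      have aA: "a \<in> A'" "!!x. x \<in> A' ==> x <= a" using ne A' by (auto simp: a_def)
      have "a + g <= k" using sep[of a k] aA kA kmax[of a] by (auto simp: A'_def)
      then show ?thesis unfolding u'_def
        by (intro cut[OF uc ub, where a=a and ?S2.0="{k}"]) (use aA ud A' in auto)
    qed
    have IH: "\<bar>expectation (%w. u' (path w)) - (\<integral>z. u' (%k. if k \<in> A' then Y k (z k) else undefined) \<partial>PiM A' (%_. M))\<bar>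
       <= 2 * card A' * \<phi> * c"
      by (rule less.hyps[OF _ A'(3) _ u'c u'b u'd]) (use cA sep A' in auto)
    let ?f = "%z. u (%j. if j \<in> A then Y j (z j) else undefined)"
    have fm: "?f \<in> borel_measurable (PiM A (%_. M))"
    proof -
      have "(%z. (%j. if j \<in> A then Y j (z j) else undefined)) \<in> borel_measurable (PiM A (%_. M))"
      proof (rule measurable_coordinatewise_then_product)
        fix j show "(%z. if j \<in> A then Y j (z j) else undefined) \<in> borel_measurable (PiM A (%_. M))"
          by (cases "j \<in> A") auto
      qed
      from measurable_compose[OF this borel_measurable_continuous_onI[OF uc]] show ?thesis .
    qed
    interpret PA: prob_space "PiM A (%_. M)" by (rule prob_space_PiM) (rule prob_space_axioms)
    have fi: "integrable (PiM (insert k A') (%_. M)) ?f"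
      using PA.integrable_bounded_by[OF fm ub] A'(1) by simp
    have "(\<integral>z. ?f z \<partial>PiM A (%_. M)) = (\<integral>z. (\<integral>y. ?f (z(k := y)) \<partial>M) \<partial>PiM A' (%_. M))"
      using PS.product_integral_insert[OF A'(3,2) fi] A'(1) by simp
    also have "... = (\<integral>z. u' (%k. if k \<in> A' then Y k (z k) else undefined) \<partial>PiM A' (%_. M))"
      unfolding u'_def avg_def
      by (intro Bochner_Integration.integral_cong refl depD[OF ud]) (use A' in \<open>auto simp: mix_def\<close>)
    finally have "(\<integral>z. ?f z \<partial>PiM A (%_. M)) = (\<integral>z. u' (%k. if k \<in> A' then Y k (z k) else undefined) \<partial>PiM A' (%_. M))" .
    then show ?thesis using s1 IH by (simp add: cA algebra_simps abs_le_iff)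
  qed
qed

end

section \<open>Covariance inequality for unbounded variables\<close>

definition clip :: "real => real => real" where "clip s x = max (- s) (min s x)"

lemma clip_abs: "s >= 0 ==> \<bar>clip s x\<bar> <= s" by (auto simp: clip_def)
lemma clip_abs2: "s >= 0 ==> \<bar>clip s x\<bar> <= \<bar>x\<bar>" by (auto simp: clip_def)
lemma clip_tail: "s >= 0 ==> \<bar>x - clip s x\<bar> <= (if \<bar>x\<bar> <= s then 0 else \<bar>x\<bar>)" by (auto simp: clip_def)
lemma continuous_clip: "continuous_on UNIV (clip s)" unfolding clip_def by (intro continuous_intros)
lemma clip_measurable[measurable]: "clip s \<in> borel_measurable borel" by (rule borel_measurable_continuous_onI[OF continuous_clip])

context prob_space begin

text \<open>Where \<open>\<bar>U\<bar> > s\<close> one has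
  \<open>1 <= (\<bar>U\<bar> / s) powr (p * \<gamma>)\<close>. The exponent
  \<open>p * \<gamma>\<close> is the largest that Hoelder's inequality allows beside
  \<open>V\<close>, since \<open>(1 + p * \<gamma>) / p + 1 / q = 1\<close>, and the level
  \<open>s\<close> is the one for which the prefactor \<open>s powr (- (p * \<gamma>))\<close>
  becomes \<open>\<alpha> powr \<gamma>\<close> up to powers of \<open>A\<close>.\<close>

lemma tail_bound:
  assumes U: "Lpb p A U" and V: "Lpb q B V" and pq: "p > 0" "q > 0" and g: "\<gamma> = 1 - 1/p - 1/q" "\<gamma> >= 0"
    and al: "\<alpha> > 0" and A: "A > 0" and s: "s = A * \<alpha> powr (- 1 / p)"
  shows "integrable M (%w. (U w - clip s (U w)) * V w)"
    "expectation (%w. \<bar>(U w - clip s (U w)) * V w\<bar>) <= \<alpha> powr \<gamma> * A * B"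
proof -
  have [measurable]: "U \<in> borel_measurable M" "V \<in> borel_measurable M" using U V by (auto dest: Lpb_meas)
  have B: "B >= 0" using V by (simp add: Lpb_def)
  have s0: "s > 0" using A al by (simp add: s)
  have pg: "p * \<gamma> >= 0" using pq g by simp
  have c1: "Lpb 1 1 (%_. 1)" using Lpb_const[of 1 1] by simp
  have ee: "(1 + p * \<gamma>) / p + 1 / q + 0 / 1 <= 1" using pq g by (simp add: add_divide_distrib)
  note L0 = Lpb_prod3_gen[OF U V c1 pq zero_less_one, of "1 + p * \<gamma>" 1 0]
  have L: "integrable M (%w. \<bar>U w\<bar> powr (1 + p * \<gamma>) * \<bar>V w\<bar>)"
     "expectation (%w. \<bar>U w\<bar> powr (1 + p * \<gamma>) * \<bar>V w\<bar>) <= A powr (1 + p * \<gamma>) * B"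
    using L0 ee pg B by auto
  have le: "\<bar>(U w - clip s (U w)) * V w\<bar> <= s powr (- (p * \<gamma>)) * (\<bar>U w\<bar> powr (1 + p * \<gamma>) * \<bar>V w\<bar>)" for w
  proof -
    have "\<bar>U w - clip s (U w)\<bar> <= s powr (- (p * \<gamma>)) * \<bar>U w\<bar> powr (1 + p * \<gamma>)"
    proof (cases "\<bar>U w\<bar> <= s")
      case True then show ?thesis using clip_tail[of s "U w"] s0 by simp
    next
      case False
      then have "\<bar>U w - clip s (U w)\<bar> <= \<bar>U w\<bar>" using clip_tail[of s "U w"] s0 by simp
      also have "... <= \<bar>U w\<bar> * (s powr (- (p * \<gamma>)) * \<bar>U w\<bar> powr (p * \<gamma>))"
      proof -
        have "s powr (p * \<gamma>) <= \<bar>U w\<bar> powr (p * \<gamma>)" using False s0 pg by (intro powr_mono2) auto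
        then have "1 <= s powr (- (p * \<gamma>)) * \<bar>U w\<bar> powr (p * \<gamma>)"
          using s0 by (simp add: powr_minus field_simps)
        from mult_left_mono[OF this, of "\<bar>U w\<bar>"] show ?thesis by simp
      qed
      also have "... = s powr (- (p * \<gamma>)) * \<bar>U w\<bar> powr (1 + p * \<gamma>)"
        by (simp add: powr_mult_base[symmetric] mult_ac)
      finally show ?thesis .
    qed
    then show ?thesis unfolding abs_mult mult.assoc[symmetric] by (intro mult_right_mono) auto
  qed
  have iR: "integrable M (%w. s powr (- (p * \<gamma>)) * (\<bar>U w\<bar> powr (1 + p * \<gamma>) * \<bar>V w\<bar>))" using L by simp
  show iL: "integrable M (%w. (U w - clip s (U w)) * V w)"
    by (rule Bochner_Integration.integrable_bound[OF iR]) (use le in auto)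
  have "expectation (%w. \<bar>(U w - clip s (U w)) * V w\<bar>) <= expectation (%w. s powr (- (p * \<gamma>)) * (\<bar>U w\<bar> powr (1 + p * \<gamma>) * \<bar>V w\<bar>))"
    by (intro integral_mono integrable_abs iL iR le)
  also have "... <= s powr (- (p * \<gamma>)) * (A powr (1 + p * \<gamma>) * B)" using L(2) by (simp add: mult_left_mono)
  also have "s powr (- (p * \<gamma>)) = A powr (- (p * \<gamma>)) * \<alpha> powr \<gamma>"
    using A al pq by (simp add: s powr_mult powr_powr)
  also have "A powr (- (p * \<gamma>)) * \<alpha> powr \<gamma> * (A powr (1 + p * \<gamma>) * B) = \<alpha> powr \<gamma> * (A powr (- (p * \<gamma>)) * A powr (1 + p * \<gamma>)) * B"
    by (simp add: mult_ac)
  also have "A powr (- (p * \<gamma>)) * A powr (1 + p * \<gamma>) = A" using A by (simp flip: powr_add)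
  finally show "expectation (%w. \<bar>(U w - clip s (U w)) * V w\<bar>) <= \<alpha> powr \<gamma> * A * B" .
qed

text \<open>Both variables are clipped at levels \<open>s\<close> and \<open>t\<close> for which the
  covariance of the clipped parts, \<open>\<alpha> * s * t\<close>, has the same size
  \<open>\<alpha> powr \<gamma> * A * B\<close> as the tails. The constant 5 counts the clipped
  covariance and four tail terms. The mixing input is needed for clipped variables only.\<close>

lemma davydov:
  assumes U: "Lpb p A U" and V: "Lpb q B V" and pq: "p >= 1" "q >= 1" and g: "\<gamma> = 1 - 1/p - 1/q" "\<gamma> >= 0"
    and al: "\<alpha> > 0" and A: "A > 0" and B: "B > 0"
    and clipb: "!!s t. s > 0 ==> t > 0 ==> \<bar>expectation (%w. clip s (U w) * clip t (V w))
       - expectation (%w. clip s (U w)) * expectation (%w. clip t (V w))\<bar> <= \<alpha> * s * t"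
  shows "\<bar>expectation (%w. U w * V w) - expectation U * expectation V\<bar> <= 5 * \<alpha> powr \<gamma> * A * B"
proof -
  have [measurable]: "U \<in> borel_measurable M" "V \<in> borel_measurable M" using U V by (auto dest: Lpb_meas)
  have p0: "p > 0" "q > 0" using pq by auto
  define s where "s = A * \<alpha> powr (- 1 / p)"
  define t where "t = B * \<alpha> powr (- 1 / q)"
  have st: "s > 0" "t > 0" using A B al by (auto simp: s_def t_def)
  define U' where "U' = (%w. clip s (U w))"
  define V' where "V' = (%w. clip t (V w))"
  have U'e: "clip s (U w) = U' w" and V'e: "clip t (V w) = V' w" for w by (auto simp: U'_def V'_def)
  have [measurable]: "U' \<in> borel_measurable M" "V' \<in> borel_measurable M" by (auto simp: U'_def V'_def)
  have g': "\<gamma> = 1 - 1/q - 1/p" using g by simp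
  have c1: "Lpb r 1 (%_. 1)" if "r > 0" for r using Lpb_const[OF that, of 1] by simp
  have U'L: "Lpb p A U'" by (rule Lpb_mono[OF U]) (use p0 st in \<open>auto simp: U'_def intro: clip_abs2\<close>)
  have V'L: "Lpb q B V'" by (rule Lpb_mono[OF V]) (use p0 st in \<open>auto simp: V'_def intro: clip_abs2\<close>)
  note T1 = tail_bound[OF U V p0 g al A s_def, unfolded U'e]
  note T2 = tail_bound[OF U c1[OF p0(2)] p0 g al A s_def, unfolded U'e, simplified]
  note T3 = tail_bound[OF V U'L p0(2,1) g' g(2) al B t_def, unfolded V'e]
  note T4 = tail_bound[OF V c1[OF p0(1)] p0(2,1) g' g(2) al B t_def, unfolded V'e, simplified]
  let ?G = "\<alpha> powr \<gamma> * A * B"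
  have iU: "integrable M U" "integrable M U'" "integrable M V" "integrable M V'"
    using Lpb_1(1) U U'L V V'L pq by auto
  have EUV: "\<bar>expectation U'\<bar> <= A" "\<bar>expectation V\<bar> <= B"
    using Lpb_1(3)[OF U'L pq(1)] Lpb_1(3)[OF V pq(2)] by auto
  have iUV': "integrable M (%w. U' w * V' w)"
    by (rule integrable_bounded_by[where c="s * t"]) (use st in \<open>auto simp: abs_mult U'_def V'_def intro!: mult_mono clip_abs\<close>)
  have b1: "\<bar>expectation (%w. (U w - U' w) * V w)\<bar> <= ?G"
    using T1(2) integral_abs_bound[of M "%w. (U w - U' w) * V w"] by linarith
  have b3: "\<bar>expectation (%w. (V w - V' w) * U' w)\<bar> <= ?G"
    using T3(2) integral_abs_bound[of M "%w. (V w - V' w) * U' w"] unfolding mult.assoc mult.commute[of A B] by linarith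
  have b2: "\<bar>expectation U - expectation U'\<bar> <= \<alpha> powr \<gamma> * A"
    using T2(2) integral_abs_bound[of M "%w. U w - U' w"] iU by simp
  have b4: "\<bar>expectation V - expectation V'\<bar> <= \<alpha> powr \<gamma> * B"
    using T4(2) integral_abs_bound[of M "%w. V w - V' w"] iU by simp
  have b2': "\<bar>(expectation U - expectation U') * expectation V\<bar> <= ?G"
    unfolding abs_mult by (rule mult_mono[OF b2 EUV(2)]) (use A in auto)
  have b4': "\<bar>expectation U' * (expectation V - expectation V')\<bar> <= ?G"
    using mult_mono[OF EUV(1) b4] A by (simp add: abs_mult mult_ac)
  have "\<alpha> * s * t = A * B * (\<alpha> powr 1 * \<alpha> powr (- 1/p) * \<alpha> powr (- 1/q))" using al by (simp add: s_def t_def mult_ac)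
  also have "\<alpha> powr 1 * \<alpha> powr (- 1/p) * \<alpha> powr (- 1/q) = \<alpha> powr (1 + - 1/p + - 1/q)" by (simp only: powr_add)
  also have "1 + - 1/p + - 1/q = \<gamma>" by (simp add: g)
  also have "A * B * \<alpha> powr \<gamma> = ?G" by simp
  finally have b0: "\<bar>expectation (%w. U' w * V' w) - expectation U' * expectation V'\<bar> <= ?G"
    using clipb[OF st] by (simp add: U'_def V'_def)
  have "expectation (%w. U w * V w) = expectation (%w. (U w - U' w) * V w + ((V w - V' w) * U' w + U' w * V' w))"
    by (intro Bochner_Integration.integral_cong) (auto simp: algebra_simps)
  also have "... = expectation (%w. (U w - U' w) * V w) + (expectation (%w. (V w - V' w) * U' w) + expectation (%w. U' w * V' w))"
    using T1(1) T3(1) iUV' by simp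
  finally have e: "expectation (%w. U w * V w) - expectation U * expectation V =
     expectation (%w. (U w - U' w) * V w) + expectation (%w. (V w - V' w) * U' w)
      + (expectation (%w. U' w * V' w) - expectation U' * expectation V')
      - (expectation U - expectation U') * expectation V - expectation U' * (expectation V - expectation V')"
    by (simp add: algebra_simps)
  show ?thesis unfolding e using b0 b1 b2' b3 b4' by linarith
qed

text \<open>One factor \<open>k\<close> comes from bounding the sum by \<open>k\<close> times its
  largest term, another from \<open>k\<close> integrals with \<open>k <= k powr p\<close>. The
  quadratic loss is harmless for neighbourhoods of bounded size and for sums multiplied by an
  arbitrarily small factor.\<close>

lemma Lpb_sum:
  assumes "finite I" "card I <= k" "!!i. i \<in> I ==> Lpb p A (X i)" "p >= 1" "A >= 0"
  shows "Lpb p (real k ^ 2 * A) (%w. \<Sum>i\<in>I. X i w)"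
proof (cases "I = {}")
  case True
  then show ?thesis using Lpb_weaken[OF Lpb_const[of p 0]] assms by simp
next
  case False
  have k1: "k >= 1" using assms False by (metis One_nat_def Suc_leI card_gt_0_iff le_trans)
  have i: "integrable M (%w. \<bar>X i w\<bar> powr p)" "expectation (%w. \<bar>X i w\<bar> powr p) <= A powr p"
     "X i \<in> borel_measurable M" if "i \<in> I" for i
    using assms(3)[OF that] by (auto simp: Lpb_def)
  have m: "(%w. \<Sum>i\<in>I. X i w) \<in> borel_measurable M" using i(3) by (intro borel_measurable_sum)
  have le: "\<bar>\<Sum>i\<in>I. X i w\<bar> powr p <= real k powr p * (\<Sum>i\<in>I. \<bar>X i w\<bar> powr p)" for w
  proof -
    define mx where "mx = Max ((%i. \<bar>X i w\<bar>) ` I)"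
    have "mx \<in> (%i. \<bar>X i w\<bar>) ` I" unfolding mx_def by (rule Max_in) (use assms False in auto)
    then obtain j where j: "j \<in> I" "mx = \<bar>X j w\<bar>" by auto
    have "\<bar>\<Sum>i\<in>I. X i w\<bar> <= (\<Sum>i\<in>I. \<bar>X i w\<bar>)" by (rule sum_abs)
    also have "... <= of_nat (card I) * mx" by (rule sum_bounded_above) (use assms in \<open>auto simp: mx_def\<close>)
    also have "... <= k * mx" using assms(2) j by (intro mult_right_mono) auto
    finally have "\<bar>\<Sum>i\<in>I. X i w\<bar> powr p <= (k * mx) powr p" using assms by (intro powr_mono2) auto
    also have "... = real k powr p * (\<bar>X j w\<bar> powr p)" using j by (simp add: powr_mult)
    also have "\<bar>X j w\<bar> powr p <= (\<Sum>i\<in>I. \<bar>X i w\<bar> powr p)" by (rule member_le_sum) (use j assms in auto)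
    finally show ?thesis by (simp add: mult_left_mono)
  qed
  have iR: "integrable M (%w. real k powr p * (\<Sum>i\<in>I. \<bar>X i w\<bar> powr p))" using i by simp
  have iL: "integrable M (%w. \<bar>\<Sum>i\<in>I. X i w\<bar> powr p)"
    by (rule Bochner_Integration.integrable_bound[OF iR]) (use m in \<open>auto intro!: AE_I2 order_trans[OF le abs_ge_self]\<close>)
  have "expectation (%w. \<bar>\<Sum>i\<in>I. X i w\<bar> powr p) <= expectation (%w. real k powr p * (\<Sum>i\<in>I. \<bar>X i w\<bar> powr p))"
    by (intro integral_mono iL iR le)
  also have "... = real k powr p * (\<Sum>i\<in>I. expectation (%w. \<bar>X i w\<bar> powr p))" using i by simp
  also have "... <= real k powr p * (real k * A powr p)"
  proof (intro mult_left_mono)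
    have "(\<Sum>i\<in>I. expectation (%w. \<bar>X i w\<bar> powr p)) <= of_nat (card I) * A powr p" by (rule sum_bounded_above) (rule i)
    also have "... <= real k * A powr p" using assms(2) by (intro mult_right_mono) auto
    finally show "(\<Sum>i\<in>I. expectation (%w. \<bar>X i w\<bar> powr p)) <= real k * A powr p" .
  qed simp
  also have "... <= real k powr p * (real k powr p * A powr p)"
  proof (intro mult_left_mono mult_right_mono)
    have "real k powr 1 <= real k powr p" using k1 assms by (intro powr_mono) auto
    then show "real k <= real k powr p" using k1 by simp
  qed auto
  also have "... = (real k ^ 2 * A) powr p" using k1 assms by (simp add: powr_mult power2_eq_square mult_ac)
  finally show ?thesis using m iL assms by (simp add: Lpb_def)
qed

end

section \<open>Arrays of variables that decorrelate with the distance of their index sets\<close>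

text \<open>Distance is measured between positions, not between indices: a single pair of close
  positions makes two summands neighbours, however far apart \<open>n\<close> and \<open>m\<close>
  are. Two-sided additions avoid truncated subtraction.\<close>

definition near :: "(nat => nat => nat) => nat => nat => nat => nat => bool" where
  "near pos ell l n m \<longleftrightarrow> (\<exists>i<ell. \<exists>j<ell. pos n i <= pos m j + l \<and> pos m j <= pos n i + l)"

lemma near_mono: "near pos ell l n m ==> l <= l' ==> near pos ell l' n m"
  unfolding near_def by (meson add_left_mono le_trans)

lemma card_pos_le:
  assumes inj: "!!j. j < ell ==> inj (%n. pos n j :: nat)"
    and B: "finite B" "!!m. m \<in> B ==> \<exists>i<ell. \<exists>j<ell. pos m j \<in> S i"
    and S: "!!i. finite (S i)" "!!i. card (S i) <= c"
  shows "card B <= ell * ell * c"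
proof -
  have "B \<subseteq> (\<Union>i<ell. \<Union>j<ell. {m \<in> B. pos m j \<in> S i})" using B(2) by blast
  then have "card B <= card (\<Union>i<ell. \<Union>j<ell. {m \<in> B. pos m j \<in> S i})"
    by (intro card_mono) (use B(1) in auto)
  also have "... <= (\<Sum>i<ell. card (\<Union>j<ell. {m \<in> B. pos m j \<in> S i}))" by (rule card_UN_le) auto
  also have "... <= (\<Sum>i<ell. \<Sum>j<ell. card {m \<in> B. pos m j \<in> S i})"
    by (intro sum_mono card_UN_le) auto
  also have "... <= (\<Sum>i<ell. \<Sum>j<ell. c)"
  proof (intro sum_mono)
    fix i j assume "j \<in> {..<ell}"
    then have "card {m \<in> B. pos m j \<in> S i} <= card (S i)"
      by (intro card_inj_on_le[where f="%n. pos n j"]) (use inj S in \<open>auto intro: inj_on_subset\<close>)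
    then show "card {m \<in> B. pos m j \<in> S i} <= c" using S(2)[of i] by linarith
  qed
  finally show ?thesis by (simp add: mult_ac)
qed

lemma near_card:
  assumes inj: "!!j. j < ell ==> inj (%n. pos n j :: nat)" and "finite J"
  shows "card {m \<in> J. near pos ell l n m} <= ell * ell * (2 * l + 1)"
proof (rule card_pos_le[OF inj])
  show "\<exists>i<ell. \<exists>j<ell. pos m j \<in> {pos n i - l..pos n i + l}" if "m \<in> {m \<in> J. near pos ell l n m}" for m
    using that unfolding near_def by fastforce
qed (use assms in auto)

text \<open>A new neighbour at distance exactly \<open>Suc l\<close> has some position at one of two
  prescribed values. The count does not grow with \<open>l\<close>, unlike that of the full ball, so
  removing a neighbourhood shell by shell leads to a convergent series.\<close>

lemma shell_card:
  assumes inj: "!!j. j < ell ==> inj (%n. pos n j :: nat)" and "finite J"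
  shows "card {m \<in> J. near pos ell (Suc l) n m \<and> \<not> near pos ell l n m} <= ell * ell * 2"
proof (rule card_pos_le[OF inj])
  show "\<exists>i<ell. \<exists>j<ell. pos m j \<in> {pos n i - Suc l, pos n i + Suc l}"
    if "m \<in> {m \<in> J. near pos ell (Suc l) n m \<and> \<not> near pos ell l n m}" for m
  proof -
    from that obtain i j where ij: "i < ell" "j < ell" "pos n i <= pos m j + Suc l" "pos m j <= pos n i + Suc l"
      and "\<not> (pos n i <= pos m j + l \<and> pos m j <= pos n i + l)" unfolding near_def by blast
    then have "pos m j \<in> {pos n i - Suc l, pos n i + Suc l}" by auto
    then show ?thesis using ij by blast
  qed
qed (use assms in \<open>auto simp: card_insert_if\<close>)

text \<open>The interface for moment and normal approximation bounds. On one side at most two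
  summands are allowed, since only single summands and products of two are ever detached; on the
  other side any finite set far from them. Windows of radius \<open>R\<close> reach towards each
  other, so distances below \<open>2 * R\<close> yield nothing and decay starts there.\<close>

locale mix_array = prob_space M for M :: "'a measure" +
  fixes Z :: "nat => 'a => real" and pos :: "nat => nat => nat" and ell R :: nat and D \<theta> :: real
  assumes Z_meas[measurable]: "!!n. Z n \<in> borel_measurable M"
    and ell_pos: "ell >= 1" and D1: "D >= 1" and theta0: "\<theta> > 0"
    and pos_inj: "!!j. j < ell ==> inj (%n. pos n j)"
    and mixing: "!!A J l u v. finite A ==> card A <= 2 ==> finite J ==> 2 * R <= l ==>
      (!!a m. a \<in> A ==> m \<in> J ==> \<not> near pos ell l a m) ==>
      continuous_on UNIV u ==> (!!x. \<bar>u x\<bar> <= 1) ==> dep A u ==>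
      continuous_on UNIV v ==> (!!x. \<bar>v x\<bar> <= 1) ==> dep J v ==>
      \<bar>expectation (%w. u (%n. Z n w) * v (%n. Z n w)) - expectation (%w. u (%n. Z n w)) * expectation (%w. v (%n. Z n w))\<bar>
        <= D * (real l + 1 - 2 * real R) powr (- \<theta>)"
begin

abbreviation row :: "'a => nat => real" where "row w \<equiv> (%n. Z n w)"

lemma row_meas[measurable]: "row \<in> borel_measurable M"
  by (rule measurable_coordinatewise_then_product) simp

lemma mix_array_shift: "mix_array M (%n w. Z n w - c n) pos ell R D \<theta>"
proof (unfold_locales)
  fix A J :: "nat set" and l and u v :: "(nat => real) => real"
  assume a: "finite A" "card A <= 2" "finite J" "2 * R <= l"
    "!!a m. a \<in> A ==> m \<in> J ==> \<not> near pos ell l a m"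
    and uv: "continuous_on UNIV u" "!!x. \<bar>u x\<bar> <= 1" "dep A u" "continuous_on UNIV v" "!!x. \<bar>v x\<bar> <= 1" "dep J v"
  have c: "continuous_on UNIV (%x n. x n - c n :: real)"
    by (rule continuous_on_coordinatewise_then_product) (intro continuous_intros continuous_on_product_coordinates)
  have sh: "continuous_on UNIV (%x. f (%n. x n - c n))" if "continuous_on UNIV f" for f :: "(nat => real) => real"
    by (rule continuous_on_compose2[OF that c]) auto
  have d: "dep S (%x. f (%n. x n - c n))" if "dep S f" for f :: "(nat => real) => real" and S
    using that unfolding dep_def by (simp)
  show "\<bar>expectation (%w. u (%n. Z n w - c n) * v (%n. Z n w - c n)) - expectation (%w. u (%n. Z n w - c n)) * expectation (%w. v (%n. Z n w - c n))\<bar>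
        <= D * (real l + 1 - 2 * real R) powr (- \<theta>)"
    by (rule mixing[OF a sh[OF uv(1)] uv(2) d[OF uv(3)] sh[OF uv(4)] uv(5) d[OF uv(6)]])
qed (use ell_pos D1 theta0 pos_inj in auto)

lemma cov_bound:
  assumes A: "finite A" "card A <= 2" "finite J" "2 * R <= l" "!!a m. a \<in> A ==> m \<in> J ==> \<not> near pos ell l a m"
    and f: "continuous_on UNIV f" "dep A f" and g: "continuous_on UNIV g" "dep J g"
    and L: "Lpb p a (%w. f (row w))" "Lpb q b (%w. g (row w))" "p >= 1" "q >= 1" "a > 0" "b > 0"
    and gm: "1/p + 1/q <= 1"
  shows "\<bar>expectation (%w. f (row w) * g (row w)) - expectation (%w. f (row w)) * expectation (%w. g (row w))\<bar>
     <= 5 * D * (real l + 1 - 2 * real R) powr (- (\<theta> * (1 - 1/p - 1/q))) * a * b"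
proof -
  define x where "x = real l + 1 - 2 * real R"
  have x: "x >= 1" using A(4) by (simp add: x_def)
  define \<alpha> where "\<alpha> = D * x powr (- \<theta>)"
  have al: "\<alpha> > 0" using x D1 by (simp add: \<alpha>_def)
  define \<gamma> where "\<gamma> = 1 - 1/p - 1/q"
  have g0: "\<gamma> >= 0" "\<gamma> <= 1"
    using gm L(3,4) add_nonneg_nonneg[of "1/p" "1/q"] by (auto simp: \<gamma>_def simp del: add_nonneg_nonneg)
  have dv: "\<bar>expectation (%w. f (row w) * g (row w)) - expectation (%w. f (row w)) * expectation (%w. g (row w))\<bar>
     <= 5 * \<alpha> powr \<gamma> * a * b"
  proof (rule davydov[OF L(1-4) \<gamma>_def g0(1) al L(5,6)])
    fix s t :: real assume st: "s > 0" "t > 0"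
    \<comment> \<open>Division by the clipping levels turns the clipped functionals into test
      functions bounded by 1, as \<open>mixing\<close> requires.\<close>
    define u where "u = (%x. clip s (f x) / s)"
    define v where "v = (%x. clip t (g x) / t)"
    have cl: "continuous_on UNIV (%x. clip s (f x))" if "continuous_on UNIV f" for s and f :: "(nat => real) => real"
      by (rule continuous_on_compose2[OF continuous_clip that]) auto
    have uc: "continuous_on UNIV u" unfolding u_def using st by (intro continuous_intros cl f) auto
    have vc: "continuous_on UNIV v" unfolding v_def using st by (intro continuous_intros cl g) auto
    have ub: "\<bar>u x\<bar> <= 1" for x using clip_abs[of s "f x"] st by (simp add: u_def)
    have vb: "\<bar>v x\<bar> <= 1" for x using clip_abs[of t "g x"] st by (simp add: v_def)
    have ud: "dep A u" using f(2) unfolding dep_def u_def by metis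
    have vd: "dep J v" using g(2) unfolding dep_def v_def by metis
    have m: "\<bar>expectation (%w. u (row w) * v (row w)) - expectation (%w. u (row w)) * expectation (%w. v (row w))\<bar> <= \<alpha>"
      unfolding \<alpha>_def x_def by (rule mixing[OF A uc ub ud vc vb vd])
    have "\<bar>expectation (%w. clip s (f (row w)) * clip t (g (row w)))
       - expectation (%w. clip s (f (row w))) * expectation (%w. clip t (g (row w)))\<bar>
      = s * t * \<bar>expectation (%w. u (row w) * v (row w)) - expectation (%w. u (row w)) * expectation (%w. v (row w))\<bar>"
    proof -
      have e: "clip s (f x) = s * u x" "clip t (g x) = t * v x" for x using st by (auto simp: u_def v_def)
      have "expectation (%w. clip s (f (row w)) * clip t (g (row w))) = s * t * expectation (%w. u (row w) * v (row w))"
        unfolding e by (subst integral_mult_right_zero[symmetric]) (simp add: mult_ac)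
      moreover have "expectation (%w. clip s (f (row w))) = s * expectation (%w. u (row w))" unfolding e by simp
      moreover have "expectation (%w. clip t (g (row w))) = t * expectation (%w. v (row w))" unfolding e by simp
      ultimately have "expectation (%w. clip s (f (row w)) * clip t (g (row w)))
       - expectation (%w. clip s (f (row w))) * expectation (%w. clip t (g (row w)))
       = s * t * (expectation (%w. u (row w) * v (row w)) - expectation (%w. u (row w)) * expectation (%w. v (row w)))"
        by (simp add: algebra_simps)
      then show ?thesis using st by (simp add: abs_mult)
    qed
    also have "... <= s * t * \<alpha>" using m st by (intro mult_left_mono) auto
    finally show "\<bar>expectation (%w. clip s (f (row w)) * clip t (g (row w)))
       - expectation (%w. clip s (f (row w))) * expectation (%w. clip t (g (row w)))\<bar> <= \<alpha> * s * t" by (simp add: mult_ac)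
  qed
  have "\<alpha> powr \<gamma> = D powr \<gamma> * x powr (- (\<theta> * \<gamma>))" using D1 x by (simp add: \<alpha>_def powr_mult powr_powr)
  also have "... <= D * x powr (- (\<theta> * \<gamma>))"
    using powr_mono[OF g0(2) D1] D1 by (intro mult_right_mono) auto
  finally have "5 * \<alpha> powr \<gamma> * a * b <= 5 * (D * x powr (- (\<theta> * \<gamma>))) * a * b"
    using L by (intro mult_right_mono mult_left_mono) auto
  then show ?thesis using dv by (simp add: x_def \<gamma>_def mult_ac)
qed

end

section \<open>Third absolute moments of sums\<close>

text \<open>The signed square. It satisfies \<open>\<bar>S\<bar> ^ 3 = S * sqs S\<close>, so the
  third absolute moment of a sum splits linearly over its summands, and increments of
  \<open>sqs\<close> still factor as a difference times a linear term.\<close>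

definition sqs :: "real => real" where "sqs x = x * \<bar>x\<bar>"

lemma sqs_diff: "\<bar>sqs x - sqs y\<bar> <= \<bar>x - y\<bar> * (\<bar>x\<bar> + \<bar>y\<bar>)"
proof -
  have "sqs x - sqs y = (x - y) * \<bar>x\<bar> + y * (\<bar>x\<bar> - \<bar>y\<bar>)" by (simp add: sqs_def algebra_simps)
  also have "\<bar>...\<bar> <= \<bar>(x - y) * \<bar>x\<bar>\<bar> + \<bar>y * (\<bar>x\<bar> - \<bar>y\<bar>)\<bar>" by (rule abs_triangle_ineq)
  also have "... <= \<bar>x - y\<bar> * \<bar>x\<bar> + \<bar>y\<bar> * \<bar>x - y\<bar>"
    unfolding abs_mult by (intro add_mono mult_left_mono) auto
  finally show ?thesis by (simp add: algebra_simps)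
qed

lemma continuous_sqs: "continuous_on UNIV sqs" unfolding sqs_def by (intro continuous_intros)
lemma sqs_measurable[measurable]: "sqs \<in> borel_measurable borel" by (rule borel_measurable_continuous_onI[OF continuous_sqs])
lemma sqs_0[simp]: "sqs 0 = 0" by (simp add: sqs_def)
context prob_space begin

lemma Lpb_abs: "Lpb p A X ==> Lpb p A (%w. \<bar>X w\<bar>)" by (auto simp: Lpb_def)

lemma abs_expectation_le:
  assumes "integrable M (%w. X w :: real)" "expectation (%w. \<bar>X w\<bar>) <= c" shows "\<bar>expectation (%w. X w)\<bar> <= c"
  using integral_abs_bound[of M X] assms(2) by linarith

lemma expectation_abs_mono:
  assumes "integrable M (%w. Y w :: real)" "X \<in> borel_measurable M" "!!w. \<bar>X w\<bar> <= Y w"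
  shows "integrable M X" "expectation (%w. \<bar>X w\<bar>) <= expectation Y"
proof -
  show i: "integrable M X"
    by (rule Bochner_Integration.integrable_bound[OF assms(1,2)]) (auto intro!: AE_I2 order_trans[OF assms(3) abs_ge_self])
  show "expectation (%w. \<bar>X w\<bar>) <= expectation Y"
    by (intro integral_mono integrable_abs i assms)
qed

end

context mix_array begin

definition S :: "nat set => 'a => real" where "S I w = (\<Sum>n\<in>I. Z n w)"

lemma S_meas[measurable]: "S I \<in> borel_measurable M" unfolding S_def by measurable

lemma continuous_sum_coord: "continuous_on UNIV (%x::nat => real. \<Sum>m\<in>I. c m * x m)"
  by (intro continuous_on_sum continuous_on_mult continuous_on_const continuous_on_product_coordinates)

text \<open>The neighbours of \<open>n\<close> are removed from the sum, first all those within
  \<open>2 * R\<close> and then one shell at a time. The first removal is bounded by the number of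
  neighbours; in the later ones the increment depends only on summands far from \<open>n\<close>, so
  the centred \<open>Z n\<close> decorrelates from it. Every term is linear in the common bound
  \<open>B\<close> for subsums, and this linearity is what \<open>third_moment\<close>
  exploits.\<close>

lemma third_moment_step:
  assumes fin: "finite J" and nJ: "n \<in> J" and A: "A > 0" and w: "w > 4"
    and L: "!!m. m \<in> J ==> Lpb w A (Z m)" and mean: "expectation (Z n) = 0"
    and B: "B > 0" "!!J'. J' \<subseteq> J ==> Lpb 3 B (S J')"
    and gam: "\<gamma> = 2/3 - 2/w" and sm: "summable (%k. real (Suc k) powr (- (\<theta> * \<gamma>)))"
  shows "\<bar>expectation (%x. Z n x * sqs (S J x))\<bar> <= (8 * real ell ^ 2 + 80 * D * real ell ^ 4 * (\<Sum>k. real (Suc k) powr (- (\<theta> * \<gamma>)))) * (R + 1) * A\<^sup>2 * B"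
proof -
  define J' where "J' = (%l. {m \<in> J. \<not> near pos ell l n m})"
  have J'sub: "J' l \<subseteq> J" for l by (auto simp: J'_def)
  have J'fin: "finite (J' l)" for l using fin J'sub finite_subset by blast
  define W where "W = (%k. S (J' (2 * R + k)))"
  have W3: "Lpb 3 B (W k)" for k unfolding W_def by (rule B(2)[OF J'sub])
  have SJ3: "Lpb 3 B (S J)" by (rule B(2)) simp
  have [measurable]: "W k \<in> borel_measurable M" for k by (simp add: W_def)
  \<comment> \<open>Large enough that position 0 of every \<open>m\<close> lies within this distance
    of position 0 of \<open>n\<close>: all summands are then neighbours and the telescoping ends in
    0.\<close>
  define N where "N = (\<Sum>m\<in>J. pos m 0) + pos n 0"
  have "J' (2 * R + N) = {}"
  proof -
    have "near pos ell (2 * R + N) n m" if "m \<in> J" for m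
    proof -
      have "pos m 0 <= (\<Sum>m\<in>J. pos m 0)" by (rule member_le_sum) (use that fin in auto)
      then show ?thesis unfolding near_def N_def using ell_pos by (intro exI[of _ 0] conjI) auto
    qed
    then show ?thesis by (auto simp: J'_def)
  qed
  then have WN: "W N x = 0" for x by (simp add: W_def S_def)
  have Zn: "Lpb w A (Z n)" using L nJ by simp
  have e3: "1 / w + 1 / 3 + 1 / 3 <= 1" "1 / w + 1 / w + 1 / 3 <= 1" using w by (auto simp: field_simps)
  have iZ: "integrable M (%x. Z n x * sqs (X x))" if X: "Lpb 3 B X" for X
  proof -
    have [measurable]: "X \<in> borel_measurable M" using X by (rule Lpb_meas)
    have "integrable M (%x. Z n x * X x * X x)"
      using Lpb_prod3(1)[OF Zn X X] e3 w by simp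
    then show ?thesis
      by (rule Bochner_Integration.integrable_bound) (auto simp: sqs_def abs_mult)
  qed
  define G where "G = (%k x. sqs (W k x) - sqs (W (Suc k) x))"
  have tel: "sqs (W 0 x) = (\<Sum>k<N. G k x)" for x
    unfolding G_def by (subst sum_lessThan_telescope') (simp add: WN)
  have iZG: "integrable M (%x. Z n x * G k x)" for k
    unfolding G_def right_diff_distrib by (intro Bochner_Integration.integrable_diff iZ W3)
  have split: "expectation (%x. Z n x * sqs (S J x)) = expectation (%x. Z n x * (sqs (S J x) - sqs (W 0 x))) + (\<Sum>k<N. expectation (%x. Z n x * G k x))"
  proof -
    have "expectation (%x. Z n x * sqs (S J x)) = expectation (%x. Z n x * (sqs (S J x) - sqs (W 0 x)) + (\<Sum>k<N. Z n x * G k x))"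
      by (intro Bochner_Integration.integral_cong) (auto simp: tel algebra_simps sum_distrib_left)
    also have "... = expectation (%x. Z n x * (sqs (S J x) - sqs (W 0 x))) + expectation (%x. \<Sum>k<N. Z n x * G k x)"
      unfolding right_diff_distrib
      by (intro Bochner_Integration.integral_add Bochner_Integration.integrable_diff iZ W3 SJ3 Bochner_Integration.integrable_sum iZG)
    finally show ?thesis using iZG by simp
  qed
  define V where "V = {m \<in> J. near pos ell (2 * R) n m}"
  have Vfin: "finite V" using fin by (simp add: V_def)
  have cV: "real (card V) <= 4 * real ell ^ 2 * (R + 1)"
  proof -
    have "card V <= ell * ell * (2 * (2 * R) + 1)" unfolding V_def by (rule near_card[OF pos_inj fin])
    also have "... <= ell * ell * (4 * (R + 1))" by (intro mult_left_mono) auto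
    finally have "real (card V) <= real (ell * ell * (4 * (R + 1)))" by (simp only: of_nat_le_iff)
    then show ?thesis by (simp add: power2_eq_square algebra_simps)
  qed
  have SJW: "S J x - W 0 x = (\<Sum>m\<in>V. Z m x)" for x
  proof -
    have "J - J' (2 * R) = V" by (auto simp: J'_def V_def)
    then show ?thesis using sum_diff[OF fin J'sub[of "2 * R"], of "%m. Z m x"] by (simp add: W_def S_def)
  qed
  have first: "\<bar>expectation (%x. Z n x * (sqs (S J x) - sqs (W 0 x)))\<bar> <= 8 * real ell ^ 2 * (R + 1) * A\<^sup>2 * B"
  proof -
    let ?Y = "%x. \<Sum>m\<in>V. \<bar>Z n x * Z m x * S J x\<bar> + \<bar>Z n x * Z m x * W 0 x\<bar>"
    have i1: "integrable M (%x. \<bar>Z n x * Z m x * X x\<bar>)" "expectation (%x. \<bar>Z n x * Z m x * X x\<bar>) <= A * A * B"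
      if "m \<in> V" "Lpb 3 B X" for m X
      using Lpb_prod3[OF Zn L[of m] that(2)] that(1) e3 w by (auto simp: V_def)
    have iY: "integrable M ?Y" by (intro Bochner_Integration.integrable_sum Bochner_Integration.integrable_add i1 SJ3 W3)
    have le: "\<bar>Z n x * (sqs (S J x) - sqs (W 0 x))\<bar> <= ?Y x" for x
    proof -
      have "\<bar>Z n x * (sqs (S J x) - sqs (W 0 x))\<bar> <= \<bar>Z n x\<bar> * (\<bar>S J x - W 0 x\<bar> * (\<bar>S J x\<bar> + \<bar>W 0 x\<bar>))"
        unfolding abs_mult by (intro mult_left_mono sqs_diff) auto
      also have "... <= \<bar>Z n x\<bar> * ((\<Sum>m\<in>V. \<bar>Z m x\<bar>) * (\<bar>S J x\<bar> + \<bar>W 0 x\<bar>))"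
        unfolding SJW by (intro mult_left_mono mult_right_mono sum_abs) auto
      also have "... = ?Y x" by (simp add: sum_distrib_left sum_distrib_right abs_mult algebra_simps sum.distrib)
      finally show ?thesis .
    qed
    have "expectation (%x. \<bar>Z n x * (sqs (S J x) - sqs (W 0 x))\<bar>) <= expectation ?Y"
      by (rule expectation_abs_mono(2)[OF iY _ le]) measurable
    also have "... = (\<Sum>m\<in>V. expectation (%x. \<bar>Z n x * Z m x * S J x\<bar>) + expectation (%x. \<bar>Z n x * Z m x * W 0 x\<bar>))"
      using i1(1) SJ3 W3 by (simp add: Bochner_Integration.integral_sum)
    also have "... <= (\<Sum>m\<in>V. A * A * B + A * A * B)"
      by (intro sum_mono add_mono i1 SJ3 W3) auto
    also have "... = real (card V) * (2 * A\<^sup>2 * B)" by (simp add: power2_eq_square)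
    also have "... <= (4 * real ell ^ 2 * (R + 1)) * (2 * A\<^sup>2 * B)"
      using B A by (intro mult_right_mono cV) auto
    finally have "expectation (%x. \<bar>Z n x * (sqs (S J x) - sqs (W 0 x))\<bar>) <= 8 * real ell ^ 2 * (R + 1) * A\<^sup>2 * B" by simp
    then show ?thesis using integral_abs_bound[of M "%x. Z n x * (sqs (S J x) - sqs (W 0 x))"] by linarith
  qed
  \<comment> \<open>An increment of \<open>sqs\<close> is a shell sum in L^w times partial sums in
    L^3, hence lies in L^q. Against \<open>Z n\<close> in L^w this leaves the Davydov exponent
    \<open>1 - 1/w - 1/q = 2/3 - 2/w\<close>.\<close>
  define q where "q = 1 / (1 / w + 1 / 3)"
  have q0: "1 / w + 1 / 3 > 0" "1 / w + 1 / 3 <= 1" using w by (auto simp: field_simps)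
  have q1: "q >= 1" "1 / q = 1 / w + 1 / 3" using q0 unfolding q_def by (auto simp: le_divide_eq)
  have shell: "\<bar>expectation (%x. Z n x * G k x)\<bar> <= 80 * D * real ell ^ 4 * A\<^sup>2 * B * real (Suc k) powr (- (\<theta> * \<gamma>))" for k
  proof -
    define l where "l = 2 * R + k"
    have GL: "Lpb q (((real (ell * ell * 2))\<^sup>2 * A) * (2 * (B + B))) (G k)"
    proof -
      define T where "T = {m \<in> J. near pos ell (Suc l) n m \<and> \<not> near pos ell l n m}"
      have T: "finite T" "card T <= ell * ell * 2" unfolding T_def using fin shell_card[OF pos_inj fin] by auto
      have "J' (Suc l) \<subseteq> J' l" using near_mono[of pos ell l n _ "Suc l"] by (auto simp: J'_def)
      moreover have "J' l - J' (Suc l) = T" by (auto simp: J'_def T_def)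
      ultimately have dW: "W k x - W (Suc k) x = (\<Sum>m\<in>T. Z m x)" for x
        using sum_diff[OF J'fin, of "J' (Suc l)" l "%m. Z m x"] by (simp add: W_def S_def l_def)
      have L1: "Lpb w ((real (ell * ell * 2))\<^sup>2 * A) (%x. \<Sum>m\<in>T. Z m x)"
        by (rule Lpb_sum[OF T L]) (use w A in \<open>auto simp: T_def\<close>)
      have L2: "Lpb 3 (2 * (B + B)) (%x. \<bar>W k x\<bar> + \<bar>W (Suc k) x\<bar>)"
        by (intro Lpb_add Lpb_abs W3) auto
      have L3: "Lpb q (((real (ell * ell * 2))\<^sup>2 * A) * (2 * (B + B))) (%x. (\<Sum>m\<in>T. Z m x) * (\<bar>W k x\<bar> + \<bar>W (Suc k) x\<bar>))"
        by (rule Lpb_mult[OF L1 L2]) (use w q1 in auto)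
      show ?thesis
      proof (rule Lpb_mono[OF L3])
        show "\<bar>G k x\<bar> <= \<bar>(\<Sum>m\<in>T. Z m x) * (\<bar>W k x\<bar> + \<bar>W (Suc k) x\<bar>)\<bar>" for x
          using sqs_diff[of "W k x" "W (Suc k) x"] by (simp add: G_def dW abs_mult)
      qed (use q1 in \<open>auto simp: G_def\<close>)
    qed
    define gg where "gg = (%y::nat => real. sqs (\<Sum>m\<in>J' l. 1 * y m) - sqs (\<Sum>m\<in>J' (Suc l). 1 * y m))"
    have gg: "G k x = gg (row x)" for x by (simp add: G_def gg_def W_def S_def l_def)
    have ggc: "continuous_on UNIV gg" unfolding gg_def
      by (intro continuous_on_diff continuous_on_compose2[OF continuous_sqs continuous_sum_coord]) auto
    have ggd: "dep (J' l) gg"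
    proof -
      have "J' (Suc l) \<subseteq> J' l" using near_mono[of pos ell l n _ "Suc l"] by (auto simp: J'_def)
      then show ?thesis unfolding dep_def gg_def by (auto intro!: arg_cong2[of _ _ _ _ "(-)"] arg_cong[of _ _ sqs] sum.cong)
    qed
    have "\<bar>expectation (%x. row x n * gg (row x)) - expectation (%x. row x n) * expectation (%x. gg (row x))\<bar>
      <= 5 * D * (real l + 1 - 2 * real R) powr (- (\<theta> * (1 - 1/w - 1/q))) * A * (((real (ell * ell * 2))\<^sup>2 * A) * (2 * (B + B)))"
    proof (rule cov_bound[of "{n}" "J' l"])
      show "continuous_on UNIV (%y::nat => real. y n)" by (rule continuous_on_product_coordinates)
      show "dep {n} (%y::nat => real. y n)" by (simp add: dep_def)
      show "Lpb q (((real (ell * ell * 2))\<^sup>2 * A) * (2 * (B + B))) (%x. gg (row x))" using GL by (simp add: gg[abs_def])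
      show "1 / w + 1 / q <= 1" using q1(2) e3(2) by simp
      show "0 < ((real (ell * ell * 2))\<^sup>2 * A) * (2 * (B + B))" using ell_pos A B by simp
    qed (use J'fin Zn ggc ggd w q1 A in \<open>auto simp: l_def J'_def\<close>)
    also have "real l + 1 - 2 * real R = real (Suc k)" by (simp add: l_def)
    also have "1 - 1/w - 1/q = \<gamma>" using q1 by (simp add: gam)
    also have "5 * D * real (Suc k) powr (- (\<theta> * \<gamma>)) * A * (((real (ell * ell * 2))\<^sup>2 * A) * (2 * (B + B)))
      = 80 * D * real ell ^ 4 * A\<^sup>2 * B * real (Suc k) powr (- (\<theta> * \<gamma>))"
      by (simp add: power2_eq_square power4_eq_xxxx algebra_simps)
    finally show ?thesis using mean by (simp add: gg)
  qed
  have "(\<Sum>k<N. \<bar>expectation (%x. Z n x * G k x)\<bar>) <= (\<Sum>k<N. 80 * D * real ell ^ 4 * A\<^sup>2 * B * real (Suc k) powr (- (\<theta> * \<gamma>)))"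
    by (intro sum_mono shell)
  also have "... = 80 * D * real ell ^ 4 * A\<^sup>2 * B * (\<Sum>k<N. real (Suc k) powr (- (\<theta> * \<gamma>)))" by (simp add: sum_distrib_left)
  also have "... <= 80 * D * real ell ^ 4 * A\<^sup>2 * B * (\<Sum>k. real (Suc k) powr (- (\<theta> * \<gamma>)))"
    using D1 B A by (intro mult_left_mono sum_le_suminf sm) auto
  also have "... <= 80 * D * real ell ^ 4 * A\<^sup>2 * B * (\<Sum>k. real (Suc k) powr (- (\<theta> * \<gamma>))) * (R + 1)"
  proof -
    have "0 <= 80 * D * real ell ^ 4 * A\<^sup>2 * B * (\<Sum>k. real (Suc k) powr (- (\<theta> * \<gamma>)))"
      using D1 B A suminf_nonneg[OF sm] by (intro mult_nonneg_nonneg) auto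
    from mult_left_mono[OF _ this, of 1 "real (R + 1)"] show ?thesis by simp
  qed
  finally have "(\<Sum>k<N. \<bar>expectation (%x. Z n x * G k x)\<bar>) <= 80 * D * real ell ^ 4 * A\<^sup>2 * B * (\<Sum>k. real (Suc k) powr (- (\<theta> * \<gamma>))) * (R + 1)" .
  then have "\<bar>expectation (%x. Z n x * sqs (S J x))\<bar> <= 8 * real ell ^ 2 * (R + 1) * A\<^sup>2 * B + 80 * D * real ell ^ 4 * A\<^sup>2 * B * (\<Sum>k. real (Suc k) powr (- (\<theta> * \<gamma>))) * (R + 1)"
    unfolding split using first sum_abs[of "%k. expectation (%x. Z n x * G k x)" "{..<N}"] by linarith
  then show ?thesis by (simp add: algebra_simps)
qed

text \<open>\<open>third_moment_step\<close> presupposes a bound for all subsums. It is applied to a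
  subset \<open>J\<close> whose L^3 norm \<open>m J\<close> is maximal, so that \<open>m J\<close>
  itself serves as that bound. This gives \<open>m J ^ 3 <= const * card I * m J\<close>, and
  dividing by \<open>m J\<close> leaves a square root of the cardinality.\<close>

theorem third_moment:
  assumes fin: "finite I" and A: "A > 0" and w: "w > 4"
    and L: "!!m. m \<in> I ==> Lpb w A (Z m)" and mean: "!!m. m \<in> I ==> expectation (Z m) = 0"
    and gam: "\<gamma> = 2/3 - 2/w" and sm: "summable (%k. real (Suc k) powr (- (\<theta> * \<gamma>)))"
  defines "K \<equiv> 8 * real ell ^ 2 + 80 * D * real ell ^ 4 * (\<Sum>k. real (Suc k) powr (- (\<theta> * \<gamma>)))"
  shows "Lpb 3 (A * sqrt (K * (R + 1) * card I)) (S I)"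
proof -
  define m where "m = (%J. expectation (%x. \<bar>S J x\<bar> powr 3) powr (1/3))"
  have L3: "Lpb 3 (m J) (S J)" if "J \<subseteq> I" for J
  proof -
    have fJ: "finite J" using that fin finite_subset by blast
    have "\<exists>B. Lpb w B (%x. \<Sum>n\<in>J. Z n x)" by (rule Lpb_setsum[of _ _ A]) (use that L w A fJ in auto)
    then obtain B where "Lpb w B (S J)" unfolding S_def[abs_def] by blast
    then have "Lpb 3 B (S J)" by (rule Lpb_lower) (use w in auto)
    then have "integrable M (%x. \<bar>S J x\<bar> powr 3)" by (simp add: Lpb_def)
    then show ?thesis by (simp add: Lpb_def m_def powr_powr)
  qed
  have "finite (m ` Pow I)" "m ` Pow I \<noteq> {}" using fin by auto
  from Max_in[OF this] obtain J where J: "J \<subseteq> I" "m J = Max (m ` Pow I)" by auto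
  have mx: "m J' <= m J" if "J' \<subseteq> I" for J' unfolding J(2) by (rule Max_ge) (use that fin in auto)
  have fJ: "finite J" using J fin finite_subset by blast
  have K0: "K >= 0" unfolding K_def using D1 suminf_nonneg[OF sm] by simp
  have "m J <= A * sqrt (K * (R + 1) * card I)"
  proof (cases "m J > 0")
    case False then show ?thesis using A K0 by (smt (verit) mult_nonneg_nonneg of_nat_0_le_iff real_sqrt_ge_zero)
  next
    case pos: True
    have B: "Lpb 3 (m J) (S J')" if "J' \<subseteq> J" for J'
    proof -
      have "J' \<subseteq> I" using that J(1) by (rule order_trans)
      from Lpb_weaken[OF L3[OF this] _ mx[OF this]] show ?thesis by simp
    qed
    have e: "\<bar>S J x\<bar> powr 3 = (\<Sum>n\<in>J. Z n x * sqs (S J x))" for x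
    proof -
      have "\<bar>S J x\<bar> powr 3 = S J x * sqs (S J x)"
        by (simp add: sqs_def power3_eq_cube abs_mult_self_eq flip: mult.assoc)
      then show ?thesis by (simp add: S_def sum_distrib_right)
    qed
    have iZ: "integrable M (%x. Z n x * sqs (S J x))" if "n \<in> J" for n
    proof -
      have "integrable M (%x. Z n x * S J x * S J x)"
        using Lpb_prod3(1)[OF L B B, of n J J] that J w by (auto simp: field_simps)
      then show ?thesis
        by (rule Bochner_Integration.integrable_bound) (auto simp: sqs_def abs_mult)
    qed
    have "m J ^ 3 = expectation (%x. \<bar>S J x\<bar> powr 3)"
    proof -
      have "m J ^ 3 = m J powr 3" using pos by simp
      also have "... = expectation (%x. \<bar>S J x\<bar> powr 3) powr 1" unfolding m_def by (simp add: powr_powr)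
      finally show ?thesis by simp
    qed
    also have "... = (\<Sum>n\<in>J. expectation (%x. Z n x * sqs (S J x)))"
      unfolding e by (rule Bochner_Integration.integral_sum) (rule iZ)
    also have "... <= (\<Sum>n\<in>J. K * (R + 1) * A\<^sup>2 * m J)"
    proof (rule sum_mono)
      fix n assume n: "n \<in> J"
      have "\<bar>expectation (%x. Z n x * sqs (S J x))\<bar> <= K * (R + 1) * A\<^sup>2 * m J"
        unfolding K_def by (rule third_moment_step[OF fJ n A w _ _ pos B gam sm]) (use n J L mean in auto)
      then show "expectation (%x. Z n x * sqs (S J x)) <= K * (R + 1) * A\<^sup>2 * m J" by linarith
    qed
    also have "... = card J * (K * (R + 1) * A\<^sup>2 * m J)" by simp
    also have "... <= card I * (K * (R + 1) * A\<^sup>2 * m J)"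
      using K0 pos card_mono[OF fin J(1)] by (intro mult_right_mono) auto
    finally have "m J * (m J)\<^sup>2 <= m J * (A\<^sup>2 * (K * (R + 1) * card I))"
      by (simp add: power2_eq_square power3_eq_cube mult_ac)
    then have "(m J)\<^sup>2 <= A\<^sup>2 * (K * (R + 1) * card I)" using pos by simp
    then have "sqrt ((m J)\<^sup>2) <= sqrt (A\<^sup>2 * (K * (R + 1) * card I))" by (rule real_sqrt_le_mono)
    then show ?thesis using pos A by (simp add: real_sqrt_mult)
  qed
  with mx[OF order_refl] have "m I <= A * sqrt (K * (R + 1) * card I)" by (rule order_trans)
  from Lpb_weaken[OF L3[OF order_refl] _ this] show ?thesis by simp
qed

end

section \<open>Stein's identity for weighted sums\<close>

lemma sin_taylor: "\<bar>sin y - sin x - cos x * (y - x)\<bar> <= (y - x :: real)\<^sup>2"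
  and cos_lipschitz: "\<bar>cos y - cos x\<bar> <= \<bar>y - x :: real\<bar>"
  and sin_lipschitz: "\<bar>sin y - sin x\<bar> <= \<bar>y - x :: real\<bar>"
proof -
  have lipc: "\<bar>cos y - cos x\<bar> <= \<bar>y - x\<bar>" for x y :: real
    using field_differentiable_bound[of UNIV cos "%x. - sin x" 1 x y]
    by (auto intro!: derivative_eq_intros simp: abs_minus_commute)
  show "\<bar>cos y - cos x\<bar> <= \<bar>y - x\<bar>" by (rule lipc)
  show "\<bar>sin y - sin x\<bar> <= \<bar>y - x\<bar>"
    using field_differentiable_bound[of UNIV sin "%x. cos x" 1 x y]
    by (auto intro!: derivative_eq_intros simp: abs_minus_commute)
  show "\<bar>sin y - sin x - cos x * (y - x)\<bar> <= (y - x)\<^sup>2"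
  proof -
    let ?S = "{min x y..max x y}"
    have "norm ((%z. sin z - cos x * z) x - (%z. sin z - cos x * z) y) <= \<bar>y - x\<bar> * norm (x - y)"
    proof (rule field_differentiable_bound[of ?S _ "%z. cos z - cos x"])
      fix z assume z: "z \<in> ?S"
      show "((%z. sin z - cos x * z) has_field_derivative cos z - cos x) (at z within ?S)"
        by (auto intro!: derivative_eq_intros)
      have "\<bar>cos z - cos x\<bar> <= \<bar>z - x\<bar>" by (rule lipc)
      also have "... <= \<bar>y - x\<bar>" using z by (auto simp: min_def max_def split: if_splits)
      finally show "norm (cos z - cos x) <= \<bar>y - x\<bar>" by simp
    qed auto
    also have "... = (y - x)\<^sup>2" by (simp add: power2_eq_square abs_minus_commute[of x y] flip: abs_mult)
    finally show ?thesis by (simp add: algebra_simps abs_le_iff)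
  qed
qed

lemma cos_taylor: "\<bar>cos y - cos x + sin x * (y - x)\<bar> <= (y - x :: real)\<^sup>2"
proof -
  have "\<bar>cos y - cos x - sin x * ((pi/2 - y) - (pi/2 - x))\<bar> <= ((pi/2 - y) - (pi/2 - x))\<^sup>2"
    using sin_taylor[of "pi/2 - y" "pi/2 - x"] unfolding cos_sin_eq[of y] cos_sin_eq[of x] sin_cos_eq[of x] by simp
  moreover have "(pi/2 - y) - (pi/2 - x) = - (y - x)" by simp
  ultimately have "\<bar>cos y - cos x - sin x * (- (y - x))\<bar> <= (- (y - x))\<^sup>2" by metis
  then show ?thesis unfolding mult_minus_right power2_minus by simp
qed

context prob_space begin

text \<open>A Gronwall argument: the Stein identity says that \<open>u \<mapsto> E cos (u W)\<close> almost solves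
  the differential equation of \<open>exp (- s u\<^sup>2 / 2)\<close>.\<close>
lemma trig_gauss:
  fixes W :: "'a => real"
  assumes W: "W \<in> borel_measurable M" "integrable M (%x. (W x)\<^sup>2)" and s: "s >= 0"
    and c: "!!u. 0 <= u ==> u <= 1 ==> \<bar>expectation (%x. W x * sin (u * W x)) - s * (u * expectation (%x. cos (u * W x)))\<bar> <= e"
    and d: "!!u. 0 <= u ==> u <= 1 ==> \<bar>expectation (%x. W x * cos (u * W x)) + s * (u * expectation (%x. sin (u * W x)))\<bar> <= e"
  shows "\<bar>expectation (%x. cos (W x)) - exp (- s / 2)\<bar> <= e" "\<bar>expectation (%x. sin (W x))\<bar> <= e"
proof -
  have [measurable]: "W \<in> borel_measurable M" by fact
  have iW: "integrable M W"
  proof (rule expectation_abs_mono(1)[of "%x. 1 + (W x)\<^sup>2" W])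
    show "integrable M (%x. 1 + (W x)\<^sup>2)" using W by simp
    show "\<bar>W x\<bar> <= 1 + (W x)\<^sup>2" for x
      using zero_le_power2[of "\<bar>W x\<bar> - 1"] by (simp add: power2_eq_square algebra_simps)
  qed simp
  have bi: "integrable M (%x. W x * k x)" if "k \<in> borel_measurable M" "!!x. \<bar>k x\<bar> <= 1" for k
    by (rule Bochner_Integration.integrable_bound[OF iW]) (use that in \<open>auto simp: abs_mult intro!: AE_I2 mult_left_le\<close>)
  have ib: "integrable M k" if "k \<in> borel_measurable M" "!!x. \<bar>k x\<bar> <= 1" for k :: "'a => real"
    by (rule integrable_bounded_by[OF that])
  have deriv: "((%u. expectation (%x. k (u * W x))) has_real_derivative expectation (%x. W x * k' (u * W x))) (at u)"
    if k: "continuous_on UNIV k" "continuous_on UNIV k'" "!!x. \<bar>k x\<bar> <= 1" "!!x. \<bar>k' x\<bar> <= 1"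
      and tay: "!!x y. \<bar>k y - k x - k' x * (y - x)\<bar> <= (y - x)\<^sup>2" for k k' :: "real => real" and u
  proof -
    have [measurable]: "k \<in> borel_measurable borel" "k' \<in> borel_measurable borel"
      using k by (auto intro: borel_measurable_continuous_onI)
    let ?F = "%u. expectation (%x. k (u * W x))" and ?D = "expectation (%x. W x * k' (u * W x))"
    define Q where "Q = expectation (%x. (W x)\<^sup>2)"
    have bnd: "\<bar>?F (u + h) - ?F u - h * ?D\<bar> <= h\<^sup>2 * Q" for h
    proof -
      have "?F (u + h) - ?F u - h * ?D = expectation (%x. k ((u + h) * W x) - k (u * W x) - h * (W x * k' (u * W x)))"
        using ib[of "%x. k ((u + h) * W x)"] ib[of "%x. k (u * W x)"] bi[of "%x. k' (u * W x)"] k by simp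
      also have "\<bar>...\<bar> <= expectation (%x. h\<^sup>2 * (W x)\<^sup>2)"
      proof (rule order_trans[OF integral_abs_bound])
        have le: "\<bar>k ((u + h) * W x) - k (u * W x) - h * (W x * k' (u * W x))\<bar> <= h\<^sup>2 * (W x)\<^sup>2" for x
          using tay[of "(u + h) * W x" "u * W x"] by (simp add: algebra_simps power_mult_distrib)
        show "expectation (%x. \<bar>k ((u + h) * W x) - k (u * W x) - h * (W x * k' (u * W x))\<bar>) <= expectation (%x. h\<^sup>2 * (W x)\<^sup>2)"
          by (rule integral_mono) (use le W ib[of "%x. k ((u + h) * W x)"] ib[of "%x. k (u * W x)"] bi[of "%x. k' (u * W x)"] k in auto)
      qed
      finally show ?thesis by (simp add: Q_def)
    qed
    have "(%h. (?F (u + h) - ?F u) / h - ?D) \<midarrow>0\<rightarrow> 0"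
    proof (rule Lim_null_comparison)
      show "\<forall>\<^sub>F h in at 0. norm ((?F (u + h) - ?F u) / h - ?D) <= \<bar>h\<bar> * Q"
      proof (rule eventually_at_ball'[OF zero_less_one, THEN eventually_mono])
        fix h :: real assume "h \<in> ball 0 1 \<and> h \<noteq> 0 \<and> h \<in> UNIV"
        then have h: "h \<noteq> 0" by simp
        have "norm ((?F (u + h) - ?F u) / h - ?D) = \<bar>?F (u + h) - ?F u - h * ?D\<bar> / \<bar>h\<bar>"
          using h by (simp add: diff_divide_distrib flip: abs_divide)
        also have "... <= h\<^sup>2 * Q / \<bar>h\<bar>" by (rule divide_right_mono[OF bnd]) simp
        also have "... = \<bar>h\<bar> * Q" using h by (simp add: power2_eq_square field_simps abs_mult_self_eq)
        finally show "norm ((?F (u + h) - ?F u) / h - ?D) <= \<bar>h\<bar> * Q" .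
      qed
      show "(%h. \<bar>h\<bar> * Q) \<midarrow>0\<rightarrow> 0" by (rule tendsto_eq_intros | simp)+
    qed
    then show ?thesis unfolding DERIV_def by (simp add: LIM_zero_iff)
  qed
  have fin: "\<bar>F 1 - F 0 * exp (- s / 2)\<bar> <= e"
    if F: "!!u. (F has_real_derivative F' u) (at u)" and b: "!!u. 0 <= u ==> u <= 1 ==> \<bar>F' u + s * (u * F u)\<bar> <= e" for F F'
  proof -
    \<comment> \<open>With the integrating factor the derivative is
      \<open>(F' u + s * (u * F u)) * exp (s * u^2 / 2)\<close>. The bound for it grows by
      \<open>exp (s / 2)\<close>, and undoing the integrating factor at \<open>u = 1\<close> cancels
      exactly this, so the final error is \<open>e\<close> for every \<open>s\<close>.\<close>
    let ?h = "%u. F u * exp (s * u\<^sup>2 / 2)"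
    have e0: "e >= 0" using b[of 0] by linarith
    have "norm (?h 0 - ?h 1) <= e * exp (s / 2) * norm (0 - 1 :: real)"
    proof (rule field_differentiable_bound[of "{0..1}" _ "%u. (F' u + s * (u * F u)) * exp (s * u\<^sup>2 / 2)"])
      fix u :: real assume u: "u \<in> {0..1}"
      show "(?h has_field_derivative (F' u + s * (u * F u)) * exp (s * u\<^sup>2 / 2)) (at u within {0..1})"
        by (rule DERIV_subset[OF _ subset_UNIV]) (auto intro!: derivative_eq_intros F simp: algebra_simps)
      have "u\<^sup>2 <= 1" using u by (simp add: power_le_one)
      then have "s * u\<^sup>2 / 2 <= s / 2" using s by (simp add: mult_left_le)
      then show "norm ((F' u + s * (u * F u)) * exp (s * u\<^sup>2 / 2)) <= e * exp (s / 2)"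
        unfolding norm_mult by (intro mult_mono) (use b[of u] u e0 in auto)
    qed auto
    then have "\<bar>F 1 * exp (s / 2) - F 0\<bar> <= e * exp (s / 2)" by (simp add: abs_minus_commute)
    then have "\<bar>F 1 * exp (s / 2) - F 0\<bar> * exp (- s / 2) <= e * exp (s / 2) * exp (- s / 2)" by (rule mult_right_mono) simp
    also have "\<bar>F 1 * exp (s / 2) - F 0\<bar> * exp (- s / 2) = \<bar>(F 1 * exp (s / 2) - F 0) * exp (- s / 2)\<bar>" by (simp add: abs_mult)
    also have "(F 1 * exp (s / 2) - F 0) * exp (- s / 2) = F 1 - F 0 * exp (- s / 2)"
      by (simp add: left_diff_distrib mult.assoc flip: exp_add)
    also have "e * exp (s / 2) * exp (- s / 2) = e" by (simp add: mult.assoc flip: exp_add)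
    finally show ?thesis .
  qed
  have cc: "continuous_on UNIV (cos :: real => real)" "continuous_on UNIV (sin :: real => real)" "continuous_on UNIV (%x::real. - sin x)"
    using continuous_on_cos[OF continuous_on_id, of "UNIV :: real set"] continuous_on_sin[OF continuous_on_id, of "UNIV :: real set"]
    by (auto intro!: continuous_on_minus)
  show "\<bar>expectation (%x. cos (W x)) - exp (- s / 2)\<bar> <= e"
  proof -
    have D: "((%u. expectation (%x. cos (u * W x))) has_real_derivative - expectation (%x. W x * sin (u * W x))) (at u)" for u
      using deriv[OF cc(1,3)] cos_taylor by simp
    show ?thesis using fin[OF D] c by (simp add: prob_space abs_minus_commute)
  qed
  show "\<bar>expectation (%x. sin (W x))\<bar> <= e"
  proof -
    have D: "((%u. expectation (%x. sin (u * W x))) has_real_derivative expectation (%x. W x * cos (u * W x))) (at u)" for u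
      using deriv[OF cc(2,1)] sin_taylor by simp
    show ?thesis using fin[OF D] d by (simp add: prob_space)
  qed
qed

end

context mix_array begin

text \<open>For each \<open>n\<close> the sum \<open>W\<close> is compared with the sum
  \<open>W'\<close> without the neighbourhood \<open>V n\<close>. The term
  \<open>Z n * f (W')\<close> is almost centred, the second order remainder involves triples of
  neighbours, and in the linear term \<open>Z n * Z m * f' (W')\<close> the neighbourhood of
  \<open>m\<close> is deleted too before the pair is decoupled. Of the coefficient 4 in the bound, 1
  comes from the Taylor remainder and 3 from changing the argument of \<open>f'\<close> back and
  forth.\<close>

lemma stein_identity:
  assumes fin: "finite I" and A: "A > 0" and w: "w > 4" and l: "2 * R <= l"
    and L: "!!m. m \<in> I ==> Lpb w A (Z m)" and mean: "!!m. m \<in> I ==> expectation (Z m) = 0"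
    and a: "!!n. n \<in> I ==> \<bar>a n\<bar> <= a0" "a0 >= 0"
    and f: "continuous_on UNIV f" "continuous_on UNIV f'" "!!x. \<bar>f x\<bar> <= b0" "!!x. \<bar>f' x\<bar> <= b1" "b0 > 0" "b1 > 0" "b2 >= 0"
    and tay: "!!x y. \<bar>f y - f x - f' x * (y - x)\<bar> <= b2 * (y - x)\<^sup>2" and lip: "!!x y. \<bar>f' y - f' x\<bar> <= b2 * \<bar>y - x\<bar>"
  defines "W \<equiv> %x. \<Sum>n\<in>I. a n * Z n x" and "k \<equiv> real (ell * ell * (2 * l + 1))"
    and "\<alpha>1 \<equiv> 5 * D * (real l + 1 - 2 * real R) powr (- (\<theta> * (1 - 2/w)))"
    and "\<alpha>2 \<equiv> 5 * D * (real l + 1 - 2 * real R) powr (- (\<theta> * (1 - 3/w)))"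
    and "N \<equiv> real (card I)"
  shows "\<bar>expectation (%x. W x * f (W x)) - expectation (%x. (W x)\<^sup>2) * expectation (%x. f' (W x))\<bar>
    <= N * a0 * (\<alpha>1 * A * b0 + 4 * b2 * a0\<^sup>2 * k\<^sup>2 * A ^ 3 + k * a0 * \<alpha>2 * A\<^sup>2 * b1) + N\<^sup>2 * a0\<^sup>2 * \<alpha>1 * A\<^sup>2 * b1"
proof -
  have [measurable]: "f \<in> borel_measurable borel" "f' \<in> borel_measurable borel"
    using f by (auto intro: borel_measurable_continuous_onI)
  define WW where "WW = (%T x. \<Sum>n\<in>T. a n * Z n x)"
  have WWm[measurable]: "WW T \<in> borel_measurable M" for T unfolding WW_def by measurable
  have W_WW: "W = WW I" by (simp add: W_def WW_def)
  have al0: "\<alpha>1 >= 0" "\<alpha>2 >= 0" using D1 by (auto simp: \<alpha>1_def \<alpha>2_def)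
  have k0: "k >= 0" by (simp add: k_def)
  define V where "V = (%n. {m \<in> I. near pos ell l n m})"
  have Vfin: "finite (V n)" and Vsub: "V n \<subseteq> I" for n using fin by (auto simp: V_def)
  have cV: "real (card (V n)) <= k" for n
    unfolding V_def k_def by (simp only: of_nat_le_iff) (rule near_card[OF pos_inj fin])
  have w0: "w > 0" "w / 2 >= 1" "w >= 1" using w by auto
  have e3: "1 / w + 1 / w + 1 / w <= 1" "1 / w + 1 / w <= 1" using w by (auto simp: field_simps)
  have i3: "integrable M (%x. Z n x * Z m x * Z j x)" "expectation (%x. \<bar>Z n x * Z m x * Z j x\<bar>) <= A ^ 3"
    if "n \<in> I" "m \<in> I" "j \<in> I" for n m j
    using Lpb_prod3[OF L L L, of n m j] that e3 w0 by (auto simp: power3_eq_cube)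
  have i2: "integrable M (%x. Z n x * Z m x)" "expectation (%x. \<bar>Z n x * Z m x\<bar>) <= A\<^sup>2" if "n \<in> I" "m \<in> I" for n m
    using Lpb_prod2[OF L L, of n m] that e3 w0 by (auto simp: power2_eq_square)
  have i1: "integrable M (Z n)" "expectation (%x. \<bar>Z n x\<bar>) <= A" if "n \<in> I" for n
    using Lpb_1[OF L[OF that] w0(3)] by auto
  have bm: "integrable M (%x. X x * h x)" if "integrable M X" "h \<in> borel_measurable M" "!!x. \<bar>h x\<bar> <= b" for X h :: "'a => real" and b
  proof -
    have i: "integrable M (%x. b * X x)" using that(1) by simp
    show ?thesis by (rule Bochner_Integration.integrable_bound[OF i])
      (use that in \<open>auto simp: abs_mult mult.commute[of b] intro!: AE_I2 mult_left_mono intro: order_trans[OF _ abs_ge_self]\<close>)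
  qed
  have WWd: "\<bar>WW I' x - WW J' x\<bar> <= a0 * (\<Sum>j\<in>T. \<bar>Z j x\<bar>)" if "J' \<subseteq> I'" "I' \<subseteq> I" "I' - J' \<subseteq> T" "T \<subseteq> I" for I' J' T x
  proof -
    have fI: "finite I'" "finite T" using that fin finite_subset by blast+
    have "WW I' x - WW J' x = (\<Sum>j\<in>I' - J'. a j * Z j x)"
      unfolding WW_def by (rule sum_diff[OF fI(1) that(1), symmetric])
    also have "\<bar>...\<bar> <= (\<Sum>j\<in>I' - J'. a0 * \<bar>Z j x\<bar>)"
      by (rule order_trans[OF sum_abs sum_mono]) (use a that in \<open>auto simp: abs_mult intro!: mult_right_mono\<close>)
    also have "... <= (\<Sum>j\<in>T. a0 * \<bar>Z j x\<bar>)" using that fI a by (intro sum_mono2) auto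
    finally show ?thesis by (simp add: sum_distrib_left)
  qed
  have lin: "continuous_on UNIV (%y::nat => real. h (\<Sum>m\<in>T. a m * y m))" if "continuous_on UNIV h" for h :: "real => real" and T
    by (rule continuous_on_compose2[OF that continuous_sum_coord]) auto
  have lind: "dep T (%y::nat => real. h (\<Sum>m\<in>T. a m * y m))" for h :: "real => real" and T
    unfolding dep_def by (auto intro!: arg_cong[of _ _ h] sum.cong)
  have bL: "Lpb w b (%x. h (WW T x))" if "!!y. \<bar>h y\<bar> <= b" "b > 0" "h \<in> borel_measurable borel" for b h T
  proof (rule Lpb_mono[OF Lpb_const[OF w0(1), of b]])
    show "\<bar>h (WW T x)\<bar> <= \<bar>b\<bar>" for x using that(1)[of "WW T x"] by linarith
  qed (use that w0 in auto)
  define Ef where "Ef = expectation (%x. f' (W x))"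
  have Efb: "\<bar>Ef\<bar> <= b1" unfolding Ef_def by (rule expectation_abs_le) (rule f)
  have c1: "\<bar>expectation (%x. Z n x * f (WW (I - V n) x))\<bar> <= \<alpha>1 * A * b0" if n: "n \<in> I" for n
  proof -
    have "\<bar>expectation (%x. row x n * f (\<Sum>m\<in>I - V n. a m * row x m)) - expectation (%x. row x n) * expectation (%x. f (\<Sum>m\<in>I - V n. a m * row x m))\<bar>
      <= 5 * D * (real l + 1 - 2 * real R) powr (- (\<theta> * (1 - 1/w - 1/w))) * A * b0"
    proof (rule cov_bound[of "{n}" "I - V n"])
      show "continuous_on UNIV (%y::nat => real. y n)" by (rule continuous_on_product_coordinates)
      show "dep {n} (%y::nat => real. y n)" by (simp add: dep_def)
      show "Lpb w b0 (%x. f (\<Sum>m\<in>I - V n. a m * row x m))" using bL[of f b0 "I - V n"] f by (simp add: WW_def)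
    qed (use fin L n w0 e3 A f l lin[OF f(1)] lind in \<open>auto simp: V_def\<close>)
    then show ?thesis using mean[OF n] by (simp add: WW_def \<alpha>1_def)
  qed
  have c2: "\<bar>expectation (%x. Z n x * (f (W x) - f (WW (I - V n) x) - f' (WW (I - V n) x) * (W x - WW (I - V n) x)))\<bar> <= b2 * a0\<^sup>2 * k\<^sup>2 * A ^ 3"
    (is "\<bar>expectation ?X\<bar> <= _") if n: "n \<in> I" for n
  proof -
    let ?Y = "%x. b2 * a0\<^sup>2 * (\<Sum>i\<in>V n. \<Sum>j\<in>V n. \<bar>Z n x * Z i x * Z j x\<bar>)"
    have iY: "integrable M ?Y"
      by (intro integrable_mult_right Bochner_Integration.integrable_sum integrable_abs i3 n) (use Vsub in auto)
    have le: "\<bar>?X x\<bar> <= ?Y x" for x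
    proof -
      have d: "\<bar>W x - WW (I - V n) x\<bar> <= a0 * (\<Sum>j\<in>V n. \<bar>Z j x\<bar>)" unfolding W_WW by (rule WWd) (use Vsub in auto)
      have "\<bar>?X x\<bar> <= \<bar>Z n x\<bar> * (b2 * (W x - WW (I - V n) x)\<^sup>2)"
        unfolding abs_mult by (intro mult_left_mono tay) auto
      also have "... <= \<bar>Z n x\<bar> * (b2 * (a0 * (\<Sum>j\<in>V n. \<bar>Z j x\<bar>))\<^sup>2)"
        using power_mono[OF d, of 2] f(7) by (intro mult_left_mono) auto
      also have "... = ?Y x"
        by (simp add: power2_eq_square sum_product sum_distrib_left abs_mult mult_ac)
      finally show ?thesis .
    qed
    have "expectation (%x. \<bar>?X x\<bar>) <= expectation ?Y"
      by (rule expectation_abs_mono(2)[OF iY _ le]) (simp add: W_WW)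
    also have "... = b2 * a0\<^sup>2 * (\<Sum>i\<in>V n. \<Sum>j\<in>V n. expectation (%x. \<bar>Z n x * Z i x * Z j x\<bar>))"
    proof -
      have i: "integrable M (%x. \<bar>Z n x * Z i x * Z j x\<bar>)" if "i \<in> V n" "j \<in> V n" for i j
        by (intro integrable_abs i3 n) (use that Vsub in auto)
      show ?thesis using i by (simp add: Bochner_Integration.integral_sum)
    qed
    also have "... <= b2 * a0\<^sup>2 * (\<Sum>i\<in>V n. \<Sum>j\<in>V n. A ^ 3)"
      using f(7) by (intro mult_left_mono sum_mono i3 n) (use Vsub in auto)
    also have "... = b2 * a0\<^sup>2 * (real (card (V n)))\<^sup>2 * A ^ 3" by (simp add: power2_eq_square)
    also have "... <= b2 * a0\<^sup>2 * k\<^sup>2 * A ^ 3"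
      using f(7) A cV[of n] by (intro mult_right_mono mult_left_mono power_mono) auto
    finally show ?thesis using integral_abs_bound[of M ?X] by linarith
  qed
  have c3: "\<bar>expectation (%x. Z n x * Z m x * f' (WW (I - V n) x)) - expectation (%x. Z n x * Z m x) * Ef\<bar>
      <= 3 * b2 * a0 * k * A ^ 3 + \<alpha>2 * A\<^sup>2 * b1" if n: "n \<in> I" and mV: "m \<in> V n" for n m
  proof -
    have m: "m \<in> I" using mV Vsub by auto
    \<comment> \<open>After deleting both neighbourhoods the remaining sum is far from
      \<open>n\<close> and from \<open>m\<close>, so the product \<open>Z n * Z m\<close> can be
      detached as one functional of two summands.\<close>
    define U where "U = V n \<union> V m"
    have Usub: "U \<subseteq> I" using Vsub by (auto simp: U_def)
    let ?p = "%x. Z n x * Z m x"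
    have ip: "integrable M ?p" by (rule i2[OF n m])
    have s1: "\<bar>expectation (%x. ?p x * (f' (WW (I - V n) x) - f' (WW (I - U) x)))\<bar> <= b2 * a0 * k * A ^ 3"
    proof -
      let ?X = "%x. ?p x * (f' (WW (I - V n) x) - f' (WW (I - U) x))"
      let ?Y = "%x. b2 * a0 * (\<Sum>j\<in>V m. \<bar>Z n x * Z m x * Z j x\<bar>)"
      have iY: "integrable M ?Y"
        by (intro integrable_mult_right Bochner_Integration.integrable_sum integrable_abs i3 n m) (use Vsub in auto)
      have le: "\<bar>?X x\<bar> <= ?Y x" for x
      proof -
        have d: "\<bar>WW (I - V n) x - WW (I - U) x\<bar> <= a0 * (\<Sum>j\<in>V m. \<bar>Z j x\<bar>)" by (rule WWd) (use Vsub in \<open>auto simp: U_def\<close>)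
        have "\<bar>?X x\<bar> <= \<bar>?p x\<bar> * (b2 * \<bar>WW (I - V n) x - WW (I - U) x\<bar>)"
          unfolding abs_mult by (intro mult_left_mono lip) auto
        also have "... <= \<bar>?p x\<bar> * (b2 * (a0 * (\<Sum>j\<in>V m. \<bar>Z j x\<bar>)))"
          using d f(7) by (intro mult_left_mono) auto
        also have "... = ?Y x" by (simp add: sum_distrib_left abs_mult mult_ac)
        finally show ?thesis .
      qed
      have "expectation (%x. \<bar>?X x\<bar>) <= expectation ?Y"
        by (rule expectation_abs_mono(2)[OF iY _ le]) measurable
      also have "... = b2 * a0 * (\<Sum>j\<in>V m. expectation (%x. \<bar>Z n x * Z m x * Z j x\<bar>))"
      proof -
        have i: "integrable M (%x. \<bar>Z n x * Z m x * Z j x\<bar>)" if "j \<in> V m" for j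
          by (intro integrable_abs i3 n m) (use that Vsub in auto)
        show ?thesis using i by (simp add: Bochner_Integration.integral_sum)
      qed
      also have "... <= b2 * a0 * (\<Sum>j\<in>V m. A ^ 3)"
        using f(7) a(2) by (intro mult_left_mono sum_mono i3 n m) (use Vsub in auto)
      also have "... = b2 * a0 * real (card (V m)) * A ^ 3" by simp
      also have "... <= b2 * a0 * k * A ^ 3"
        using f(7) A a(2) cV[of m] by (intro mult_right_mono mult_left_mono) auto
      finally show ?thesis using integral_abs_bound[of M ?X] by linarith
    qed
    have s2: "\<bar>expectation (%x. ?p x * f' (WW (I - U) x)) - expectation ?p * expectation (%x. f' (WW (I - U) x))\<bar> <= \<alpha>2 * A\<^sup>2 * b1"
    proof -
      have "\<bar>expectation (%x. row x n * row x m * f' (\<Sum>j\<in>I - U. a j * row x j)) - expectation (%x. row x n * row x m) * expectation (%x. f' (\<Sum>j\<in>I - U. a j * row x j))\<bar>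
        <= 5 * D * (real l + 1 - 2 * real R) powr (- (\<theta> * (1 - 1/(w/2) - 1/w))) * A\<^sup>2 * b1"
      proof (rule cov_bound[of "{n, m}" "I - U"])
        show "continuous_on UNIV (%y::nat => real. y n * y m)"
          by (intro continuous_on_mult continuous_on_product_coordinates)
        show "dep {n, m} (%y::nat => real. y n * y m)" by (simp add: dep_def)
        show "Lpb w b1 (%x. f' (\<Sum>m\<in>I - U. a m * row x m))" using bL[of f' b1 "I - U"] f by (simp add: WW_def)
        \<comment> \<open>A product of two summands has only \<open>w / 2\<close> moments; together
          with \<open>f'\<close> in L^w this turns the exponent \<open>1 - 2/w\<close> of single
          summands into \<open>1 - 3/w\<close>.\<close>
        show "Lpb (w / 2) (A\<^sup>2) (%x. row x n * row x m)"
          unfolding power2_eq_square by (rule Lpb_mult[OF L[OF n] L[OF m]]) (use w0 in auto)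
        show "card {n, m} <= 2" by (simp add: card_insert_if)
        show "1 / (w / 2) + 1 / w <= 1" using w by (simp add: field_simps)
      qed (use fin w0 e3 A f l lin[OF f(2)] lind in \<open>auto simp: V_def U_def\<close>)
      moreover have "1 - 1/(w/2) - 1/w = 1 - 3/w" by (simp add: field_simps)
      ultimately show ?thesis by (simp add: WW_def \<alpha>2_def)
    qed
    have s3: "\<bar>expectation ?p * (expectation (%x. f' (WW (I - U) x)) - Ef)\<bar> <= 2 * b2 * a0 * k * A ^ 3"
    proof -
      let ?X = "%x. f' (WW (I - U) x) - f' (W x)"
      let ?Y = "%x. b2 * a0 * (\<Sum>j\<in>U. \<bar>Z j x\<bar>)"
      have iY: "integrable M ?Y"
        by (intro integrable_mult_right Bochner_Integration.integrable_sum integrable_abs i1) (use Usub in auto)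
      have le: "\<bar>?X x\<bar> <= ?Y x" for x
      proof -
        have d: "\<bar>W x - WW (I - U) x\<bar> <= a0 * (\<Sum>j\<in>U. \<bar>Z j x\<bar>)" unfolding W_WW by (rule WWd) (use Usub in auto)
        have "\<bar>?X x\<bar> <= b2 * \<bar>WW (I - U) x - W x\<bar>" by (rule lip)
        also have "... <= b2 * (a0 * (\<Sum>j\<in>U. \<bar>Z j x\<bar>))"
          using d f(7) by (intro mult_left_mono) (auto simp: abs_minus_commute)
        finally show ?thesis by (simp add: mult_ac)
      qed
      have "expectation (%x. \<bar>?X x\<bar>) <= expectation ?Y"
        by (rule expectation_abs_mono(2)[OF iY _ le]) (simp add: W_WW)
      also have "... = b2 * a0 * (\<Sum>j\<in>U. expectation (%x. \<bar>Z j x\<bar>))"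
      proof -
        have i: "integrable M (%x. \<bar>Z j x\<bar>)" if "j \<in> U" for j
          by (intro integrable_abs i1) (use that Usub in auto)
        show ?thesis using i by (simp add: Bochner_Integration.integral_sum)
      qed
      also have "... <= b2 * a0 * (\<Sum>j\<in>U. A)"
        using f(7) a(2) by (intro mult_left_mono sum_mono i1) (use Usub in auto)
      also have "... = b2 * a0 * real (card U) * A" by simp
      also have "... <= b2 * a0 * (2 * k) * A"
      proof -
        have "card U <= card (V n) + card (V m)" unfolding U_def by (rule card_Un_le)
        then have "real (card U) <= 2 * k" using cV[of n] cV[of m] by linarith
        then show ?thesis using f(7) A a(2) by (intro mult_right_mono mult_left_mono) auto
      qed
      finally have E: "\<bar>expectation ?X\<bar> <= b2 * a0 * (2 * k) * A" using integral_abs_bound[of M ?X] by linarith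
      have iff': "integrable M (%x. f' (WW T x))" for T by (rule integrable_bounded_by[where c=b1]) (use f in auto)
      have "expectation ?X = expectation (%x. f' (WW (I - U) x)) - Ef"
        unfolding Ef_def W_WW by (rule Bochner_Integration.integral_diff) (rule iff')+
      then have "\<bar>expectation ?p * (expectation (%x. f' (WW (I - U) x)) - Ef)\<bar> <= A\<^sup>2 * (b2 * a0 * (2 * k) * A)"
        unfolding abs_mult using E order_trans[OF integral_abs_bound i2(2)[OF n m]] by (intro mult_mono) auto
      then show ?thesis by (simp add: power2_eq_square power3_eq_cube mult_ac)
    qed
    have iff: "integrable M (%x. ?p x * f' (WW T x))" for T by (rule bm[OF ip]) (use f in auto)
    have "expectation (%x. ?p x * (f' (WW (I - V n) x) - f' (WW (I - U) x))) = expectation (%x. ?p x * f' (WW (I - V n) x)) - expectation (%x. ?p x * f' (WW (I - U) x))"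
      unfolding right_diff_distrib by (rule Bochner_Integration.integral_diff) (rule iff)+
    then show ?thesis using s1 s2 s3 unfolding right_diff_distrib by linarith
  qed
  have per_n: "\<bar>expectation (%x. Z n x * f (W x)) - (\<Sum>m\<in>V n. a m * expectation (%x. Z n x * Z m x)) * Ef\<bar>
     <= \<alpha>1 * A * b0 + 4 * b2 * a0\<^sup>2 * k\<^sup>2 * A ^ 3 + k * a0 * \<alpha>2 * A\<^sup>2 * b1" if n: "n \<in> I" for n
  proof -
    let ?W' = "WW (I - V n)"
    let ?X = "%x. Z n x * (f (W x) - f (?W' x) - f' (?W' x) * (W x - ?W' x))"
    have ia: "integrable M (%x. Z n x * f (?W' x))" by (rule bm[OF i1(1)[OF n]]) (use f in auto)
    have ib: "integrable M (%x. Z n x * f (W x))" unfolding W_WW by (rule bm[OF i1(1)[OF n]]) (use f in auto)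
    have ic: "integrable M (%x. Z n x * Z m x * f' (?W' x))" if "m \<in> V n" for m
      by (rule bm[OF i2(1)[OF n]]) (use f that Vsub in auto)
    have T: "W x - ?W' x = (\<Sum>m\<in>V n. a m * Z m x)" for x
    proof -
      have "I - (I - V n) = V n" using Vsub by auto
      then show ?thesis unfolding W_WW WW_def using sum_diff[OF fin, of "I - V n" "%m. a m * Z m x"] by auto
    qed
    have id: "integrable M (%x. \<Sum>m\<in>V n. a m * (Z n x * Z m x * f' (?W' x)))"
      by (intro Bochner_Integration.integrable_sum integrable_mult_right ic)
    have eX: "?X x = Z n x * f (W x) - Z n x * f (?W' x) - (\<Sum>m\<in>V n. a m * (Z n x * Z m x * f' (?W' x)))" for x
      unfolding T by (simp add: algebra_simps sum_distrib_left)
    have "expectation ?X = expectation (%x. Z n x * f (W x)) - expectation (%x. Z n x * f (?W' x)) - (\<Sum>m\<in>V n. a m * expectation (%x. Z n x * Z m x * f' (?W' x)))"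
      unfolding eX using ia ib ic id by (simp add: Bochner_Integration.integral_sum)
    moreover have "\<bar>(\<Sum>m\<in>V n. a m * expectation (%x. Z n x * Z m x * f' (?W' x))) - (\<Sum>m\<in>V n. a m * expectation (%x. Z n x * Z m x)) * Ef\<bar>
       <= k * (a0 * (3 * b2 * a0 * k * A ^ 3 + \<alpha>2 * A\<^sup>2 * b1))"
    proof -
      have eq: "(\<Sum>m\<in>V n. a m * expectation (%x. Z n x * Z m x * f' (?W' x))) - (\<Sum>m\<in>V n. a m * expectation (%x. Z n x * Z m x)) * Ef
        = (\<Sum>m\<in>V n. a m * (expectation (%x. Z n x * Z m x * f' (?W' x)) - expectation (%x. Z n x * Z m x) * Ef))"
        by (simp add: sum_distrib_right right_diff_distrib sum_subtractf mult.assoc)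
      have "\<bar>\<Sum>m\<in>V n. a m * (expectation (%x. Z n x * Z m x * f' (?W' x)) - expectation (%x. Z n x * Z m x) * Ef)\<bar>
        <= (\<Sum>m\<in>V n. a0 * (3 * b2 * a0 * k * A ^ 3 + \<alpha>2 * A\<^sup>2 * b1))"
      proof (rule order_trans[OF sum_abs sum_mono])
        fix m assume m: "m \<in> V n"
        then have "m \<in> I" using Vsub by auto
        then show "\<bar>a m * (expectation (%x. Z n x * Z m x * f' (?W' x)) - expectation (%x. Z n x * Z m x) * Ef)\<bar> <= a0 * (3 * b2 * a0 * k * A ^ 3 + \<alpha>2 * A\<^sup>2 * b1)"
          unfolding abs_mult using a by (intro mult_mono c3 n m) auto
      qed
      also have "... = real (card (V n)) * (a0 * (3 * b2 * a0 * k * A ^ 3 + \<alpha>2 * A\<^sup>2 * b1))" by simp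
      also have "... <= k * (a0 * (3 * b2 * a0 * k * A ^ 3 + \<alpha>2 * A\<^sup>2 * b1))"
        using cV[of n] a f A k0 al0 by (intro mult_right_mono mult_nonneg_nonneg add_nonneg_nonneg) auto
      finally show ?thesis unfolding eq .
    qed
    moreover have "k * (a0 * (3 * b2 * a0 * k * A ^ 3 + \<alpha>2 * A\<^sup>2 * b1)) = 3 * b2 * a0\<^sup>2 * k\<^sup>2 * A ^ 3 + k * a0 * \<alpha>2 * A\<^sup>2 * b1"
      by (simp add: power2_eq_square algebra_simps)
    ultimately show ?thesis using c1[OF n] c2[OF n] by linarith
  qed
  define err where "err = \<alpha>1 * A * b0 + 4 * b2 * a0\<^sup>2 * k\<^sup>2 * A ^ 3 + k * a0 * \<alpha>2 * A\<^sup>2 * b1"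
  have err0: "err >= 0" using al0 A f a k0 by (simp add: err_def)
  have EWf: "expectation (%x. W x * f (W x)) = (\<Sum>n\<in>I. a n * expectation (%x. Z n x * f (W x)))"
  proof -
    have ib: "integrable M (%x. Z n x * f (W x))" if "n \<in> I" for n unfolding W_WW by (rule bm[OF i1(1)[OF that]]) (use f in auto)
    have "expectation (%x. W x * f (W x)) = expectation (%x. \<Sum>n\<in>I. a n * (Z n x * f (W x)))"
      by (intro Bochner_Integration.integral_cong refl) (simp add: W_def sum_distrib_right mult_ac)
    then show ?thesis using ib by (simp add: Bochner_Integration.integral_sum)
  qed
  have EWW: "expectation (%x. (W x)\<^sup>2) = (\<Sum>n\<in>I. a n * (\<Sum>m\<in>I. a m * expectation (%x. Z n x * Z m x)))"
  proof -
    have "expectation (%x. (W x)\<^sup>2) = expectation (%x. \<Sum>n\<in>I. \<Sum>m\<in>I. a n * a m * (Z n x * Z m x))"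
      by (intro Bochner_Integration.integral_cong refl) (simp add: W_def power2_eq_square sum_product mult_ac)
    also have "... = (\<Sum>n\<in>I. \<Sum>m\<in>I. a n * a m * expectation (%x. Z n x * Z m x))"
      using i2(1) by (simp add: Bochner_Integration.integral_sum)
    finally show ?thesis by (simp add: sum_distrib_left mult_ac)
  qed
  \<comment> \<open>The local expansion produces covariances within \<open>V n\<close> only, while
    the variance of \<open>W\<close> contains all pairs. The missing pairs decorrelate, and summing
    over all of them gives the term with \<open>N\<close> squared.\<close>
  have far: "\<bar>(\<Sum>m\<in>I. a m * expectation (%x. Z n x * Z m x)) - (\<Sum>m\<in>V n. a m * expectation (%x. Z n x * Z m x))\<bar> <= N * (a0 * (\<alpha>1 * A\<^sup>2))" if n: "n \<in> I" for n
  proof -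
    have "(\<Sum>m\<in>I. a m * expectation (%x. Z n x * Z m x)) - (\<Sum>m\<in>V n. a m * expectation (%x. Z n x * Z m x)) = (\<Sum>m\<in>I - V n. a m * expectation (%x. Z n x * Z m x))"
      by (rule sum_diff[OF fin Vsub, symmetric])
    also have "\<bar>...\<bar> <= (\<Sum>m\<in>I - V n. a0 * (\<alpha>1 * A\<^sup>2))"
    proof (rule order_trans[OF sum_abs sum_mono])
      fix m assume m: "m \<in> I - V n"
      have "\<bar>expectation (%x. row x n * row x m) - expectation (%x. row x n) * expectation (%x. row x m)\<bar>
        <= 5 * D * (real l + 1 - 2 * real R) powr (- (\<theta> * (1 - 1/w - 1/w))) * A * A"
      proof (rule cov_bound[of "{n}" "{m}" l "%y. y n" "%y. y m"])
        show "continuous_on UNIV (%y::nat => real. y n)" "continuous_on UNIV (%y::nat => real. y m)" by (rule continuous_on_product_coordinates)+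
        show "dep {n} (%y::nat => real. y n)" "dep {m} (%y::nat => real. y m)" by (auto simp: dep_def)
      qed (use n m L w0 e3 A l in \<open>auto simp: V_def\<close>)
      then have "\<bar>expectation (%x. Z n x * Z m x)\<bar> <= \<alpha>1 * A\<^sup>2" using mean[OF n] by (simp add: \<alpha>1_def power2_eq_square mult_ac)
      then show "\<bar>a m * expectation (%x. Z n x * Z m x)\<bar> <= a0 * (\<alpha>1 * A\<^sup>2)"
        unfolding abs_mult using a m by (intro mult_mono) auto
    qed
    also have "... = real (card (I - V n)) * (a0 * (\<alpha>1 * A\<^sup>2))" by simp
    also have "... <= N * (a0 * (\<alpha>1 * A\<^sup>2))"
      unfolding N_def using al0 a card_mono[OF fin, of "I - V n"] by (intro mult_right_mono) auto
    finally show ?thesis .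
  qed
  \<comment> \<open>The total error belonging to \<open>n\<close>: that of the expansion minus the
    contribution of the far covariances. With this choice the weighted sum of the \<open>G n\<close>
    equals the left-hand side exactly.\<close>
  define G where "G = (%n. (expectation (%x. Z n x * f (W x)) - (\<Sum>m\<in>V n. a m * expectation (%x. Z n x * Z m x)) * Ef)
       - ((\<Sum>m\<in>I. a m * expectation (%x. Z n x * Z m x)) - (\<Sum>m\<in>V n. a m * expectation (%x. Z n x * Z m x))) * Ef)"
  have alg: "a' * ((X - U * E) - (T - U) * E) = a' * X - (a' * T) * E" for a' X U E T :: real
    by (simp add: algebra_simps)
  have EQ: "expectation (%x. W x * f (W x)) - expectation (%x. (W x)\<^sup>2) * Ef = (\<Sum>n\<in>I. a n * G n)"
  proof -
    let ?X = "%n. expectation (%x. Z n x * f (W x))" and ?T = "%n. \<Sum>m\<in>I. a m * expectation (%x. Z n x * Z m x)"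
    have "(\<Sum>n\<in>I. a n * G n) = (\<Sum>n\<in>I. a n * ?X n - (a n * ?T n) * Ef)"
      unfolding G_def by (intro sum.cong refl alg)
    also have "... = (\<Sum>n\<in>I. a n * ?X n) - (\<Sum>n\<in>I. a n * ?T n) * Ef"
      by (simp only: sum_subtractf sum_distrib_right)
    finally show ?thesis unfolding EWf EWW by simp
  qed
  have Gb: "\<bar>G n\<bar> <= err + N * (a0 * (\<alpha>1 * A\<^sup>2)) * b1" if n: "n \<in> I" for n
  proof -
    have "\<bar>((\<Sum>m\<in>I. a m * expectation (%x. Z n x * Z m x)) - (\<Sum>m\<in>V n. a m * expectation (%x. Z n x * Z m x))) * Ef\<bar> <= N * (a0 * (\<alpha>1 * A\<^sup>2)) * b1"
      unfolding abs_mult using far[OF n] Efb by (intro mult_mono) auto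
    then show ?thesis using per_n[OF n, folded err_def] unfolding G_def by linarith
  qed
  have "\<bar>\<Sum>n\<in>I. a n * G n\<bar> <= (\<Sum>n\<in>I. a0 * (err + N * (a0 * (\<alpha>1 * A\<^sup>2)) * b1))"
  proof (rule order_trans[OF sum_abs sum_mono])
    fix n assume n: "n \<in> I"
    show "\<bar>a n * G n\<bar> <= a0 * (err + N * (a0 * (\<alpha>1 * A\<^sup>2)) * b1)"
      unfolding abs_mult using a n Gb by (intro mult_mono) auto
  qed
  also have "... = N * a0 * err + N\<^sup>2 * a0\<^sup>2 * \<alpha>1 * A\<^sup>2 * b1" by (simp add: N_def power2_eq_square algebra_simps)
  finally have "\<bar>\<Sum>n\<in>I. a n * G n\<bar> <= N * a0 * err + N\<^sup>2 * a0\<^sup>2 * \<alpha>1 * A\<^sup>2 * b1" .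
  then show ?thesis unfolding EQ[symmetric] by (simp add: err_def Ef_def)
qed

text \<open>The functions \<open>sin (u * x)\<close> and \<open>cos (u * x)\<close> with
  \<open>u\<close> between 0 and 1 have derivatives and second order constants bounded by 1. The
  Stein error is therefore uniform in \<open>u\<close>, as the Gronwall argument
  \<open>trig_gauss\<close> demands, and the variance is left as it is.\<close>

theorem trig_moments_close_to_gauss:
  assumes fin: "finite I" and A: "A > 0" and w: "w > 4" and l: "2 * R <= l"
    and L: "!!m. m \<in> I ==> Lpb w A (Z m)" and mean: "!!m. m \<in> I ==> expectation (Z m) = 0"
    and a: "!!n. n \<in> I ==> \<bar>a n\<bar> <= a0" "a0 >= 0"
  defines "W \<equiv> %x. \<Sum>n\<in>I. a n * Z n x" and "k \<equiv> real (ell * ell * (2 * l + 1))"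
    and "\<alpha>1 \<equiv> 5 * D * (real l + 1 - 2 * real R) powr (- (\<theta> * (1 - 2/w)))"
    and "\<alpha>2 \<equiv> 5 * D * (real l + 1 - 2 * real R) powr (- (\<theta> * (1 - 3/w)))"
    and "N \<equiv> real (card I)"
  defines "e \<equiv> N * a0 * (\<alpha>1 * A + 4 * a0\<^sup>2 * k\<^sup>2 * A ^ 3 + k * a0 * \<alpha>2 * A\<^sup>2) + N\<^sup>2 * a0\<^sup>2 * \<alpha>1 * A\<^sup>2"
  shows "\<bar>expectation (%x. cos (W x)) - exp (- expectation (%x. (W x)\<^sup>2) / 2)\<bar> <= e" "\<bar>expectation (%x. sin (W x))\<bar> <= e"
proof -
  have Wm[measurable]: "W \<in> borel_measurable M" unfolding W_def by measurable
  have WL: "\<exists>B. Lpb 2 B W"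
  proof -
    have "\<exists>B. Lpb 2 B (%x. \<Sum>n\<in>I. a n * Z n x)"
    proof (rule Lpb_setsum[of _ _ "a0 * A"])
      fix n assume n: "n \<in> I"
      have "Lpb 2 A (Z n)" by (rule Lpb_lower[OF L[OF n]]) (use w in auto)
      from Lpb_scale[OF this, of "a n"] have "Lpb 2 (\<bar>a n\<bar> * A) (%x. a n * Z n x)" by simp
      then show "Lpb 2 (a0 * A) (%x. a n * Z n x)" by (rule Lpb_weaken) (use a n A in auto)
    qed (use fin a A in auto)
    then show ?thesis by (simp add: W_def)
  qed
  have W2: "integrable M (%x. (W x)\<^sup>2)" using WL by (auto simp: Lpb_def)
  have s: "0 <= expectation (%x. (W x)\<^sup>2)" by simp
  have lipu: "\<bar>u * y - u * x\<bar> = u * \<bar>y - x\<bar>" if "u >= 0" for u x y :: real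
    using that by (simp add: abs_mult flip: right_diff_distrib)
  have uu: "u * u <= 1" if "0 <= u" "u <= 1" for u :: real using that by (simp add: mult_le_one)
  have c: "\<bar>expectation (%x. W x * sin (u * W x)) - expectation (%x. (W x)\<^sup>2) * (u * expectation (%x. cos (u * W x)))\<bar> <= e"
    if u: "0 <= u" "u <= 1" for u
  proof -
    have t: "\<bar>sin (u * y) - sin (u * x) - u * cos (u * x) * (y - x)\<bar> <= 1 * (y - x)\<^sup>2" for x y
    proof -
      have "\<bar>sin (u * y) - sin (u * x) - cos (u * x) * (u * y - u * x)\<bar> <= (u * y - u * x)\<^sup>2" by (rule sin_taylor)
      also have "... = (u * u) * (y - x)\<^sup>2" by (simp add: power2_eq_square algebra_simps)
      also have "... <= 1 * (y - x)\<^sup>2" by (rule mult_right_mono[OF uu[OF u]]) simp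
      finally show ?thesis by (simp add: algebra_simps)
    qed
    have lp: "\<bar>u * cos (u * y) - u * cos (u * x)\<bar> <= 1 * \<bar>y - x\<bar>" for x y
    proof -
      have "\<bar>u * cos (u * y) - u * cos (u * x)\<bar> = u * \<bar>cos (u * y) - cos (u * x)\<bar>" by (rule lipu[OF u(1)])
      also have "... <= u * (u * \<bar>y - x\<bar>)" using cos_lipschitz[of "u * y" "u * x"] lipu[OF u(1), of y x] u by (intro mult_left_mono) auto
      also have "... = (u * u) * \<bar>y - x\<bar>" by simp
      also have "... <= 1 * \<bar>y - x\<bar>" by (rule mult_right_mono[OF uu[OF u]]) simp
      finally show ?thesis .
    qed
    have "\<bar>u * cos (u * x)\<bar> <= 1" for x using u by (auto simp: abs_mult intro!: mult_le_one)
    note bnd = this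
    have "\<bar>expectation (%x. W x * sin (u * W x)) - expectation (%x. (W x)\<^sup>2) * expectation (%x. u * cos (u * W x))\<bar>
      <= N * a0 * (\<alpha>1 * A * 1 + 4 * 1 * a0\<^sup>2 * k\<^sup>2 * A ^ 3 + k * a0 * \<alpha>2 * A\<^sup>2 * 1) + N\<^sup>2 * a0\<^sup>2 * \<alpha>1 * A\<^sup>2 * 1"
      unfolding W_def k_def \<alpha>1_def \<alpha>2_def N_def
      by (rule stein_identity[OF fin A w l L mean a, where f="%x. sin (u * x)" and f'="%x. u * cos (u * x)"])
        (use t lp bnd in \<open>auto intro!: continuous_intros\<close>)
    then show ?thesis by (simp add: e_def)
  qed
  have d: "\<bar>expectation (%x. W x * cos (u * W x)) + expectation (%x. (W x)\<^sup>2) * (u * expectation (%x. sin (u * W x)))\<bar> <= e"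
    if u: "0 <= u" "u <= 1" for u
  proof -
    have t: "\<bar>cos (u * y) - cos (u * x) - - (u * sin (u * x)) * (y - x)\<bar> <= 1 * (y - x)\<^sup>2" for x y
    proof -
      have "\<bar>cos (u * y) - cos (u * x) + sin (u * x) * (u * y - u * x)\<bar> <= (u * y - u * x)\<^sup>2" by (rule cos_taylor)
      also have "... = (u * u) * (y - x)\<^sup>2" by (simp add: power2_eq_square algebra_simps)
      also have "... <= 1 * (y - x)\<^sup>2" by (rule mult_right_mono[OF uu[OF u]]) simp
      finally show ?thesis by (simp add: algebra_simps)
    qed
    have lp: "\<bar>- (u * sin (u * y)) - - (u * sin (u * x))\<bar> <= 1 * \<bar>y - x\<bar>" for x y
    proof -
      have "\<bar>- (u * sin (u * y)) - - (u * sin (u * x))\<bar> = u * \<bar>sin (u * y) - sin (u * x)\<bar>" using lipu[OF u(1), of "sin (u * y)" "sin (u * x)"] by linarith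
      also have "... <= u * (u * \<bar>y - x\<bar>)" using sin_lipschitz[of "u * y" "u * x"] lipu[OF u(1), of y x] u by (intro mult_left_mono) auto
      also have "... = (u * u) * \<bar>y - x\<bar>" by simp
      also have "... <= 1 * \<bar>y - x\<bar>" by (rule mult_right_mono[OF uu[OF u]]) simp
      finally show ?thesis .
    qed
    have "\<bar>- (u * sin (u * x))\<bar> <= 1" for x using u by (auto simp: abs_mult intro!: mult_le_one)
    note bnd = this
    have "\<bar>expectation (%x. W x * cos (u * W x)) - expectation (%x. (W x)\<^sup>2) * expectation (%x. - (u * sin (u * W x)))\<bar>
      <= N * a0 * (\<alpha>1 * A * 1 + 4 * 1 * a0\<^sup>2 * k\<^sup>2 * A ^ 3 + k * a0 * \<alpha>2 * A\<^sup>2 * 1) + N\<^sup>2 * a0\<^sup>2 * \<alpha>1 * A\<^sup>2 * 1"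
      unfolding W_def k_def \<alpha>1_def \<alpha>2_def N_def
      by (rule stein_identity[OF fin A w l L mean a, where f="%x. cos (u * x)" and f'="%x. - (u * sin (u * x))"])
        (use t lp bnd in \<open>auto intro!: continuous_intros\<close>)
    then show ?thesis by (simp add: e_def)
  qed
  show "\<bar>expectation (%x. cos (W x)) - exp (- expectation (%x. (W x)\<^sup>2) / 2)\<bar> <= e" "\<bar>expectation (%x. sin (W x))\<bar> <= e"
    by (rule trig_gauss[OF Wm W2 s c d]; assumption)+
qed

end

section \<open>From trigonometric moments to bounded Lipschitz functions\<close>

definition gker :: "nat => real => (nat => real) => (nat => real) => real" where
  "gker m \<sigma> x y = (\<Prod>j<m. normal_density (x j) \<sigma> (y j))"

abbreviation "leb m \<equiv> PiM {..<m} (%_::nat. lborel :: real measure)"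
abbreviation "gss m \<equiv> PiM {..<m} (%_::nat. std_normal_distribution)"

interpretation lebP: product_sigma_finite "%_::nat. lborel :: real measure"
  by (intro product_sigma_finite.intro sigma_finite_lborel)

interpretation gssP: product_sigma_finite "%_::nat. std_normal_distribution"
  by (intro product_sigma_finite.intro prob_space_imp_sigma_finite prob_space_normal_density) simp

lemma prob_space_gss: "prob_space (gss m)"
  by (intro prob_space_PiM prob_space_normal_density) simp

lemma sigma_finite_leb: "sigma_finite_measure (leb m)"
  by (intro lebP.sigma_finite) simp

lemma gker_nonneg: "gker m \<sigma> x y >= 0" unfolding gker_def by (intro prod_nonneg) simp

lemma gker_integral:
  assumes "\<sigma> > 0" shows "integrable (leb m) (gker m \<sigma> x)" "(\<integral>y. gker m \<sigma> x y \<partial>leb m) = 1"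
proof -
  have i: "integrable lborel (normal_density (x j) \<sigma>)" for j using assms by simp
  show "integrable (leb m) (gker m \<sigma> x)" unfolding gker_def[abs_def]
    by (rule lebP.product_integrable_prod) (auto intro: i)
  have "(\<integral>y. (\<Prod>j<m. normal_density (x j) \<sigma> (y j)) \<partial>leb m) = (\<Prod>j<m. integral\<^sup>L lborel (normal_density (x j) \<sigma>))"
    by (rule lebP.product_integral_prod) (auto intro: i)
  then show "(\<integral>y. gker m \<sigma> x y \<partial>leb m) = 1" using assms by (simp add: gker_def)
qed

text \<open>The normal density is, up to scaling, its own Fourier transform: an average of cosines
  of linear forms in \<open>y - x\<close> over normal frequencies. Averaging over a random
  \<open>x\<close> thus expresses a smoothed density through trigonometric moments alone.\<close>

lemma gker_fourier:
  assumes s: "\<sigma> > 0"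
  shows "gker m \<sigma> x y = (1 / (\<sigma> * sqrt (2 * pi))) ^ m * (\<integral>t. cos (\<Sum>j<m. t j / \<sigma> * (y j - x j)) \<partial>gss m)"
proof -
  interpret G: prob_space "gss m" by (rule prob_space_gss)
  have one: "complex_of_real (normal_density a \<sigma> b) = complex_of_real (1 / (\<sigma> * sqrt (2 * pi))) * (CLINT t|std_normal_distribution. iexp (t / \<sigma> * (b - a)))" for a b
  proof -
    have "(CLINT t|std_normal_distribution. iexp (t / \<sigma> * (b - a))) = char std_normal_distribution ((b - a) / \<sigma>)"
      unfolding char_def by (intro Bochner_Integration.integral_cong) (auto simp: field_simps)
    also have "... = complex_of_real (exp (- (((b - a) / \<sigma>)\<^sup>2) / 2))" by (simp add: char_std_normal_distribution)
    also have "- (((b - a) / \<sigma>)\<^sup>2) / 2 = - (b - a)\<^sup>2 / (2 * \<sigma>\<^sup>2)" by (simp add: power_divide)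
    finally show ?thesis using s unfolding normal_density_def
      by (simp add: real_sqrt_mult flip: of_real_mult of_real_divide)
  qed
  have i1: "integrable std_normal_distribution (%t. iexp (t / \<sigma> * c))" for c :: real
    by (rule prob_space.integrable_iexp[OF prob_space_normal_density]) auto
  have "complex_of_real (gker m \<sigma> x y) = (\<Prod>j<m. complex_of_real (1 / (\<sigma> * sqrt (2 * pi))) * (CLINT t|std_normal_distribution. iexp (t / \<sigma> * (y j - x j))))"
    unfolding gker_def of_real_prod by (intro prod.cong refl one)
  also have "... = complex_of_real ((1 / (\<sigma> * sqrt (2 * pi))) ^ m) * (\<Prod>j<m. CLINT t|std_normal_distribution. iexp (t / \<sigma> * (y j - x j)))"
    by (simp only: prod.distrib prod_constant card_lessThan of_real_power)
  also have "(\<Prod>j<m. CLINT t|std_normal_distribution. iexp (t / \<sigma> * (y j - x j))) = (CLINT t|gss m. (\<Prod>j<m. iexp (t j / \<sigma> * (y j - x j))))"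
    by (rule gssP.product_integral_prod[symmetric]) (rule finite_lessThan i1)+
  also have "... = (CLINT t|gss m. iexp (\<Sum>j<m. t j / \<sigma> * (y j - x j)))"
    by (simp add: exp_sum sum_distrib_left)
  finally have "complex_of_real (gker m \<sigma> x y) = complex_of_real ((1 / (\<sigma> * sqrt (2 * pi))) ^ m) * (CLINT t|gss m. iexp (\<Sum>j<m. t j / \<sigma> * (y j - x j)))" .
  then have "gker m \<sigma> x y = Re (complex_of_real ((1 / (\<sigma> * sqrt (2 * pi))) ^ m) * (CLINT t|gss m. iexp (\<Sum>j<m. t j / \<sigma> * (y j - x j))))"
    by (metis Re_complex_of_real)
  also have "... = (1 / (\<sigma> * sqrt (2 * pi))) ^ m * Re (CLINT t|gss m. iexp (\<Sum>j<m. t j / \<sigma> * (y j - x j)))"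
    unfolding times_complex.sel by simp
  also have "Re (CLINT t|gss m. iexp (\<Sum>j<m. t j / \<sigma> * (y j - x j))) = (\<integral>t. Re (iexp (\<Sum>j<m. t j / \<sigma> * (y j - x j))) \<partial>gss m)"
    by (rule integral_Re[symmetric]) (rule G.integrable_iexp, measurable)
  also have "... = (\<integral>t. cos (\<Sum>j<m. t j / \<sigma> * (y j - x j)) \<partial>gss m)" by (simp add: Re_exp)
  finally show ?thesis .
qed

lemma gker_measurable:
  assumes "!!j. j < m ==> Z j \<in> borel_measurable M"
  shows "(%p. gker m \<sigma> (%j. Z j (fst p)) (snd p)) \<in> borel_measurable (M \<Otimes>\<^sub>M leb m)"
  unfolding gker_def normal_density_def
proof (intro borel_measurable_prod)
  fix j assume j: "j \<in> {..<m}"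
  have [measurable]: "Z j \<in> borel_measurable M" using assms j by simp
  have [measurable]: "(%p. snd p j) \<in> borel_measurable (M \<Otimes>\<^sub>M leb m)"
    using measurable_compose[OF measurable_snd measurable_component_singleton[OF j, of "%_. lborel :: real measure"]] by simp
  show "(%p. 1 / sqrt (2 * pi * \<sigma>\<^sup>2) * exp (- (snd p j - Z j (fst p))\<^sup>2 / (2 * \<sigma>\<^sup>2))) \<in> borel_measurable (M \<Otimes>\<^sub>M leb m)"
    by measurable
qed

lemma first_abs_moment_gker:
  assumes s: "\<sigma> > 0" and i: "i < m"
  shows "integrable (leb m) (%y. \<bar>y i - x i\<bar> * gker m \<sigma> x y)" "(\<integral>y. \<bar>y i - x i\<bar> * gker m \<sigma> x y \<partial>leb m) <= \<sigma>"
proof -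
  let ?f = "%j z. (if j = i then \<bar>z - x i\<bar> else 1) * normal_density (x j) \<sigma> z"
  have ia: "integrable lborel (%z. \<bar>z - x i\<bar> * normal_density (x i) \<sigma> z)"
    using integrable_normal_moment_abs[OF s, of "x i" 1] by (simp add: mult.commute)
  have int: "integrable lborel (?f j)" for j using s ia by (cases "j = i") auto
  have eq: "\<bar>y i - x i\<bar> * gker m \<sigma> x y = (\<Prod>j<m. ?f j (y j))" for y
  proof -
    have "(\<Prod>j<m. ?f j (y j)) = (\<Prod>j<m. if j = i then \<bar>y j - x i\<bar> else 1) * gker m \<sigma> x y"
      unfolding gker_def prod.distrib[symmetric] ..
    also have "(\<Prod>j<m. if j = i then \<bar>y j - x i\<bar> else 1) = \<bar>y i - x i\<bar>"
      using i by (simp add: prod.delta)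
    finally show ?thesis by simp
  qed
  show "integrable (leb m) (%y. \<bar>y i - x i\<bar> * gker m \<sigma> x y)"
    unfolding eq by (rule lebP.product_integrable_prod) (auto intro: int)
  have "(\<integral>y. \<bar>y i - x i\<bar> * gker m \<sigma> x y \<partial>leb m) = (\<Prod>j<m. \<integral>z. ?f j z \<partial>lborel)"
    unfolding eq by (rule lebP.product_integral_prod) (auto intro: int)
  also have "... = (\<Prod>j<m. if j = i then \<sigma> * sqrt (2 / pi) else 1)"
  proof (intro prod.cong refl)
    fix j show "(\<integral>z. ?f j z \<partial>lborel) = (if j = i then \<sigma> * sqrt (2 / pi) else 1)"
      using integral_normal_moment_abs_odd[OF s, of "x i" 0] s by (auto simp: mult.commute)
  qed
  also have "... = \<sigma> * sqrt (2 / pi)" using i by (simp add: prod.delta)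
  also have "... <= \<sigma> * 1" using s pi_gt3 by (intro mult_left_mono) auto
  finally show "(\<integral>y. \<bar>y i - x i\<bar> * gker m \<sigma> x y \<partial>leb m) <= \<sigma>" by simp
qed

text \<open>Turns a point of the finite product into a full sequence, to which a functional of
  sequences applies. Functionals that are Lipschitz in the first \<open>m\<close> coordinates do not
  see the value 0 filled in.\<close>

definition cut0 :: "nat => (nat => real) => nat => real" where "cut0 m y = (%j. if j < m then y j else 0)"

section \<open>Adding independent normal noise to a random vector\<close>

locale smoothing = prob_space M for M :: "'a measure" +
  fixes Z :: "nat => 'a => real" and m :: nat and \<sigma> :: real
  assumes Zm[measurable]: "!!j. Z j \<in> borel_measurable M" and s0: "\<sigma> > 0"
begin

text \<open>The Lebesgue density of the first \<open>m\<close> coordinates of \<open>Z\<close> after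
  adding independent normal noise of standard deviation \<open>\<sigma>\<close>.\<close>

definition dens :: "(nat => real) => real" where
  "dens y = expectation (%w. gker m \<sigma> (%j. Z j w) y)"

sublocale PSF: pair_sigma_finite M "leb m"
  by (intro pair_sigma_finite.intro sigma_finite_measure_axioms sigma_finite_leb)

lemma gkm: "(%(w, y). gker m \<sigma> (%j. Z j w) y) \<in> borel_measurable (M \<Otimes>\<^sub>M leb m)"
  using gker_measurable[of m Z M] Zm by (simp add: case_prod_beta')

lemma ig:
  assumes h[measurable]: "h \<in> borel_measurable (leb m)" and b: "!!y. \<bar>h y\<bar> <= B"
  shows "integrable (M \<Otimes>\<^sub>M leb m) (%(w, y). h y * gker m \<sigma> (%j. Z j w) y)"
    and "integrable (leb m) (%y. h y * gker m \<sigma> x y)"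
proof -
  have k1: "gker m \<sigma> x \<in> borel_measurable (leb m)" for x using gker_integral(1)[OF s0] by auto
  have i: "integrable (leb m) (%y. h y * gker m \<sigma> x y)" for x
    by (rule Bochner_Integration.integrable_bound[OF integrable_mult_right[OF gker_integral(1)[OF s0, of m x], where c=B]])
       (use k1 b in \<open>auto simp: abs_mult gker_nonneg intro!: AE_I2 mult_right_mono intro: order_trans[OF _ abs_ge_self]\<close>)
  show "integrable (leb m) (%y. h y * gker m \<sigma> x y)" by (rule i)
  have hm: "(%p. h (snd p)) \<in> borel_measurable (M \<Otimes>\<^sub>M leb m)" by measurable
  show "integrable (M \<Otimes>\<^sub>M leb m) (%(w, y). h y * gker m \<sigma> (%j. Z j w) y)"
  proof (rule PSF.Fubini_integrable)
    show mm: "(%(w, y). h y * gker m \<sigma> (%j. Z j w) y) \<in> borel_measurable (M \<Otimes>\<^sub>M leb m)"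
      using borel_measurable_times[OF hm gkm[unfolded case_prod_beta']] by (simp only: case_prod_beta')
    have mI: "(%w. \<integral>y. norm (h y * gker m \<sigma> (%j. Z j w) y) \<partial>leb m) \<in> borel_measurable M"
      by (rule sigma_finite_measure.borel_measurable_lebesgue_integral[OF sigma_finite_leb])
         (use measurable_compose[OF mm borel_measurable_norm] in \<open>simp only: case_prod_beta'\<close>)
    have bI: "\<bar>\<integral>y. norm (h y * gker m \<sigma> (%j. Z j w) y) \<partial>leb m\<bar> <= B" for w
    proof -
      have "(\<integral>y. norm (h y * gker m \<sigma> (%j. Z j w) y) \<partial>leb m) <= (\<integral>y. B * gker m \<sigma> (%j. Z j w) y \<partial>leb m)"
        by (intro integral_mono integrable_norm i integrable_mult_right gker_integral s0)
           (use b in \<open>auto simp: abs_mult gker_nonneg intro!: mult_right_mono\<close>)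
      also have "... = B" using gker_integral[OF s0] by simp
      finally show ?thesis by simp
    qed
    show "integrable M (%w. \<integral>y. norm (case (w, y) of (w, y) => h y * gker m \<sigma> (%j. Z j w) y) \<partial>leb m)"
      unfolding prod.case by (rule integrable_bounded_by[OF mI bI])
  qed (use i in auto)
qed

lemma dens_props: "integrable (leb m) dens" "(\<integral>y. dens y \<partial>leb m) = 1" "dens y >= 0"
proof -
  have i: "integrable (M \<Otimes>\<^sub>M leb m) (%(w, y). gker m \<sigma> (%j. Z j w) y)"
    using ig(1)[of "%_. 1" 1] by simp
  show "integrable (leb m) dens" using PSF.integrable_snd[OF i] by (simp add: dens_def[abs_def])
  show "(\<integral>y. dens y \<partial>leb m) = 1"
    using PSF.Fubini_integral[OF i] gker_integral[OF s0] by (simp add: dens_def prob_space)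
  show "dens y >= 0" unfolding dens_def by (simp add: gker_nonneg)
qed

lemma cut0_meas: "cut0 m \<in> borel_measurable (leb m)"
proof (rule measurable_coordinatewise_then_product)
  fix j show "(%y. cut0 m y j) \<in> borel_measurable (leb m)"
    by (cases "j < m") (auto simp: cut0_def intro!: measurable_component_singleton[where M="%_. lborel", simplified])
qed

lemma smooth_close:
  assumes g: "!!x. \<bar>g x\<bar> <= B" "!!x y. \<bar>g x - g y\<bar> <= L * (\<Sum>j<m. \<bar>x j - y j\<bar>)" and gm: "g \<in> borel_measurable borel" and L0: "L >= 0"
  shows "\<bar>(\<integral>y. g (cut0 m y) * dens y \<partial>leb m) - expectation (%w. g (%j. Z j w))\<bar> <= L * m * \<sigma>"
proof -
  let ?h = "%y. g (cut0 m y)"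
  have hm[measurable]: "?h \<in> borel_measurable (leb m)" using measurable_compose[OF cut0_meas gm] .
  have hb: "\<bar>?h y\<bar> <= B" for y by (rule g)
  have zm: "(%w. g (%j. Z j w)) \<in> borel_measurable M"
    by (rule measurable_compose[OF measurable_coordinatewise_then_product gm]) simp
  note I = ig(1)[OF hm hb] and I2 = ig(2)[OF hm hb]
  have "(\<integral>y. ?h y * dens y \<partial>leb m) = (\<integral>y. (\<integral>w. ?h y * gker m \<sigma> (%j. Z j w) y \<partial>M) \<partial>leb m)"
    unfolding dens_def by simp
  also have "... = expectation (%w. \<integral>y. ?h y * gker m \<sigma> (%j. Z j w) y \<partial>leb m)"
    by (rule PSF.Fubini_integral[OF I])
  finally have e: "(\<integral>y. ?h y * dens y \<partial>leb m) = expectation (%w. \<integral>y. ?h y * gker m \<sigma> (%j. Z j w) y \<partial>leb m)" .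
  have im: "integrable M (%w. \<integral>y. ?h y * gker m \<sigma> (%j. Z j w) y \<partial>leb m)"
    using PSF.integrable_fst[OF I] by simp
  have ig': "integrable M (%w. g (%j. Z j w))" by (rule integrable_const_bound[where B=B]) (use zm g in auto)
  have pt: "\<bar>(\<integral>y. ?h y * gker m \<sigma> x y \<partial>leb m) - g x\<bar> <= L * m * \<sigma>" for x
  proof -
    have ix: "integrable (leb m) (%y. g x * gker m \<sigma> x y)" using gker_integral[OF s0] by simp
    have "(\<integral>y. ?h y * gker m \<sigma> x y \<partial>leb m) - g x = (\<integral>y. ?h y * gker m \<sigma> x y \<partial>leb m) - (\<integral>y. g x * gker m \<sigma> x y \<partial>leb m)"
      using gker_integral[OF s0] by simp
    also have "... = (\<integral>y. ?h y * gker m \<sigma> x y - g x * gker m \<sigma> x y \<partial>leb m)"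
      by (rule Bochner_Integration.integral_diff[OF I2 ix, symmetric])
    finally have eq: "(\<integral>y. ?h y * gker m \<sigma> x y \<partial>leb m) - g x = (\<integral>y. ?h y * gker m \<sigma> x y - g x * gker m \<sigma> x y \<partial>leb m)" .
    have "\<bar>\<integral>y. ?h y * gker m \<sigma> x y - g x * gker m \<sigma> x y \<partial>leb m\<bar> <= (\<integral>y. \<bar>?h y * gker m \<sigma> x y - g x * gker m \<sigma> x y\<bar> \<partial>leb m)"
      by (rule integral_abs_bound)
    also have "... <= (\<integral>y. L * (\<Sum>j<m. \<bar>y j - x j\<bar> * gker m \<sigma> x y) \<partial>leb m)"
    proof (rule integral_mono)
      show "integrable (leb m) (%y. \<bar>?h y * gker m \<sigma> x y - g x * gker m \<sigma> x y\<bar>)"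
        using I2 ix by (intro integrable_abs Bochner_Integration.integrable_diff)
      show "integrable (leb m) (%y. L * (\<Sum>j<m. \<bar>y j - x j\<bar> * gker m \<sigma> x y))"
        by (intro integrable_mult_right Bochner_Integration.integrable_sum first_abs_moment_gker s0) auto
      fix y
      have "\<bar>?h y - g x\<bar> <= L * (\<Sum>j<m. \<bar>cut0 m y j - x j\<bar>)" by (rule g)
      also have "(\<Sum>j<m. \<bar>cut0 m y j - x j\<bar>) = (\<Sum>j<m. \<bar>y j - x j\<bar>)" by (intro sum.cong) (auto simp: cut0_def)
      finally have "\<bar>?h y - g x\<bar> * gker m \<sigma> x y <= L * (\<Sum>j<m. \<bar>y j - x j\<bar>) * gker m \<sigma> x y"
        by (rule mult_right_mono) (rule gker_nonneg)
      then show "\<bar>?h y * gker m \<sigma> x y - g x * gker m \<sigma> x y\<bar> <= L * (\<Sum>j<m. \<bar>y j - x j\<bar> * gker m \<sigma> x y)"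
        by (simp add: abs_mult gker_nonneg sum_distrib_right mult.assoc flip: left_diff_distrib)
    qed
    also have "... = L * (\<Sum>j<m. \<integral>y. \<bar>y j - x j\<bar> * gker m \<sigma> x y \<partial>leb m)"
      using first_abs_moment_gker(1)[OF s0] by (simp add: Bochner_Integration.integral_sum)
    also have "... <= L * (\<Sum>j<m. \<sigma>)"
      by (intro mult_left_mono sum_mono first_abs_moment_gker s0 L0) auto
    finally show ?thesis unfolding eq by simp
  qed
  have "\<bar>expectation (%w. (\<integral>y. ?h y * gker m \<sigma> (%j. Z j w) y \<partial>leb m) - g (%j. Z j w))\<bar> <= L * m * \<sigma>"
  proof -
    have "\<bar>expectation (%w. (\<integral>y. ?h y * gker m \<sigma> (%j. Z j w) y \<partial>leb m) - g (%j. Z j w))\<bar>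
      <= expectation (%w. \<bar>(\<integral>y. ?h y * gker m \<sigma> (%j. Z j w) y \<partial>leb m) - g (%j. Z j w)\<bar>)" by (rule integral_abs_bound)
    also have "... <= expectation (%_. L * m * \<sigma>)" using im ig' pt by (intro integral_mono) auto
    finally show ?thesis by (simp add: prob_space)
  qed
  then show ?thesis unfolding e using im ig' by simp
qed

lemma dens_trig:
  "dens y = (1 / (\<sigma> * sqrt (2 * pi))) ^ m * (\<integral>t. (cos (\<Sum>j<m. t j / \<sigma> * y j) * expectation (%w. cos (\<Sum>j<m. t j / \<sigma> * Z j w))
      + sin (\<Sum>j<m. t j / \<sigma> * y j) * expectation (%w. sin (\<Sum>j<m. t j / \<sigma> * Z j w))) \<partial>gss m)"
proof -
  interpret G: prob_space "gss m" by (rule prob_space_gss)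
  interpret MG: pair_prob_space M "gss m" ..
  let ?f = "%w t. cos (\<Sum>j<m. t j / \<sigma> * (y j - Z j w))"
  have comp[measurable]: "(%p. snd p j) \<in> borel_measurable (M \<Otimes>\<^sub>M gss m)" if "j \<in> {..<m}" for j
    using measurable_compose[OF measurable_snd measurable_component_singleton[OF that, of "%_. std_normal_distribution"]] by simp
  have Zf: "(%p. Z j (fst p)) \<in> borel_measurable (M \<Otimes>\<^sub>M gss m)" for j by measurable
  have mf: "case_prod ?f \<in> borel_measurable (M \<Otimes>\<^sub>M gss m)"
    unfolding case_prod_beta'
    by (intro measurable_compose[OF _ borel_measurable_continuous_onI[OF continuous_on_cos[OF continuous_on_id]]] borel_measurable_sum borel_measurable_times borel_measurable_divide borel_measurable_diff borel_measurable_const comp Zf)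
  have int: "integrable (M \<Otimes>\<^sub>M gss m) (case_prod ?f)"
    by (rule MG.integrable_const_bound[where B=1]) (use mf in auto)
  have "dens y = (1 / (\<sigma> * sqrt (2 * pi))) ^ m * (\<integral>w. (\<integral>t. ?f w t \<partial>gss m) \<partial>M)"
    unfolding dens_def gker_fourier[OF s0] by simp
  also have "(\<integral>w. (\<integral>t. ?f w t \<partial>gss m) \<partial>M) = (\<integral>t. (\<integral>w. ?f w t \<partial>M) \<partial>gss m)"
    by (rule MG.Fubini_integral[OF int, symmetric])
  also have "... = (\<integral>t. (cos (\<Sum>j<m. t j / \<sigma> * y j) * expectation (%w. cos (\<Sum>j<m. t j / \<sigma> * Z j w))
      + sin (\<Sum>j<m. t j / \<sigma> * y j) * expectation (%w. sin (\<Sum>j<m. t j / \<sigma> * Z j w))) \<partial>gss m)"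
  proof (intro Bochner_Integration.integral_cong refl)
    fix t :: "nat => real"
    let ?a = "\<Sum>j<m. t j / \<sigma> * y j" and ?b = "%w. \<Sum>j<m. t j / \<sigma> * Z j w"
    have "?f w t = cos ?a * cos (?b w) + sin ?a * sin (?b w)" for w
      unfolding right_diff_distrib sum_subtractf by (rule cos_diff)
    moreover have "integrable M (%w. cos (?b w))" "integrable M (%w. sin (?b w))"
      by (rule integrable_const_bound[where B=1]; simp)+
    ultimately show "(\<integral>w. ?f w t \<partial>M) = cos ?a * expectation (%w. cos (?b w)) + sin ?a * expectation (%w. sin (?b w))" by simp
  qed
  finally show ?thesis .
qed

end

text \<open>Noise of size \<open>\<sigma>\<close> changes the expectation of \<open>g\<close> by at
  most \<open>L * m * \<sigma>\<close>. The smoothed laws have densities given by trigonometric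
  moments, so these densities converge pointwise; by Scheffe's lemma they converge in L^1, after
  which only the boundedness of \<open>g\<close> matters. Neither tightness nor a multivariate
  continuity theorem is involved.\<close>

theorem trig_moments_imp_lipschitz:
  fixes Z :: "nat => nat => 'a => real" and Y :: "nat => 'b => real"
  assumes M: "prob_space M" and P: "prob_space P"
    and Zm: "!!N j. Z N j \<in> borel_measurable M" and Ym: "!!j. Y j \<in> borel_measurable P"
    and c: "!!u. (%N. \<integral>w. cos (\<Sum>j<m. u j * Z N j w) \<partial>M) \<longlonglongrightarrow> (\<integral>w. cos (\<Sum>j<m. u j * Y j w) \<partial>P)"
    and s: "!!u. (%N. \<integral>w. sin (\<Sum>j<m. u j * Z N j w) \<partial>M) \<longlonglongrightarrow> (\<integral>w. sin (\<Sum>j<m. u j * Y j w) \<partial>P)"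
    and g: "!!x. \<bar>g x\<bar> <= B" "!!x y. \<bar>g x - g y\<bar> <= L * (\<Sum>j<m. \<bar>x j - y j\<bar>)" and gm: "g \<in> borel_measurable borel" and L0: "L >= 0"
  shows "(%N. \<integral>w. g (%j. Z N j w) \<partial>M) \<longlonglongrightarrow> (\<integral>w. g (%j. Y j w) \<partial>P)"
proof (rule LIMSEQ_I)
  fix e :: real assume e: "e > 0"
  \<comment> \<open>Smoothing is paid for twice, for the approximating and for the limiting law,
    hence the share \<open>e / 3\<close>; the added 1 covers \<open>L * m = 0\<close>.\<close>
  define \<sigma> where "\<sigma> = e / (3 * (L * m + 1))"
  have Lm: "L * m + 1 > 0" using L0 by (simp add: add_nonneg_pos)
  have s0: "\<sigma> > 0" using e Lm by (simp add: \<sigma>_def)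
  have small: "L * m * \<sigma> < e / 3"
  proof -
    have "L * m * \<sigma> < (L * m + 1) * \<sigma>" using s0 by simp
    also have "... = e / 3"
    proof -
      have "X * (e / (3 * X)) = e / 3" if "X > 0" for X :: real using that by (simp add: field_simps)
      from this[OF Lm] show ?thesis by (simp add: \<sigma>_def)
    qed
    finally show ?thesis .
  qed
  have SM: "smoothing M (Z N) \<sigma>" for N by (intro smoothing.intro smoothing_axioms.intro M Zm s0)
  have SP: "smoothing P Y \<sigma>" by (intro smoothing.intro smoothing_axioms.intro P Ym s0)
  define d where "d = (%N. smoothing.dens M (Z N) m \<sigma>)"
  define d' where "d' = smoothing.dens P Y m \<sigma>"
  interpret G: prob_space "gss m" by (rule prob_space_gss)
  have pw: "(%N. d N y) \<longlonglongrightarrow> d' y" for y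
    unfolding d_def d'_def smoothing.dens_trig[OF SM] smoothing.dens_trig[OF SP]
  proof (intro tendsto_mult tendsto_const integral_dominated_convergence[where w="%_. 2"])
    have comp[measurable]: "(%t. t j) \<in> borel_measurable (gss m)" if "j \<in> {..<m}" for j
      using measurable_component_singleton[OF that, of "%_. std_normal_distribution"] by simp
    have ch: "(%t. \<integral>w. k (\<Sum>j<m. t j / \<sigma> * X j w) \<partial>Q) \<in> borel_measurable (gss m)"
      if Q: "prob_space Q" and X: "!!j. X j \<in> borel_measurable Q" and k[measurable]: "k \<in> borel_measurable borel" for Q :: "'c measure" and X and k :: "real => real"
    proof -
      interpret Q: prob_space Q by (rule Q)
      have cp: "(%p. fst p j) \<in> borel_measurable (gss m \<Otimes>\<^sub>M Q)" if "j \<in> {..<m}" for j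
        using measurable_compose[OF measurable_fst comp[OF that]] .
      have Xs: "(%p. X j (snd p)) \<in> borel_measurable (gss m \<Otimes>\<^sub>M Q)" for j using X by measurable
      have "(%p. k (\<Sum>j<m. fst p j / \<sigma> * X j (snd p))) \<in> borel_measurable (gss m \<Otimes>\<^sub>M Q)"
        by (intro measurable_compose[OF _ k] borel_measurable_sum borel_measurable_times borel_measurable_divide borel_measurable_const cp Xs)
      then show ?thesis by (intro Q.borel_measurable_lebesgue_integral) (simp add: case_prod_beta')
    qed
    have tr: "(%t. k (\<Sum>j<m. t j / \<sigma> * y j)) \<in> borel_measurable (gss m)" if k[measurable]: "k \<in> borel_measurable borel" for k :: "real => real"
      by (intro measurable_compose[OF _ k] borel_measurable_sum borel_measurable_times borel_measurable_divide borel_measurable_const comp)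
    show "(%t. cos (\<Sum>j<m. t j / \<sigma> * y j) * (\<integral>w. cos (\<Sum>j<m. t j / \<sigma> * Y j w) \<partial>P) + sin (\<Sum>j<m. t j / \<sigma> * y j) * (\<integral>w. sin (\<Sum>j<m. t j / \<sigma> * Y j w) \<partial>P)) \<in> borel_measurable (gss m)"
      by (intro borel_measurable_add borel_measurable_times tr ch P Ym) simp_all
    show "(%t. cos (\<Sum>j<m. t j / \<sigma> * y j) * (\<integral>w. cos (\<Sum>j<m. t j / \<sigma> * Z N j w) \<partial>M) + sin (\<Sum>j<m. t j / \<sigma> * y j) * (\<integral>w. sin (\<Sum>j<m. t j / \<sigma> * Z N j w) \<partial>M)) \<in> borel_measurable (gss m)" for N
      by (intro borel_measurable_add borel_measurable_times tr ch M Zm) simp_all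
    show "AE t in gss m. (%N. cos (\<Sum>j<m. t j / \<sigma> * y j) * (\<integral>w. cos (\<Sum>j<m. t j / \<sigma> * Z N j w) \<partial>M) + sin (\<Sum>j<m. t j / \<sigma> * y j) * (\<integral>w. sin (\<Sum>j<m. t j / \<sigma> * Z N j w) \<partial>M))
      \<longlonglongrightarrow> cos (\<Sum>j<m. t j / \<sigma> * y j) * (\<integral>w. cos (\<Sum>j<m. t j / \<sigma> * Y j w) \<partial>P) + sin (\<Sum>j<m. t j / \<sigma> * y j) * (\<integral>w. sin (\<Sum>j<m. t j / \<sigma> * Y j w) \<partial>P)"
      by (intro AE_I2 tendsto_add tendsto_mult tendsto_const c s)
    show "AE t in gss m. norm (cos (\<Sum>j<m. t j / \<sigma> * y j) * (\<integral>w. cos (\<Sum>j<m. t j / \<sigma> * Z N j w) \<partial>M) + sin (\<Sum>j<m. t j / \<sigma> * y j) * (\<integral>w. sin (\<Sum>j<m. t j / \<sigma> * Z N j w) \<partial>M)) <= 2" for N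
    proof (rule AE_I2)
      fix t :: "nat => real"
      have "\<bar>\<integral>w. cos (\<Sum>j<m. t j / \<sigma> * Z N j w) \<partial>M\<bar> <= 1" "\<bar>\<integral>w. sin (\<Sum>j<m. t j / \<sigma> * Z N j w) \<partial>M\<bar> <= 1"
        by (rule prob_space.expectation_abs_le[OF M]; simp)+
      then have "\<bar>cos (\<Sum>j<m. t j / \<sigma> * y j) * (\<integral>w. cos (\<Sum>j<m. t j / \<sigma> * Z N j w) \<partial>M)\<bar> <= 1"
         "\<bar>sin (\<Sum>j<m. t j / \<sigma> * y j) * (\<integral>w. sin (\<Sum>j<m. t j / \<sigma> * Z N j w) \<partial>M)\<bar> <= 1"
        unfolding abs_mult by (auto intro!: mult_le_one)
      then show "norm (cos (\<Sum>j<m. t j / \<sigma> * y j) * (\<integral>w. cos (\<Sum>j<m. t j / \<sigma> * Z N j w) \<partial>M) + sin (\<Sum>j<m. t j / \<sigma> * y j) * (\<integral>w. sin (\<Sum>j<m. t j / \<sigma> * Z N j w) \<partial>M)) <= 2"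
        by (simp add: abs_le_iff)
    qed
  qed simp
  have dp: "integrable (leb m) (d N)" "(\<integral>y. d N y \<partial>leb m) = 1" "d N y >= 0" for N y
    unfolding d_def by (rule smoothing.dens_props[OF SM])+
  have dp': "integrable (leb m) d'" "(\<integral>y. d' y \<partial>leb m) = 1" "d' y >= 0" for y
    unfolding d'_def by (rule smoothing.dens_props[OF SP])+
  have dm[measurable]: "d N \<in> borel_measurable (leb m)" "d' \<in> borel_measurable (leb m)" for N using dp(1)[of N] dp'(1) by auto
  have nn1: "(\<integral>\<^sup>+ y. ennreal (norm (d N y)) \<partial>leb m) = 1" "(\<integral>\<^sup>+ y. ennreal (norm (d' y)) \<partial>leb m) = 1" for N
    using nn_integral_eq_integral[OF dp(1)[of N]] nn_integral_eq_integral[OF dp'(1)] dp dp' by auto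
  have sch: "(%N. \<integral>\<^sup>+ y. norm (d N y - d' y) \<partial>leb m) \<longlonglongrightarrow> 0"
    by (rule Scheffe_lemma2) (use dp'(1) pw nn1 in auto)
  have idd: "integrable (leb m) (%y. norm (d N y - d' y))" for N using dp(1)[of N] dp'(1) by auto
  have "(%N. ennreal (\<integral>y. norm (d N y - d' y) \<partial>leb m)) \<longlonglongrightarrow> ennreal 0"
    using sch nn_integral_eq_integral[OF idd] by simp
  then have sch': "(%N. \<integral>y. norm (d N y - d' y) \<partial>leb m) \<longlonglongrightarrow> 0"
    by (subst (asm) tendsto_ennreal_iff) auto
  let ?h = "%y. g (cut0 m y)"
  have hm[measurable]: "?h \<in> borel_measurable (leb m)" using measurable_compose[OF smoothing.cut0_meas[OF SP] gm] .
  have ih: "integrable (leb m) (%y. ?h y * k y)" if "integrable (leb m) k" for k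
  proof -
    have [measurable]: "k \<in> borel_measurable (leb m)" using that by auto
    show ?thesis by (rule Bochner_Integration.integrable_bound[OF integrable_mult_right[OF that, where c=B]])
      (use g in \<open>auto simp: abs_mult intro!: AE_I2 mult_right_mono intro: order_trans[OF _ abs_ge_self]\<close>)
  qed
  have B0: "B >= 0" using g(1)[of "%_. 0"] by linarith
  have hd: "\<bar>(\<integral>y. ?h y * d N y \<partial>leb m) - (\<integral>y. ?h y * d' y \<partial>leb m)\<bar> <= B * (\<integral>y. norm (d N y - d' y) \<partial>leb m)" for N
  proof -
    have "(\<integral>y. ?h y * d N y \<partial>leb m) - (\<integral>y. ?h y * d' y \<partial>leb m) = (\<integral>y. ?h y * (d N y - d' y) \<partial>leb m)"
      unfolding right_diff_distrib by (rule Bochner_Integration.integral_diff[symmetric]) (use dp dp' ih in auto)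
    moreover have "\<bar>\<integral>y. ?h y * (d N y - d' y) \<partial>leb m\<bar> <= (\<integral>y. \<bar>?h y * (d N y - d' y)\<bar> \<partial>leb m)" by (rule integral_abs_bound)
    moreover have "(\<integral>y. \<bar>?h y * (d N y - d' y)\<bar> \<partial>leb m) <= (\<integral>y. B * norm (d N y - d' y) \<partial>leb m)"
      by (intro integral_mono integrable_abs ih integrable_mult_right idd Bochner_Integration.integrable_diff dp dp')
         (use g in \<open>auto simp: abs_mult intro!: mult_right_mono\<close>)
    ultimately show ?thesis unfolding integral_mult_right_zero by linarith
  qed
  have "(%N. B * (\<integral>y. norm (d N y - d' y) \<partial>leb m)) \<longlonglongrightarrow> B * 0" by (intro tendsto_mult tendsto_const sch')
  then have "\<forall>\<^sub>F N in sequentially. B * (\<integral>y. norm (d N y - d' y) \<partial>leb m) < e / 3"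
    using e by (intro order_tendstoD(2)[where a="e/3"]) auto
  then obtain N0 where N0: "!!N. N >= N0 ==> B * (\<integral>y. norm (d N y - d' y) \<partial>leb m) < e / 3"
    by (auto simp: eventually_sequentially)
  show "\<exists>no. \<forall>N\<ge>no. norm ((\<integral>w. g (%j. Z N j w) \<partial>M) - (\<integral>w. g (%j. Y j w) \<partial>P)) < e"
  proof (intro exI allI impI)
    fix N assume "N >= N0"
    from N0[OF this] hd[of N] have "\<bar>(\<integral>y. ?h y * d N y \<partial>leb m) - (\<integral>y. ?h y * d' y \<partial>leb m)\<bar> < e / 3" by linarith
    moreover have "\<bar>(\<integral>y. ?h y * d N y \<partial>leb m) - (\<integral>w. g (%j. Z N j w) \<partial>M)\<bar> <= L * m * \<sigma>"
      unfolding d_def by (rule smoothing.smooth_close[OF SM g gm L0])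
    moreover have "\<bar>(\<integral>y. ?h y * d' y \<partial>leb m) - (\<integral>w. g (%j. Y j w) \<partial>P)\<bar> <= L * m * \<sigma>"
      unfolding d'_def by (rule smoothing.smooth_close[OF SP g gm L0])
    ultimately show "norm ((\<integral>w. g (%j. Z N j w) \<partial>M) - (\<integral>w. g (%j. Y j w) \<partial>P)) < e" using small unfolding real_norm_def by linarith
  qed
qed

section \<open>Weak convergence in the Skorokhod space\<close>

text \<open>The identity is an admissible time change. Through this bound Skorokhod continuity
  enters the proof only as continuity for uniform perturbations. The infimum is over nonnegative
  numbers because time changes map the unit interval to itself.\<close>

lemma skorokhod_dist_le:
  assumes "!!t. t \<in> {0..1} ==> \<bar>f t - g t\<bar> <= e" shows "skorokhod_dist f g <= e"
proof -
  let ?F = "%la::real => real. max (SUP t\<in>{0..1}. \<bar>la t - t\<bar>) (SUP t\<in>{0..1}. \<bar>f t - g (la t)\<bar>)"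
  have id: "(%t. t) \<in> time_changes"
    by (auto simp: time_changes_def strict_mono_on_def)
  have "?F la >= 0" if "la \<in> time_changes" for la
  proof -
    have la: "la t \<in> {0..1}" if "t \<in> {0..1}" for t using \<open>la \<in> time_changes\<close> that by (auto simp: time_changes_def)
    have "bdd_above ((%t. \<bar>la t - t\<bar>) ` {0..1})" using la by (intro bdd_aboveI[of _ 1]) force
    then have "\<bar>la 0 - 0\<bar> <= (SUP t\<in>{0..1}. \<bar>la t - t\<bar>)" by (intro cSUP_upper) auto
    then show ?thesis by linarith
  qed
  then have "bdd_below (?F ` time_changes)" by (intro bdd_belowI[of _ 0]) auto
  then have "skorokhod_dist f g <= ?F (%t. t)" unfolding skorokhod_dist_def by (intro cINF_lower id)
  also have "... <= e"
  proof -
    have "(SUP t\<in>{0..1::real}. \<bar>t - t\<bar>) <= e" using assms[of 0] by (intro cSUP_least) auto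
    moreover have "(SUP t\<in>{0..1}. \<bar>f t - g t\<bar>) <= e" using assms by (intro cSUP_least) auto
    ultimately show ?thesis by simp
  qed
  finally show ?thesis .
qed

lemma step_Dspace:
  fixes a :: "nat => real" assumes c: "c >= 0" shows "(%t. a (nat \<lfloor>c * t\<rfloor>)) \<in> Dspace"
proof (cases "c = 0")
  case True then show ?thesis by (auto simp: Dspace_def cadlag01_def)
next
  case False
  then have c0: "c > 0" using c by simp
  have r: "((%t. a (nat \<lfloor>c * t\<rfloor>)) \<longlongrightarrow> a (nat \<lfloor>c * t\<rfloor>)) (at_right t)" for t
  proof (rule tendsto_eventually)
    have "t < (of_int \<lfloor>c * t\<rfloor> + 1) / c" using c0 by (simp add: field_simps) linarith
    then have "\<forall>\<^sub>F s in at_right t. s \<in> {t<..<(of_int \<lfloor>c * t\<rfloor> + 1) / c}" by (rule eventually_at_right_real)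
    then show "\<forall>\<^sub>F s in at_right t. a (nat \<lfloor>c * s\<rfloor>) = a (nat \<lfloor>c * t\<rfloor>)"
    proof (rule eventually_mono)
      fix s assume s: "s \<in> {t<..<(of_int \<lfloor>c * t\<rfloor> + 1) / c}"
      have "c * t <= c * s" using s c0 by simp
      moreover have "c * s < of_int \<lfloor>c * t\<rfloor> + 1" using s c0 by (simp add: field_simps)
      ultimately have "\<lfloor>c * s\<rfloor> = \<lfloor>c * t\<rfloor>" by (intro floor_unique) linarith+
      then show "a (nat \<lfloor>c * s\<rfloor>) = a (nat \<lfloor>c * t\<rfloor>)" by simp
    qed
  qed
  \<comment> \<open>Just to the left of \<open>t\<close> the floor of \<open>c * s\<close> equals
    the ceiling of \<open>c * t\<close> minus 1, whether or not \<open>c * t\<close> is an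
    integer.\<close>
  have l: "((%t. a (nat \<lfloor>c * t\<rfloor>)) \<longlongrightarrow> a (nat (\<lceil>c * t\<rceil> - 1))) (at_left t)" for t
  proof (rule tendsto_eventually)
    have "(of_int \<lceil>c * t\<rceil> - 1) / c < t" using c0 by (simp add: field_simps) linarith
    then have "\<forall>\<^sub>F s in at_left t. s \<in> {(of_int \<lceil>c * t\<rceil> - 1) / c<..<t}" by (rule eventually_at_left_real)
    then show "\<forall>\<^sub>F s in at_left t. a (nat \<lfloor>c * s\<rfloor>) = a (nat (\<lceil>c * t\<rceil> - 1))"
    proof (rule eventually_mono)
      fix s assume s: "s \<in> {(of_int \<lceil>c * t\<rceil> - 1) / c<..<t}"
      have "c * s < c * t" using s c0 by simp
      moreover have "of_int \<lceil>c * t\<rceil> - 1 < c * s" using s c0 by (simp add: field_simps)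
      ultimately have "\<lfloor>c * s\<rfloor> = \<lceil>c * t\<rceil> - 1" by (intro floor_unique) (simp_all, linarith+)
      then show "a (nat \<lfloor>c * s\<rfloor>) = a (nat (\<lceil>c * t\<rceil> - 1))" by simp
    qed
  qed
  show ?thesis using r l by (auto simp: Dspace_def cadlag01_def)
qed

lemma continuous_Dspace: assumes "continuous_on UNIV f" shows "f \<in> Dspace"
proof -
  have c: "(f \<longlongrightarrow> f t) (at t within S)" for t S
  proof -
    have "(f \<longlongrightarrow> f t) (at t within UNIV)" using assms by (auto simp: continuous_on_def)
    from tendsto_within_subset[OF this subset_UNIV] show ?thesis .
  qed
  show ?thesis unfolding Dspace_def cadlag01_def using c by blast
qed

text \<open>Continuity at each single path for the uniform distance. It follows from Skorokhod
  continuity and is easier to pass through inf-convolutions and sampling.\<close>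

definition sup_cont :: "((real => real) => real) => bool" where
  "sup_cont h \<longleftrightarrow> (\<forall>f\<in>Dspace. \<forall>e>0. \<exists>d>0. \<forall>g\<in>Dspace. (\<forall>t\<in>{0..1}. \<bar>f t - g t\<bar> <= d) --> \<bar>h g - h f\<bar> < e)"

lemma sup_contD:
  assumes "sup_cont h" "f \<in> Dspace" "e > 0"
  obtains d where "d > 0" "!!g. g \<in> Dspace ==> (!!t. t \<in> {0..1} ==> \<bar>f t - g t\<bar> <= d) ==> \<bar>h g - h f\<bar> < e"
  using assms unfolding sup_cont_def by metis

lemma bounded_cont_D_sup_cont: "bounded_cont_D h ==> sup_cont h"
  unfolding sup_cont_def
proof (intro ballI allI impI)
  fix f and e :: real assume h: "bounded_cont_D h" and f: "f \<in> Dspace" and e: "e > 0"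
  then obtain d where d: "d > 0" "!!g. g \<in> Dspace ==> skorokhod_dist f g < d ==> \<bar>h g - h f\<bar> < e"
    unfolding bounded_cont_D_def by meson
  show "\<exists>d>0. \<forall>g\<in>Dspace. (\<forall>t\<in>{0..1}. \<bar>f t - g t\<bar> <= d) --> \<bar>h g - h f\<bar> < e"
  proof (intro exI[of _ "d / 2"] conjI ballI impI)
    fix g assume g: "g \<in> Dspace" "\<forall>t\<in>{0..1}. \<bar>f t - g t\<bar> <= d / 2"
    have "skorokhod_dist f g <= d / 2" by (rule skorokhod_dist_le) (use g in auto)
    then show "\<bar>h g - h f\<bar> < e" using d g by auto
  qed (use d in simp)
qed

lemma bounded_cont_D_uminus: "bounded_cont_D h ==> bounded_cont_D (%f. - h f)"
  unfolding bounded_cont_D_def by (auto simp: abs_minus_commute)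

lemma grid_index: "t \<in> {0..1} ==> c >= 0 ==> nat \<lfloor>c * t\<rfloor> <= nat \<lfloor>c\<rfloor>"
  by (intro nat_mono floor_mono) (auto simp: mult_left_le)

text \<open>On step paths over a fixed grid a functional is a continuous function of finitely many
  real numbers. Measurability of a functional of a step process then needs no sigma-algebra on the
  path space.\<close>

lemma step_functional_continuous:
  assumes h: "sup_cont h" and c: "c >= 0"
  shows "continuous_on UNIV (%x::nat => real. h (%t. x (nat \<lfloor>c * t\<rfloor>)))"
proof (rule continuous_on_sequentiallyI)
  fix x :: "nat => nat => real" and a assume x: "x \<longlonglongrightarrow> a"
  have xj: "(%n. x n j) \<longlonglongrightarrow> a j" for j
    by (rule continuous_on_tendsto_compose[OF _ x, of UNIV "%x. x j"]) (auto intro: continuous_on_product_coordinates)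
  show "(%n. h (%t. x n (nat \<lfloor>c * t\<rfloor>))) \<longlonglongrightarrow> h (%t. a (nat \<lfloor>c * t\<rfloor>))"
  proof (rule tendstoI)
    fix e :: real assume "e > 0"
    then obtain d where d: "d > 0" "!!g. g \<in> Dspace ==> (!!t. t \<in> {0..1} ==> \<bar>a (nat \<lfloor>c * t\<rfloor>) - g t\<bar> <= d)
        ==> \<bar>h g - h (%t. a (nat \<lfloor>c * t\<rfloor>))\<bar> < e"
      using sup_contD[OF h step_Dspace[OF c, of a]] by metis
    have "\<forall>\<^sub>F n in sequentially. \<forall>j\<in>{..nat \<lfloor>c\<rfloor>}. dist (x n j) (a j) < d"
      by (intro eventually_ball_finite ballI) (use xj d in \<open>auto simp: tendsto_iff\<close>)
    then show "\<forall>\<^sub>F n in sequentially. dist (h (%t. x n (nat \<lfloor>c * t\<rfloor>))) (h (%t. a (nat \<lfloor>c * t\<rfloor>))) < e"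
    proof (rule eventually_mono)
      fix n assume n: "\<forall>j\<in>{..nat \<lfloor>c\<rfloor>}. dist (x n j) (a j) < d"
      have "\<bar>h (%t. x n (nat \<lfloor>c * t\<rfloor>)) - h (%t. a (nat \<lfloor>c * t\<rfloor>))\<bar> < e"
      proof (rule d(2)[OF step_Dspace[OF c]])
        fix t :: real assume "t \<in> {0..1}"
        then have "dist (x n (nat \<lfloor>c * t\<rfloor>)) (a (nat \<lfloor>c * t\<rfloor>)) < d" using n grid_index[OF _ c] by auto
        then show "\<bar>a (nat \<lfloor>c * t\<rfloor>) - x n (nat \<lfloor>c * t\<rfloor>)\<bar> <= d" by (simp add: dist_real_def abs_minus_commute)
      qed
      then show "dist (h (%t. x n (nat \<lfloor>c * t\<rfloor>))) (h (%t. a (nat \<lfloor>c * t\<rfloor>))) < e" by (simp add: dist_real_def)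
    qed
  qed
qed

lemma step_functional_measurable:
  assumes h: "sup_cont h" and c: "c >= 0" and Z: "!!j. Z j \<in> borel_measurable M"
  shows "(%w. h (%t. Z (nat \<lfloor>c * t\<rfloor>) w)) \<in> borel_measurable M"
  using measurable_compose[OF measurable_coordinatewise_then_product borel_measurable_continuous_onI[OF step_functional_continuous[OF h c]],
     of "%w j. Z j w" M] Z by simp

text \<open>The largest minorant of \<open>h\<close> that is Lipschitz with constant
  \<open>m\<close> in the uniform distance. The infimum runs over upper bounds \<open>e\<close> of
  the distance, so no supremum over the time interval has to be formed.\<close>

definition inf_conv :: "((real => real) => real) => real => (real => real) => real" where
  "inf_conv h m f = Inf {h g + m * e | g e. g \<in> Dspace \<and> 0 <= e \<and> (\<forall>t\<in>{0..1}. \<bar>f t - g t\<bar> <= e)}"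

lemma inf_conv_props:
  assumes b: "!!f. f \<in> Dspace ==> \<bar>h f\<bar> <= B" and m: "m >= 0" and f: "f \<in> Dspace"
  shows "- B <= inf_conv h m f" "inf_conv h m f <= h f"
    "g \<in> Dspace ==> 0 <= e ==> (!!t. t \<in> {0..1} ==> \<bar>f t - g t\<bar> <= e) ==> inf_conv h m f <= h g + m * e"
    "(!!g e. g \<in> Dspace ==> 0 <= e ==> (!!t. t \<in> {0..1} ==> \<bar>f t - g t\<bar> <= e) ==> z <= h g + m * e) ==> z <= inf_conv h m f"
proof -
  let ?S = "{h g + m * e | g e. g \<in> Dspace \<and> 0 <= e \<and> (\<forall>t\<in>{0..1}. \<bar>f t - g t\<bar> <= e)}"
  have ne: "?S \<noteq> {}" using f by (auto intro!: exI[of _ f] exI[of _ "0::real"])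
  have lb: "- B <= y" if "y \<in> ?S" for y
  proof -
    from that obtain g e where ge: "y = h g + m * e" "g \<in> Dspace" "0 <= e" by auto
    have "m * e >= 0" using m ge by simp
    then show ?thesis using b[OF ge(2)] ge(1) by linarith
  qed
  then have bdd: "bdd_below ?S" by (rule bdd_belowI)
  show "- B <= inf_conv h m f" unfolding inf_conv_def by (rule cInf_greatest[OF ne lb])
  have up: "inf_conv h m f <= h g + m * e" if "g \<in> Dspace" "0 <= e" "!!t. t \<in> {0..1} ==> \<bar>f t - g t\<bar> <= e" for g e
    unfolding inf_conv_def by (rule cInf_lower[OF _ bdd]) (use that in blast)
  show "inf_conv h m f <= h g + m * e" if "g \<in> Dspace" "0 <= e" "!!t. t \<in> {0..1} ==> \<bar>f t - g t\<bar> <= e" by (rule up[OF that])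
  show "inf_conv h m f <= h f" using up[OF f, of 0] by simp
  show "z <= inf_conv h m f" if "!!g e. g \<in> Dspace ==> 0 <= e ==> (!!t. t \<in> {0..1} ==> \<bar>f t - g t\<bar> <= e) ==> z <= h g + m * e"
    unfolding inf_conv_def by (rule cInf_greatest[OF ne]) (use that in auto)
qed

lemma inf_conv_lipschitz:
  assumes b: "!!f. f \<in> Dspace ==> \<bar>h f\<bar> <= B" and m: "m >= 0" and f: "f \<in> Dspace" "f' \<in> Dspace"
    and d: "0 <= d" "!!t. t \<in> {0..1} ==> \<bar>f t - f' t\<bar> <= d"
  shows "\<bar>inf_conv h m f - inf_conv h m f'\<bar> <= m * d"
proof -
  have *: "inf_conv h m f1 - m * d <= inf_conv h m f2"
    if f12: "f1 \<in> Dspace" "f2 \<in> Dspace" "!!t. t \<in> {0..1} ==> \<bar>f1 t - f2 t\<bar> <= d" for f1 f2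
  proof (rule inf_conv_props(4)[OF b m f12(2)])
    fix g e assume g: "g \<in> Dspace" "0 <= e" "!!t. t \<in> {0..1} ==> \<bar>f2 t - g t\<bar> <= e"
    have "\<bar>f1 t - g t\<bar> <= e + d" if "t \<in> {0..1}" for t using f12(3)[OF that] g(3)[OF that] by linarith
    then have "inf_conv h m f1 <= h g + m * (e + d)"
      by (intro inf_conv_props(3)[OF b m f12(1) g(1)]) (use g d in auto)
    then show "inf_conv h m f1 - m * d <= h g + m * e" by (simp add: algebra_simps)
  qed
  show ?thesis using *[OF f d(2)] *[OF f(2,1)] d(2) by (simp add: abs_le_iff abs_minus_commute)
qed

lemma inf_conv_tendsto:
  assumes b: "!!f. f \<in> Dspace ==> \<bar>h f\<bar> <= B" and h: "sup_cont h" and f: "f \<in> Dspace"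
  shows "(%m::nat. inf_conv h (real m) f) \<longlonglongrightarrow> h f"
proof (rule LIMSEQ_I)
  fix e :: real assume e: "e > 0"
  obtain d where d: "d > 0" "!!g. g \<in> Dspace ==> (!!t. t \<in> {0..1} ==> \<bar>f t - g t\<bar> <= d) ==> \<bar>h g - h f\<bar> < e / 2"
    using sup_contD[OF h f, of "e/2"] e by (metis half_gt_zero)
  \<comment> \<open>Paths within \<open>d\<close> are controlled by continuity; for the others the
    penalty is at least \<open>m * d >= 2 * B\<close>, more than \<open>h\<close> can vary.\<close>
  obtain n :: nat where n: "real n >= 2 * B / d" using real_arch_simple by blast
  show "\<exists>no. \<forall>m\<ge>no. norm (inf_conv h (real m) f - h f) < e"
  proof (intro exI[of _ n] allI impI)
    fix m assume m: "n <= m"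
    have m0: "0 <= real m" by simp
    have "h f - e / 2 <= inf_conv h (real m) f"
    proof (rule inf_conv_props(4)[OF b m0 f])
      fix g s assume g: "g \<in> Dspace" "0 <= s" "!!t. t \<in> {0..1} ==> \<bar>f t - g t\<bar> <= s"
      show "h f - e / 2 <= h g + real m * s"
      proof (cases "s <= d")
        case True
        have "\<bar>h g - h f\<bar> < e / 2" by (rule d(2)[OF g(1)]) (use g(3) True in force)
        moreover have "real m * s >= 0" using g by simp
        ultimately show ?thesis by linarith
      next
        case False
        have "2 * B <= real n * d" using n d(1) by (simp add: field_simps)
        also have "... <= real m * s" using False m d(1) by (intro mult_mono) auto
        finally show ?thesis using b[OF f] b[OF g(1)] e by linarith
      qed
    qed
    moreover have "inf_conv h (real m) f <= h f" by (rule inf_conv_props(2)[OF b m0 f])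
    ultimately show "norm (inf_conv h (real m) f - h f) < e" using e by simp
  qed
qed

lemma inf_conv_sup_cont:
  assumes b: "!!f. f \<in> Dspace ==> \<bar>h f\<bar> <= B" and m: "m >= 0" shows "sup_cont (inf_conv h m)"
  unfolding sup_cont_def
proof (intro ballI allI impI)
  fix f and e :: real assume f: "f \<in> Dspace" and e: "e > 0"
  show "\<exists>d>0. \<forall>g\<in>Dspace. (\<forall>t\<in>{0..1}. \<bar>f t - g t\<bar> <= d) --> \<bar>inf_conv h m g - inf_conv h m f\<bar> < e"
  proof (intro exI[of _ "e / (m + 1)"] conjI ballI impI)
    fix g assume g: "g \<in> Dspace" "\<forall>t\<in>{0..1}. \<bar>f t - g t\<bar> <= e / (m + 1)"
    have "\<bar>inf_conv h m f - inf_conv h m g\<bar> <= m * (e / (m + 1))"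
      by (rule inf_conv_lipschitz[OF b m f g(1)]) (use g e m in auto)
    also have "... < e" using e m by (simp add: field_simps)
    finally show "\<bar>inf_conv h m g - inf_conv h m f\<bar> < e" by (simp add: abs_minus_commute)
  qed (use e m in auto)
qed

definition lip_D :: "real => ((real => real) => real) => bool" where
  "lip_D L h \<longleftrightarrow> L >= 0 \<and> (\<forall>f\<in>Dspace. \<forall>g\<in>Dspace. \<forall>d\<ge>0. (\<forall>t\<in>{0..1}. \<bar>f t - g t\<bar> <= d) --> \<bar>h f - h g\<bar> <= L * d)"

lemma lip_DD: "lip_D L h ==> f \<in> Dspace ==> g \<in> Dspace ==> 0 <= d ==> (!!t. t \<in> {0..1} ==> \<bar>f t - g t\<bar> <= d) ==> \<bar>h f - h g\<bar> <= L * d"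
  by (auto simp: lip_D_def)

text \<open>Bounded continuous functionals are monotone limits of their Lipschitz inf-convolutions,
  so no compactness of path sets is needed.\<close>
lemma lipschitz_functionals_suffice:
  fixes X :: "nat => 'a => real => real" and Y :: "'b => real => real"
  assumes M: "prob_space M" and P: "prob_space P"
    and XD: "!!N w. X N w \<in> Dspace" and YD: "!!w. Y w \<in> Dspace"
    and Xm: "!!h N. sup_cont h ==> (%w. h (X N w)) \<in> borel_measurable M"
    and Ym: "!!h. sup_cont h ==> (%w. h (Y w)) \<in> borel_measurable P"
    and conv: "!!h B L. (!!f. f \<in> Dspace ==> \<bar>h f\<bar> <= B) ==> lip_D L h ==> sup_cont h ==>
        (%N. \<integral>w. h (X N w) \<partial>M) \<longlonglongrightarrow> (\<integral>w. h (Y w) \<partial>P)"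
    and h: "bounded_cont_D h"
  shows "(%N. \<integral>w. h (X N w) \<partial>M) \<longlonglongrightarrow> (\<integral>w. h (Y w) \<partial>P)"
proof -
  \<comment> \<open>Lipschitz minorants give lower bounds for the limit inferior; the upper bounds
    follow by applying the same claim to \<open>- h\<close>.\<close>
  have lower: "\<forall>\<^sub>F N in sequentially. (\<integral>w. h (Y w) \<partial>P) - e < (\<integral>w. h (X N w) \<partial>M)"
    if h: "bounded_cont_D h" and e: "e > 0" for h and e :: real
  proof -
    obtain B where B: "!!f. f \<in> Dspace ==> \<bar>h f\<bar> <= B" using h unfolding bounded_cont_D_def by blast
    have hc: "sup_cont h" by (rule bounded_cont_D_sup_cont[OF h])
    have icc: "sup_cont (inf_conv h (real m))" for m by (rule inf_conv_sup_cont[OF B]) auto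
    have icb: "\<bar>inf_conv h (real m) f\<bar> <= B" if f: "f \<in> Dspace" for f m
      using inf_conv_props(1)[OF B _ f, where m="real m"] inf_conv_props(2)[OF B _ f, where m="real m"] B[OF f] by force
    interpret P: prob_space P by (rule P)
    interpret M: prob_space M by (rule M)
    have "(%m. \<integral>w. inf_conv h (real m) (Y w) \<partial>P) \<longlonglongrightarrow> (\<integral>w. h (Y w) \<partial>P)"
      by (rule integral_dominated_convergence[where w="%_. B"])
         (use Ym[OF hc] Ym[OF icc] icb[OF YD] inf_conv_tendsto[OF B hc YD] in auto)
    then have "\<forall>\<^sub>F m in sequentially. (\<integral>w. h (Y w) \<partial>P) - e < (\<integral>w. inf_conv h (real m) (Y w) \<partial>P)"
      using e by (intro order_tendstoD(1)) auto
    then obtain m where m: "(\<integral>w. h (Y w) \<partial>P) - e < (\<integral>w. inf_conv h (real m) (Y w) \<partial>P)"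
      using eventually_happens'[OF sequentially_bot] by blast
    have "lip_D (real m) (inf_conv h (real m))"
      unfolding lip_D_def using inf_conv_lipschitz[OF B, where m="real m"] by auto
    from conv[OF icb this icc] have "(%N. \<integral>w. inf_conv h (real m) (X N w) \<partial>M) \<longlonglongrightarrow> (\<integral>w. inf_conv h (real m) (Y w) \<partial>P)" by simp
    then have "\<forall>\<^sub>F N in sequentially. (\<integral>w. h (Y w) \<partial>P) - e < (\<integral>w. inf_conv h (real m) (X N w) \<partial>M)"
      using m by (intro order_tendstoD(1)) auto
    then show ?thesis
    proof (rule eventually_mono)
      fix N assume "(\<integral>w. h (Y w) \<partial>P) - e < (\<integral>w. inf_conv h (real m) (X N w) \<partial>M)"
      also have "... <= (\<integral>w. h (X N w) \<partial>M)"
        by (intro integral_mono M.integrable_bounded_by[where c=B] Xm icc hc icb XD B inf_conv_props(2)[OF B]) auto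
      finally show "(\<integral>w. h (Y w) \<partial>P) - e < (\<integral>w. h (X N w) \<partial>M)" .
    qed
  qed
  show ?thesis
  proof (rule tendstoI)
    fix e :: real assume e: "e > 0"
    from lower[OF h e] lower[OF bounded_cont_D_uminus[OF h] e]
    show "\<forall>\<^sub>F N in sequentially. dist (\<integral>w. h (X N w) \<partial>M) (\<integral>w. h (Y w) \<partial>P) < e"
      by eventually_elim (auto simp: dist_real_def abs_less_iff)
  qed
qed

section \<open>Sampling paths on dyadic grids\<close>

abbreviation samp :: "nat => (real => real) => real => real" where
  "samp k f \<equiv> (%t. f (real (nat \<lfloor>2 ^ k * t\<rfloor>) / 2 ^ k))"

lemma samp_Dspace: "samp k f \<in> Dspace"
  by (rule step_Dspace[where a="%j. f (real j / 2 ^ k)"]) simp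

lemma samp_tendsto:
  assumes h: "sup_cont h" and f: "continuous_on UNIV f"
  shows "(%k. h (samp k f)) \<longlonglongrightarrow> h f"
proof (rule LIMSEQ_I)
  fix e :: real assume e: "e > 0"
  obtain d where d: "d > 0" "!!g. g \<in> Dspace ==> (!!t. t \<in> {0..1} ==> \<bar>f t - g t\<bar> <= d) ==> \<bar>h g - h f\<bar> < e"
    using sup_contD[OF h continuous_Dspace[OF f] e] by metis
  have "uniformly_continuous_on {0..1} f"
    by (rule compact_uniformly_continuous) (use f continuous_on_subset in auto)
  then obtain r where r: "r > 0" "!!x y. x \<in> {0..1} ==> y \<in> {0..1} ==> dist y x < r ==> dist (f y) (f x) < d"
    unfolding uniformly_continuous_on_def using d(1) by meson
  obtain n where n: "(1/2::real) ^ n < r" using real_arch_pow_inv[OF r(1), of "1/2"] by auto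
  show "\<exists>no. \<forall>k\<ge>no. norm (h (samp k f) - h f) < e"
  proof (intro exI[of _ n] allI impI)
    fix k assume k: "n <= k"
    have "\<bar>h (samp k f) - h f\<bar> < e"
    proof (rule d(2)[OF samp_Dspace])
      fix t :: real assume t: "t \<in> {0..1}"
      let ?s = "real (nat \<lfloor>2 ^ k * t\<rfloor>) / 2 ^ k"
      have fl: "real (nat \<lfloor>2 ^ k * t\<rfloor>) = of_int \<lfloor>2 ^ k * t\<rfloor>" using t by simp
      have "real (nat \<lfloor>2 ^ k * t\<rfloor>) <= 2 ^ k * t" unfolding fl by simp
      then have s1: "?s <= t" by (simp add: field_simps)
      have "2 ^ k * t < real (nat \<lfloor>2 ^ k * t\<rfloor>) + 1" unfolding fl by linarith
      then have "t < (real (nat \<lfloor>2 ^ k * t\<rfloor>) + 1) / 2 ^ k" by (simp add: pos_less_divide_eq mult.commute)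
      then have s2: "t - ?s < 1 / 2 ^ k" by (simp add: add_divide_distrib)
      have "(1::real) / 2 ^ k <= (1/2) ^ n" using power_decreasing[OF k, of "1/2::real"] by (simp add: power_divide)
      then have "dist ?s t < r" using s1 s2 n by (simp add: dist_real_def)
      moreover have "?s \<in> {0..1}"
      proof -
        have "?s <= 1" using s1 t by (meson atLeastAtMost_iff order_trans)
        moreover have "0 <= ?s" by simp
        ultimately show ?thesis by (simp only: atLeastAtMost_iff)
      qed
      ultimately have "dist (f ?s) (f t) < d" using r(2)[OF t] by blast
      then show "\<bar>f t - f ?s\<bar> <= d" by (simp add: dist_real_def abs_minus_commute)
    qed
    then show "norm (h (samp k f) - h f) < e" by simp
  qed
qed

lemma sampm:
  assumes "sup_cont h" "!!t. A t \<in> borel_measurable Q"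
  shows "(%w. h (samp k (%t. A t w))) \<in> borel_measurable Q"
  by (rule step_functional_measurable[OF assms(1), of "2 ^ k" "%j w. A (real j / 2 ^ k) w"]) (use assms(2) in auto)

text \<open>Three comparisons: \<open>X N\<close> with its dyadic sample, controlled by
  \<open>D\<close>; the sample of \<open>X N\<close> with that of \<open>Y\<close>, a matter of
  finitely many coordinates; the sample of \<open>Y\<close> with \<open>Y\<close>, by continuity of
  paths. Using an integrable majorant \<open>D\<close> instead of the supremum over \<open>t\<close>
  avoids any measurability question for the latter. Its mean splits into a part small in
  \<open>k\<close> and a part small in \<open>N\<close>, so \<open>k\<close> is fixed first.\<close>

theorem weak_convergence_of_step_processes:
  fixes Z :: "nat => nat => 'a => real" and Y :: "real => 'b => real"
  defines "X \<equiv> %N w t. Z N (nat \<lfloor>real N * t\<rfloor>) w"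
  assumes M: "prob_space M" and P: "prob_space P"
    and Zm: "!!N j. Z N j \<in> borel_measurable M" and Ym: "!!t. Y t \<in> borel_measurable P"
    and Yc: "!!w. continuous_on UNIV (%t. Y t w)"
    and tc: "!!(n::nat) ts u. (!!i. i < n ==> ts i \<in> {0..1}) ==>
       (%N. \<integral>w. cos (\<Sum>i<n. u i * X N w (ts i)) \<partial>M) \<longlonglongrightarrow> (\<integral>w. cos (\<Sum>i<n. u i * Y (ts i) w) \<partial>P)"
    and tsn: "!!(n::nat) ts u. (!!i. i < n ==> ts i \<in> {0..1}) ==>
       (%N. \<integral>w. sin (\<Sum>i<n. u i * X N w (ts i)) \<partial>M) \<longlonglongrightarrow> (\<integral>w. sin (\<Sum>i<n. u i * Y (ts i) w) \<partial>P)"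
    and D: "!!N k. integrable M (D N k)" "!!N k w t. N >= N0 k ==> t \<in> {0..1} ==> \<bar>X N w t - samp k (X N w) t\<bar> <= D N k w" "!!N k w. D N k w >= 0"
    and De: "!!N k. N >= N0 k ==> (\<integral>w. D N k w \<partial>M) <= eps k + r N" and eps: "eps \<longlonglongrightarrow> 0" and r: "r \<longlonglongrightarrow> 0"
    and h: "bounded_cont_D h"
  shows "(%N. \<integral>w. h (X N w) \<partial>M) \<longlonglongrightarrow> (\<integral>w. h (%t. Y t w) \<partial>P)"
proof (rule lipschitz_functionals_suffice[OF M P _ _ _ _ _ h])
  interpret P: prob_space P by (rule P)
  interpret M: prob_space M by (rule M)
  show XD: "X N w \<in> Dspace" for N w unfolding X_def by (rule step_Dspace[of _ "%j. Z N j w"]) simp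
  show YD: "(%t. Y t w) \<in> Dspace" for w by (rule continuous_Dspace[OF Yc])
  show Xm: "(%w. h (X N w)) \<in> borel_measurable M" if "sup_cont h" for h N
    unfolding X_def by (rule step_functional_measurable[OF that _ Zm]) simp
  show Ym': "(%w. h (%t. Y t w)) \<in> borel_measurable P" if "sup_cont h" for h
    by (rule borel_measurable_LIMSEQ_real[OF samp_tendsto[OF that Yc] sampm[OF that Ym]])
  fix h B L assume B: "!!f. f \<in> Dspace ==> \<bar>h f\<bar> <= B" and L: "lip_D L h" and hc: "sup_cont h"
  have L0: "L >= 0" using L by (simp add: lip_D_def)
  have Xtm: "(%w. X N w t) \<in> borel_measurable M" for N t unfolding X_def by (rule Zm)
  have fd: "(%N. \<integral>w. h (samp k (X N w)) \<partial>M) \<longlonglongrightarrow> (\<integral>w. h (samp k (%t. Y t w)) \<partial>P)" for k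
  proof -
    \<comment> \<open>The time \<open>t = 1\<close> has index \<open>2 ^ k\<close>, hence one more
      coordinate than intervals.\<close>
    define m where "m = (2::nat) ^ k + 1"
    define G where "G = (%x::nat => real. h (%t. x (nat \<lfloor>2 ^ k * t\<rfloor>)))"
    have GD: "(%t. x (nat \<lfloor>2 ^ k * t\<rfloor>)) \<in> Dspace" for x :: "nat => real" by (rule step_Dspace) simp
    have Gb: "\<bar>G x\<bar> <= B" for x unfolding G_def by (rule B[OF GD])
    have GL: "\<bar>G x - G y\<bar> <= L * (\<Sum>j<m. \<bar>x j - y j\<bar>)" for x y
    proof -
      have "\<bar>x (nat \<lfloor>2 ^ k * t\<rfloor>) - y (nat \<lfloor>2 ^ k * t\<rfloor>)\<bar> <= (\<Sum>j<m. \<bar>x j - y j\<bar>)" if "t \<in> {0..1}" for t :: real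
      proof -
        have "nat \<lfloor>2 ^ k * t\<rfloor> <= nat \<lfloor>2 ^ k :: real\<rfloor>" by (rule grid_index[OF that]) simp
        also have "\<lfloor>2 ^ k :: real\<rfloor> = 2 ^ k" by (metis floor_of_int of_int_numeral of_int_power)
        finally have "nat \<lfloor>2 ^ k * t\<rfloor> < m" unfolding m_def by (simp add: nat_power_eq less_Suc_eq_le nat_le_iff)
        then show ?thesis by (intro member_le_sum[of "nat \<lfloor>2 ^ k * t\<rfloor>" "{..<m}" "%j. \<bar>x j - y j\<bar>"]) auto
      qed
      moreover have "0 <= (\<Sum>j<m. \<bar>x j - y j\<bar>)" by (intro sum_nonneg) simp
      ultimately show ?thesis unfolding G_def by (intro lip_DD[OF L GD GD])
    qed
    have Gm: "G \<in> borel_measurable borel"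
      unfolding G_def by (intro borel_measurable_continuous_onI step_functional_continuous hc) simp
    have ts: "real j / 2 ^ k \<in> {0..1}" if "j < m" for j using that by (auto simp: m_def less_Suc_eq_le)
    have "(%N. \<integral>w. G (%j. X N w (real j / 2 ^ k)) \<partial>M) \<longlonglongrightarrow> (\<integral>w. G (%j. Y (real j / 2 ^ k) w) \<partial>P)"
      by (rule trig_moments_imp_lipschitz[where m=m and B=B and L=L and g=G, OF M P _ _ _ _ Gb GL Gm L0])
         (use Xtm Ym tc[of m "%j. real j / 2 ^ k"] tsn[of m "%j. real j / 2 ^ k"] ts in auto)
    then show ?thesis by (simp add: G_def)
  qed
  have close: "\<bar>(\<integral>w. h (X N w) \<partial>M) - (\<integral>w. h (samp k (X N w)) \<partial>M)\<bar> <= L * (eps k + r N)" if N: "N >= N0 k" for N k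
  proof -
    have i1: "integrable M (%w. h (X N w))" by (rule M.integrable_bounded_by[where c=B]) (use Xm[OF hc] B XD in auto)
    have i2: "integrable M (%w. h (samp k (X N w)))"
      by (rule M.integrable_bounded_by[where c=B]) (use sampm[OF hc, of "%t w. X N w t"] Xtm B samp_Dspace in auto)
    have "\<bar>(\<integral>w. h (X N w) \<partial>M) - (\<integral>w. h (samp k (X N w)) \<partial>M)\<bar> = \<bar>\<integral>w. h (X N w) - h (samp k (X N w)) \<partial>M\<bar>"
      using i1 i2 by simp
    also have "... <= (\<integral>w. \<bar>h (X N w) - h (samp k (X N w))\<bar> \<partial>M)" by (rule integral_abs_bound)
    also have "... <= (\<integral>w. L * D N k w \<partial>M)"
    proof (intro integral_mono integrable_abs Bochner_Integration.integrable_diff i1 i2 integrable_mult_right D(1))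
      fix w show "\<bar>h (X N w) - h (samp k (X N w))\<bar> <= L * D N k w"
        by (rule lip_DD[OF L XD samp_Dspace D(3) D(2)[OF N]])
    qed
    also have "... <= L * (eps k + r N)" using De[OF N] L0 by (simp add: mult_left_mono)
    finally show ?thesis .
  qed
  have Yl: "(%k. \<integral>w. h (samp k (%t. Y t w)) \<partial>P) \<longlonglongrightarrow> (\<integral>w. h (%t. Y t w) \<partial>P)"
  proof (rule integral_dominated_convergence[where w="%_. B"])
    show "AE w in P. norm (h (samp k (%t. Y t w))) <= B" for k
    proof (rule AE_I2)
      fix w show "norm (h (samp k (%t. Y t w))) <= B"
        using B[OF samp_Dspace[where k=k and f="%t. Y t w"]] by simp
    qed
    show "(%w. h (samp k (%t. Y t w))) \<in> borel_measurable P" for k by (rule sampm[OF hc Ym])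
  qed (use Ym'[OF hc] samp_tendsto[OF hc Yc] in auto)
  show "(%N. \<integral>w. h (X N w) \<partial>M) \<longlonglongrightarrow> (\<integral>w. h (%t. Y t w) \<partial>P)"
  proof (rule tendstoI)
    fix e :: real assume e: "e > 0"
    have "(%k. L * eps k) \<longlonglongrightarrow> L * 0" by (intro tendsto_mult tendsto_const eps)
    then have "\<forall>\<^sub>F k in sequentially. L * eps k < e / 4" using e by (intro order_tendstoD(2)) auto
    moreover have "\<forall>\<^sub>F k in sequentially. dist (\<integral>w. h (samp k (%t. Y t w)) \<partial>P) (\<integral>w. h (%t. Y t w) \<partial>P) < e / 4"
      using Yl e by (intro tendstoD) auto
    ultimately have "\<forall>\<^sub>F k in sequentially. L * eps k < e / 4 \<and> dist (\<integral>w. h (samp k (%t. Y t w)) \<partial>P) (\<integral>w. h (%t. Y t w) \<partial>P) < e / 4"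
      by eventually_elim simp
    then obtain k where k: "L * eps k < e / 4" "dist (\<integral>w. h (samp k (%t. Y t w)) \<partial>P) (\<integral>w. h (%t. Y t w) \<partial>P) < e / 4"
      using eventually_happens'[OF sequentially_bot] by blast
    have "(%N. L * r N) \<longlonglongrightarrow> L * 0" by (intro tendsto_mult tendsto_const r)
    then have "\<forall>\<^sub>F N in sequentially. L * r N < e / 4" using e by (intro order_tendstoD(2)) auto
    moreover have "\<forall>\<^sub>F N in sequentially. dist (\<integral>w. h (samp k (X N w)) \<partial>M) (\<integral>w. h (samp k (%t. Y t w)) \<partial>P) < e / 4"
      using fd[of k] e by (intro tendstoD) auto
    moreover have "\<forall>\<^sub>F N in sequentially. N >= N0 k" by (rule eventually_ge_at_top)
    ultimately show "\<forall>\<^sub>F N in sequentially. dist (\<integral>w. h (X N w) \<partial>M) (\<integral>w. h (%t. Y t w) \<partial>P) < e"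
    proof eventually_elim
      case (elim N)
      have "\<bar>(\<integral>w. h (X N w) \<partial>M) - (\<integral>w. h (samp k (X N w)) \<partial>M)\<bar> <= L * eps k + L * r N"
        using close[OF elim(3)] by (simp add: algebra_simps)
      then show ?case using elim k unfolding dist_real_def by linarith
    qed
  qed
qed

section \<open>Gaussian processes with continuous paths\<close>

context prob_space begin

lemma char_distr_trig:
  fixes X :: "'a => real"
  assumes [measurable]: "X \<in> borel_measurable M"
  shows "char (distr M borel X) u = Complex (expectation (%w. cos (u * X w))) (expectation (%w. sin (u * X w)))"
proof -
  have i: "integrable M (%w. iexp (u * X w))" by (rule integrable_iexp) auto
  have "char (distr M borel X) u = (CLINT w|M. iexp (u * X w))" by (simp add: char_def integral_distr)
  moreover have "Re (CLINT w|M. iexp (u * X w)) = expectation (%w. cos (u * X w))"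
    using integral_Re[OF i] by (simp add: Re_exp)
  moreover have "Im (CLINT w|M. iexp (u * X w)) = expectation (%w. sin (u * X w))"
    using integral_Im[OF i] by (simp add: Im_exp)
  ultimately show ?thesis by (simp add: complex_eq_iff)
qed

text \<open>The hypotheses state that the characteristic function is real and equal to that of a
  centred normal law. Division by \<open>sqrt s\<close> reduces to the standard normal law; for
  \<open>s = 0\<close> there is no density and the law is a point mass.\<close>

lemma gauss_law_of_trig:
  fixes X :: "'a => real"
  assumes X[measurable]: "X \<in> borel_measurable M" and s: "s >= 0"
    and c: "!!u. expectation (%w. cos (u * X w)) = exp (- (s * u\<^sup>2) / 2)" and d: "!!u. expectation (%w. sin (u * X w)) = 0"
  shows "distr M borel X = (if s = 0 then return borel 0 else density lborel (normal_density 0 (sqrt s)))"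
proof (cases "s = 0")
  case True
  interpret r: prob_space "return borel (0::real)" by (rule prob_space_return) simp
  have rd: "real_distribution (return borel (0::real))" by unfold_locales auto
  have "char (distr M borel X) u = char (return borel 0) u" for u
    unfolding char_distr_trig[OF X] c d by (simp add: True char_def integral_return complex_eq_iff)
  then have "distr M borel X = return borel 0"
    by (intro Levy_uniqueness rd real_distribution_distr X ext)
  then show ?thesis using True by simp
next
  case False
  then have s0: "s > 0" using s by simp
  define Y where "Y = (%w. X w / sqrt s)"
  have Y[measurable]: "Y \<in> borel_measurable M" by (simp add: Y_def)
  have "char (distr M borel Y) u = char std_normal_distribution u" for u
  proof -
    have e: "u * Y w = (u / sqrt s) * X w" for w by (simp add: Y_def)
    have "s * (u / sqrt s)\<^sup>2 = u\<^sup>2" using s0 by (simp add: power_divide)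
    then show ?thesis unfolding char_distr_trig[OF Y] e c d char_std_normal_distribution by (simp add: complex_eq_iff)
  qed
  then have "distr M borel Y = std_normal_distribution"
    by (intro Levy_uniqueness real_dist_normal_dist real_distribution_distr Y ext)
  then have dY: "distributed M lborel Y std_normal_density"
    unfolding distributed_def by (simp cong: distr_cong)
  have dX: "distributed M lborel (%x. 0 + sqrt s * Y x) (normal_density (0 + sqrt s * 0) (\<bar>sqrt s\<bar> * 1))"
    by (rule normal_density_affine[OF dY]) (use s0 in auto)
  have "(%x. 0 + sqrt s * Y x) = X" using s0 by (auto simp: Y_def)
  then have "distributed M lborel X (normal_density 0 (sqrt s))" using dX s0 by simp
  then show ?thesis using False unfolding distributed_def by (simp cong: distr_cong)
qed

lemma gauss_moments_of_trig:
  fixes X :: "'a => real"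
  assumes X[measurable]: "X \<in> borel_measurable M" and s: "s >= 0"
    and c: "!!u. expectation (%w. cos (u * X w)) = exp (- (s * u\<^sup>2) / 2)" and d: "!!u. expectation (%w. sin (u * X w)) = 0"
  shows "integrable M X" "expectation X = 0" "integrable M (%w. (X w)\<^sup>2)" "expectation (%w. (X w)\<^sup>2) = s"
    "integrable M (%w. (X w) ^ 4)" "expectation (%w. (X w) ^ 4) = 3 * s\<^sup>2"
proof -
  note law = gauss_law_of_trig[OF assms]
  have key: "integrable M (%w. (X w) ^ k) \<and> expectation (%w. (X w) ^ k) = (if s = 0 then 0 ^ k else (\<integral>x. normal_density 0 (sqrt s) x * (x - 0) ^ k \<partial>lborel))" for k
  proof (cases "s = 0")
    case True
    then have l: "distr M borel X = return borel 0" using law by simp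
    have "integrable (distr M borel X) (%x. x ^ k)" unfolding l by (simp add: integrable_iff_bounded nn_integral_return)
    moreover have "(\<integral>x. x ^ k \<partial>distr M borel X) = 0 ^ k" unfolding l by (subst integral_return) auto
    ultimately show ?thesis using True by (simp add: integrable_distr_eq integral_distr)
  next
    case False
    then have s0: "sqrt s > 0" using s by simp
    have l: "distr M borel X = density lborel (normal_density 0 (sqrt s))" using law False by simp
    have "integrable (distr M borel X) (%x. x ^ k)" unfolding l
      using integrable_normal_moment[OF s0, of 0 k] by (subst integrable_density) auto
    moreover have "(\<integral>x. x ^ k \<partial>distr M borel X) = (\<integral>x. normal_density 0 (sqrt s) x * (x - 0) ^ k \<partial>lborel)" unfolding l
      by (subst integral_density) auto
    ultimately show ?thesis using False by (simp add: integrable_distr_eq integral_distr)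
  qed
  show "integrable M X" "integrable M (%w. (X w)\<^sup>2)" "integrable M (%w. (X w) ^ 4)" using key[of 1] key[of 2] key[of 4] by auto
  show "expectation X = 0"
    using key[of 1] integral_normal_moment_odd[of "sqrt s" 0 0] s by (cases "s = 0") auto
  show "expectation (%w. (X w)\<^sup>2) = s"
    using key[of 2] integral_normal_moment_even[of "sqrt s" 0 1] s by (cases "s = 0") auto
  show "expectation (%w. (X w) ^ 4) = 3 * s\<^sup>2"
    using key[of 4] integral_normal_moment_even[of "sqrt s" 0 2] s
    by (cases "s = 0") (auto simp: fact_numeral power2_eq_square field_simps)
qed

end

subsection \<open>Cholesky factorisation of an infinite positive semidefinite matrix\<close>

text \<open>Index maps \<open>ix\<close>, with repetitions allowed, take the place of finite
  subsets, so that a further index can always be adjoined to a quadratic form without checking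
  whether it already occurs.\<close>

definition psd :: "(nat => nat => real) => bool" where
  "psd B \<longleftrightarrow> (\<forall>i j. B i j = B j i) \<and> (\<forall>(n::nat) ix c. 0 <= (\<Sum>i<n. \<Sum>j<n. c i * c j * B (ix i) (ix j)))"

text \<open>If \<open>B k k = 0\<close> then the whole row vanishes, and the convention \<open>x / 0 = 0\<close> makes this the right definition.\<close>
definition schur :: "(nat => nat => real) => nat => nat => nat => real" where
  "schur B k i j = B i j - B i k * B k j / B k k"

lemma psd_diag: "psd B ==> B k k >= 0"
  unfolding psd_def by (elim conjE, drule spec[of _ 1], drule spec[of _ "%_. k"], drule spec[of _ "%_. 1"]) simp

lemma psd_zero_row: assumes B: "psd B" and z: "B k k = 0" shows "B i k = 0"
proof (rule ccontr)
  assume ne: "B i k \<noteq> 0"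
  \<comment> \<open>With a zero at \<open>k\<close> the form in \<open>i\<close> and
    \<open>k\<close> is affine in the coefficient \<open>y\<close> of \<open>k\<close>; this
    \<open>y\<close> gives it the value -1.\<close>
  define y where "y = - (B i i + 1) / (2 * B i k)"
  have gen: "0 <= (\<Sum>p<(2::nat). \<Sum>q<(2::nat). c p * c q * B (ix p) (ix q))" for c ix
    using B unfolding psd_def by blast
  have "0 <= (\<Sum>p<(2::nat). \<Sum>q<(2::nat). (if p = 0 then 1 else y) * (if q = 0 then 1 else y) * B (if p = 0 then i else k) (if q = 0 then i else k))"
    by (rule gen)
  also have "... = B i i + 2 * y * B i k"
    using B z unfolding psd_def by (simp add: numeral_2_eq_2)
  also have "... = - 1" using ne by (simp add: y_def field_simps)
  finally show False by simp
qed

text \<open>The form of the Schur complement is the form of \<open>B\<close> with the index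
  \<open>k\<close> adjoined, evaluated at the minimising coefficient
  \<open>- \<beta> / B k k\<close>; it inherits nonnegativity.\<close>

lemma psd_schur: assumes B: "psd B" shows "psd (schur B k)"
proof -
  have sym: "B i j = B j i" for i j using B by (simp add: psd_def)
  have "0 <= (\<Sum>i<n. \<Sum>j<n. c i * c j * schur B k (ix i) (ix j))" for n :: nat and ix c
  proof -
    define Q where "Q = (\<Sum>i<n. \<Sum>j<n. c i * c j * B (ix i) (ix j))"
    define \<beta> where "\<beta> = (\<Sum>i<n. c i * B (ix i) k)"
    have "\<beta>\<^sup>2 = (\<Sum>i<n. \<Sum>j<n. c i * c j * (B (ix i) k * B k (ix j)))"
      unfolding \<beta>_def power2_eq_square sum_product by (intro sum.cong refl) (simp add: sym[of k] mult_ac)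
    then have b2: "\<beta>\<^sup>2 / B k k = (\<Sum>i<n. \<Sum>j<n. c i * c j * (B (ix i) k * B k (ix j) / B k k))"
      by (simp add: sum_divide_distrib)
    have e: "(\<Sum>i<n. \<Sum>j<n. c i * c j * schur B k (ix i) (ix j)) = Q - \<beta>\<^sup>2 / B k k"
      unfolding b2 Q_def schur_def by (simp add: right_diff_distrib sum_subtractf)
    have gen: "0 <= (\<Sum>i<Suc n. \<Sum>j<Suc n. c' i * c' j * B (ix' i) (ix' j))" for c' ix'
      using B unfolding psd_def by blast
    show ?thesis
    proof (cases "B k k = 0")
      case True
      have "0 <= Q" using B unfolding psd_def Q_def by blast
      then show ?thesis unfolding e using True by simp
    next
      case False
      define y where "y = - \<beta> / B k k"
      define c' where "c' = (%i. if i < n then c i else y)"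
      define ix' where "ix' = (%i. if i < n then ix i else k)"
      have "0 <= (\<Sum>i<Suc n. \<Sum>j<Suc n. c' i * c' j * B (ix' i) (ix' j))" by (rule gen)
      also have "... = Q + (\<Sum>i<n. c i * y * B (ix i) k) + ((\<Sum>j<n. y * c j * B k (ix j)) + y * y * B k k)"
        by (simp add: c'_def ix'_def Q_def sum.distrib)
      also have "(\<Sum>i<n. c i * y * B (ix i) k) = y * \<beta>" by (simp add: \<beta>_def sum_distrib_left mult_ac)
      also have "(\<Sum>j<n. y * c j * B k (ix j)) = y * \<beta>" by (simp add: \<beta>_def sum_distrib_left mult_ac sym[of k])
      also have "Q + y * \<beta> + (y * \<beta> + y * y * B k k) = Q - \<beta>\<^sup>2 / B k k"
        using False by (simp add: y_def power2_eq_square field_simps)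
      finally show ?thesis unfolding e .
    qed
  qed
  then show ?thesis unfolding psd_def schur_def using sym by (auto simp: mult_ac)
qed

primrec schur_iter :: "(nat => nat => real) => nat => nat => nat => real" where
  "schur_iter B 0 = B"
| "schur_iter B (Suc k) = schur (schur_iter B k) k"

lemma schur_iter_psd: "psd B ==> psd (schur_iter B k)"
  by (induction k) (auto intro: psd_schur)

lemma schur_iter_zero: assumes B: "psd B" shows "i < k ==> schur_iter B k i j = 0"
proof (induction k arbitrary: j)
  case (Suc k)
  let ?A = "schur_iter B k"
  have A: "psd ?A" by (rule schur_iter_psd[OF B])
  show ?case
  proof (cases "i < k")
    case True
    then show ?thesis by (simp add: schur_def Suc.IH)
  next
    case False
    then have "i = k" using Suc.prems by simp
    moreover have "?A k j = 0" if "?A k k = 0" using psd_zero_row[OF A that] A by (simp add: psd_def)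
    ultimately show ?thesis by (cases "?A k k = 0") (auto simp: schur_def)
  qed
qed simp

text \<open>Elimination step \<open>k\<close> subtracts the rank-one matrix
  \<open>L i k * L j k\<close>. After more than \<open>i\<close> steps row \<open>i\<close> is
  exhausted, so the telescoping sum reproduces \<open>B i j\<close> exactly after finitely many
  terms, although the matrix is infinite.\<close>

lemma cholesky:
  assumes B: "psd B"
  obtains L where "!!i k. i < k ==> L i k = 0" "!!i j n. i < n ==> B i j = (\<Sum>k<n. L i k * L j k)"
proof -
  define L where "L = (%i k. schur_iter B k i k / sqrt (schur_iter B k k k))"
  have z: "L i k = 0" if "i < k" for i k using schur_iter_zero[OF B that] by (simp add: L_def)
  have prod: "L i k * L j k = schur_iter B k i j - schur_iter B (Suc k) i j" for i j k
  proof -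
    have A: "psd (schur_iter B k)" by (rule schur_iter_psd[OF B])
    have "sqrt (schur_iter B k k k) * sqrt (schur_iter B k k k) = schur_iter B k k k" using psd_diag[OF A] by simp
    moreover have "schur_iter B k j k = schur_iter B k k j" using A by (simp add: psd_def)
    ultimately show ?thesis by (simp add: L_def schur_def)
  qed
  have "B i j = (\<Sum>k<n. L i k * L j k)" if "i < n" for i j n
  proof -
    have "(\<Sum>k<n. L i k * L j k) = schur_iter B 0 i j - schur_iter B n i j"
      unfolding prod by (rule sum_lessThan_telescope')
    then show ?thesis using schur_iter_zero[OF B that] by simp
  qed
  then show ?thesis using that z by blast
qed

section \<open>Gaussian families as linear images of independent standard normal variables\<close>

abbreviation "normal_seq \<equiv> PiM UNIV (%_::nat. std_normal_distribution)"

lemma prob_space_normal_seq: "prob_space normal_seq"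
  by (intro prob_space_PiM prob_space_normal_density) simp

lemma normal_seq_comp[measurable]: "(%w. w k) \<in> borel_measurable normal_seq"
  using measurable_component_singleton[of k UNIV "%_. std_normal_distribution"] by simp

lemma normal_seq_trig:
  "(\<integral>w. cos (\<Sum>k<n. a k * w k) \<partial>normal_seq) = exp (- (\<Sum>k<n. (a k)\<^sup>2) / 2)" "(\<integral>w. sin (\<Sum>k<n. a k * w k) \<partial>normal_seq) = 0"
proof -
  interpret NS: prob_space normal_seq by (rule prob_space_normal_seq)
  have i1: "integrable std_normal_distribution (%t. iexp (a k * t))" for k
    by (rule prob_space.integrable_iexp[OF prob_space_normal_density]) auto
  have cm[measurable]: "(%w. w k) \<in> borel_measurable (gss n)" if "k \<in> {..<n}" for k
    using measurable_component_singleton[OF that, of "%_. std_normal_distribution"] by simp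
  have m: "(%w. iexp (\<Sum>k<n. a k * w k)) \<in> borel_measurable (gss n)"
  proof -
    have [measurable]: "(%w. \<Sum>k<n. a k * w k) \<in> borel_measurable (gss n)"
      by (intro borel_measurable_sum borel_measurable_times borel_measurable_const cm)
    show ?thesis by measurable
  qed
  have rm: "(%w. restrict w {..<n}) \<in> measurable normal_seq (gss n)"
    by (rule measurable_restrict_subset) simp
  have "(CLINT w|normal_seq. iexp (\<Sum>k<n. a k * w k)) = (CLINT w|normal_seq. iexp (\<Sum>k<n. a k * (restrict w {..<n}) k))"
    by (intro Bochner_Integration.integral_cong refl arg_cong[where f="%x. iexp x"] sum.cong) auto
  also have "... = (CLINT w|distr normal_seq (gss n) (%w. restrict w {..<n}). iexp (\<Sum>k<n. a k * w k))"
    by (rule integral_distr[OF rm m, symmetric])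
  also have "distr normal_seq (gss n) (%w. restrict w {..<n}) = gss n"
    by (rule product_prob_space.distr_PiM_restrict_finite[OF product_prob_spaceI[OF prob_space_normal_density]]) auto
  also have "(CLINT w|gss n. iexp (\<Sum>k<n. a k * w k)) = (CLINT w|gss n. (\<Prod>k<n. iexp (a k * w k)))"
    by (simp add: exp_sum sum_distrib_left)
  also have "... = (\<Prod>k<n. CLINT t|std_normal_distribution. iexp (a k * t))"
    by (rule gssP.product_integral_prod) (rule finite_lessThan i1)+
  also have "... = (\<Prod>k<n. char std_normal_distribution (a k))" by (simp add: char_def)
  also have "... = complex_of_real (\<Prod>k<n. exp (- (a k)\<^sup>2 / 2))" unfolding char_std_normal_distribution by simp
  also have "(\<Prod>k<n. exp (- (a k)\<^sup>2 / 2)) = exp (- (\<Sum>k<n. (a k)\<^sup>2) / 2)"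
    by (simp add: sum_negf sum_divide_distrib flip: exp_sum)
  finally have e: "(CLINT w|normal_seq. iexp (\<Sum>k<n. a k * w k)) = complex_of_real (exp (- (\<Sum>k<n. (a k)\<^sup>2) / 2))" .
  have mN: "(%w. \<Sum>k<n. a k * w k) \<in> borel_measurable normal_seq" by measurable
  have i: "integrable normal_seq (%w. iexp (\<Sum>k<n. a k * w k))"
    by (rule NS.integrable_iexp) (use mN in auto)
  show "(\<integral>w. cos (\<Sum>k<n. a k * w k) \<partial>normal_seq) = exp (- (\<Sum>k<n. (a k)\<^sup>2) / 2)"
    using integral_Re[OF i] unfolding e by (simp add: Re_exp)
  show "(\<integral>w. sin (\<Sum>k<n. a k * w k) \<partial>normal_seq) = 0"
    using integral_Im[OF i] unfolding e by (simp add: Im_exp)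
qed

text \<open>Triangularity of the Cholesky factor makes each \<open>Z i\<close> a finite combination
  of independent normal variables, and a finite combination of the \<open>Z\<close> again one. All
  joint laws are thus read off from one-dimensional normal variables, with repeated indices
  allowed.\<close>

lemma gaussian_family_exists:
  assumes B: "psd B"
  obtains Z :: "nat => (nat => real) => real" where "!!i. Z i \<in> borel_measurable normal_seq"
    "!!(n::nat) ix u. (\<integral>w. cos (\<Sum>i<n. u i * Z (ix i) w) \<partial>normal_seq) = exp (- (\<Sum>i<n. \<Sum>j<n. u i * u j * B (ix i) (ix j)) / 2)"
    "!!(n::nat) ix u. (\<integral>w. sin (\<Sum>i<n. u i * Z (ix i) w) \<partial>normal_seq) = 0"
proof -
  obtain L where L: "!!i k. i < k ==> L i k = 0" "!!i j n. i < n ==> B i j = (\<Sum>k<n. L i k * L j k)"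
    using cholesky[OF B] by blast
  define Z where "Z = (%i (w :: nat => real). \<Sum>k<Suc i. L i k * w k)"
  have ext: "Z i w = (\<Sum>k<m. L i k * w k)" if "i < m" for i m w
    unfolding Z_def by (rule sum.mono_neutral_left) (use that L(1) in auto)
  have comb: "\<exists>m a. (\<forall>w. (\<Sum>i<n. u i * Z (ix i) w) = (\<Sum>k<m. a k * w k)) \<and> (\<Sum>k<m. (a k)\<^sup>2) = (\<Sum>i<n. \<Sum>j<n. u i * u j * B (ix i) (ix j))" for n :: nat and ix u
  proof -
    obtain m where m: "!!i. i < n ==> ix i < m"
    proof -
      have "finite (ix ` {..<n})" by simp
      then obtain m where m: "ix ` {..<n} \<subseteq> {..<m}" using finite_nat_iff_bounded by blast
      show ?thesis by (rule that[of m]) (use m in auto)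
    qed
    define a where "a = (%k. \<Sum>i<n. u i * L (ix i) k)"
    have "(\<Sum>i<n. u i * Z (ix i) w) = (\<Sum>k<m. a k * w k)" for w
    proof -
      have "(\<Sum>i<n. u i * Z (ix i) w) = (\<Sum>i<n. \<Sum>k<m. u i * L (ix i) k * w k)"
        by (intro sum.cong refl) (simp add: ext[OF m] sum_distrib_left mult_ac)
      also have "... = (\<Sum>k<m. \<Sum>i<n. u i * L (ix i) k * w k)" by (rule sum.swap)
      finally show ?thesis by (simp add: a_def sum_distrib_right)
    qed
    moreover have "(\<Sum>k<m. (a k)\<^sup>2) = (\<Sum>i<n. \<Sum>j<n. u i * u j * B (ix i) (ix j))"
    proof -
      have "(\<Sum>k<m. (a k)\<^sup>2) = (\<Sum>k<m. \<Sum>i<n. \<Sum>j<n. (u i * u j) * (L (ix i) k * L (ix j) k))"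
        unfolding a_def power2_eq_square sum_product by (simp add: mult_ac)
      also have "... = (\<Sum>i<n. \<Sum>k<m. \<Sum>j<n. (u i * u j) * (L (ix i) k * L (ix j) k))" by (rule sum.swap)
      also have "... = (\<Sum>i<n. \<Sum>j<n. \<Sum>k<m. (u i * u j) * (L (ix i) k * L (ix j) k))" by (intro sum.cong refl sum.swap)
      also have "... = (\<Sum>i<n. \<Sum>j<n. u i * u j * B (ix i) (ix j))"
        by (intro sum.cong refl) (simp add: L(2)[OF m] sum_distrib_left)
      finally show ?thesis .
    qed
    ultimately show ?thesis by blast
  qed
  show ?thesis
  proof (rule that)
    show "Z i \<in> borel_measurable normal_seq" for i unfolding Z_def by measurable
    show "(\<integral>w. cos (\<Sum>i<n. u i * Z (ix i) w) \<partial>normal_seq) = exp (- (\<Sum>i<n. \<Sum>j<n. u i * u j * B (ix i) (ix j)) / 2)" for n :: nat and ix u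
    proof -
      obtain m a where ma: "!!w. (\<Sum>i<n. u i * Z (ix i) w) = (\<Sum>k<m. a k * w k)" "(\<Sum>k<m. (a k)\<^sup>2) = (\<Sum>i<n. \<Sum>j<n. u i * u j * B (ix i) (ix j))"
        using comb[of u ix n] by blast
      show ?thesis unfolding ma(1) ma(2)[symmetric] by (rule normal_seq_trig)
    qed
    show "(\<integral>w. sin (\<Sum>i<n. u i * Z (ix i) w) \<partial>normal_seq) = 0" for n :: nat and ix u
    proof -
      obtain m a where ma: "!!w. (\<Sum>i<n. u i * Z (ix i) w) = (\<Sum>k<m. a k * w k)" "(\<Sum>k<m. (a k)\<^sup>2) = (\<Sum>i<n. \<Sum>j<n. u i * u j * B (ix i) (ix j))"
        using comb[of u ix n] by blast
      show ?thesis unfolding ma(1) ma(2)[symmetric] by (rule normal_seq_trig)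
    qed
  qed
qed

subsection \<open>Chaining\<close>

lemma chain_limit:
  fixes z :: "nat => real"
  assumes d: "!!k. \<bar>z (Suc k) - z k\<bar> <= D k" and s: "summable D"
  shows "z \<longlonglongrightarrow> lim z" "\<bar>lim z - z k\<bar> <= (\<Sum>j. D (j + k))"
proof -
  have sz: "summable (%k. z (Suc k) - z k)" by (rule summable_comparison_test'[OF s, of 0]) (use d in auto)
  then have "(%n. \<Sum>k<n. z (Suc k) - z k) \<longlonglongrightarrow> (\<Sum>k. z (Suc k) - z k)" by (rule summable_LIMSEQ)
  then have "(%n. (z n - z 0) + z 0) \<longlonglongrightarrow> (\<Sum>k. z (Suc k) - z k) + z 0"
    unfolding sum_lessThan_telescope by (rule tendsto_add) simp
  then have "convergent z" by (auto simp: convergent_def)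
  then show l: "z \<longlonglongrightarrow> lim z" by (simp add: convergent_LIMSEQ_iff)
  have D0: "D k >= 0" for k using d[of k] by linarith
  have sk: "summable (%j. D (j + k))" using s by (simp add: summable_iff_shift)
  have "\<bar>z (n + k) - z k\<bar> <= (\<Sum>j. D (j + k))" for n
  proof -
    have "\<bar>z (n + k) - z k\<bar> <= (\<Sum>j<n. D (j + k))"
    proof (induction n)
      case (Suc n) then show ?case using d[of "n + k"] by simp
    qed simp
    also have "... <= (\<Sum>j. D (j + k))" by (rule sum_le_suminf[OF sk]) (use D0 in auto)
    finally show ?thesis .
  qed
  moreover have "(%n. \<bar>z (n + k) - z k\<bar>) \<longlonglongrightarrow> \<bar>lim z - z k\<bar>"
    by (intro tendsto_intros LIMSEQ_ignore_initial_segment l)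
  ultimately show "\<bar>lim z - z k\<bar> <= (\<Sum>j. D (j + k))" by (intro LIMSEQ_le_const2) auto
qed

lemma nat_floor_double: assumes "x >= 0" shows "nat \<lfloor>2 * x\<rfloor> div 2 = nat \<lfloor>x :: real\<rfloor>"
proof -
  define n where "n = nat \<lfloor>2 * x\<rfloor>"
  have n: "real n = of_int \<lfloor>2 * x\<rfloor>" using assms by (simp add: n_def)
  have "real n <= 2 * x" "2 * x < real n + 1" unfolding n by linarith+
  moreover have "2 * real (n div 2) <= real n" "real n + 1 <= 2 * real (n div 2) + 2" by linarith+
  ultimately have "\<lfloor>x\<rfloor> = int (n div 2)" by (intro floor_unique) linarith+
  then show ?thesis by (simp add: n_def)
qed

lemma nat_floor_near: "a - b < (1::real) ==> nat \<lfloor>a\<rfloor> <= Suc (nat \<lfloor>b\<rfloor>)"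
  by linarith

text \<open>Summing the right-hand side over many variables bounds their maximum by \<open>a\<close>
  plus the sum of cubes over the square of \<open>a\<close>. Its expectation is linear in third
  moments, and \<open>a\<close> is free to be chosen at each dyadic scale.\<close>

lemma abs_le_cube: assumes "a > 0" shows "\<bar>x\<bar> <= a + \<bar>x :: real\<bar> ^ 3 / a\<^sup>2"
proof (cases "\<bar>x\<bar> <= a")
  case True then show ?thesis using assms by (simp add: add_increasing2)
next
  case False
  then have "\<bar>x\<bar> * a\<^sup>2 <= \<bar>x\<bar> * \<bar>x\<bar>\<^sup>2" using assms by (intro mult_left_mono power_mono) auto
  then have "\<bar>x\<bar> <= \<bar>x\<bar> ^ 3 / a\<^sup>2" using assms by (simp add: field_simps power2_eq_square power3_eq_cube)
  then show ?thesis using assms by simp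
qed

lemma (in prob_space) AE_summable:
  assumes D: "!!k::nat. integrable M (D k)" "!!k w. D k w >= (0::real)" and s: "summable (%k. expectation (D k))"
  shows "AE w in M. (\<Sum>k. ennreal (D k w)) \<noteq> \<infinity>"
proof -
  have [measurable]: "D k \<in> borel_measurable M" for k using D(1) by auto
  have "(\<integral>\<^sup>+ w. (\<Sum>k. ennreal (D k w)) \<partial>M) = (\<Sum>k. \<integral>\<^sup>+ w. ennreal (D k w) \<partial>M)" by (rule nn_integral_suminf) simp
  also have "... = (\<Sum>k. ennreal (expectation (D k)))" by (intro suminf_cong nn_integral_eq_integral D) (auto simp: D)
  also have "... = ennreal (\<Sum>k. expectation (D k))" by (rule suminf_ennreal2[OF _ s]) (use D in auto)
  finally have "(\<integral>\<^sup>+ w. (\<Sum>k. ennreal (D k w)) \<partial>M) \<noteq> \<infinity>" by simp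
  then show ?thesis by (intro nn_integral_noteq_infinite) auto
qed

abbreviation clamp01 :: "real => real" where "clamp01 t \<equiv> max 0 (min 1 t)"

text \<open>Kolmogorov's chaining. Increments of two kinds are controlled at each dyadic level: from
  a grid point to its parent, which makes the approximations converge uniformly, and between
  neighbouring grid points, which makes the limit continuous.\<close>

theorem gaussian_process_exists:
  fixes b :: "real => real => real"
  assumes sym: "!!s t. s \<in> {0..1} ==> t \<in> {0..1} ==> b s t = b t s"
    and pos: "!!(n::nat) ts c. (!!i. ts i \<in> {0..1}) ==> 0 <= (\<Sum>i<n. \<Sum>j<n. c i * c j * b (ts i) (ts j))"
    and inc: "!!s t. s \<in> {0..1} ==> t \<in> {0..1} ==> b t t - 2 * b t s + b s s <= C * \<bar>t - s\<bar>" and C: "C > 0"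
    and cont: "!!s t t'. s \<in> {0..1} ==> t \<in> {0..1} ==> t' \<in> {0..1} ==> \<bar>b t s - b t' s\<bar> <= C * sqrt \<bar>t - t'\<bar>"
  obtains Y :: "real => (nat => real) => real" where "!!t. Y t \<in> borel_measurable normal_seq"
    "!!w. continuous_on UNIV (%t. Y t w)"
    "!!(n::nat) ts u. (!!i. i < n ==> ts i \<in> {0..1}) ==> (\<integral>w. cos (\<Sum>i<n. u i * Y (ts i) w) \<partial>normal_seq) = exp (- (\<Sum>i<n. \<Sum>j<n. u i * u j * b (ts i) (ts j)) / 2)"
    "!!(n::nat) ts u. (!!i. i < n ==> ts i \<in> {0..1}) ==> (\<integral>w. sin (\<Sum>i<n. u i * Y (ts i) w) \<partial>normal_seq) = 0"
proof -
  interpret NS: prob_space normal_seq by (rule prob_space_normal_seq)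
  \<comment> \<open>Enumerates the dyadic times by pairs of level and index, truncated at 1. One
    time occurs under many indices, and the variables attached to them agree only almost surely;
    parent increments cover this case as well.\<close>
  define \<tau> where "\<tau> = (%n. case prod_decode n of (k, i) => min 1 (real i / 2 ^ k))"
  have \<tau>I: "\<tau> n \<in> {0..1}" for n by (cases "prod_decode n") (auto simp: \<tau>_def)
  define B where "B = (%m n. b (\<tau> m) (\<tau> n))"
  have "psd B" unfolding psd_def B_def using sym[OF \<tau>I \<tau>I] pos[of "%i. \<tau> (ix i)" for ix] \<tau>I by auto
  then obtain Z :: "nat => (nat => real) => real" where Zm[measurable]: "!!i. Z i \<in> borel_measurable normal_seq"
    and Zc: "!!(n::nat) ix u. (\<integral>w. cos (\<Sum>i<n. u i * Z (ix i) w) \<partial>normal_seq) = exp (- (\<Sum>i<n. \<Sum>j<n. u i * u j * B (ix i) (ix j)) / 2)"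
    and Zs: "!!(n::nat) ix u. (\<integral>w. sin (\<Sum>i<n. u i * Z (ix i) w) \<partial>normal_seq) = 0"
    using gaussian_family_exists by blast
  have dm: "integrable normal_seq (%w. \<bar>Z p w - Z q w\<bar> ^ 3) \<and> NS.expectation (%w. \<bar>Z p w - Z q w\<bar> ^ 3) <= 2 * \<sigma> ^ 3"
    if \<sigma>: "\<sigma> > 0" "C * \<bar>\<tau> p - \<tau> q\<bar> <= \<sigma>\<^sup>2" for p q \<sigma>
  proof -
    define s where "s = B p p - 2 * B p q + B q q"
    let ?ix = "%i::nat. if i = 0 then p else q"
    let ?u = "%u (i::nat). if i = 0 then u else - u :: real"
    have Bs: "B p q = B q p" unfolding B_def using sym[OF \<tau>I \<tau>I] by simp
    have e1: "(\<Sum>i<2. ?u u i * Z (?ix i) w) = u * (Z p w - Z q w)" for u w by (simp add: numeral_2_eq_2 algebra_simps)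
    have e2: "(\<Sum>i<2. \<Sum>j<2. ?u u i * ?u u j * B (?ix i) (?ix j)) = s * u\<^sup>2" for u
      by (simp add: numeral_2_eq_2 s_def Bs power2_eq_square algebra_simps)
    have c: "NS.expectation (%w. cos (u * (Z p w - Z q w))) = exp (- (s * u\<^sup>2) / 2)" for u
      using Zc[of "?u u" ?ix 2] unfolding e1 e2 .
    have d: "NS.expectation (%w. sin (u * (Z p w - Z q w))) = 0" for u using Zs[of "?u u" ?ix 2] unfolding e1 .
    have s0: "s >= 0" using pos[of "%i. \<tau> (?ix i)" "?u 1" 2] \<tau>I e2[of 1] unfolding B_def by simp
    have s1: "s <= \<sigma>\<^sup>2" using inc[OF \<tau>I[of q] \<tau>I[of p]] \<sigma>(2) by (simp add: s_def B_def)
    have m: "(%w. Z p w - Z q w) \<in> borel_measurable normal_seq" by measurable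
    note G = NS.gauss_moments_of_trig[OF m s0 c d]
    let ?x = "%w. Z p w - Z q w"
    \<comment> \<open>Arithmetic-geometric mean between second and fourth moments, which are
      explicit for normal variables; with variance at most the square of \<open>\<sigma>\<close> it
      yields \<open>(1 + 3) / 2 = 2\<close> times the cube of \<open>\<sigma>\<close>.\<close>
    have le: "\<bar>?x w\<bar> ^ 3 <= (\<sigma> * (?x w)\<^sup>2 + (?x w) ^ 4 / \<sigma>) / 2" for w
    proof -
      have "0 <= (\<bar>?x w\<bar> - \<sigma>)\<^sup>2" by simp
      then have "2 * \<bar>?x w\<bar> * \<sigma> <= (?x w)\<^sup>2 + \<sigma>\<^sup>2" by (simp add: power2_diff)
      then have "\<bar>?x w\<bar> <= ((?x w)\<^sup>2 / \<sigma> + \<sigma>) / 2" using \<sigma>(1) by (simp add: field_simps power2_eq_square)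
      then have "(?x w)\<^sup>2 * \<bar>?x w\<bar> <= (?x w)\<^sup>2 * (((?x w)\<^sup>2 / \<sigma> + \<sigma>) / 2)" by (rule mult_left_mono) simp
      moreover have "(?x w)\<^sup>2 * \<bar>?x w\<bar> = \<bar>?x w\<bar> ^ 3" by (simp add: power3_eq_cube power2_eq_square abs_mult_self_eq)
      moreover have "(?x w)\<^sup>2 * (((?x w)\<^sup>2 / \<sigma> + \<sigma>) / 2) = (\<sigma> * (?x w)\<^sup>2 + (?x w) ^ 4 / \<sigma>) / 2"
        by (simp add: algebra_simps power2_eq_square power4_eq_xxxx)
      ultimately show ?thesis by linarith
    qed
    have iR: "integrable normal_seq (%w. (\<sigma> * (?x w)\<^sup>2 + (?x w) ^ 4 / \<sigma>) / 2)" using G by auto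
    have iL: "integrable normal_seq (%w. \<bar>?x w\<bar> ^ 3)"
      by (rule NS.expectation_abs_mono(1)[OF iR]) (use le in auto)
    have "NS.expectation (%w. \<bar>?x w\<bar> ^ 3) <= NS.expectation (%w. (\<sigma> * (?x w)\<^sup>2 + (?x w) ^ 4 / \<sigma>) / 2)"
      by (intro integral_mono iL iR le)
    also have "... = (\<sigma> * s + 3 * s\<^sup>2 / \<sigma>) / 2" using G by simp
    also have "... <= (\<sigma> * \<sigma>\<^sup>2 + 3 * (\<sigma>\<^sup>2)\<^sup>2 / \<sigma>) / 2"
      using s0 s1 \<sigma>(1) by (intro divide_right_mono add_mono mult_left_mono power_mono) auto
    also have "... = 2 * \<sigma> ^ 3" using \<sigma>(1) by (simp add: power2_eq_square power3_eq_cube field_simps)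
    finally show ?thesis using iL by simp
  qed
  define e where "e = (%k i. prod_encode (k, i))"
  have \<tau>e: "\<tau> (e k i) = min 1 (real i / 2 ^ k)" for k i by (simp add: \<tau>_def e_def)
  \<comment> \<open>Level \<open>k\<close> has of the order of \<open>2 ^ k\<close> increments whose
    cubes have means of the order of \<open>h k ^ 3\<close>, in total of the order of
    \<open>h k = sqrt (1/2) ^ k\<close>. The threshold ratio 9/10 is chosen so that dividing by its
    square still leaves geometric decay: \<open>sqrt (1/2) <= (9/10) ^ 3\<close>.\<close>
  define D where "D = (%k w. (9/10) ^ k + ((\<Sum>i<2 ^ Suc k + 1. \<bar>Z (e (Suc k) i) w - Z (e k (i div 2)) w\<bar> ^ 3)
      + (\<Sum>i<2 ^ k. \<bar>Z (e k (Suc i)) w - Z (e k i) w\<bar> ^ 3)) / ((9/10) ^ k)\<^sup>2)"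
  have D0: "D k w >= 0" for k w unfolding D_def by (intro add_nonneg_nonneg divide_nonneg_nonneg sum_nonneg) auto
  have big: "\<bar>x\<bar> <= (9/10) ^ k + (S1 + S2) / ((9/10) ^ k)\<^sup>2" if "\<bar>x\<bar> ^ 3 <= S1 + S2" for x S1 S2 :: real and k
  proof -
    have "\<bar>x\<bar> <= (9/10) ^ k + \<bar>x\<bar> ^ 3 / ((9/10) ^ k)\<^sup>2" by (rule abs_le_cube) simp
    also have "... <= (9/10) ^ k + (S1 + S2) / ((9/10) ^ k)\<^sup>2" using that by (intro add_left_mono divide_right_mono) auto
    finally show ?thesis .
  qed
  have D1: "\<bar>Z (e (Suc k) i) w - Z (e k (i div 2)) w\<bar> <= D k w" if "i <= 2 ^ Suc k" for k i w
    unfolding D_def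
  proof (rule big)
    have "\<bar>Z (e (Suc k) i) w - Z (e k (i div 2)) w\<bar> ^ 3 <= (\<Sum>i<2 ^ Suc k + 1. \<bar>Z (e (Suc k) i) w - Z (e k (i div 2)) w\<bar> ^ 3)"
      by (rule member_le_sum[of i]) (use that in auto)
    moreover have "0 <= (\<Sum>i<2 ^ k. \<bar>Z (e k (Suc i)) w - Z (e k i) w\<bar> ^ 3)" by (intro sum_nonneg) simp
    ultimately show "\<bar>Z (e (Suc k) i) w - Z (e k (i div 2)) w\<bar> ^ 3 <= (\<Sum>i<2 ^ Suc k + 1. \<bar>Z (e (Suc k) i) w - Z (e k (i div 2)) w\<bar> ^ 3)
      + (\<Sum>i<2 ^ k. \<bar>Z (e k (Suc i)) w - Z (e k i) w\<bar> ^ 3)" by linarith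
  qed
  have D2: "\<bar>Z (e k (Suc i)) w - Z (e k i) w\<bar> <= D k w" if "i < 2 ^ k" for k i w
    unfolding D_def
  proof (rule big)
    have "\<bar>Z (e k (Suc i)) w - Z (e k i) w\<bar> ^ 3 <= (\<Sum>i<2 ^ k. \<bar>Z (e k (Suc i)) w - Z (e k i) w\<bar> ^ 3)"
      by (rule member_le_sum[of i]) (use that in auto)
    moreover have "0 <= (\<Sum>i<2 ^ Suc k + 1. \<bar>Z (e (Suc k) i) w - Z (e k (i div 2)) w\<bar> ^ 3)" by (intro sum_nonneg) simp
    ultimately show "\<bar>Z (e k (Suc i)) w - Z (e k i) w\<bar> ^ 3 <= (\<Sum>i<2 ^ Suc k + 1. \<bar>Z (e (Suc k) i) w - Z (e k (i div 2)) w\<bar> ^ 3)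
      + (\<Sum>i<2 ^ k. \<bar>Z (e k (Suc i)) w - Z (e k i) w\<bar> ^ 3)" by linarith
  qed
  define h where "h = (%k::nat. sqrt (1/2) ^ k)"
  have h2: "(h k)\<^sup>2 = 1 / 2 ^ k" for k
  proof -
    have "(h k)\<^sup>2 = (sqrt (1/2) * sqrt (1/2)) ^ k" unfolding h_def power2_eq_square by (rule power_mult_distrib[symmetric])
    also have "sqrt (1/2) * sqrt (1/2) = (1/2 :: real)" by simp
    finally show ?thesis by (simp add: power_divide)
  qed
  have h0: "h k > 0" for k by (simp add: h_def)
  have min_lip: "\<bar>min 1 x - min 1 y\<bar> <= \<bar>x - y :: real\<bar>" for x y by (auto simp: min_def)
  have close1: "\<bar>\<tau> (e (Suc k) i) - \<tau> (e k (i div 2))\<bar> <= 1 / 2 ^ k" for k i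
  proof -
    have "2 * real (i div 2) <= real i" "real i <= 2 * real (i div 2) + 1" by linarith+
    then have d1: "\<bar>real i - 2 * real (i div 2)\<bar> <= 1" by linarith
    have "real i / 2 ^ Suc k - real (i div 2) / 2 ^ k = (real i - 2 * real (i div 2)) / 2 ^ Suc k" by (simp add: field_simps)
    then have "\<bar>real i / 2 ^ Suc k - real (i div 2) / 2 ^ k\<bar> = \<bar>real i - 2 * real (i div 2)\<bar> / 2 ^ Suc k" by simp
    also have "... <= 1 / 2 ^ Suc k" using d1 by (intro divide_right_mono) auto
    also have "... <= 1 / 2 ^ k" by (simp add: field_simps)
    finally show ?thesis unfolding \<tau>e using min_lip order_trans by blast
  qed
  have close2: "\<bar>\<tau> (e k (Suc i)) - \<tau> (e k i)\<bar> <= 1 / 2 ^ k" for k i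
  proof -
    have "real (Suc i) / 2 ^ k - real i / 2 ^ k = 1 / 2 ^ k" by (simp add: diff_divide_distrib[symmetric])
    then have "\<bar>real (Suc i) / 2 ^ k - real i / 2 ^ k\<bar> <= 1 / 2 ^ k" by simp
    then show ?thesis unfolding \<tau>e using min_lip order_trans by blast
  qed
  have dm': "integrable normal_seq (%w. \<bar>Z p w - Z q w\<bar> ^ 3)" "NS.expectation (%w. \<bar>Z p w - Z q w\<bar> ^ 3) <= 2 * (sqrt C * h k) ^ 3"
    if "\<bar>\<tau> p - \<tau> q\<bar> <= 1 / 2 ^ k" for p q k
  proof -
    have "C * \<bar>\<tau> p - \<tau> q\<bar> <= C * (h k)\<^sup>2" using that C unfolding h2 by (intro mult_left_mono) auto
    then have "C * \<bar>\<tau> p - \<tau> q\<bar> <= (sqrt C * h k)\<^sup>2" using C by (simp add: power_mult_distrib)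
    then show "integrable normal_seq (%w. \<bar>Z p w - Z q w\<bar> ^ 3)" "NS.expectation (%w. \<bar>Z p w - Z q w\<bar> ^ 3) <= 2 * (sqrt C * h k) ^ 3"
      using dm[of "sqrt C * h k" p q] C h0[of k] by auto
  qed
  have iD: "integrable normal_seq (D k)" for k
    unfolding D_def
    by (intro Bochner_Integration.integrable_add Bochner_Integration.integrable_divide Bochner_Integration.integrable_sum dm'(1)[OF close1] dm'(1)[OF close2]) auto
  have ED: "NS.expectation (D k) <= (1 + 8 * sqrt C ^ 3) * (9/10) ^ k" for k
  proof -
    define E where "E = 2 * (sqrt C * h k) ^ 3"
    have E0: "E >= 0" using C h0[of k] by (simp add: E_def)
    have "NS.expectation (D k) = (9/10) ^ k + ((\<Sum>i<2 ^ Suc k + 1. NS.expectation (%w. \<bar>Z (e (Suc k) i) w - Z (e k (i div 2)) w\<bar> ^ 3))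
      + (\<Sum>i<2 ^ k. NS.expectation (%w. \<bar>Z (e k (Suc i)) w - Z (e k i) w\<bar> ^ 3))) / ((9/10) ^ k)\<^sup>2"
    proof -
      have i1: "integrable normal_seq (%w. \<Sum>i<2 ^ Suc k + 1. \<bar>Z (e (Suc k) i) w - Z (e k (i div 2)) w\<bar> ^ 3)"
        by (intro Bochner_Integration.integrable_sum dm'(1)[OF close1])
      have i2: "integrable normal_seq (%w. \<Sum>i<2 ^ k. \<bar>Z (e k (Suc i)) w - Z (e k i) w\<bar> ^ 3)"
        by (intro Bochner_Integration.integrable_sum dm'(1)[OF close2])
      have s1: "NS.expectation (%w. \<Sum>i<2 ^ Suc k + 1. \<bar>Z (e (Suc k) i) w - Z (e k (i div 2)) w\<bar> ^ 3) = (\<Sum>i<2 ^ Suc k + 1. NS.expectation (%w. \<bar>Z (e (Suc k) i) w - Z (e k (i div 2)) w\<bar> ^ 3))"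
        by (rule Bochner_Integration.integral_sum) (rule dm'(1)[OF close1])
      have s2: "NS.expectation (%w. \<Sum>i<2 ^ k. \<bar>Z (e k (Suc i)) w - Z (e k i) w\<bar> ^ 3) = (\<Sum>i<2 ^ k. NS.expectation (%w. \<bar>Z (e k (Suc i)) w - Z (e k i) w\<bar> ^ 3))"
        by (rule Bochner_Integration.integral_sum) (rule dm'(1)[OF close2])
      show ?thesis unfolding D_def using i1 i2 s1 s2 NS.prob_space by simp
    qed
    also have "... <= (9/10) ^ k + ((\<Sum>i<(2::nat) ^ Suc k + 1. E) + (\<Sum>i<(2::nat) ^ k. E)) / ((9/10) ^ k)\<^sup>2"
      unfolding E_def by (intro add_left_mono divide_right_mono add_mono sum_mono dm'(2)[OF close1] dm'(2)[OF close2]) auto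
    also have "... <= (9/10) ^ k + (4 * 2 ^ k * E) / ((9/10) ^ k)\<^sup>2"
    proof (intro add_left_mono divide_right_mono)
      have "(1::real) <= 2 ^ k" by simp
      then have "(2 ^ Suc k + 1 + 2 ^ k) * E <= (4 * 2 ^ k) * E" using E0 by (intro mult_right_mono) auto
      then show "(\<Sum>i<(2::nat) ^ Suc k + 1. E) + (\<Sum>i<(2::nat) ^ k. E) <= 4 * 2 ^ k * E" by (simp add: algebra_simps)
    qed simp
    also have "4 * 2 ^ k * E = 8 * sqrt C ^ 3 * h k * (2 ^ k * (h k)\<^sup>2)"
      by (simp add: E_def power_mult_distrib power3_eq_cube power2_eq_square)
    also have "2 ^ k * (h k)\<^sup>2 = 1" by (simp add: h2)
    also have "(9/10) ^ k + 8 * sqrt C ^ 3 * h k * 1 / ((9/10) ^ k)\<^sup>2 <= (9/10) ^ k + 8 * sqrt C ^ 3 * (9/10) ^ k"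
    proof -
      have "sqrt (1/2) <= sqrt ((9/10)^3 * (9/10)^3 :: real)" by (rule real_sqrt_le_mono) (simp add: power3_eq_cube)
      also have "... = (9/10) ^ 3" by (simp only: real_sqrt_abs2) simp
      finally have "h k <= ((9/10) ^ 3) ^ k" unfolding h_def by (rule power_mono) simp
      also have "... = ((9/10) ^ k) ^ 3" by (simp only: power_mult[symmetric] mult.commute)
      also have "... = (9/10) ^ k * ((9/10) ^ k)\<^sup>2" by (simp only: power3_eq_cube power2_eq_square mult.assoc)
      finally have "h k / ((9/10) ^ k)\<^sup>2 <= (9/10) ^ k" by (simp add: divide_le_eq)
      then have "8 * sqrt C ^ 3 * (h k / ((9/10) ^ k)\<^sup>2) <= 8 * sqrt C ^ 3 * (9/10) ^ k" using C by (intro mult_left_mono) auto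
      then show ?thesis by simp
    qed
    finally show ?thesis by (simp add: algebra_simps)
  qed
  have sED: "summable (%k. NS.expectation (D k))"
  proof (rule summable_comparison_test'[of "%k. (1 + 8 * sqrt C ^ 3) * (9/10) ^ k" 0])
    show "summable (%k. (1 + 8 * sqrt C ^ 3) * (9/10 :: real) ^ k)" by (intro summable_mult summable_geometric) simp
    show "norm (NS.expectation (D k)) <= (1 + 8 * sqrt C ^ 3) * (9/10) ^ k" for k
      using ED[of k] D0 by (simp add: abs_of_nonneg)
  qed
  have Dm[measurable]: "D k \<in> borel_measurable normal_seq" for k using iD by auto
  \<comment> \<open>On the null set where the majorants fail to be summable the process is set to 0,
    so that every path is continuous and not only almost every one.\<close>
  define good where "good = (%w. (\<Sum>k. ennreal (D k w)) \<noteq> \<infinity>)"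
  have goodm[measurable]: "Measurable.pred normal_seq good" unfolding good_def by measurable
  have AEgood: "AE w in normal_seq. good w" unfolding good_def by (rule NS.AE_summable[OF iD D0 sED])
  have goodS: "summable (%k. D k w)" if "good w" for w
    using that D0 unfolding good_def by (intro summable_suminf_not_top) auto
  \<comment> \<open>Clamping freezes the process outside the unit interval, which gives paths
    continuous on the whole line.\<close>
  define z where "z = (%t k w. Z (e k (nat \<lfloor>2 ^ k * clamp01 t\<rfloor>)) w)"
  have zm[measurable]: "z t k \<in> borel_measurable normal_seq" for t k unfolding z_def by measurable
  have grid: "nat \<lfloor>2 ^ k * clamp01 t\<rfloor> <= 2 ^ k" for k t
  proof -
    have "2 ^ k * clamp01 t <= 2 ^ k * 1" by (intro mult_left_mono) auto
    then have "\<lfloor>2 ^ k * clamp01 t\<rfloor> <= \<lfloor>of_int (2 ^ k) :: real\<rfloor>" by (intro floor_mono) simp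
    then show ?thesis by (simp only: floor_of_int) (simp add: nat_le_iff)
  qed
  have zstep: "\<bar>z t (Suc k) w - z t k w\<bar> <= D k w" for t k w
  proof -
    have "nat \<lfloor>2 ^ Suc k * clamp01 t\<rfloor> div 2 = nat \<lfloor>2 ^ k * clamp01 t\<rfloor>"
      using nat_floor_double[of "2 ^ k * clamp01 t"] by (simp add: mult.assoc)
    then show ?thesis using D1[OF grid[of "Suc k" t], of w] unfolding z_def by simp
  qed
  define Y where "Y = (%t w. if good w then lim (%k. z t k w) else 0)"
  have Ym: "Y t \<in> borel_measurable normal_seq" for t
    unfolding Y_def by (intro measurable_If borel_measurable_lim_metric) auto
  define T where "T = (%w k. \<Sum>j. D (j + k) w)"
  have Ylim: "(%k. z t k w) \<longlonglongrightarrow> Y t w" "\<bar>Y t w - z t k w\<bar> <= T w k" if "good w" for t k w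
    using chain_limit[of "%k. z t k w" "%k. D k w", OF zstep goodS[OF that]] that by (auto simp: Y_def T_def)
  have Ycont: "continuous_on UNIV (%t. Y t w)" for w
  proof (cases "good w")
    case False then show ?thesis by (simp add: Y_def)
  next
    case True
    have sm: "summable (%k. D k w)" by (rule goodS[OF True])
    have "T w = (%k. (\<Sum>j. D j w) - (\<Sum>j<k. D j w))" unfolding T_def by (rule ext) (rule suminf_minus_initial_segment[OF sm])
    then have Tl: "T w \<longlonglongrightarrow> 0" using tendsto_diff[OF tendsto_const summable_LIMSEQ[OF sm], of "\<Sum>j. D j w"] by simp
    have lim0: "(%k. D k w + 2 * T w k) \<longlonglongrightarrow> 0 + 2 * 0" by (intro tendsto_add tendsto_mult tendsto_const Tl summable_LIMSEQ_zero[OF sm])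
    show ?thesis
      unfolding continuous_on_iff
    proof (intro ballI allI impI)
      fix t \<epsilon> :: real assume "\<epsilon> > 0"
      then have "\<forall>\<^sub>F k in sequentially. D k w + 2 * T w k < \<epsilon>" using lim0 by (intro order_tendstoD(2)) auto
      then obtain k where k: "D k w + 2 * T w k < \<epsilon>" using eventually_happens'[OF sequentially_bot] by blast
      show "\<exists>d>0. \<forall>x'\<in>UNIV. dist x' t < d --> dist (Y x' w) (Y t w) < \<epsilon>"
      proof (intro exI[of _ "1 / 2 ^ k"] conjI ballI impI)
        fix t' :: real assume "dist t' t < 1 / 2 ^ k"
        moreover have "\<bar>clamp01 t' - clamp01 t\<bar> <= \<bar>t' - t\<bar>" by (auto simp: max_def min_def)
        ultimately have "\<bar>clamp01 t' - clamp01 t\<bar> < 1 / 2 ^ k" unfolding dist_real_def by linarith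
        then have d: "\<bar>2 ^ k * clamp01 t' - 2 ^ k * clamp01 t\<bar> < 1"
          unfolding right_diff_distrib[symmetric] abs_mult by (simp add: field_simps)
        have adj: "\<bar>Z (e k i) w - Z (e k j) w\<bar> <= D k w" if "i <= Suc j" "j <= Suc i" "i <= 2 ^ k" "j <= 2 ^ k" for i j
        proof -
          have "i = j \<or> i = Suc j \<or> j = Suc i" using that(1,2) by arith
          then show ?thesis using D0 D2[of j k w] D2[of i k w] that(3,4) by (elim disjE) (auto simp: abs_minus_commute Suc_le_eq)
        qed
        have "\<bar>z t' k w - z t k w\<bar> <= D k w"
          unfolding z_def
        proof (rule adj[OF _ _ grid grid])
          show "nat \<lfloor>2 ^ k * clamp01 t'\<rfloor> <= Suc (nat \<lfloor>2 ^ k * clamp01 t\<rfloor>)" "nat \<lfloor>2 ^ k * clamp01 t\<rfloor> <= Suc (nat \<lfloor>2 ^ k * clamp01 t'\<rfloor>)"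
            using d by (auto intro!: nat_floor_near simp: abs_less_iff)
        qed
        then have "\<bar>Y t' w - Y t w\<bar> <= D k w + 2 * T w k"
          using Ylim(2)[OF True, of t k] Ylim(2)[OF True, of t' k] by linarith
        then show "dist (Y t' w) (Y t w) < \<epsilon>" using k by (simp add: dist_real_def)
      qed simp
    qed
  qed
  have AElim: "AE w in normal_seq. \<forall>t. (%k. z t k w) \<longlonglongrightarrow> Y t w"
    using AEgood by (rule eventually_mono) (use Ylim(1) in blast)
  \<comment> \<open>Joint laws are known at dyadic times only. They pass to arbitrary times because
    the covariance is continuous and the approximations converge almost surely.\<close>
  define tk where "tk = (%t k. \<tau> (e k (nat \<lfloor>2 ^ k * clamp01 t\<rfloor>)))"
  have tkl: "(%k. tk t k) \<longlonglongrightarrow> t" if t: "t \<in> {0..1}" for t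
  proof (rule LIMSEQ_I)
    fix r :: real assume "r > 0"
    then obtain n where n: "(1/2::real) ^ n < r" using real_arch_pow_inv[of r "1/2"] by auto
    have ct: "clamp01 t = t" using t by auto
    show "\<exists>no. \<forall>k\<ge>no. norm (tk t k - t) < r"
    proof (intro exI[of _ n] allI impI)
      fix k assume k: "n <= k"
      let ?s = "real (nat \<lfloor>2 ^ k * t\<rfloor>)"
      have fl: "?s = of_int \<lfloor>2 ^ k * t\<rfloor>" using t by simp
      have "?s <= 2 ^ k * t" "2 ^ k * t < ?s + 1" unfolding fl by linarith+
      then have "?s / 2 ^ k <= t" "t < (?s + 1) / 2 ^ k" by (simp_all add: pos_less_divide_eq pos_divide_le_eq mult.commute)
      then have "?s / 2 ^ k <= t" "t - ?s / 2 ^ k < 1 / 2 ^ k" by (simp_all add: add_divide_distrib)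
      moreover have "(1::real) / 2 ^ k <= (1/2) ^ n" using power_decreasing[OF k, of "1/2::real"] by (simp add: power_divide)
      moreover have "tk t k = ?s / 2 ^ k" unfolding tk_def \<tau>e ct using \<open>?s / 2 ^ k <= t\<close> t by (intro min_absorb2) (meson atLeastAtMost_iff order_trans)
      ultimately show "norm (tk t k - t) < r" using n unfolding real_norm_def by linarith
    qed
  qed
  have tkI: "tk t k \<in> {0..1}" for t k unfolding tk_def by (rule \<tau>I)
  have bl: "(%k. b (tk t k) (tk s k)) \<longlonglongrightarrow> b t s" if ts: "t \<in> {0..1}" "s \<in> {0..1}" for t s
  proof -
    have sq: "(%k. C * sqrt \<bar>tk t k - t\<bar>) \<longlonglongrightarrow> 0" if "t \<in> {0..1}" for t
    proof -
      have "(%k. C * sqrt \<bar>tk t k - t\<bar>) \<longlonglongrightarrow> C * sqrt \<bar>t - t\<bar>" by (intro tendsto_intros tkl that)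
      then show ?thesis by simp
    qed
    have "(%k. b (tk t k) (tk s k) - b t s) \<longlonglongrightarrow> 0"
    proof (rule Lim_null_comparison)
      show "\<forall>\<^sub>F k in sequentially. norm (b (tk t k) (tk s k) - b t s) <= C * sqrt \<bar>tk t k - t\<bar> + C * sqrt \<bar>tk s k - s\<bar>"
      proof (rule always_eventually, rule allI)
        fix k
        have "\<bar>b (tk t k) (tk s k) - b t (tk s k)\<bar> <= C * sqrt \<bar>tk t k - t\<bar>" by (rule cont[OF tkI tkI ts(1)])
        moreover have "\<bar>b (tk s k) t - b s t\<bar> <= C * sqrt \<bar>tk s k - s\<bar>" by (rule cont[OF ts(1) tkI ts(2)])
        ultimately show "norm (b (tk t k) (tk s k) - b t s) <= C * sqrt \<bar>tk t k - t\<bar> + C * sqrt \<bar>tk s k - s\<bar>"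
          using sym[OF ts] sym[OF ts(1) tkI[of s k]] unfolding real_norm_def by linarith
      qed
      show "(%k. C * sqrt \<bar>tk t k - t\<bar> + C * sqrt \<bar>tk s k - s\<bar>) \<longlonglongrightarrow> 0"
        using tendsto_add[OF sq[OF ts(1)] sq[OF ts(2)]] by simp
    qed
    then show ?thesis by (simp add: LIM_zero_iff)
  qed
  have AEl2: "AE w in normal_seq. (%k. \<Sum>i<n. u i * z (ts i) k w) \<longlonglongrightarrow> (\<Sum>i<n. u i * Y (ts i) w)" for n :: nat and u ts
    using AElim by (rule eventually_mono) (auto intro!: tendsto_sum tendsto_mult)
  show ?thesis
  proof (rule that[OF Ym Ycont])
    fix n and ts u :: "nat => real" assume ts: "!!i. i < n ==> ts i \<in> {0..1}"
    have "(%k. \<integral>w. cos (\<Sum>i<n. u i * z (ts i) k w) \<partial>normal_seq) \<longlonglongrightarrow> (\<integral>w. cos (\<Sum>i<n. u i * Y (ts i) w) \<partial>normal_seq)"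
    proof (rule integral_dominated_convergence[where w="%_. 1"])
      show "AE w in normal_seq. (%k. cos (\<Sum>i<n. u i * z (ts i) k w)) \<longlonglongrightarrow> cos (\<Sum>i<n. u i * Y (ts i) w)"
        by (rule eventually_mono[OF AEl2]) (rule tendsto_cos)
    qed (use Ym in auto)
    moreover have "(%k. \<integral>w. cos (\<Sum>i<n. u i * z (ts i) k w) \<partial>normal_seq) \<longlonglongrightarrow> exp (- (\<Sum>i<n. \<Sum>j<n. u i * u j * b (ts i) (ts j)) / 2)"
    proof -
      have "(\<integral>w. cos (\<Sum>i<n. u i * z (ts i) k w) \<partial>normal_seq) = exp (- (\<Sum>i<n. \<Sum>j<n. u i * u j * b (tk (ts i) k) (tk (ts j) k)) / 2)" for k
        using Zc[of u "%i. e k (nat \<lfloor>2 ^ k * clamp01 (ts i)\<rfloor>)" n] by (simp add: z_def B_def tk_def)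
      moreover have "(%k. exp (- (\<Sum>i<n. \<Sum>j<n. u i * u j * b (tk (ts i) k) (tk (ts j) k)) / 2)) \<longlonglongrightarrow> exp (- (\<Sum>i<n. \<Sum>j<n. u i * u j * b (ts i) (ts j)) / 2)"
        by (intro tendsto_intros bl) (use ts in auto)
      ultimately show ?thesis by simp
    qed
    ultimately show "(\<integral>w. cos (\<Sum>i<n. u i * Y (ts i) w) \<partial>normal_seq) = exp (- (\<Sum>i<n. \<Sum>j<n. u i * u j * b (ts i) (ts j)) / 2)"
      by (rule LIMSEQ_unique)
  next
    fix n and ts u :: "nat => real" assume ts: "!!i. i < n ==> ts i \<in> {0..1}"
    have "(%k. \<integral>w. sin (\<Sum>i<n. u i * z (ts i) k w) \<partial>normal_seq) \<longlonglongrightarrow> (\<integral>w. sin (\<Sum>i<n. u i * Y (ts i) w) \<partial>normal_seq)"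
    proof (rule integral_dominated_convergence[where w="%_. 1"])
      show "AE w in normal_seq. (%k. sin (\<Sum>i<n. u i * z (ts i) k w)) \<longlonglongrightarrow> sin (\<Sum>i<n. u i * Y (ts i) w)"
        by (rule eventually_mono[OF AEl2]) (rule tendsto_sin)
    qed (use Ym in auto)
    moreover have "(\<integral>w. sin (\<Sum>i<n. u i * z (ts i) k w) \<partial>normal_seq) = 0" for k
      using Zs[of u "%i. e k (nat \<lfloor>2 ^ k * clamp01 (ts i)\<rfloor>)" n] by (simp add: z_def)
    ultimately show "(\<integral>w. sin (\<Sum>i<n. u i * Y (ts i) w) \<partial>normal_seq) = 0"
      using LIMSEQ_unique[OF tendsto_const] by fastforce
  qed
qed

section \<open>A functional central limit theorem for triangular arrays\<close>

lemma nat_floor_le: "x >= 0 ==> real (nat \<lfloor>x\<rfloor>) <= x" by simp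
lemma nat_floor_gt: "x < real (nat \<lfloor>x\<rfloor>) + 1" by linarith

text \<open>What the functional limit theorem asks of an array. The moment bound must hold for every
  finite index set, since chaining applies it to all dyadic increments. The trigonometric moments
  are compared with the normal ones of the actual variance, which is identified only afterwards
  through \<open>cov\<close>. Means need not vanish but have to be negligible in total.\<close>

locale clt_array = prob_space M for M :: "'a measure" +
  fixes X :: "nat => nat => 'a => real" and C :: real and b :: "real => real => real"
  assumes Xi: "!!N n. integrable M (X N n)" and C0: "C > 0"
    and mom: "!!N I. N >= 1 ==> finite I ==> Lpb 3 (C * sqrt (card I)) (%w. \<Sum>n\<in>I. (X N n w - expectation (X N n)))"
    and mean: "(%N. (\<Sum>n\<in>{1..N}. \<bar>expectation (X N n)\<bar>) / sqrt N) \<longlonglongrightarrow> 0"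
    and trig: "!!(m::nat) ts u. (!!i. i < m ==> ts i \<in> {0..1}) ==>
       (%N. expectation (%w. cos (\<Sum>i<m. u i * (1 / sqrt N * (\<Sum>n\<in>{1..nat \<lfloor>real N * ts i\<rfloor>}. X N n w - expectation (X N n)))))
         - exp (- expectation (%w. (\<Sum>i<m. u i * (1 / sqrt N * (\<Sum>n\<in>{1..nat \<lfloor>real N * ts i\<rfloor>}. X N n w - expectation (X N n))))\<^sup>2) / 2)) \<longlonglongrightarrow> 0"
       "!!(m::nat) ts u. (!!i. i < m ==> ts i \<in> {0..1}) ==>
       (%N. expectation (%w. sin (\<Sum>i<m. u i * (1 / sqrt N * (\<Sum>n\<in>{1..nat \<lfloor>real N * ts i\<rfloor>}. X N n w - expectation (X N n)))))) \<longlonglongrightarrow> 0"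
    and cov: "!!t s. t \<in> {0..1} ==> s \<in> {0..1} ==>
       (%N. expectation (%w. (1 / sqrt N * (\<Sum>n\<in>{1..nat \<lfloor>real N * t\<rfloor>}. X N n w)) * (1 / sqrt N * (\<Sum>n\<in>{1..nat \<lfloor>real N * s\<rfloor>}. X N n w)))) \<longlonglongrightarrow> b t s"
begin

text \<open>\<open>P\<close> and \<open>S\<close> are centred, \<open>Q\<close> and \<open>U\<close>
  are not: moment bounds are available for the former, while the assumed covariances and the
  conclusion concern the latter. \<open>ex\<close> is the deterministic difference.\<close>

definition P :: "nat => nat => 'a => real" where
  "P N j w = 1 / sqrt N * (\<Sum>n\<in>{1..j}. X N n w - expectation (X N n))"

definition Q :: "nat => nat => 'a => real" where
  "Q N j w = 1 / sqrt N * (\<Sum>n\<in>{1..j}. X N n w)"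

definition S :: "nat => real => 'a => real" where "S N t = P N (nat \<lfloor>real N * t\<rfloor>)"
definition U :: "nat => real => 'a => real" where "U N t = Q N (nat \<lfloor>real N * t\<rfloor>)"
definition ex :: "nat => nat => real" where "ex N j = 1 / sqrt N * (\<Sum>n\<in>{1..j}. expectation (X N n))"
definition \<mu> :: "nat => real" where "\<mu> N = (\<Sum>n\<in>{1..N}. \<bar>expectation (X N n)\<bar>) / sqrt N"

lemma X_meas[measurable]: "X N n \<in> borel_measurable M" using Xi by auto
lemma P_meas[measurable]: "P N j \<in> borel_measurable M" unfolding P_def by measurable
lemma Q_meas[measurable]: "Q N j \<in> borel_measurable M" unfolding Q_def by measurable
lemma S_meas[measurable]: "S N t \<in> borel_measurable M" unfolding S_def by measurable
lemma U_meas[measurable]: "U N t \<in> borel_measurable M" unfolding U_def by measurable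

lemma QP: "Q N j w = P N j w + ex N j"
  by (simp add: Q_def P_def ex_def sum_subtractf algebra_simps)

lemma ex_bound: "j <= N ==> \<bar>ex N j\<bar> <= \<mu> N"
proof -
  assume j: "j <= N"
  have "\<bar>\<Sum>n\<in>{1..j}. expectation (X N n)\<bar> <= (\<Sum>n\<in>{1..j}. \<bar>expectation (X N n)\<bar>)" by (rule sum_abs)
  also have "... <= (\<Sum>n\<in>{1..N}. \<bar>expectation (X N n)\<bar>)" by (rule sum_mono2) (use j in auto)
  finally show ?thesis by (simp add: ex_def \<mu>_def abs_mult divide_right_mono)
qed

lemma grid_N: "t \<in> {0..1} ==> nat \<lfloor>real N * t\<rfloor> <= N"
  using grid_index[of t "real N"] by simp

lemma P_diff:
  assumes "N >= 1" "i <= j" shows "Lpb 3 (C * sqrt (real (j - i) / N)) (%w. P N j w - P N i w)"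
proof -
  have "{1..j} - {1..i} = {Suc i..j}" by auto
  then have e: "P N j w - P N i w = 1 / sqrt N * (\<Sum>n\<in>{Suc i..j}. X N n w - expectation (X N n))" for w
  proof -
    have "(\<Sum>n\<in>{1..j}. X N n w - expectation (X N n)) - (\<Sum>n\<in>{1..i}. X N n w - expectation (X N n)) = (\<Sum>n\<in>{1..j} - {1..i}. X N n w - expectation (X N n))"
      by (rule sum_diff[symmetric]) (use assms in auto)
    then show ?thesis unfolding P_def right_diff_distrib[symmetric] \<open>{1..j} - {1..i} = {Suc i..j}\<close> by simp
  qed
  have "Lpb 3 (C * sqrt (card {Suc i..j})) (%w. \<Sum>n\<in>{Suc i..j}. X N n w - expectation (X N n))" by (rule mom) (use assms in auto)
  from Lpb_scale[OF this, of "1 / sqrt N"] show ?thesis unfolding e by (simp add: real_sqrt_divide mult_ac)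
qed

lemma P_L3: "N >= 1 ==> j <= N ==> Lpb 3 C (P N j)"
proof -
  assume a: "N >= 1" "j <= N"
  have "P N 0 w = 0" for w by (simp add: P_def)
  then have "Lpb 3 (C * sqrt (real (j - 0) / N)) (P N j)" using P_diff[OF a(1), of 0 j] by simp
  moreover have "sqrt (real (j - 0) / N) <= 1" using a by simp
  ultimately show ?thesis using C0 by (elim Lpb_weaken) auto
qed

lemma S_L2: "N >= 1 ==> t \<in> {0..1} ==> Lpb 2 C (S N t)"
  unfolding S_def by (rule Lpb_lower[OF P_L3]) (use grid_N in auto)

lemma S_diff: assumes "N >= 1" "s \<in> {0..1}" "t \<in> {0..1}"
  shows "Lpb 2 (C * sqrt (\<bar>t - s\<bar> + 1 / N)) (%w. S N t w - S N s w)"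
proof -
  have *: "Lpb 2 (C * sqrt (\<bar>t - s\<bar> + 1 / N)) (%w. S N t w - S N s w)" if st: "s <= t" "s \<in> {0..1}" "t \<in> {0..1}" for s t
  proof -
    let ?i = "nat \<lfloor>real N * s\<rfloor>" and ?j = "nat \<lfloor>real N * t\<rfloor>"
    have ij: "?i <= ?j" using st by (intro nat_mono floor_mono mult_left_mono) auto
    have "real ?j <= N * t" "N * s < real ?i + 1" using st nat_floor_le nat_floor_gt by auto
    then have "real (?j - ?i) <= N * (t - s) + 1" using ij by (simp add: of_nat_diff algebra_simps)
    then have "real (?j - ?i) / N <= \<bar>t - s\<bar> + 1 / N" using assms(1) st by (simp add: field_simps)
    then have "C * sqrt (real (?j - ?i) / N) <= C * sqrt (\<bar>t - s\<bar> + 1 / N)" using C0 by simp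
    then show ?thesis unfolding S_def
      by (intro Lpb_lower[OF Lpb_weaken[OF P_diff[OF assms(1) ij]]]) auto
  qed
  show ?thesis
  proof (cases "s <= t")
    case True then show ?thesis using * assms by simp
  next
    case False
    then have "Lpb 2 (C * sqrt (\<bar>s - t\<bar> + 1 / N)) (%w. S N s w - S N t w)" using * assms by simp
    from Lpb_uminus[OF this] show ?thesis by (simp add: abs_minus_commute)
  qed
qed

lemma ES0: "expectation (S N t) = 0"
  unfolding S_def P_def using Xi by (simp add: prob_space)

lemma iSS: "N >= 1 ==> t \<in> {0..1} ==> s \<in> {0..1} ==> integrable M (%w. S N t w * S N s w)"
  by (rule Lpb_prod2(1)[OF S_L2 S_L2]) auto

lemma iS: "integrable M (S N t)" unfolding S_def P_def using Xi by auto

lemma exl: "t \<in> {0..1} ==> (%N. ex N (nat \<lfloor>real N * t\<rfloor>)) \<longlonglongrightarrow> 0"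
proof (rule Lim_null_comparison)
  assume t: "t \<in> {0..1}"
  show "\<forall>\<^sub>F N in sequentially. norm (ex N (nat \<lfloor>real N * t\<rfloor>)) <= \<mu> N"
    unfolding real_norm_def by (intro always_eventually allI ex_bound grid_N t)
  show "\<mu> \<longlonglongrightarrow> 0" unfolding \<mu>_def[abs_def] by (rule mean)
qed

lemma covS: assumes ts: "t \<in> {0..1}" "s \<in> {0..1}"
  shows "(%N. expectation (%w. S N t w * S N s w)) \<longlonglongrightarrow> b t s"
proof -
  have "(%N. expectation (%w. U N t w * U N s w) - ex N (nat \<lfloor>real N * t\<rfloor>) * ex N (nat \<lfloor>real N * s\<rfloor>)) \<longlonglongrightarrow> b t s - 0 * 0"
    using cov[OF ts] unfolding U_def Q_def by (intro tendsto_diff tendsto_mult exl ts) simp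
  moreover have "\<forall>\<^sub>F N in sequentially. expectation (%w. U N t w * U N s w) - ex N (nat \<lfloor>real N * t\<rfloor>) * ex N (nat \<lfloor>real N * s\<rfloor>) = expectation (%w. S N t w * S N s w)"
    using eventually_ge_at_top[of "1::nat"]
  proof eventually_elim
    case (elim N)
    have "U N t w * U N s w = S N t w * S N s w + (ex N (nat \<lfloor>real N * s\<rfloor>) * S N t w + ex N (nat \<lfloor>real N * t\<rfloor>) * S N s w) + ex N (nat \<lfloor>real N * t\<rfloor>) * ex N (nat \<lfloor>real N * s\<rfloor>)" for w
      unfolding U_def QP S_def by (simp add: algebra_simps)
    then show ?case using iSS[OF elim ts] iS[of N t] iS[of N s] by (simp add: ES0 prob_space)
  qed
  ultimately show ?thesis by (simp add: tendsto_cong)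
qed

lemma b_sym: "t \<in> {0..1} ==> s \<in> {0..1} ==> b t s = b s t"
  using LIMSEQ_unique[OF covS[of t s]] covS[of s t] by (simp add: mult.commute)

lemma comb_var:
  fixes m :: nat assumes ts: "!!i. i < m ==> ts i \<in> {0..1}"
  shows "(%N. expectation (%w. (\<Sum>i<m. u i * S N (ts i) w)\<^sup>2)) \<longlonglongrightarrow> (\<Sum>i<m. \<Sum>j<m. u i * u j * b (ts i) (ts j))"
proof -
  have "(%N. \<Sum>i<m. \<Sum>j<m. u i * u j * expectation (%w. S N (ts i) w * S N (ts j) w)) \<longlonglongrightarrow> (\<Sum>i<m. \<Sum>j<m. u i * u j * b (ts i) (ts j))"
    by (intro tendsto_sum tendsto_mult tendsto_const covS ts) auto
  moreover have "\<forall>\<^sub>F N in sequentially. (\<Sum>i<m. \<Sum>j<m. u i * u j * expectation (%w. S N (ts i) w * S N (ts j) w)) = expectation (%w. (\<Sum>i<m. u i * S N (ts i) w)\<^sup>2)"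
    using eventually_ge_at_top[of "1::nat"]
  proof eventually_elim
    case (elim N)
    have "expectation (%w. (\<Sum>i<m. u i * S N (ts i) w)\<^sup>2) = expectation (%w. \<Sum>i<m. \<Sum>j<m. u i * u j * (S N (ts i) w * S N (ts j) w))"
      by (intro Bochner_Integration.integral_cong refl) (simp add: power2_eq_square sum_product mult_ac)
    also have "... = (\<Sum>i<m. expectation (%w. \<Sum>j<m. u i * u j * (S N (ts i) w * S N (ts j) w)))"
      by (rule Bochner_Integration.integral_sum) (intro Bochner_Integration.integrable_sum integrable_mult_right iSS elim ts; simp)
    also have "... = (\<Sum>i<m. \<Sum>j<m. expectation (%w. u i * u j * (S N (ts i) w * S N (ts j) w)))"
      by (intro sum.cong refl Bochner_Integration.integral_sum integrable_mult_right iSS elim ts) simp_all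
    finally show ?case by simp
  qed
  ultimately show ?thesis by (simp add: tendsto_cong)
qed

lemma b_pos: fixes m :: nat assumes "!!i. i < m ==> ts i \<in> {0..1}" shows "0 <= (\<Sum>i<m. \<Sum>j<m. u i * u j * b (ts i) (ts j))"
  by (rule LIMSEQ_le_const[OF comb_var[OF assms]]) auto

lemma sqrt_lim: "(%N::nat. c * sqrt (d + 1 / real N)) \<longlonglongrightarrow> c * sqrt d"
proof -
  have "(%N::nat. c * sqrt (d + 1 / real N)) \<longlonglongrightarrow> c * sqrt (d + 0)"
    by (intro tendsto_intros lim_1_over_n)
  then show ?thesis by simp
qed

text \<open>Rounding times to multiples of \<open>1 / N\<close> spoils the increment bound by
  \<open>1 / N\<close>, which disappears in the limit. The limiting covariance thus has the
  regularity needed for a process with continuous paths.\<close>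

lemma b_inc: assumes st: "s \<in> {0..1}" "t \<in> {0..1}"
  shows "b t t - 2 * b t s + b s s <= C\<^sup>2 * \<bar>t - s\<bar>"
proof -
  have l: "(%N. expectation (%w. S N t w * S N t w) - 2 * expectation (%w. S N t w * S N s w) + expectation (%w. S N s w * S N s w))
     \<longlonglongrightarrow> b t t - 2 * b t s + b s s" by (intro tendsto_intros covS st)
  have r: "(%N::nat. C\<^sup>2 * (\<bar>t - s\<bar> + 1 / N)) \<longlonglongrightarrow> C\<^sup>2 * (\<bar>t - s\<bar> + 0)" by (intro tendsto_intros lim_1_over_n)
  have "expectation (%w. S N t w * S N t w) - 2 * expectation (%w. S N t w * S N s w) + expectation (%w. S N s w * S N s w) <= C\<^sup>2 * (\<bar>t - s\<bar> + 1 / N)"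
    if N: "N >= 1" for N
  proof -
    have "expectation (%w. \<bar>S N t w - S N s w\<bar> powr 2) <= (C * sqrt (\<bar>t - s\<bar> + 1 / N)) powr 2"
      using S_diff[OF N st] unfolding Lpb_def by blast
    also have "(C * sqrt (\<bar>t - s\<bar> + 1 / N)) powr 2 = C\<^sup>2 * (\<bar>t - s\<bar> + 1 / N)" using C0 by (simp add: power_mult_distrib)
    also have "(%w. \<bar>S N t w - S N s w\<bar> powr 2) = (%w. S N t w * S N t w - 2 * (S N t w * S N s w) + S N s w * S N s w)"
      by (rule ext) (simp add: power2_eq_square algebra_simps)
    also have "expectation (%w. S N t w * S N t w - 2 * (S N t w * S N s w) + S N s w * S N s w)
      = expectation (%w. S N t w * S N t w) - 2 * expectation (%w. S N t w * S N s w) + expectation (%w. S N s w * S N s w)"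
      using iSS[OF N st(2) st(2)] iSS[OF N st(2) st(1)] iSS[OF N st(1) st(1)] by simp
    finally show ?thesis .
  qed
  then show ?thesis using LIMSEQ_le[OF l r] by auto
qed

lemma b_cont: assumes st: "s \<in> {0..1}" "t \<in> {0..1}" "t' \<in> {0..1}"
  shows "\<bar>b t s - b t' s\<bar> <= C\<^sup>2 * sqrt \<bar>t - t'\<bar>"
proof -
  have l: "(%N. \<bar>expectation (%w. S N t w * S N s w) - expectation (%w. S N t' w * S N s w)\<bar>) \<longlonglongrightarrow> \<bar>b t s - b t' s\<bar>"
    by (intro tendsto_intros covS st)
  have "\<bar>expectation (%w. S N t w * S N s w) - expectation (%w. S N t' w * S N s w)\<bar> <= C\<^sup>2 * sqrt (\<bar>t - t'\<bar> + 1 / N)" if N: "N >= 1" for N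
  proof -
    note L = Lpb_prod2[OF S_diff[OF N st(3,2)] S_L2[OF N st(1)]]
    have "expectation (%w. S N t w * S N s w) - expectation (%w. S N t' w * S N s w) = expectation (%w. (S N t w - S N t' w) * S N s w)"
      unfolding left_diff_distrib by (rule Bochner_Integration.integral_diff[symmetric]) (rule iSS[OF N]; rule st)+
    also have "\<bar>...\<bar> <= C * sqrt (\<bar>t - t'\<bar> + 1 / N) * C" by (rule abs_expectation_le) (use L in auto)
    finally show ?thesis by (simp add: power2_eq_square mult_ac)
  qed
  then show ?thesis using LIMSEQ_le[OF l sqrt_lim] by auto
qed

text \<open>The centred combination is close to normal with its own variance, and that variance
  converges by \<open>comb_var\<close>. The drift is deterministic and tends to 0, so by the
  Lipschitz property it moves sine and cosine by a vanishing amount.\<close>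

lemma trig_limit:
  fixes m :: nat assumes ts: "!!i. i < m ==> ts i \<in> {0..1}"
  shows "(%N. expectation (%w. cos (\<Sum>i<m. u i * U N (ts i) w))) \<longlonglongrightarrow> exp (- (\<Sum>i<m. \<Sum>j<m. u i * u j * b (ts i) (ts j)) / 2)"
    "(%N. expectation (%w. sin (\<Sum>i<m. u i * U N (ts i) w))) \<longlonglongrightarrow> 0"
proof -
  let ?W = "%N w. \<Sum>i<m. u i * S N (ts i) w"
  define sh where "sh = (%N. \<Sum>i<m. u i * ex N (nat \<lfloor>real N * ts i\<rfloor>))"
  have shl: "sh \<longlonglongrightarrow> 0"
  proof -
    have "sh \<longlonglongrightarrow> (\<Sum>i<m. u i * 0)" unfolding sh_def by (intro tendsto_sum tendsto_mult tendsto_const exl ts) auto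
    then show ?thesis by simp
  qed
  have UW: "(\<Sum>i<m. u i * U N (ts i) w) = ?W N w + sh N" for N w
    by (simp add: U_def S_def QP sh_def sum.distrib distrib_left)
  have c: "(%N. expectation (%w. cos (?W N w))) \<longlonglongrightarrow> exp (- (\<Sum>i<m. \<Sum>j<m. u i * u j * b (ts i) (ts j)) / 2)"
  proof -
    have "(%N. exp (- expectation (%w. (?W N w)\<^sup>2) / 2)) \<longlonglongrightarrow> exp (- (\<Sum>i<m. \<Sum>j<m. u i * u j * b (ts i) (ts j)) / 2)"
      by (intro tendsto_intros comb_var ts) auto
    moreover have "(%N. expectation (%w. cos (?W N w)) - exp (- expectation (%w. (?W N w)\<^sup>2) / 2)) \<longlonglongrightarrow> 0"
      unfolding S_def P_def by (rule trig(1)) (rule ts)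
    ultimately show ?thesis using tendsto_add by fastforce
  qed
  have s: "(%N. expectation (%w. sin (?W N w))) \<longlonglongrightarrow> 0"
    unfolding S_def P_def by (rule trig(2)) (rule ts)
  have shift: "(%N. expectation (%w. f (?W N w + sh N)) - expectation (%w. f (?W N w))) \<longlonglongrightarrow> 0"
    if f: "!!x y. \<bar>f y - f x\<bar> <= \<bar>y - x\<bar>" "f \<in> borel_measurable borel" "!!x. \<bar>f x\<bar> <= 1" for f :: "real => real"
  proof (rule Lim_null_comparison)
    show "(%N. \<bar>sh N\<bar>) \<longlonglongrightarrow> 0" using tendsto_rabs[OF shl] by simp
    have "\<bar>expectation (%w. f (?W N w + sh N)) - expectation (%w. f (?W N w))\<bar> <= \<bar>sh N\<bar>" for N
    proof -
      note [measurable] = f(2)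
      have "expectation (%w. f (?W N w + sh N)) - expectation (%w. f (?W N w)) = expectation (%w. f (?W N w + sh N) - f (?W N w))"
        by (rule Bochner_Integration.integral_diff[symmetric]; rule integrable_bounded_by[where c=1]) (use f in auto)
      also have "\<bar>...\<bar> <= \<bar>sh N\<bar>"
      proof (rule expectation_abs_le)
        fix w show "\<bar>f (?W N w + sh N) - f (?W N w)\<bar> <= \<bar>sh N\<bar>" using f(1)[of "?W N w + sh N" "?W N w"] by simp
      qed
      finally show ?thesis .
    qed
    then show "\<forall>\<^sub>F N in sequentially. norm (expectation (%w. f (?W N w + sh N)) - expectation (%w. f (?W N w))) <= \<bar>sh N\<bar>" by simp
  qed
  show "(%N. expectation (%w. cos (\<Sum>i<m. u i * U N (ts i) w))) \<longlonglongrightarrow> exp (- (\<Sum>i<m. \<Sum>j<m. u i * u j * b (ts i) (ts j)) / 2)"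
    unfolding UW using tendsto_add[OF shift[of cos, OF cos_lipschitz] c] by simp
  show "(%N. expectation (%w. sin (\<Sum>i<m. u i * U N (ts i) w))) \<longlonglongrightarrow> 0"
    unfolding UW using tendsto_add[OF shift[of sin, OF sin_lipschitz] s] by simp
qed

subsection \<open>Uniform approximation by dyadic sampling\<close>

text \<open>The summation index that belongs to the dyadic time \<open>real i / 2 ^ k\<close>.
  \<open>DD\<close> is the chaining majorant built on these indices, with the same threshold ratio
  as for the limit process.\<close>

definition J :: "nat => nat => nat => nat" where "J N k i = nat \<lfloor>real N * (real i / 2 ^ k)\<rfloor>"
definition DD :: "nat => nat => 'a => real" where
  "DD N j w = (9/10) ^ j + (\<Sum>i<2 ^ Suc j + 1. \<bar>P N (J N (Suc j) i) w - P N (J N j (i div 2)) w\<bar> ^ 3) / ((9/10) ^ j)\<^sup>2"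
text \<open>Majorant for a single summation step, used below the finest dyadic scale. There are
  \<open>N\<close> steps with cubes of mean order \<open>N powr (- 3/2)\<close>; dividing by the
  squared threshold leaves \<open>N powr (- 1/4)\<close>. Any threshold exponent strictly between
  \<open>- 1/4\<close> and 0 would serve.\<close>

definition FF :: "nat => 'a => real" where
  "FF N w = real N powr (- 1/8) + (\<Sum>n\<in>{1..N}. \<bar>P N n w - P N (n - 1) w\<bar> ^ 3) / (real N powr (- 1/8))\<^sup>2"

lemma cube_powr: "\<bar>x\<bar> ^ 3 = \<bar>x :: real\<bar> powr 3"
  by (simp add: powr_numeral)

lemma P_diff3:
  assumes "N >= 1" "real j <= real i + B" "real i <= real j + B" "B >= 0"
  shows "integrable M (%w. \<bar>P N j w - P N i w\<bar> ^ 3)" "expectation (%w. \<bar>P N j w - P N i w\<bar> ^ 3) <= C ^ 3 * sqrt (B / N) ^ 3"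
proof -
  have "Lpb 3 (C * sqrt (B / N)) (%w. P N j w - P N i w)"
  proof (cases "i <= j")
    case True
    have "sqrt (real (j - i) / N) <= sqrt (B / N)" using True assms by (intro real_sqrt_le_mono divide_right_mono) (auto simp: of_nat_diff)
    then show ?thesis using P_diff[OF assms(1) True] C0 by (elim Lpb_weaken) auto
  next
    case False
    have "sqrt (real (i - j) / N) <= sqrt (B / N)" using False assms by (intro real_sqrt_le_mono divide_right_mono) (auto simp: of_nat_diff)
    then have "Lpb 3 (C * sqrt (B / N)) (%w. P N i w - P N j w)" using P_diff[OF assms(1) less_imp_le[OF not_le_imp_less[OF False]]] C0 by (elim Lpb_weaken) auto
    from Lpb_uminus[OF this] show ?thesis by simp
  qed
  then have "integrable M (%w. \<bar>P N j w - P N i w\<bar> powr 3)" "expectation (%w. \<bar>P N j w - P N i w\<bar> powr 3) <= (C * sqrt (B / N)) powr 3"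
    by (auto simp: Lpb_def)
  moreover have "(C * sqrt (B / N)) powr 3 = (C * sqrt (B / N)) ^ 3" using C0 assms by (intro powr_numeral) simp
  ultimately show "integrable M (%w. \<bar>P N j w - P N i w\<bar> ^ 3)" "expectation (%w. \<bar>P N j w - P N i w\<bar> ^ 3) <= C ^ 3 * sqrt (B / N) ^ 3"
    unfolding cube_powr by (simp_all add: power_mult_distrib)
qed

text \<open>Rounding both indices down may add 1 to their distance. As long as the finer mesh
  \<open>N / 2 ^ Suc j\<close> is at least 1, this extra step is absorbed by passing to
  \<open>N / 2 ^ j\<close>.\<close>

lemma J_close:
  assumes "2 ^ Suc j <= N"
  shows "real (J N (Suc j) i) <= real (J N j (i div 2)) + N / 2 ^ j" "real (J N j (i div 2)) <= real (J N (Suc j) i) + N / 2 ^ j"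
proof -
  have "2 * real (i div 2) <= real i" "real i <= 2 * real (i div 2) + 1" by linarith+
  then have "real N * (2 * real (i div 2)) <= real N * real i" "real N * real i <= real N * (2 * real (i div 2) + 1)" by (intro mult_left_mono; simp)+
  then have a: "real N * (real (i div 2) / 2 ^ j) <= real N * (real i / 2 ^ Suc j)" "real N * (real i / 2 ^ Suc j) <= real N * (real (i div 2) / 2 ^ j) + N / 2 ^ Suc j"
    by (simp_all add: field_simps)
  have "real (2 ^ Suc j) <= real N" using assms by (simp only: of_nat_le_iff)
  then have "1 <= N / 2 ^ Suc j" by (simp add: field_simps)
  then have b: "N / 2 ^ Suc j + 1 <= N / 2 ^ j" "0 <= N / 2 ^ Suc j" by (simp_all add: field_simps)
  have "\<forall>k i. real (J N k i) <= real N * (real i / 2 ^ k) \<and> real N * (real i / 2 ^ k) < real (J N k i) + 1"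
    unfolding J_def by (intro allI conjI nat_floor_le nat_floor_gt) simp
  note c = this[rule_format, of "Suc j" i] this[rule_format, of j "i div 2"]
  show "real (J N (Suc j) i) <= real (J N j (i div 2)) + N / 2 ^ j" using a b c by linarith
  show "real (J N j (i div 2)) <= real (J N (Suc j) i) + N / 2 ^ j" using a b c by linarith
qed

lemma DD_int: assumes "N >= 1" "2 ^ Suc j <= N"
  shows "integrable M (DD N j)" "expectation (DD N j) <= (1 + 3 * C ^ 3) * (9/10) ^ j"
proof -
  have N0: "real N > 0" using assms by simp
  have B: "sqrt (real N / 2 ^ j / N) = sqrt (1/2) ^ j"
    using N0 by (simp add: real_sqrt_power[symmetric] power_divide)
  have t: "integrable M (%w. \<bar>P N (J N (Suc j) i) w - P N (J N j (i div 2)) w\<bar> ^ 3)"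
     "expectation (%w. \<bar>P N (J N (Suc j) i) w - P N (J N j (i div 2)) w\<bar> ^ 3) <= C ^ 3 * (sqrt (1/2) ^ j) ^ 3" for i
    using P_diff3[OF assms(1) J_close[OF assms(2)], of i] unfolding B by auto
  show "integrable M (DD N j)" unfolding DD_def[abs_def]
    by (intro Bochner_Integration.integrable_add Bochner_Integration.integrable_divide Bochner_Integration.integrable_sum t(1)) auto
  define h where "h = sqrt (1/2 :: real) ^ j"
  have h2: "h * h * 2 ^ j = 1"
  proof -
    have "h * h = (sqrt (1/2) * sqrt (1/2)) ^ j" unfolding h_def by (rule power_mult_distrib[symmetric])
    also have "sqrt (1/2) * sqrt (1/2) = (1/2 :: real)" by simp
    finally show ?thesis by (simp add: power_divide)
  qed
  have h0: "h > 0" by (simp add: h_def)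
  have "expectation (DD N j) = (9/10) ^ j + (\<Sum>i<2 ^ Suc j + 1. expectation (%w. \<bar>P N (J N (Suc j) i) w - P N (J N j (i div 2)) w\<bar> ^ 3)) / ((9/10) ^ j)\<^sup>2"
  proof -
    have i1: "integrable M (%w. \<Sum>i<2 ^ Suc j + 1. \<bar>P N (J N (Suc j) i) w - P N (J N j (i div 2)) w\<bar> ^ 3)"
      by (intro Bochner_Integration.integrable_sum t(1))
    have s1: "expectation (%w. \<Sum>i<2 ^ Suc j + 1. \<bar>P N (J N (Suc j) i) w - P N (J N j (i div 2)) w\<bar> ^ 3) = (\<Sum>i<2 ^ Suc j + 1. expectation (%w. \<bar>P N (J N (Suc j) i) w - P N (J N j (i div 2)) w\<bar> ^ 3))"
      by (rule Bochner_Integration.integral_sum) (rule t(1))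
    show ?thesis unfolding DD_def using i1 s1 prob_space by simp
  qed
  also have "... <= (9/10) ^ j + (\<Sum>i<(2::nat) ^ Suc j + 1. C ^ 3 * h ^ 3) / ((9/10) ^ j)\<^sup>2"
    unfolding h_def by (intro add_left_mono divide_right_mono sum_mono t(2)) auto
  also have "... <= (9/10) ^ j + (3 * 2 ^ j * (C ^ 3 * h ^ 3)) / ((9/10) ^ j)\<^sup>2"
  proof (intro add_left_mono divide_right_mono)
    have "(1::real) <= 2 ^ j" by simp
    then have "(2 ^ Suc j + 1) * (C ^ 3 * h ^ 3) <= (3 * 2 ^ j) * (C ^ 3 * h ^ 3)" using C0 h0 by (intro mult_right_mono) auto
    then show "(\<Sum>i<(2::nat) ^ Suc j + 1. C ^ 3 * h ^ 3) <= 3 * 2 ^ j * (C ^ 3 * h ^ 3)" by (simp add: algebra_simps)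
  qed simp
  also have "3 * 2 ^ j * (C ^ 3 * h ^ 3) = 3 * C ^ 3 * h * (h * h * 2 ^ j)" by (simp add: power3_eq_cube mult_ac)
  also have "... = 3 * C ^ 3 * h" by (simp add: h2)
  also have "(9/10) ^ j + 3 * C ^ 3 * h / ((9/10) ^ j)\<^sup>2 <= (9/10) ^ j + 3 * C ^ 3 * (9/10) ^ j"
  proof -
    have "sqrt (1/2) <= sqrt ((9/10)^3 * (9/10)^3 :: real)" by (rule real_sqrt_le_mono) (simp add: power3_eq_cube)
    also have "... = (9/10) ^ 3" by (simp only: real_sqrt_abs2) simp
    finally have "h <= ((9/10) ^ 3) ^ j" unfolding h_def by (rule power_mono) simp
    also have "... = ((9/10) ^ j) ^ 3" by (simp only: power_mult[symmetric] mult.commute)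
    also have "... = (9/10) ^ j * ((9/10) ^ j)\<^sup>2" by (simp only: power3_eq_cube power2_eq_square mult.assoc)
    finally have "h / ((9/10) ^ j)\<^sup>2 <= (9/10) ^ j" by (simp add: divide_le_eq)
    then have "3 * C ^ 3 * (h / ((9/10) ^ j)\<^sup>2) <= 3 * C ^ 3 * (9/10) ^ j" using C0 by (intro mult_left_mono) auto
    then show ?thesis by simp
  qed
  finally show "expectation (DD N j) <= (1 + 3 * C ^ 3) * (9/10) ^ j" by (simp add: algebra_simps)
qed

lemma FF_int: assumes "N >= 1"
  shows "integrable M (FF N)" "expectation (FF N) <= real N powr (- 1/8) + C ^ 3 * real N powr (- 1/4)"
proof -
  have N0: "real N > 0" using assms by simp
  have t: "integrable M (%w. \<bar>P N n w - P N (n - 1) w\<bar> ^ 3)" "expectation (%w. \<bar>P N n w - P N (n - 1) w\<bar> ^ 3) <= C ^ 3 * sqrt (1 / N) ^ 3" for n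
    using P_diff3[OF assms, of n "n - 1" 1] by auto
  show "integrable M (FF N)" unfolding FF_def[abs_def]
    by (intro Bochner_Integration.integrable_add Bochner_Integration.integrable_divide Bochner_Integration.integrable_sum t(1)) auto
  have "expectation (FF N) = real N powr (- 1/8) + (\<Sum>n\<in>{1..N}. expectation (%w. \<bar>P N n w - P N (n - 1) w\<bar> ^ 3)) / (real N powr (- 1/8))\<^sup>2"
  proof -
    have i1: "integrable M (%w. \<Sum>n\<in>{1..N}. \<bar>P N n w - P N (n - 1) w\<bar> ^ 3)"
      by (intro Bochner_Integration.integrable_sum t(1))
    have s1: "expectation (%w. \<Sum>n\<in>{1..N}. \<bar>P N n w - P N (n - 1) w\<bar> ^ 3) = (\<Sum>n\<in>{1..N}. expectation (%w. \<bar>P N n w - P N (n - 1) w\<bar> ^ 3))"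
      by (rule Bochner_Integration.integral_sum) (rule t(1))
    show ?thesis unfolding FF_def using i1 s1 prob_space by simp
  qed
  also have "... <= real N powr (- 1/8) + (\<Sum>n\<in>{1..N}. C ^ 3 * sqrt (1 / N) ^ 3) / (real N powr (- 1/8))\<^sup>2"
    by (intro add_left_mono divide_right_mono sum_mono t(2)) auto
  also have "(\<Sum>n\<in>{1..N}. C ^ 3 * sqrt (1 / N) ^ 3) / (real N powr (- 1/8))\<^sup>2 = C ^ 3 * real N powr (- 1/4)"
  proof -
    have a: "sqrt (1 / N) ^ 3 = real N powr (- 3/2)"
    proof -
      have "sqrt (1 / N) = real N powr (- 1/2)" using N0 by (simp add: powr_half_sqrt[symmetric] powr_minus_divide real_sqrt_divide)
      then have "sqrt (1 / N) ^ 3 = (real N powr (- 1/2)) powr 3" using N0 by (simp add: powr_numeral)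
      then show ?thesis by (simp add: powr_powr)
    qed
    have b: "(real N powr (- 1/8))\<^sup>2 = real N powr (- 1/4)"
      by (simp add: power2_eq_square flip: powr_add)
    have c: "real N * real N powr (- 3/2) / real N powr (- 1/4) = real N powr (1 + - 3/2 - (- 1/4))"
      unfolding powr_diff powr_add using N0 by simp
    have "(\<Sum>n\<in>{1..N}. C ^ 3 * sqrt (1 / N) ^ 3) / (real N powr (- 1/8))\<^sup>2 = C ^ 3 * (real N * real N powr (- 3/2) / real N powr (- 1/4))"
      unfolding a b by simp
    also have "... = C ^ 3 * real N powr (- 1/4)" unfolding c by simp
    finally show ?thesis .
  qed
  finally show "expectation (FF N) <= real N powr (- 1/8) + C ^ 3 * real N powr (- 1/4)" .
qed

text \<open>The chain runs from level \<open>k\<close> to the largest level \<open>K\<close> with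
  \<open>2 ^ K <= N\<close>; finer grids would not separate summation indices. What remains at level
  \<open>K\<close> is at most two summation steps, each bounded by \<open>FF\<close>. The guarded
  sum up to \<open>Suc N\<close> hides \<open>K\<close>, which depends on \<open>N\<close>.\<close>

lemma dyadic_sandwich:
  assumes t: "t \<in> {0..1}" and N: "N >= 2 ^ k"
  shows "\<bar>P N (nat \<lfloor>real N * t\<rfloor>) w - P N (J N k (nat \<lfloor>2 ^ k * t\<rfloor>)) w\<bar> <= (\<Sum>j\<in>{k..<Suc N}. if 2 ^ Suc j <= N then DD N j w else 0) + 2 * FF N w"
proof -
  have N1: "N >= 1" using N by (metis One_nat_def Suc_leI le_trans zero_less_numeral zero_less_power)
  define K where "K = (GREATEST K. (2::nat) ^ K <= N)"
  have bd: "!!y. 2 ^ y <= N ==> y <= N" by (meson less_exp le_trans less_imp_le)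
  have K1: "2 ^ K <= N" unfolding K_def by (rule GreatestI_nat[of _ k N]) (use N bd in auto)
  have K2: "y <= K" if "2 ^ y <= N" for y unfolding K_def by (rule Greatest_le_nat[of _ _ N]) (use that bd in auto)
  have kK: "k <= K" by (rule K2[OF N])
  have K3: "N < 2 ^ Suc K" using K2[of "Suc K"] by (meson Suc_n_not_le_n not_le)
  define p where "p = (%j. J N j (nat \<lfloor>2 ^ j * t\<rfloor>))"
  have step: "\<bar>P N (p (Suc j)) w - P N (p j) w\<bar> <= DD N j w" for j
  proof -
    let ?i = "nat \<lfloor>2 ^ Suc j * t\<rfloor>"
    have "?i div 2 = nat \<lfloor>2 ^ j * t\<rfloor>" using nat_floor_double[of "2 ^ j * t"] t by (simp add: mult.assoc)
    moreover have "?i < 2 ^ Suc j + 1"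
    proof -
      have "?i <= nat \<lfloor>2 ^ Suc j :: real\<rfloor>" by (rule grid_index[OF t]) simp
      also have "\<lfloor>2 ^ Suc j :: real\<rfloor> = 2 ^ Suc j" by (metis floor_of_int of_int_numeral of_int_power)
      finally show ?thesis by (simp add: nat_power_eq less_Suc_eq_le nat_le_iff)
    qed
    then have "\<bar>P N (J N (Suc j) ?i) w - P N (J N j (?i div 2)) w\<bar> ^ 3 <= (\<Sum>i<2 ^ Suc j + 1. \<bar>P N (J N (Suc j) i) w - P N (J N j (i div 2)) w\<bar> ^ 3)"
      by (intro member_le_sum) auto
    then have "\<bar>P N (J N (Suc j) ?i) w - P N (J N j (?i div 2)) w\<bar> <= DD N j w"
      unfolding DD_def by (intro order_trans[OF abs_le_cube[of "(9/10) ^ j"]] add_left_mono divide_right_mono) auto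
    ultimately show ?thesis by (simp add: p_def)
  qed
  have DD0: "DD N j w >= 0" for j unfolding DD_def by (intro add_nonneg_nonneg divide_nonneg_nonneg sum_nonneg) auto
  have tel: "\<bar>P N (p n) w - P N (p k) w\<bar> <= (\<Sum>j\<in>{k..<n}. DD N j w)" if "k <= n" for n
    using that
  proof (induction n rule: dec_induct)
    case (step n) then show ?case using \<open>\<bar>P N (p (Suc n)) w - P N (p n) w\<bar> <= DD N n w\<close> by simp
  qed simp
  have "(\<Sum>j\<in>{k..<K}. DD N j w) = (\<Sum>j\<in>{k..<K}. if 2 ^ Suc j <= N then DD N j w else 0)"
  proof (intro sum.cong refl)
    fix j assume "j \<in> {k..<K}"
    then have "(2::nat) ^ Suc j <= 2 ^ K" by (intro power_increasing) auto
    then show "DD N j w = (if 2 ^ Suc j <= N then DD N j w else 0)" using K1 by simp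
  qed
  also have "... <= (\<Sum>j\<in>{k..<Suc N}. if 2 ^ Suc j <= N then DD N j w else 0)"
    by (rule sum_mono2) (use DD0 bd[OF K1] in auto)
  finally have a: "\<bar>P N (p K) w - P N (p k) w\<bar> <= (\<Sum>j\<in>{k..<Suc N}. if 2 ^ Suc j <= N then DD N j w else 0)"
    using tel[OF kK] by linarith
  let ?m = "nat \<lfloor>real N * t\<rfloor>"
  have mN: "?m <= N" by (rule grid_N[OF t])
  have FFb: "\<bar>P N n w - P N (n - 1) w\<bar> <= FF N w" if "n <= N" for n
  proof (cases "n = 0")
    case True
    then show ?thesis unfolding FF_def by (auto intro!: add_nonneg_nonneg divide_nonneg_nonneg sum_nonneg)
  next
    case False
    then have "\<bar>P N n w - P N (n - 1) w\<bar> ^ 3 <= (\<Sum>n\<in>{1..N}. \<bar>P N n w - P N (n - 1) w\<bar> ^ 3)"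
      using that by (intro member_le_sum) auto
    then show ?thesis unfolding FF_def using N1
      by (intro order_trans[OF abs_le_cube[of "real N powr (- 1/8)"]] add_left_mono divide_right_mono) auto
  qed
  \<comment> \<open>The mesh in summation indices is below 2 by maximality of \<open>K\<close>, and
    rounding down adds less than 1, so the integer difference is at most 2.\<close>
  have pm: "p K <= ?m \<and> ?m <= p K + 2"
  proof -
    let ?s = "real (nat \<lfloor>2 ^ K * t\<rfloor>)"
    have "?s <= 2 ^ K * t" "2 ^ K * t < ?s + 1" using t by (auto intro: nat_floor_le nat_floor_gt)
    then have s: "?s / 2 ^ K <= t" "t <= ?s / 2 ^ K + 1 / 2 ^ K" by (simp_all add: field_simps)
    have "real N < real (2 ^ Suc K)" using K3 by (simp only: of_nat_less_iff)
    then have "real N * (1 / 2 ^ K) < 2" by (simp add: field_simps)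
    moreover have "real N * t <= real N * (?s / 2 ^ K + 1 / 2 ^ K)" "real N * (?s / 2 ^ K) <= real N * t" using s by (intro mult_left_mono; simp)+
    ultimately have c: "real N * t < real N * (?s / 2 ^ K) + 2" "real N * (?s / 2 ^ K) <= real N * t" by (simp_all add: distrib_left)
    have "p K <= ?m" unfolding p_def J_def using c(2) by (intro nat_mono floor_mono) simp
    moreover have "real ?m < real (p K) + 3"
    proof -
      have "real ?m <= real N * t" using t by (intro nat_floor_le) simp
      moreover have "real N * (?s / 2 ^ K) < real (p K) + 1" unfolding p_def J_def by (rule nat_floor_gt)
      ultimately show ?thesis using c(1) by linarith
    qed
    ultimately show ?thesis by linarith
  qed
  have F0: "FF N w >= 0" using FFb[of 0] by simp
  have bb: "\<bar>P N ?m w - P N (p K) w\<bar> <= 2 * FF N w"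
  proof -
    consider "?m = p K" | "?m = Suc (p K)" | "?m = Suc (Suc (p K))" using pm by linarith
    then show ?thesis
    proof cases
      case 1 then show ?thesis using F0 by simp
    next
      case 2 then show ?thesis using FFb[OF mN] F0 by simp
    next
      case 3
      then have "\<bar>P N (Suc (Suc (p K))) w - P N (Suc (p K)) w\<bar> <= FF N w" "\<bar>P N (Suc (p K)) w - P N (p K) w\<bar> <= FF N w"
        using FFb[of "Suc (Suc (p K))"] FFb[of "Suc (p K)"] mN by auto
      then show ?thesis using 3 by simp
    qed
  qed
  show ?thesis using a bb unfolding p_def by linarith
qed

text \<open>The limit law is carried by continuous paths and lives on the cylinder sigma-algebra, where Skorokhod
  continuous functionals are measurable as limits of functionals of finitely many coordinates.\<close>
theorem functional_clt:
  "\<exists>Q. centered_gaussian_D_law Q b \<and> conv_distr_D M (%N w t. U N t w) Q"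
proof -
  have C2: "C\<^sup>2 > 0" using C0 by simp
  obtain Y :: "real => (nat => real) => real" where Ym[measurable]: "!!t. Y t \<in> borel_measurable normal_seq"
    and Yc: "!!w. continuous_on UNIV (%t. Y t w)"
    and Ycos: "!!(n::nat) ts u. (!!i. i < n ==> ts i \<in> {0..1}) ==> (\<integral>w. cos (\<Sum>i<n. u i * Y (ts i) w) \<partial>normal_seq) = exp (- (\<Sum>i<n. \<Sum>j<n. u i * u j * b (ts i) (ts j)) / 2)"
    and Ysin: "!!(n::nat) ts u. (!!i. i < n ==> ts i \<in> {0..1}) ==> (\<integral>w. sin (\<Sum>i<n. u i * Y (ts i) w) \<partial>normal_seq) = 0"
    using gaussian_process_exists[OF b_sym b_pos b_inc C2 b_cont] by blast
  \<comment> \<open>Continuous functions on the line with the sigma-algebra generated by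
    coordinates; every Skorokhod continuous functional is on it a pointwise limit of sampled
    ones.\<close>
  define Np where "Np = restrict_space (PiM UNIV (%_::real. borel :: real measure)) {f. continuous_on UNIV f}"
  have YN: "(%w t. Y t w) \<in> measurable normal_seq Np"
    unfolding Np_def
    by (intro measurable_restrict_space2 measurable_PiM_single') (use Yc in auto)
  have spN: "space Np = {f. continuous_on UNIV f}" by (auto simp: Np_def space_restrict_space space_PiM)
  have coord[measurable]: "(%f. f t) \<in> borel_measurable Np" for t
    unfolding Np_def by (intro measurable_restrict_space1 measurable_component_singleton) simp
  define QQ where "QQ = distr normal_seq Np (%w t. Y t w)"
  interpret NS: prob_space normal_seq by (rule prob_space_normal_seq)
  have psQ: "prob_space QQ" unfolding QQ_def by (rule NS.prob_space_distr[OF YN])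
  have int: "(\<integral>f. h f \<partial>QQ) = (\<integral>w. h (%t. Y t w) \<partial>normal_seq)" if "h \<in> borel_measurable Np" for h :: "(real => real) => real"
    unfolding QQ_def by (rule integral_distr[OF YN that])
  have g_law: "distr normal_seq borel (%w. \<Sum>i<k. a i * Y (ts i) w) = (if s = 0 then return borel 0 else density lborel (normal_density 0 (sqrt s)))"
    and g_mom: "NS.expectation (%w. \<Sum>i<k. a i * Y (ts i) w) = 0" "NS.expectation (%w. (\<Sum>i<k. a i * Y (ts i) w)\<^sup>2) = s" "integrable normal_seq (%w. (\<Sum>i<k. a i * Y (ts i) w)\<^sup>2)" and s0: "s >= 0"
    if ts: "!!i. i < k ==> ts i \<in> {0..1}" and s: "s = (\<Sum>i<k. \<Sum>j<k. a i * a j * b (ts i) (ts j))" for k :: nat and a ts s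
  proof -
    show s0: "s >= 0" unfolding s by (rule b_pos[OF ts])
    have e: "u * (\<Sum>i<k. a i * Y (ts i) w) = (\<Sum>i<k. (u * a i) * Y (ts i) w)" for u w by (simp add: sum_distrib_left mult_ac)
    have e2: "(\<Sum>i<k. \<Sum>j<k. (u * a i) * (u * a j) * b (ts i) (ts j)) = s * u\<^sup>2" for u
      by (simp add: s sum_distrib_left sum_distrib_right power2_eq_square mult_ac)
    have c: "NS.expectation (%w. cos (u * (\<Sum>i<k. a i * Y (ts i) w))) = exp (- (s * u\<^sup>2) / 2)" for u
      unfolding e using Ycos[of k ts "%i. u * a i", OF ts] unfolding e2 .
    have d: "NS.expectation (%w. sin (u * (\<Sum>i<k. a i * Y (ts i) w))) = 0" for u
      unfolding e by (rule Ysin[OF ts])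
    have m: "(%w. \<Sum>i<k. a i * Y (ts i) w) \<in> borel_measurable normal_seq" by measurable
    show "distr normal_seq borel (%w. \<Sum>i<k. a i * Y (ts i) w) = (if s = 0 then return borel 0 else density lborel (normal_density 0 (sqrt s)))"
      by (rule NS.gauss_law_of_trig[OF m s0 c d])
    show "NS.expectation (%w. \<Sum>i<k. a i * Y (ts i) w) = 0" "NS.expectation (%w. (\<Sum>i<k. a i * Y (ts i) w)\<^sup>2) = s" "integrable normal_seq (%w. (\<Sum>i<k. a i * Y (ts i) w)\<^sup>2)"
      using NS.gauss_moments_of_trig[OF m s0 c d] by auto
  qed
  have one: "NS.expectation (Y t) = 0" "NS.expectation (%w. (Y t w)\<^sup>2) = b t t" "integrable normal_seq (%w. (Y t w)\<^sup>2)" if "t \<in> {0..1}" for t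
    using g_mom[of 1 "%_. t" _ "%_. 1", OF _ refl] that by simp_all
  have two: "NS.expectation (%w. Y t w * Y s w) = b t s" if ts: "t \<in> {0..1}" "s \<in> {0..1}" for t s
  proof -
    let ?ts = "%i::nat. if i = 0 then t else s"
    have "(\<Sum>i<(2::nat). \<Sum>j<(2::nat). 1 * 1 * b (?ts i) (?ts j)) = b t t + 2 * b t s + b s s"
      using b_sym[OF ts] by (simp add: numeral_2_eq_2)
    then have a: "NS.expectation (%w. (Y t w + Y s w)\<^sup>2) = b t t + 2 * b t s + b s s" "integrable normal_seq (%w. (Y t w + Y s w)\<^sup>2)"
      using g_mom(2,3)[of 2 ?ts _ "%_. 1", OF _ refl] ts by (simp_all add: numeral_2_eq_2)
    have "Y t w * Y s w = ((Y t w + Y s w)\<^sup>2 - (Y t w)\<^sup>2 - (Y s w)\<^sup>2) / 2" for w by (simp add: power2_eq_square algebra_simps)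
    then have "NS.expectation (%w. Y t w * Y s w) = NS.expectation (%w. ((Y t w + Y s w)\<^sup>2 - (Y t w)\<^sup>2 - (Y s w)\<^sup>2) / 2)"
      by (intro Bochner_Integration.integral_cong refl)
    also have "... = b t s" using a one[OF ts(1)] one[OF ts(2)] by simp
    finally show ?thesis .
  qed
  have "centered_gaussian_D_law QQ b"
    unfolding centered_gaussian_D_law_def
  proof (intro conjI ballI allI impI)
    show "prob_space QQ" by (rule psQ)
    show "space QQ \<subseteq> Dspace" unfolding QQ_def by (auto simp: spN intro: continuous_Dspace)
    show "(%f. f t) \<in> borel_measurable QQ" for t unfolding QQ_def by simp
    show "(\<integral>f. f t \<partial>QQ) = 0" if "t \<in> {0..1}" for t using one(1)[OF that] by (simp add: int)
    show "(\<integral>f. f t * f s \<partial>QQ) = b t s" if "t \<in> {0..1}" "s \<in> {0..1}" for t s using two[OF that] by (simp add: int)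
    fix k and ts a :: "nat => real" assume ts: "\<forall>i<k. ts i \<in> {0..1}"
    define s where "s = (\<Sum>i<k. \<Sum>j<k. a i * a j * b (ts i) (ts j))"
    have "distr QQ borel (%f. \<Sum>i<k. a i * f (ts i)) = distr normal_seq borel (%w. \<Sum>i<k. a i * Y (ts i) w)"
      unfolding QQ_def by (subst distr_distr[OF _ YN]) (auto simp: comp_def)
    also have "... = (if s = 0 then return borel 0 else density lborel (normal_density 0 (sqrt s)))"
      by (rule g_law[OF _ s_def]) (use ts in auto)
    finally show "gaussian_law (distr QQ borel (%f. \<Sum>i<k. a i * f (ts i)))"
      unfolding gaussian_law_def using s0[OF _ s_def] ts by (intro exI[of _ 0] exI[of _ "sqrt s"]) auto
  qed
  moreover have "conv_distr_D M (%N w t. U N t w) QQ"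
    unfolding conv_distr_D_def
  proof (intro allI impI)
    fix h assume h: "bounded_cont_D h"
    have hc: "sup_cont h" by (rule bounded_cont_D_sup_cont[OF h])
    have hm: "h \<in> borel_measurable Np"
    proof (rule borel_measurable_LIMSEQ_real)
      show "(%k. h (samp k f)) \<longlonglongrightarrow> h f" if "f \<in> space Np" for f
        by (rule samp_tendsto[OF hc]) (use that in \<open>simp add: spN\<close>)
      show "(%f. h (samp k f)) \<in> borel_measurable Np" for k by (rule sampm[OF hc coord])
    qed
    define eps where "eps = (%k. \<Sum>j. (1 + 3 * C ^ 3) * (9/10 :: real) ^ (j + k))"
    have sg: "summable (%j. (1 + 3 * C ^ 3) * (9/10 :: real) ^ j)" by (intro summable_mult summable_geometric) simp
    have epsl: "eps \<longlonglongrightarrow> 0"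
    proof -
      have "eps = (%k. (\<Sum>j. (1 + 3 * C ^ 3) * (9/10 :: real) ^ j) - (\<Sum>j<k. (1 + 3 * C ^ 3) * (9/10 :: real) ^ j))"
        unfolding eps_def by (rule ext) (rule suminf_minus_initial_segment[OF sg])
      then show ?thesis using tendsto_diff[OF tendsto_const summable_LIMSEQ[OF sg], of "\<Sum>j. (1 + 3 * C ^ 3) * (9/10 :: real) ^ j"] by simp
    qed
    define r where "r = (%N::nat. 2 * (real N powr (- 1/8) + C ^ 3 * real N powr (- 1/4)) + 2 * \<mu> N)"
    have rl: "r \<longlonglongrightarrow> 0"
    proof -
      have a: "(%N::nat. real N powr (- 1/8)) \<longlonglongrightarrow> 0" "(%N::nat. real N powr (- 1/4)) \<longlonglongrightarrow> 0"
        by (rule tendsto_neg_powr; simp add: filterlim_real_sequentially)+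
      have "r \<longlonglongrightarrow> 2 * (0 + C ^ 3 * 0) + 2 * 0"
        unfolding r_def \<mu>_def by (intro tendsto_intros a mean)
      then show ?thesis by simp
    qed
    \<comment> \<open>Chaining terms, the two last steps, and twice the total drift, because the
      paths are uncentred while the majorants concern centred sums. The value 0 at
      \<open>N = 0\<close> keeps integrability unconditional.\<close>
    define Dk where "Dk = (%N k w. if N >= 1 then (\<Sum>j\<in>{k..<Suc N}. if 2 ^ Suc j <= N then DD N j w else 0) + 2 * FF N w + 2 * \<mu> N else 0)"
    have mu0: "\<mu> N >= 0" for N unfolding \<mu>_def by (intro divide_nonneg_nonneg sum_nonneg) auto
    have Dint: "integrable M (%w. if 2 ^ Suc j <= N then DD N j w else 0)" if "N >= 1" for N j
      using DD_int(1)[OF that, of j] by (cases "2 ^ Suc j <= N") simp_all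
    have X: "U N t w = Q N (nat \<lfloor>real N * t\<rfloor>) w" for N t w by (simp add: U_def)
    have "(%N. \<integral>w. h (%t. Q N (nat \<lfloor>real N * t\<rfloor>) w) \<partial>M) \<longlonglongrightarrow> (\<integral>w. h (%t. Y t w) \<partial>normal_seq)"
    proof (rule weak_convergence_of_step_processes[where Z=Q and Y=Y and D=Dk and eps=eps and r=r and ?N0.0="%k. 2 ^ k", OF prob_space_axioms prob_space_normal_seq _ Ym Yc _ _ _ _ _ _ epsl rl h])
      show "Q N j \<in> borel_measurable M" for N j by simp
      show "(%N. \<integral>w. cos (\<Sum>i<n. u i * Q N (nat \<lfloor>real N * ts i\<rfloor>) w) \<partial>M) \<longlonglongrightarrow> (\<integral>w. cos (\<Sum>i<n. u i * Y (ts i) w) \<partial>normal_seq)"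
        if ts: "!!i. i < n ==> ts i \<in> {0..1}" for n :: nat and ts u
        using trig_limit(1)[of n ts u] Ycos[of n ts u] ts by (simp add: U_def)
      show "(%N. \<integral>w. sin (\<Sum>i<n. u i * Q N (nat \<lfloor>real N * ts i\<rfloor>) w) \<partial>M) \<longlonglongrightarrow> (\<integral>w. sin (\<Sum>i<n. u i * Y (ts i) w) \<partial>normal_seq)"
        if ts: "!!i. i < n ==> ts i \<in> {0..1}" for n :: nat and ts u
        using trig_limit(2)[of n ts u] Ysin[of n ts u] ts by (simp add: U_def)
      show "integrable M (Dk N k)" for N k
      proof (cases "N >= 1")
        case True
        show ?thesis unfolding Dk_def if_P[OF True]
          by (intro Bochner_Integration.integrable_add Bochner_Integration.integrable_sum integrable_mult_right integrable_const Dint FF_int(1) True)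
      qed (simp add: Dk_def)
      show D0: "Dk N k w >= 0" for N k w
      proof -
        have "DD N j w >= 0" for j unfolding DD_def by (intro add_nonneg_nonneg divide_nonneg_nonneg sum_nonneg) auto
        moreover have "FF N w >= 0" unfolding FF_def by (intro add_nonneg_nonneg divide_nonneg_nonneg sum_nonneg) auto
        ultimately show ?thesis unfolding Dk_def using mu0 by (auto intro!: add_nonneg_nonneg sum_nonneg)
      qed
      show "\<bar>Q N (nat \<lfloor>real N * t\<rfloor>) w - samp k (%t. Q N (nat \<lfloor>real N * t\<rfloor>) w) t\<bar> <= Dk N k w" if N: "2 ^ k <= N" and t: "t \<in> {0..1}" for N k w t
      proof -
        have N1: "N >= 1" using N by (metis One_nat_def Suc_leI le_trans zero_less_numeral zero_less_power)
        let ?j = "J N k (nat \<lfloor>2 ^ k * t\<rfloor>)"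
        have "real (nat \<lfloor>2 ^ k * t\<rfloor>) <= 2 ^ k * t" using t by (intro nat_floor_le) simp
        then have "real (nat \<lfloor>2 ^ k * t\<rfloor>) / 2 ^ k <= t" by (simp add: field_simps)
        then have "real (nat \<lfloor>2 ^ k * t\<rfloor>) / 2 ^ k \<in> {0..1}" using t by (simp only: atLeastAtMost_iff) (meson divide_nonneg_nonneg of_nat_0_le_iff order_trans zero_le_numeral zero_le_power)
        then have jN: "?j <= N" unfolding J_def by (rule grid_N)
        have "\<bar>Q N (nat \<lfloor>real N * t\<rfloor>) w - Q N ?j w\<bar> <= \<bar>P N (nat \<lfloor>real N * t\<rfloor>) w - P N ?j w\<bar> + 2 * \<mu> N"
          unfolding QP using ex_bound[OF grid_N[OF t], of N] ex_bound[OF jN] by linarith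
        then show ?thesis using dyadic_sandwich[OF t N, of w] N1 by (simp add: Dk_def J_def)
      qed
      show "(\<integral>w. Dk N k w \<partial>M) <= eps k + r N" if N: "2 ^ k <= N" for N k
      proof -
        have N1: "N >= 1" using N by (metis One_nat_def Suc_leI le_trans zero_less_numeral zero_less_power)
        have "(\<integral>w. Dk N k w \<partial>M) = (\<Sum>j\<in>{k..<Suc N}. expectation (%w. if 2 ^ Suc j <= N then DD N j w else 0)) + 2 * expectation (FF N) + 2 * \<mu> N"
          unfolding Dk_def using N1 Dint[OF N1] FF_int(1)[OF N1] by (simp add: Bochner_Integration.integral_sum prob_space del: sum.op_ivl_Suc)
        also have "(\<Sum>j\<in>{k..<Suc N}. expectation (%w. if 2 ^ Suc j <= N then DD N j w else 0)) <= (\<Sum>j\<in>{k..<Suc N}. (1 + 3 * C ^ 3) * (9/10) ^ j)"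
        proof (rule sum_mono)
          fix j
          have "0 <= (1 + 3 * C ^ 3) * (9/10 :: real) ^ j" using C0 by simp
          then show "expectation (%w. if 2 ^ Suc j <= N then DD N j w else 0) <= (1 + 3 * C ^ 3) * (9/10) ^ j" using DD_int(2)[OF N1, of j] by (cases "2 ^ Suc j <= N") simp_all
        qed
        also have "(\<Sum>j\<in>{k..<Suc N}. (1 + 3 * C ^ 3) * (9/10 :: real) ^ j) <= eps k"
        proof -
          have "k <= Suc N" using N by (meson le_SucI less_exp less_imp_le le_trans)
          then obtain n where n: "Suc N = n + k" by (metis add.commute le_Suc_ex)
          have "(\<Sum>j\<in>{k..<Suc N}. (1 + 3 * C ^ 3) * (9/10 :: real) ^ j) = (\<Sum>j<n. (1 + 3 * C ^ 3) * (9/10) ^ (j + k))"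
            unfolding n using sum.shift_bounds_nat_ivl[of "%j. (1 + 3 * C ^ 3) * (9/10 :: real) ^ j" 0 k n] by (simp add: atLeast0LessThan)
          also have "... <= eps k" unfolding eps_def
            by (rule sum_le_suminf[OF summable_ignore_initial_segment[OF sg]]) (use C0 in auto)
          finally show ?thesis .
        qed
        finally show ?thesis using FF_int(2)[OF N1] by (simp add: r_def)
      qed
    qed
    then show "h \<in> borel_measurable QQ \<and> (%N. \<integral>w. h (%t. U N t w) \<partial>M) \<longlonglongrightarrow> (\<integral>f. h f \<partial>QQ)"
      using hm by (simp add: X int) (simp add: QQ_def)
  qed
  ultimately show ?thesis by blast
qed

end

section \<open>Functionals of a locally approximable field along several position sequences\<close>

text \<open>Peeling off the first term gives \<open>2 * (c + 4 * (c / 8)) = 3 * c <= 4 * c\<close>: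
  the ratio 1/8 beats the factor 2 that each addition loses.\<close>

lemma (in prob_space) Lpb_geom:
  assumes "!!j. j < J ==> Lpb p (c * (1/8) ^ j) (X j)" "p >= 1" "c >= 0"
  shows "Lpb p (4 * c) (%w. \<Sum>j<J. X j w)"
  using assms
proof (induction J arbitrary: X c)
  case 0
  have "Lpb p \<bar>0\<bar> (%_. 0)" by (rule Lpb_const) (use 0 in simp)
  then show ?case using 0 by (auto elim: Lpb_weaken)
next
  case (Suc J)
  have "Lpb p (4 * (c / 8)) (%w. \<Sum>j<J. X (Suc j) w)"
  proof (rule Suc.IH)
    fix j assume "j < J"
    then show "Lpb p (c / 8 * (1/8) ^ j) (X (Suc j))" using Suc.prems(1)[of "Suc j"] by simp
  qed (use Suc.prems in auto)
  moreover have "Lpb p c (X 0)" using Suc.prems(1)[of 0] by simp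
  ultimately have "Lpb p (2 * (c + 4 * (c / 8))) (%w. X 0 w + (\<Sum>j<J. X (Suc j) w))" using Suc.prems by (intro Lpb_add)
  then have "Lpb p (4 * c) (%w. X 0 w + (\<Sum>j<J. X (Suc j) w))" by (rule Lpb_weaken) (use Suc.prems in auto)
  then show ?case unfolding sum.lessThan_Suc_shift .
qed

text \<open>\<open>xr r k\<close> approximates \<open>\<xi> k\<close> by what is visible in a window
  of radius \<open>r\<close>. \<open>FL\<close> and \<open>FA\<close> bound the functional and its
  approximation error uniformly over all choices of positions. \<open>F0\<close> is what remains of
  the vanishing average of \<open>F\<close> after approximation and clipping, stated for independent
  copies indexed by distinct positions.\<close>

locale nonconv_array = prob_space M for M :: "'a measure" +
  fixes \<xi> :: "nat => 'a => 'b::euclidean_space" and xr :: "nat => nat => 'a => 'b"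
    and Past Fut :: "nat => nat => 'a measure" and F :: "(nat => 'b) => real" and ell :: nat and d \<theta> w c1 :: real
  assumes fields: "!!r r' l. r' <= r ==> 2 * r <= l ==>
      decoupled_field M (%k x. (xr r k x, xr r' k x)) (Past r) (Fut r) (l + 1) (d * (real l + 1 - 2 * real r) powr (- \<theta>))"
    and F_cont: "continuous_on UNIV F" and F_dep: "dep {..<ell} F"
    and d1: "d >= 1" and ell1: "ell >= 1" and w4: "w > 4" and theta: "\<theta> > 4 * w / (w - 2)" and c1: "c1 > 0"
    and FL: "!!k. Lpb w c1 (%x. F (%i. \<xi> (k i) x))"
    and FA: "!!r k. r >= 1 ==> Lpb w (c1 * real r powr (- \<theta>)) (%x. F (%i. \<xi> (k i) x) - F (%i. xr r (k i) x))"
    and F0: "!!r k s. r >= 1 ==> s > 0 ==> inj_on k {..<ell} ==>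
      \<bar>\<integral>z. clip s (F (%i. xr r (k i) (z (k i)))) \<partial>PiM (k ` {..<ell}) (%_. M)\<bar> <= c1 * (real r powr (- \<theta>) + s powr (1 - w))"
begin

text \<open>The first bound restates the hypothesis on \<open>\<theta>\<close>; the third uses
  \<open>1 - 2 / w <= 2 * (1 - 3 / w)\<close>, which is \<open>w >= 4\<close>. They serve in turn
  the choice of the neighbourhood radius, the geometric decay over dyadic window sizes, the
  decoupling of pairs, the summability of shells, and the estimate of means.\<close>

lemma theta_bounds: "\<theta> * (1 - 2 / w) > 4" "\<theta> > 4" "\<theta> * (1 - 3 / w) > 2" "\<theta> * (2/3 - 2 / w) > 1" "\<theta> * (1 - 1 / w) > 4"
proof -
  have *: "4 * w < \<theta> * (w - 2)" using theta w4 by (simp add: field_simps)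
  then show a: "\<theta> * (1 - 2 / w) > 4" using w4 by (simp add: field_simps)
  have "0 < 4 * w / (w - 2)" using w4 by simp
  then have t0: "\<theta> > 0" using theta by linarith
  have "\<theta> * (1 - 2 / w) <= \<theta> * 1" using t0 w4 by (intro mult_left_mono) auto
  then show t4: "\<theta> > 4" using a by linarith
  have "1 - 2 / w <= 2 * (1 - 3 / w)" using w4 by (simp add: field_simps)
  then have "\<theta> * (1 - 2 / w) <= \<theta> * (2 * (1 - 3 / w))" using t0 by (intro mult_left_mono) auto
  then show b: "\<theta> * (1 - 3 / w) > 2" using a by linarith
  have "\<theta> * (2/3 - 2 / w) = 2/3 * (\<theta> * (1 - 3 / w))" by (simp add: algebra_simps)
  then show "\<theta> * (2/3 - 2 / w) > 1" using b by linarith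
  have "\<theta> * (1 - 2 / w) <= \<theta> * (1 - 1 / w)" using t0 w4 by (intro mult_left_mono) (auto simp: field_simps)
  then show "\<theta> * (1 - 1 / w) > 4" using a by linarith
qed

text \<open>Two window radii are carried at once so that a difference of two approximations is again
  a functional of a single field. A set of at most two summands occupies at most
  \<open>2 * ell\<close> positions, so the factor 8 of \<open>covariance_interlaced\<close> becomes
  \<open>16 * ell\<close>.\<close>

lemma pair_mix_array:
  assumes r: "r' <= r" and inj: "!!j. j < ell ==> inj (%n. pos n j)"
    and \<Phi>: "continuous_on UNIV \<Phi>" "dep {..<ell} \<Phi>"
  shows "mix_array M (%n x. \<Phi> (%i. (xr r (pos n i) x, xr r' (pos n i) x))) pos ell r (16 * real ell * d) \<theta>"
proof
  have c: "continuous_on UNIV (%y::nat => 'b \<times> 'b. (%i. y (p i)))" for p :: "nat => nat"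
    by (rule continuous_on_coordinatewise_then_product) (rule continuous_on_product_coordinates)
  have \<Phi>c: "continuous_on UNIV (%y. \<Phi> (%i. y (p i)))" for p :: "nat => nat"
    by (rule continuous_on_compose2[OF \<Phi>(1) c]) auto
  interpret B: decoupled_field M "%k x. (xr r k x, xr r' k x)" "Past r" "Fut r" "2 * r + 1" "d * (real (2 * r) + 1 - 2 * real r) powr (- \<theta>)"
    by (rule fields[OF r order_refl])
  show "(%x. \<Phi> (%i. (xr r (pos n i) x, xr r' (pos n i) x))) \<in> borel_measurable M" for n
    using B.u_path_meas[OF \<Phi>c[of "pos n"]] by simp
  have "1 * 1 <= real ell * d" using ell1 d1 by (intro mult_mono) auto
  then show "1 <= ell" "1 <= 16 * real ell * d" "0 < \<theta>" using ell1 theta_bounds(2) by auto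
  show "inj (%n. pos n j)" if "j < ell" for j by (rule inj[OF that])
  fix A J :: "nat set" and l and u v :: "(nat => real) => real"
  assume A: "finite A" "card A <= 2" and J: "finite J" and l: "2 * r <= l" and far: "!!a m. a \<in> A ==> m \<in> J ==> \<not> near pos ell l a m"
    and u: "continuous_on UNIV u" "!!x. \<bar>u x\<bar> <= 1" "dep A u" and v: "continuous_on UNIV v" "!!x. \<bar>v x\<bar> <= 1" "dep J v"
  interpret decoupled_field M "%k x. (xr r k x, xr r' k x)" "Past r" "Fut r" "l + 1" "d * (real l + 1 - 2 * real r) powr (- \<theta>)"
    by (rule fields[OF r l])
  define T where "T = (%y n. \<Phi> (%i. y (pos n i) :: 'b \<times> 'b))"
  define P where "P = (%A. \<Union>n\<in>A. pos n ` {..<ell})"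
  have Tc: "continuous_on UNIV (%y. T y)" unfolding T_def
    by (rule continuous_on_coordinatewise_then_product) (rule \<Phi>c)
  have uc: "continuous_on UNIV (%y. f (T y))" if "continuous_on UNIV f" for f :: "(nat => real) => real"
    by (rule continuous_on_compose2[OF that Tc]) auto
  have dp: "dep (P A) (%y. f (T y))" if "dep A f" for f :: "(nat => real) => real" and A
    unfolding dep_def
  proof (intro allI impI)
    fix x y :: "nat => 'b \<times> 'b" assume e: "\<forall>k\<in>P A. x k = y k"
    show "f (T x) = f (T y)"
    proof (rule depD[OF that])
      fix n assume "n \<in> A"
      then show "T x n = T y n" unfolding T_def by (intro depD[OF \<Phi>(2)]) (use e in \<open>auto simp: P_def\<close>)
    qed
  qed
  have fP: "finite (P A)" "finite (P J)" using A J by (auto simp: P_def)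
  have "card (P A) <= (\<Sum>n\<in>A. card (pos n ` {..<ell}))" unfolding P_def by (rule card_UN_le[OF A(1)])
  also have "... <= (\<Sum>n\<in>A. ell)" by (intro sum_mono) (metis card_image_le card_lessThan finite_lessThan)
  also have "... <= 2 * ell" using A by simp
  finally have cP: "real (card (P A)) <= 2 * real ell" by linarith
  have sep: "a + (l + 1) <= b \<or> b + (l + 1) <= a" if "a \<in> P A" "b \<in> P J" for a b
  proof -
    from that obtain n i m j where "n \<in> A" "i < ell" "a = pos n i" "m \<in> J" "j < ell" "b = pos m j" by (auto simp: P_def)
    then show ?thesis using far[of n m] unfolding near_def by force
  qed
  have "\<bar>expectation (%w. u (T (path w)) * v (T (path w))) - expectation (%w. u (T (path w))) * expectation (%w. v (T (path w)))\<bar>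
     <= 8 * card (P A) * (d * (real l + 1 - 2 * real r) powr (- \<theta>))"
    by (rule covariance_interlaced[OF fP sep _ uc[OF u(1)] u(2) dp[OF u(3)] uc[OF v(1)] v(2) dp[OF v(3)]]) auto
  also have "... <= 8 * (2 * real ell) * (d * (real l + 1 - 2 * real r) powr (- \<theta>))"
    by (intro mult_right_mono mult_left_mono) (use d1 cP in auto)
  finally show "\<bar>expectation (%w. u (%n. \<Phi> (%i. (xr r (pos n i) w, xr r' (pos n i) w))) * v (%n. \<Phi> (%i. (xr r (pos n i) w, xr r' (pos n i) w)))) - expectation (%w. u (%n. \<Phi> (%i. (xr r (pos n i) w, xr r' (pos n i) w)))) * expectation (%w. v (%n. \<Phi> (%i. (xr r (pos n i) w, xr r' (pos n i) w))))\<bar>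
        <= 16 * real ell * d * (real l + 1 - 2 * real r) powr (- \<theta>)"
    by (simp add: T_def mult_ac)
qed

definition D where "D = 16 * real ell * d"
definition KK where "KK = 8 * real ell ^ 2 + 80 * D * real ell ^ 4 * (\<Sum>k. real (Suc k) powr (- (\<theta> * (2/3 - 2 / w))))"

lemma summ: "summable (%k. real (Suc k) powr (- (\<theta> * (2/3 - 2 / w))))"
proof -
  have "summable (%n. real n powr (- (\<theta> * (2/3 - 2 / w))))"
    unfolding summable_real_powr_iff using theta_bounds(4) by simp
  then show ?thesis by (subst summable_Suc_iff)
qed

lemma KK_pos: "KK > 0"
proof -
  have "D >= 0" using d1 by (simp add: D_def)
  then have "0 <= 80 * D * real ell ^ 4 * (\<Sum>k. real (Suc k) powr (- (\<theta> * (2/3 - 2 / w))))"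
    by (intro mult_nonneg_nonneg suminf_nonneg summ) auto
  moreover have "8 * real ell ^ 2 > 0" using ell1 by simp
  ultimately show ?thesis unfolding KK_def by linarith
qed

lemma level_third_moment:
  fixes pos :: "nat => nat => nat"
  assumes r: "r' <= r" and inj: "!!j. j < ell ==> inj (%n. pos n j)"
    and \<Phi>: "continuous_on UNIV \<Phi>" "dep {..<ell} \<Phi>" and A: "A > 0" and I: "finite I"
  defines "Z \<equiv> %n x. \<Phi> (%i. (xr r (pos n i) x, xr r' (pos n i) x))"
  assumes L: "!!n. Lpb w A (Z n)"
  shows "Lpb 3 (4 * A * sqrt (KK * (r + 1) * card I)) (%x. \<Sum>n\<in>I. Z n x - expectation (Z n))"
proof -
  interpret B: mix_array M Z pos ell r D \<theta> unfolding Z_def D_def by (rule pair_mix_array[OF r inj \<Phi>])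
  interpret Q: mix_array M "%n x. Z n x - expectation (Z n)" pos ell r D \<theta> by (rule B.mix_array_shift)
  have w1: "w >= 1" using w4 by simp
  have m0: "expectation (%x. Z n x - expectation (Z n)) = 0" for n
    using Lpb_1(1)[OF L w1] by (simp add: prob_space)
  show ?thesis
    using Q.third_moment[OF I _ w4 Lpb_center[OF L w1] m0 refl summ] A
    unfolding Q.S_def[abs_def] KK_def by simp
qed

lemma approx_L: "r >= 1 ==> Lpb w (4 * c1) (%x. F (%i. xr r (k i) x))"
proof -
  assume r: "r >= 1"
  have "real r powr (- \<theta>) <= real r powr 0" using r theta_bounds(2) by (intro powr_mono) auto
  then have "c1 * real r powr (- \<theta>) <= c1 * 1" using r c1 by (intro mult_left_mono) auto
  then have "Lpb w c1 (%x. F (%i. \<xi> (k i) x) - F (%i. xr r (k i) x))" using FA[OF r, of k] w4 by (auto elim: Lpb_weaken)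
  from Lpb_diff[OF FL this, of k] w4 show ?thesis by simp
qed

lemma inc_L: "r >= 1 ==> Lpb w (4 * c1 * real r powr (- \<theta>)) (%x. F (%i. xr (2 * r) (k i) x) - F (%i. xr r (k i) x))"
proof -
  assume r: "r >= 1"
  then have "real (2 * r) powr (- \<theta>) <= real r powr (- \<theta>)" using theta_bounds(2) by (intro powr_mono2') auto
  then have "c1 * real (2 * r) powr (- \<theta>) <= c1 * real r powr (- \<theta>)" using c1 by simp
  then have "Lpb w (c1 * real r powr (- \<theta>)) (%x. F (%i. \<xi> (k i) x) - F (%i. xr (2 * r) (k i) x))"
    using FA[of "2 * r" k] r w4 by (auto elim: Lpb_weaken)
  from Lpb_diff[OF FA[OF r] this, of k] w4 show ?thesis by (simp add: algebra_simps)
qed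

lemma F_fst: "continuous_on UNIV (%y::nat => 'b \<times> 'b. F (%i. fst (y i)))" "continuous_on UNIV (%y::nat => 'b \<times> 'b. F (%i. snd (y i)))"
  by (rule continuous_on_compose2[OF F_cont], rule continuous_on_coordinatewise_then_product, intro continuous_intros continuous_on_product_coordinates, simp)+

lemma F_fst_dep: "dep {..<ell} (%y::nat => 'b \<times> 'b. F (%i. fst (y i)))" "dep {..<ell} (%y::nat => 'b \<times> 'b. F (%i. fst (y i)) - F (%i. snd (y i)))"
  using F_dep unfolding dep_def by (metis (no_types, lifting))+

text \<open>Summing the third moment bounds of the dyadic increments \<open>F(xr (2^(j+1))) - F(xr (2^j))\<close>, whose
  size \<open>16^(-j)\<close> beats the loss \<open>2^j\<close> of their dependence range.\<close>
lemma third_moment_sum: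
  fixes pos :: "nat => nat => nat"
  assumes inj: "!!j. j < ell ==> inj (%n. pos n j)" and I: "finite I"
  defines "X \<equiv> %n x. F (%i. \<xi> (pos n i) x)"
  shows "Lpb 3 ((2048 * c1 * sqrt (2 * KK) + 8 * c1) * sqrt (card I)) (%x. \<Sum>n\<in>I. X n x - expectation (X n))"
proof (cases "I = {}")
  case True
  then show ?thesis using Lpb_const[of 3 0] by simp
next
  case False
  then have cI: "card I >= 1" using I by (simp add: Suc_le_eq card_gt_0_iff)
  have w1: "w >= 1" using w4 by simp
  \<comment> \<open>Level 0 is the approximation with window 1, the later levels are increments
    under doubling of the window, so that the first levels telescope to a single
    approximation.\<close>
  define Z where "Z = (%j n x. case j of 0 => F (%i. xr 1 (pos n i) x) | Suc j => F (%i. xr (2 * 2 ^ j) (pos n i) x) - F (%i. xr (2 ^ j) (pos n i) x))"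
  define c where "c = 256 * c1 * sqrt (2 * KK) * sqrt (card I)"
  have sq: "sqrt (KK * (2 ^ j + 1) * card I) <= 2 ^ j * (sqrt (2 * KK) * sqrt (card I))" for j
  proof -
    have "(1::real) <= 2 ^ j" by simp
    then have "(2::real) ^ j * 1 <= 2 ^ j * 2 ^ j" "(1::real) * 1 <= 2 ^ j * 2 ^ j" by (intro mult_mono; simp)+
    then have "KK * (2 ^ j + 1) * card I <= KK * (2 * (2 ^ j * 2 ^ j)) * card I" using KK_pos by (intro mult_right_mono mult_left_mono) linarith+
    then have "sqrt (KK * (2 ^ j + 1) * card I) <= sqrt ((2 ^ j)\<^sup>2 * (2 * KK * card I))" by (simp add: power2_eq_square mult_ac)
    also have "... = 2 ^ j * (sqrt (2 * KK) * sqrt (card I))" by (simp add: real_sqrt_mult)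
    finally show ?thesis .
  qed
  have p16: "real (2 ^ j) powr (- \<theta>) <= (1/16) ^ j" for j
  proof -
    have "real (2 ^ j) powr (- \<theta>) <= real (2 ^ j) powr (- 4)" using theta_bounds(2) by (intro powr_mono) auto
    also have "... = inverse ((2 ^ 4) ^ j)" by (simp only: powr_minus powr_numeral of_nat_power of_nat_numeral zero_le_power zero_le_numeral power_mult[symmetric] mult.commute)
    also have "... = (1/16) ^ j" by (simp add: power_one_over inverse_eq_divide)
    finally show ?thesis .
  qed
  have lev: "Lpb 3 (c * (1/8) ^ j) (%x. \<Sum>n\<in>I. Z j n x - expectation (Z j n))" for j
  proof (cases j)
    case 0
    have "Lpb 3 (4 * (4 * c1) * sqrt (KK * (1 + 1) * card I)) (%x. \<Sum>n\<in>I. F (%i. xr 1 (pos n i) x) - expectation (%x. F (%i. xr 1 (pos n i) x)))"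
      using level_third_moment[where r=1 and r'=1 and pos=pos and A="4 * c1", OF order_refl inj F_fst(1) F_fst_dep(1) _ I] approx_L[of 1] c1 by simp
    then show ?thesis
    proof (rule Lpb_weaken[of 3, THEN back_subst[of "Lpb 3 (c * (1/8) ^ j)"]])
      show "4 * (4 * c1) * sqrt (KK * (1 + 1) * card I) <= c * (1/8) ^ j"
        using sq[of 0] c1 KK_pos by (simp add: 0 c_def real_sqrt_mult mult_ac)
      show "(%x. \<Sum>n\<in>I. F (%i. xr 1 (pos n i) x) - expectation (%x. F (%i. xr 1 (pos n i) x))) = (%x. \<Sum>n\<in>I. Z j n x - expectation (Z j n))"
        by (simp add: Z_def 0)
    qed simp
  next
    case (Suc i)
    have A: "4 * c1 * (1/16) ^ i > 0" using c1 by simp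
    have L: "Lpb w (4 * c1 * (1/16) ^ i) (%x. F (%k. xr (2 * 2 ^ i) (pos n k) x) - F (%k. xr (2 ^ i) (pos n k) x))" for n
      by (rule Lpb_weaken[OF inc_L]) (use p16[of i] c1 w4 in auto)
    have "Lpb 3 (4 * (4 * c1 * (1/16) ^ i) * sqrt (KK * (real (2 * 2 ^ i) + 1) * card I)) (%x. \<Sum>n\<in>I. (F (%k. xr (2 * 2 ^ i) (pos n k) x) - F (%k. xr (2 ^ i) (pos n k) x)) - expectation (%x. F (%k. xr (2 * 2 ^ i) (pos n k) x) - F (%k. xr (2 ^ i) (pos n k) x)))"
      using level_third_moment[where r="2 * 2 ^ i" and r'="2 ^ i" and pos=pos, OF _ inj continuous_on_diff[OF F_fst] F_fst_dep(2) A I] L by (simp add: add.commute)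
    then have "Lpb 3 (4 * (4 * c1 * (1/16) ^ i) * sqrt (KK * (real (2 * 2 ^ i) + 1) * card I)) (%x. \<Sum>n\<in>I. Z j n x - expectation (Z j n))"
      by (simp add: Z_def Suc)
    then show ?thesis
    proof (rule Lpb_weaken)
      have "4 * (4 * c1 * (1/16) ^ i) * sqrt (KK * (real (2 * 2 ^ i) + 1) * card I) <= 4 * (4 * c1 * (1/16) ^ i) * (2 ^ Suc i * (sqrt (2 * KK) * sqrt (card I)))"
        using sq[of "Suc i"] c1 by (intro mult_left_mono) auto
      also have "... = (32 * c1 * sqrt (2 * KK) * sqrt (card I)) * ((1/16) ^ i * 2 ^ i)" by simp
      also have "(1/16) ^ i * 2 ^ i = (1/8 :: real) ^ i" by (simp add: power_mult_distrib[symmetric])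
      also have "(32 * c1 * sqrt (2 * KK) * sqrt (card I)) * (1/8 :: real) ^ i = c * (1/8) ^ j" by (simp add: c_def Suc)
      finally show "4 * (4 * c1 * (1/16) ^ i) * sqrt (KK * (real (2 * 2 ^ i) + 1) * card I) <= c * (1/8) ^ j" .
    qed simp
  qed
  \<comment> \<open>For fixed \<open>I\<close> the remainder after level \<open>J\<close> has size
    \<open>(1/16) ^ J\<close>; taking \<open>J\<close> large in terms of \<open>card I\<close> makes
    even the crude bound with the squared cardinality harmless.\<close>
  have "(%J. (real (card I))\<^sup>2 * 4 * (1/16) ^ J) \<longlonglongrightarrow> (real (card I))\<^sup>2 * 4 * 0"
    by (intro tendsto_intros LIMSEQ_power_zero) simp
  then have "\<forall>\<^sub>F J in sequentially. (real (card I))\<^sup>2 * 4 * (1/16) ^ J < 1" by (intro order_tendstoD(2)[where y=0]) simp_all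
  then obtain J where J: "(real (card I))\<^sup>2 * 4 * (1/16) ^ J < 1" by (auto simp: eventually_sequentially)
  define E where "E = (%n x. F (%i. \<xi> (pos n i) x) - F (%i. xr (2 ^ J) (pos n i) x))"
  have EL: "Lpb w (c1 * (1/16) ^ J) (E n)" for n
    unfolding E_def by (rule Lpb_weaken[OF FA]) (use p16[of J] c1 w4 in auto)
  have iE: "integrable M (E n)" for n by (rule Lpb_1(1)[OF EL w1])
  have iZ: "integrable M (Z j n)" for j n
  proof (cases j)
    case 0 then show ?thesis unfolding Z_def using Lpb_1(1)[OF approx_L w1, of 1 "pos n"] by simp
  next
    case (Suc i) then show ?thesis unfolding Z_def using Lpb_1(1)[OF inc_L w1, of "2 ^ i" "pos n"] by simp
  qed
  have tel: "(\<Sum>j<Suc J. Z j n x) = F (%i. xr (2 ^ J) (pos n i) x)" for n x J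
    by (induction J) (simp_all add: Z_def)
  have Xe: "X n x = (\<Sum>j<Suc J. Z j n x) + E n x" for n x unfolding tel X_def E_def by simp
  have eX: "expectation (X n) = (\<Sum>j<Suc J. expectation (Z j n)) + expectation (E n)" for n
    unfolding Xe[abs_def] using iZ iE by (simp add: Bochner_Integration.integral_sum del: sum.lessThan_Suc)
  have split: "(\<Sum>n\<in>I. X n x - expectation (X n)) = (\<Sum>j<Suc J. \<Sum>n\<in>I. Z j n x - expectation (Z j n)) + (\<Sum>n\<in>I. E n x - expectation (E n))" for x
    unfolding eX unfolding Xe sum.swap[of _ I] sum.distrib[symmetric] sum_subtractf by (simp add: sum.distrib del: sum.lessThan_Suc)
  have c0: "c >= 0" using c1 KK_pos by (simp add: c_def)
  have a: "Lpb 3 (4 * c) (%x. \<Sum>j<Suc J. \<Sum>n\<in>I. Z j n x - expectation (Z j n))"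
    by (rule Lpb_geom) (use lev c0 in auto)
  have "Lpb w (real (card I) ^ 2 * (4 * (c1 * (1/16) ^ J))) (%x. \<Sum>n\<in>I. E n x - expectation (E n))"
    by (rule Lpb_sum[OF I order_refl Lpb_center[OF EL w1] w1]) (use c1 in auto)
  then have "Lpb 3 (real (card I) ^ 2 * (4 * (c1 * (1/16) ^ J))) (%x. \<Sum>n\<in>I. E n x - expectation (E n))"
    by (rule Lpb_lower) (use w4 in auto)
  then have b: "Lpb 3 (4 * c1 * sqrt (card I)) (%x. \<Sum>n\<in>I. E n x - expectation (E n))"
  proof (rule Lpb_weaken)
    have "real (card I) ^ 2 * (4 * (c1 * (1/16) ^ J)) = c1 * ((real (card I))\<^sup>2 * 4 * (1/16) ^ J)" by simp
    also have "... <= c1 * 1" using J c1 by (intro mult_left_mono) auto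
    also have "... <= c1 * (4 * sqrt (card I))" using cI c1 by (intro mult_left_mono) (auto intro: order_trans[of _ "sqrt (real (card I))"])
    finally show "real (card I) ^ 2 * (4 * (c1 * (1/16) ^ J)) <= 4 * c1 * sqrt (card I)" by simp
  qed simp
  from Lpb_add[OF a b] show ?thesis unfolding split[symmetric] by (simp add: c_def algebra_simps)
qed

end

subsection \<open>Gaussian approximation of weighted sums\<close>

lemma exp_minus_lipschitz: "(x::real) >= 0 ==> y >= 0 ==> \<bar>exp (- x) - exp (- y)\<bar> <= \<bar>x - y\<bar>"
proof -
  have *: "\<bar>exp (- x) - exp (- y)\<bar> <= \<bar>x - y\<bar>" if "x >= 0" "x <= y" for x y :: real
  proof -
    have "exp (- y) = exp (- x) * exp (- (y - x))" by (simp flip: exp_add)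
    then have "exp (- x) - exp (- y) = exp (- x) * (1 - exp (- (y - x)))" by (simp add: algebra_simps)
    also have "... <= 1 * (y - x)"
    proof (rule mult_mono)
      show "1 - exp (- (y - x)) <= y - x" using exp_ge_add_one_self[of "- (y - x)"] by linarith
    qed (use that in auto)
    finally show ?thesis using that by simp
  qed
  assume "x >= 0" "y >= 0"
  then show ?thesis using *[of x y] *[of y x] by (cases "x <= y") (auto simp: abs_minus_commute)
qed

lemma (in prob_space) quadratic_diff:
  assumes fin: "finite I" and X: "!!n. n \<in> I ==> Lpb 2 B (X n)" and Y: "!!n. n \<in> I ==> Lpb 2 B (Y n)"
    and XY: "!!n. n \<in> I ==> Lpb 2 \<delta> (%w. X n w - Y n w)"
  shows "\<bar>expectation (%w. (\<Sum>n\<in>I. a n * X n w)\<^sup>2) - expectation (%w. (\<Sum>n\<in>I. a n * Y n w)\<^sup>2)\<bar> <= (\<Sum>n\<in>I. \<bar>a n\<bar>)\<^sup>2 * (4 * B * \<delta>)"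
proof -
  have S: "Lpb 2 (2 * (B + B)) (%w. X n w + Y n w)" if "n \<in> I" for n by (rule Lpb_add[OF X Y]) (use that in auto)
  have P: "integrable M (%w. (X n w - Y n w) * (X m w + Y m w))" "expectation (%w. \<bar>(X n w - Y n w) * (X m w + Y m w)\<bar>) <= \<delta> * (2 * (B + B))" if "n \<in> I" "m \<in> I" for n m
    by (rule Lpb_prod2[OF XY[OF that(1)] S[OF that(2)]]; simp)+
  have iX: "integrable M (%w. (\<Sum>n\<in>I. a n * X n w)\<^sup>2)" if X: "!!n. n \<in> I ==> Lpb 2 B (X n)" for X
    unfolding power2_eq_square sum_product
  proof (intro Bochner_Integration.integrable_sum)
    fix n m assume nm: "n \<in> I" "m \<in> I"
    have "integrable M (%w. X n w * X m w)" by (rule Lpb_prod2(1)[OF X[OF nm(1)] X[OF nm(2)]]) auto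
    then have "integrable M (%w. (a n * a m) * (X n w * X m w))" by simp
    then show "integrable M (%w. a n * X n w * (a m * X m w))" by (simp add: mult_ac)
  qed
  have "(\<Sum>n\<in>I. a n * X n w)\<^sup>2 - (\<Sum>n\<in>I. a n * Y n w)\<^sup>2 = (\<Sum>n\<in>I. \<Sum>m\<in>I. (a n * a m) * ((X n w - Y n w) * (X m w + Y m w)))" for w
  proof -
    have "(\<Sum>n\<in>I. a n * X n w)\<^sup>2 - (\<Sum>n\<in>I. a n * Y n w)\<^sup>2 = (\<Sum>n\<in>I. a n * (X n w - Y n w)) * (\<Sum>m\<in>I. a m * (X m w + Y m w))"
      by (simp add: power2_eq_square algebra_simps sum_subtractf sum.distrib)
    then show ?thesis by (simp add: sum_product mult_ac)
  qed
  then have "expectation (%w. (\<Sum>n\<in>I. a n * X n w)\<^sup>2) - expectation (%w. (\<Sum>n\<in>I. a n * Y n w)\<^sup>2)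
    = expectation (%w. \<Sum>n\<in>I. \<Sum>m\<in>I. (a n * a m) * ((X n w - Y n w) * (X m w + Y m w)))"
    using iX[OF X] iX[OF Y] by (simp flip: Bochner_Integration.integral_diff)
  also have "... = (\<Sum>n\<in>I. \<Sum>m\<in>I. (a n * a m) * expectation (%w. (X n w - Y n w) * (X m w + Y m w)))"
    using P(1) by (subst Bochner_Integration.integral_sum, force, intro sum.cong refl, subst Bochner_Integration.integral_sum) auto
  also have "\<bar>...\<bar> <= (\<Sum>n\<in>I. \<Sum>m\<in>I. \<bar>a n\<bar> * \<bar>a m\<bar> * (\<delta> * (2 * (B + B))))"
  proof (intro order_trans[OF sum_abs] sum_mono)
    fix n m assume nm: "n \<in> I" "m \<in> I"
    have "\<bar>expectation (%w. (X n w - Y n w) * (X m w + Y m w))\<bar> <= \<delta> * (2 * (B + B))"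
      by (rule abs_expectation_le) (use P[OF nm] in auto)
    then show "\<bar>a n * a m * expectation (%w. (X n w - Y n w) * (X m w + Y m w))\<bar> <= \<bar>a n\<bar> * \<bar>a m\<bar> * (\<delta> * (2 * (B + B)))"
      unfolding abs_mult by (intro mult_left_mono) auto
  qed
  also have "... = (\<Sum>n\<in>I. \<bar>a n\<bar>)\<^sup>2 * (4 * B * \<delta>)"
    unfolding sum_distrib_right[symmetric] sum_product[symmetric] sum_distrib_left[symmetric] by (simp add: power2_eq_square)
  finally show ?thesis .
qed

context nonconv_array begin

text \<open>The normal approximation is run on the approximations with window \<open>R\<close> and
  neighbourhood radius \<open>4 * R\<close>, so that a distance of more than \<open>2 * R\<close> is
  left for decorrelation. Returning to the original summands costs \<open>N * a0 * \<delta>\<close>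
  in sine and cosine by the Lipschitz property, and the square of \<open>N * a0\<close> times
  \<open>4 * A * \<delta>\<close> in the variance.\<close>

lemma trig_error:
  fixes pos :: "nat => nat => nat"
  assumes inj: "!!j. j < ell ==> inj (%n. pos n j)" and I: "finite I" and R: "R >= 1"
    and a: "!!n. n \<in> I ==> \<bar>a n\<bar> <= a0" "a0 >= 0"
  defines "X \<equiv> %n x. F (%i. \<xi> (pos n i) x)"
  defines "W \<equiv> %x. \<Sum>n\<in>I. a n * (X n x - expectation (X n))"
  defines "A \<equiv> 16 * c1" and "k \<equiv> real (ell * ell * (2 * (4 * R) + 1))" and "N \<equiv> real (card I)"
    and "\<alpha>1 \<equiv> 5 * D * (real (4 * R) + 1 - 2 * real R) powr (- (\<theta> * (1 - 2/w)))"
    and "\<alpha>2 \<equiv> 5 * D * (real (4 * R) + 1 - 2 * real R) powr (- (\<theta> * (1 - 3/w)))"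
    and "\<delta> \<equiv> 4 * c1 * real R powr (- \<theta>)"
  defines "e \<equiv> N * a0 * (\<alpha>1 * A + 4 * a0\<^sup>2 * k\<^sup>2 * A ^ 3 + k * a0 * \<alpha>2 * A\<^sup>2) + N\<^sup>2 * a0\<^sup>2 * \<alpha>1 * A\<^sup>2
     + N * a0 * \<delta> + (N * a0)\<^sup>2 * (4 * A * \<delta>)"
  shows "\<bar>expectation (%x. cos (W x)) - exp (- expectation (%x. (W x)\<^sup>2) / 2)\<bar> <= e" "\<bar>expectation (%x. sin (W x))\<bar> <= e"
proof -
  define Z where "Z = (%n x. F (%i. xr R (pos n i) x))"
  define Wr where "Wr = (%x. \<Sum>n\<in>I. a n * (Z n x - expectation (Z n)))"
  have w1: "w >= 1" and w0: "w > 0" using w4 by auto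
  have A0: "A > 0" using c1 by (simp add: A_def)
  have d0: "\<delta> >= 0" using c1 by (simp add: \<delta>_def)
  interpret B: mix_array M Z pos ell R D \<theta>
    using pair_mix_array[OF order_refl[of R] inj F_fst(1) F_fst_dep(1)] by (simp add: Z_def D_def)
  interpret Q: mix_array M "%n x. Z n x - expectation (Z n)" pos ell R D \<theta> by (rule B.mix_array_shift)
  have ZL: "Lpb w (4 * c1) (Z n)" for n unfolding Z_def by (rule approx_L[OF R])
  have XL: "Lpb w c1 (X n)" for n unfolding X_def by (rule FL)
  have DL: "Lpb w (c1 * real R powr (- \<theta>)) (%x. X n x - Z n x)" for n unfolding X_def Z_def by (rule FA[OF R])
  have iX: "integrable M (X n)" "integrable M (Z n)" for n using Lpb_1(1)[OF XL w1] Lpb_1(1)[OF ZL w1] by auto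
  have Xc: "Lpb w A (%x. X n x - expectation (X n))" for n
    by (rule Lpb_weaken[OF Lpb_center[OF XL w1]]) (use w4 c1 in \<open>auto simp: A_def\<close>)
  have Zc: "Lpb w A (%x. Z n x - expectation (Z n))" for n
    by (rule Lpb_weaken[OF Lpb_center[OF ZL w1]]) (use w4 c1 in \<open>auto simp: A_def\<close>)
  have Dc: "Lpb w \<delta> (%x. (X n x - expectation (X n)) - (Z n x - expectation (Z n)))" for n
    using Lpb_center[OF DL[of n] w1] iX[of n] by (simp add: \<delta>_def algebra_simps)
  have L2: "Lpb w B Y ==> Lpb 2 B Y" for B Y by (rule Lpb_lower) (use w4 in auto)
  have m0: "expectation (%x. Z n x - expectation (Z n)) = 0" for n using iX by (simp add: prob_space)
  have [measurable]: "X n \<in> borel_measurable M" "Z n \<in> borel_measurable M" for n using iX by auto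
  have Wm[measurable]: "W \<in> borel_measurable M" "Wr \<in> borel_measurable M" unfolding W_def Wr_def by measurable
  let ?c = "N * a0 * (\<alpha>1 * A + 4 * a0\<^sup>2 * k\<^sup>2 * A ^ 3 + k * a0 * \<alpha>2 * A\<^sup>2) + N\<^sup>2 * a0\<^sup>2 * \<alpha>1 * A\<^sup>2"
  have core: "\<bar>expectation (%x. cos (Wr x)) - exp (- expectation (%x. (Wr x)\<^sup>2) / 2)\<bar> <= ?c" "\<bar>expectation (%x. sin (Wr x))\<bar> <= ?c"
    using Q.trig_moments_close_to_gauss[OF I A0 w4 _ Zc m0 a(1) a(2), of "4 * R"]
    unfolding Wr_def k_def \<alpha>1_def \<alpha>2_def N_def by auto
  have sa: "(\<Sum>n\<in>I. \<bar>a n\<bar>) <= N * a0" using sum_bounded_above[of I "%n. \<bar>a n\<bar>" a0] a by (simp add: N_def)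
  have sa0: "0 <= (\<Sum>n\<in>I. \<bar>a n\<bar>)" by (intro sum_nonneg) auto
  have WWi: "integrable M (%x. \<bar>W x - Wr x\<bar>)" and WW: "expectation (%x. \<bar>W x - Wr x\<bar>) <= N * a0 * \<delta>"
  proof -
    have e: "W x - Wr x = (\<Sum>n\<in>I. a n * ((X n x - expectation (X n)) - (Z n x - expectation (Z n))))" for x
      unfolding W_def Wr_def sum_subtractf[symmetric] right_diff_distrib[symmetric] ..
    have i: "integrable M (%x. \<Sum>n\<in>I. \<bar>a n\<bar> * \<bar>(X n x - expectation (X n)) - (Z n x - expectation (Z n))\<bar>)"
      by (intro Bochner_Integration.integrable_sum integrable_mult_right integrable_abs Lpb_1(1)[OF Dc w1])
    have le: "\<bar>W x - Wr x\<bar> <= (\<Sum>n\<in>I. \<bar>a n\<bar> * \<bar>(X n x - expectation (X n)) - (Z n x - expectation (Z n))\<bar>)" for x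
      unfolding e by (rule order_trans[OF sum_abs]) (simp add: abs_mult)
    show WWi: "integrable M (%x. \<bar>W x - Wr x\<bar>)" by (rule Bochner_Integration.integrable_bound[OF i]) (use le in \<open>auto intro: order_trans[OF _ abs_ge_self]\<close>)
    have "expectation (%x. \<bar>W x - Wr x\<bar>) <= expectation (%x. \<Sum>n\<in>I. \<bar>a n\<bar> * \<bar>(X n x - expectation (X n)) - (Z n x - expectation (Z n))\<bar>)"
      by (rule integral_mono[OF WWi i le])
    also have "... = (\<Sum>n\<in>I. \<bar>a n\<bar> * expectation (%x. \<bar>(X n x - expectation (X n)) - (Z n x - expectation (Z n))\<bar>))"
      by (subst Bochner_Integration.integral_sum) (intro integrable_mult_right integrable_abs Lpb_1(1)[OF Dc w1], simp)
    also have "... <= (\<Sum>n\<in>I. \<bar>a n\<bar> * \<delta>)" by (intro sum_mono mult_left_mono Lpb_1(2)[OF Dc w1]) auto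
    also have "... <= N * a0 * \<delta>" unfolding sum_distrib_right[symmetric] by (rule mult_right_mono[OF sa d0])
    finally show "expectation (%x. \<bar>W x - Wr x\<bar>) <= N * a0 * \<delta>" .
  qed
  have lip: "\<bar>expectation (%x. f (W x)) - expectation (%x. f (Wr x))\<bar> <= N * a0 * \<delta>"
    if f: "!!x y. \<bar>f y - f x\<bar> <= \<bar>y - x\<bar>" "f \<in> borel_measurable borel" "!!x. \<bar>f x\<bar> <= 1" for f :: "real => real"
  proof -
    note [measurable] = f(2)
    have i: "integrable M (%x. f (W x))" "integrable M (%x. f (Wr x))" by (rule integrable_bounded_by[where c=1]; use f in auto)+
    have "expectation (%x. f (W x)) - expectation (%x. f (Wr x)) = expectation (%x. f (W x) - f (Wr x))" using i by simp
    also have "\<bar>...\<bar> <= expectation (%x. \<bar>f (W x) - f (Wr x)\<bar>)" by (rule integral_abs_bound)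
    also have "... <= expectation (%x. \<bar>W x - Wr x\<bar>)" by (rule integral_mono[OF _ WWi f(1)]) (use i in auto)
    finally show ?thesis using WW by linarith
  qed
  have "\<bar>expectation (%x. (W x)\<^sup>2) - expectation (%x. (Wr x)\<^sup>2)\<bar> <= (\<Sum>n\<in>I. \<bar>a n\<bar>)\<^sup>2 * (4 * A * \<delta>)"
    unfolding W_def Wr_def by (rule quadratic_diff[OF I L2[OF Xc] L2[OF Zc] L2[OF Dc]])
  also have "... <= (N * a0)\<^sup>2 * (4 * A * \<delta>)" using sa sa0 A0 d0 by (intro mult_right_mono power_mono) auto
  finally have q: "\<bar>expectation (%x. (W x)\<^sup>2) - expectation (%x. (Wr x)\<^sup>2)\<bar> <= (N * a0)\<^sup>2 * (4 * A * \<delta>)" .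
  have "\<bar>exp (- (expectation (%x. (W x)\<^sup>2) / 2)) - exp (- (expectation (%x. (Wr x)\<^sup>2) / 2))\<bar> <= \<bar>expectation (%x. (W x)\<^sup>2) / 2 - expectation (%x. (Wr x)\<^sup>2) / 2\<bar>"
    by (rule exp_minus_lipschitz) auto
  then have ex: "\<bar>exp (- expectation (%x. (W x)\<^sup>2) / 2) - exp (- expectation (%x. (Wr x)\<^sup>2) / 2)\<bar> <= (N * a0)\<^sup>2 * (4 * A * \<delta>)"
    using q by simp
  show "\<bar>expectation (%x. cos (W x)) - exp (- expectation (%x. (W x)\<^sup>2) / 2)\<bar> <= e"
    using core(1) ex lip[of cos, OF cos_lipschitz borel_measurable_continuous_onI[OF continuous_on_cos[OF continuous_on_id]] abs_cos_le_one] unfolding e_def by linarith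
  have "0 <= (N * a0)\<^sup>2 * (4 * A * \<delta>)" using A0 d0 by simp
  then show "\<bar>expectation (%x. sin (W x))\<bar> <= e"
    using core(2) lip[of sin, OF sin_lipschitz borel_measurable_continuous_onI[OF continuous_on_sin[OF continuous_on_id]] abs_sin_le_one] unfolding e_def by linarith
qed

text \<open>The window grows as \<open>N powr h\<close>. The rate \<open>G\<close> must not depend
  on the weights or the positions, because both change with \<open>N\<close> in the application; it
  depends on \<open>U\<close> only. Its six terms match those of the error in
  \<open>trig_error\<close>.\<close>

lemma trig_rate:
  assumes U: "U >= 0"
  shows "\<exists>G :: nat => real. G \<longlonglongrightarrow> 0 \<and>
    (\<forall>N a (pos :: nat => nat => nat). N >= 1 --> (\<forall>j<ell. inj (%n. pos n j)) --> (\<forall>n\<in>{1..N}. \<bar>a n\<bar> <= U / sqrt N) -->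
      \<bar>expectation (%x. cos (\<Sum>n\<in>{1..N}. a n * (F (%i. \<xi> (pos n i) x) - expectation (%x. F (%i. \<xi> (pos n i) x)))))
        - exp (- expectation (%x. (\<Sum>n\<in>{1..N}. a n * (F (%i. \<xi> (pos n i) x) - expectation (%x. F (%i. \<xi> (pos n i) x))))\<^sup>2) / 2)\<bar> <= G N \<and>
      \<bar>expectation (%x. sin (\<Sum>n\<in>{1..N}. a n * (F (%i. \<xi> (pos n i) x) - expectation (%x. F (%i. \<xi> (pos n i) x)))))\<bar> <= G N)"
proof -
  define t1 where "t1 = \<theta> * (1 - 2/w)"
  define t2 where "t2 = \<theta> * (1 - 3/w)"
  have t: "t1 > 4" "t2 > 2" "\<theta> > 4" using theta_bounds by (auto simp: t1_def t2_def)
  have tt: "t1 <= \<theta>" using mult_left_mono[of "1 - 2/w" 1 \<theta>] w4 t by (simp add: t1_def)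
  \<comment> \<open>Midpoint of the admissible interval: \<open>h < 1/4\<close> is needed for the
    term \<open>2 * h - 1/2\<close> of the squared neighbourhood size, \<open>h * t1 > 1\<close> for
    covariances summed over all pairs.\<close>
  define h where "h = (1 / t1 + 1 / 4) / 2"
  have "1 / t1 < 1 / 4" using t by (simp add: field_simps)
  then have h: "1 / t1 < h" "h < 1/4" by (auto simp: h_def)
  have h0: "h > 0" using h t by (meson less_trans zero_less_divide_1_iff zero_less_numeral)
  have ht: "1 < h * t1" using h t by (simp add: field_simps)
  have ht': "1 < h * \<theta>" by (rule less_le_trans[OF ht mult_left_mono[OF tt]]) (use h0 in simp)
  have ht2: "h < h * t2" using h0 t by simp
  define A where "A = 16 * c1"
  define d5 where "d5 = 5 * D"
  have A0: "A > 0" "d5 >= 0" using c1 d1 by (auto simp: A_def D_def d5_def)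
  define L where "L = 9 * real ell ^ 2"
  define dd where "dd = 4 * c1 * 2 powr \<theta>"
  define G where "G = (%N::nat. U * d5 * A * real N powr (1/2 - h * t1) + 4 * U ^ 3 * A ^ 3 * L\<^sup>2 * real N powr (2 * h - 1/2)
     + U\<^sup>2 * A\<^sup>2 * L * d5 * real N powr (h - h * t2) + U\<^sup>2 * A\<^sup>2 * d5 * real N powr (1 - h * t1)
     + U * dd * real N powr (1/2 - h * \<theta>) + U\<^sup>2 * (4 * A * dd) * real N powr (1 - h * \<theta>))"
  have p0: "(%N::nat. real N powr y) \<longlonglongrightarrow> 0" if "y < 0" for y
    by (rule tendsto_neg_powr[OF that filterlim_real_sequentially])
  have "G \<longlonglongrightarrow> U * d5 * A * 0 + 4 * U ^ 3 * A ^ 3 * L\<^sup>2 * 0 + U\<^sup>2 * A\<^sup>2 * L * d5 * 0 + U\<^sup>2 * A\<^sup>2 * d5 * 0 + U * dd * 0 + U\<^sup>2 * (4 * A * dd) * 0"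
    unfolding G_def by (intro tendsto_add tendsto_mult tendsto_const p0) (use ht ht' ht2 h in auto)
  then have G0: "G \<longlonglongrightarrow> 0" by simp
  show ?thesis
  proof (intro exI[of _ G] conjI[OF G0] allI impI)
    fix N :: nat and a :: "nat => real" and pos :: "nat => nat => nat"
    assume N: "N >= 1" and inj': "\<forall>j<ell. inj (%n. pos n j)" and a: "\<forall>n\<in>{1..N}. \<bar>a n\<bar> <= U / sqrt N"
    have inj: "!!j. j < ell ==> inj (%n. pos n j)" using inj' by blast
    define x where "x = real N"
    have x1: "x >= 1" using N by (simp add: x_def)
    define R where "R = nat \<lfloor>x powr h\<rfloor>"
    have xh: "x powr h >= 1" using x1 h0 by (simp add: ge_one_powr_ge_zero)
    then have R1: "R >= 1" unfolding R_def by (simp add: le_nat_iff)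
    have Rle: "real R <= x powr h" unfolding R_def by (rule nat_floor_le) simp
    have Rgt: "x powr h < real R + 1" unfolding R_def by (rule nat_floor_gt)
    define a0 where "a0 = U / sqrt x"
    have Na0: "x * a0 = U * x powr (1/2)" using x1 by (simp add: a0_def powr_half_sqrt real_div_sqrt field_simps)
    have a02: "x * a0 ^ 2 = U ^ 2" using x1 by (simp add: a0_def power_divide)
    have a00: "a0 >= 0" using U x1 by (simp add: a0_def)
    define k where "k = real (ell * ell * (2 * (4 * R) + 1))"
    define al1 where "al1 = 5 * D * (real (4 * R) + 1 - 2 * real R) powr (- (\<theta> * (1 - 2/w)))"
    define al2 where "al2 = 5 * D * (real (4 * R) + 1 - 2 * real R) powr (- (\<theta> * (1 - 3/w)))"
    define dl where "dl = 4 * c1 * real R powr (- \<theta>)"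
    have base: "x powr h <= real (4 * R) + 1 - 2 * real R" using Rgt by simp
    have al: "al1 <= d5 * x powr (- (h * t1))" "al2 <= d5 * x powr (- (h * t2))"
    proof -
      have "(real (4 * R) + 1 - 2 * real R) powr (- t) <= x powr (- (h * t))" if "t > 0" for t
      proof -
        have "(real (4 * R) + 1 - 2 * real R) powr (- t) <= (x powr h) powr (- t)" by (rule powr_mono2') (use that base xh in auto)
        then show ?thesis by (simp add: powr_powr)
      qed
      then show "al1 <= d5 * x powr (- (h * t1))" "al2 <= d5 * x powr (- (h * t2))"
        unfolding al1_def al2_def d5_def[symmetric] t1_def[symmetric] t2_def[symmetric] using t A0 by (auto intro!: mult_left_mono)
    qed
    have alp: "al1 >= 0" "al2 >= 0" using A0 by (auto simp: al1_def al2_def d5_def)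
    have kL: "k <= L * x powr h"
    proof -
      have "2 * (4 * real R) + 1 <= 9 * x powr h" using Rle xh by linarith
      then have "real ell ^ 2 * (2 * (4 * real R) + 1) <= real ell ^ 2 * (9 * x powr h)" by (intro mult_left_mono) auto
      moreover have "k = real ell ^ 2 * (2 * (4 * real R) + 1)" unfolding k_def power2_eq_square of_nat_mult of_nat_add of_nat_1 of_nat_numeral ..
      moreover have "L * x powr h = real ell ^ 2 * (9 * x powr h)" by (simp add: L_def)
      ultimately show ?thesis by (simp only:)
    qed
    have k0: "k >= 0" and L0: "L >= 0" by (auto simp: k_def L_def)
    have dle: "dl <= dd * x powr (- (h * \<theta>))"
    proof -
      have "x powr h / 2 <= real R" using Rgt R1 by simp
      then have "real R powr (- \<theta>) <= (x powr h / 2) powr (- \<theta>)" by (intro powr_mono2') (use t xh in auto)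
      also have "... = 2 powr \<theta> * x powr (- (h * \<theta>))" using x1 by (simp add: powr_divide powr_powr powr_minus field_simps)
      finally show ?thesis using c1 by (simp add: dl_def dd_def)
    qed
    have d0: "dl >= 0" "dd >= 0" using c1 by (auto simp: dl_def dd_def)
    have "x * a0 * (al1 * A + 4 * a0\<^sup>2 * k\<^sup>2 * A ^ 3 + k * a0 * al2 * A\<^sup>2) + x\<^sup>2 * a0\<^sup>2 * al1 * A\<^sup>2
     + x * a0 * dl + (x * a0)\<^sup>2 * (4 * A * dl) <= G N"
    proof -
      have e1: "x * a0 * (al1 * A) <= U * d5 * A * x powr (1/2 - h * t1)"
      proof -
        have "x * a0 * (al1 * A) <= U * x powr (1/2) * (d5 * x powr (- (h * t1)) * A)"
          unfolding Na0 using U A0 al by (intro mult_left_mono mult_right_mono) auto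
        also have "... = U * d5 * A * (x powr (1/2) * x powr (- (h * t1)))" by simp
        finally show ?thesis by (simp flip: powr_add)
      qed
      have e2: "x * a0 * (4 * a0\<^sup>2 * k\<^sup>2 * A ^ 3) <= 4 * U ^ 3 * A ^ 3 * L\<^sup>2 * x powr (2 * h - 1/2)"
      proof -
        have "x * a0 * (4 * a0\<^sup>2 * k\<^sup>2 * A ^ 3) = 4 * (x * a0\<^sup>2) * a0 * k\<^sup>2 * A ^ 3" by (simp add: power2_eq_square)
        also have "... <= 4 * (x * a0\<^sup>2) * a0 * (L * x powr h)\<^sup>2 * A ^ 3"
          using kL k0 A0 x1 a00 by (intro mult_right_mono mult_left_mono power_mono) auto
        also have "... = 4 * U ^ 3 * A ^ 3 * L\<^sup>2 * ((x powr h)\<^sup>2 * (1 / sqrt x))" unfolding a02 by (simp add: a0_def power2_eq_square power3_eq_cube)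
        also have "(x powr h)\<^sup>2 * (1 / sqrt x) = x powr (2 * h - 1/2)" using x1
          by (simp add: power2_eq_square powr_diff powr_half_sqrt flip: powr_add)
        finally show ?thesis .
      qed
      have e3: "x * a0 * (k * a0 * al2 * A\<^sup>2) <= U\<^sup>2 * A\<^sup>2 * L * d5 * x powr (h - h * t2)"
      proof -
        have "x * a0 * (k * a0 * al2 * A\<^sup>2) = (x * a0\<^sup>2) * A\<^sup>2 * (k * al2)" by (simp add: power2_eq_square)
        also have "... <= (x * a0\<^sup>2) * A\<^sup>2 * ((L * x powr h) * (d5 * x powr (- (h * t2))))"
          using kL k0 al alp L0 x1 by (intro mult_left_mono mult_mono) auto
        also have "... = U\<^sup>2 * A\<^sup>2 * L * d5 * (x powr h * x powr (- (h * t2)))" unfolding a02 by simp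
        finally show ?thesis by (simp flip: powr_add)
      qed
      have x2: "x\<^sup>2 * a0\<^sup>2 = U\<^sup>2 * x" using a02 by (simp add: power2_eq_square mult_ac)
      have xp: "x * x powr y = x powr (1 + y)" for y using x1 by (simp add: powr_add)
      have e4: "x\<^sup>2 * a0\<^sup>2 * al1 * A\<^sup>2 <= U\<^sup>2 * A\<^sup>2 * d5 * x powr (1 - h * t1)"
      proof -
        have "x\<^sup>2 * a0\<^sup>2 * al1 * A\<^sup>2 <= U\<^sup>2 * x * (d5 * x powr (- (h * t1))) * A\<^sup>2"
          unfolding x2 using al x1 by (intro mult_right_mono mult_left_mono) auto
        also have "... = U\<^sup>2 * A\<^sup>2 * d5 * (x * x powr (- (h * t1)))" by simp
        finally show ?thesis unfolding xp by simp
      qed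
      have e5: "x * a0 * dl <= U * dd * x powr (1/2 - h * \<theta>)"
      proof -
        have "x * a0 * dl <= U * x powr (1/2) * (dd * x powr (- (h * \<theta>)))"
          unfolding Na0 using U dle by (intro mult_left_mono) auto
        also have "... = U * dd * (x powr (1/2) * x powr (- (h * \<theta>)))" by simp
        finally show ?thesis by (simp flip: powr_add)
      qed
      have e6: "(x * a0)\<^sup>2 * (4 * A * dl) <= U\<^sup>2 * (4 * A * dd) * x powr (1 - h * \<theta>)"
      proof -
        have "(x * a0)\<^sup>2 * (4 * A * dl) <= U\<^sup>2 * x * (4 * A * (dd * x powr (- (h * \<theta>))))"
          unfolding power_mult_distrib x2 using dle A0 x1 by (intro mult_left_mono) auto
        also have "... = U\<^sup>2 * (4 * A * dd) * (x * x powr (- (h * \<theta>)))" by simp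
        finally show ?thesis unfolding xp by simp
      qed
      show ?thesis unfolding G_def x_def[symmetric] using e1 e2 e3 e4 e5 e6 by (simp add: distrib_left)
    qed
    moreover have "real (card {1..N}) = x" by (simp add: x_def)
    moreover note trig_error[where pos=pos and a=a and ?a0.0=a0, OF inj finite_atLeastAtMost[of 1 N] R1]
    ultimately show "\<bar>expectation (%x. cos (\<Sum>n\<in>{1..N}. a n * (F (%i. \<xi> (pos n i) x) - expectation (%x. F (%i. \<xi> (pos n i) x)))))
        - exp (- expectation (%x. (\<Sum>n\<in>{1..N}. a n * (F (%i. \<xi> (pos n i) x) - expectation (%x. F (%i. \<xi> (pos n i) x))))\<^sup>2) / 2)\<bar> <= G N \<and>
      \<bar>expectation (%x. sin (\<Sum>n\<in>{1..N}. a n * (F (%i. \<xi> (pos n i) x) - expectation (%x. F (%i. \<xi> (pos n i) x)))))\<bar> <= G N"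
      using a a00 unfolding k_def[symmetric] al1_def[symmetric] al2_def[symmetric] dl_def[symmetric] A_def[symmetric]
      by (auto simp: a0_def x_def intro: order_trans)
  qed
qed

lemma fclt:
  fixes pos :: "nat => nat => nat => nat"
  defines "X \<equiv> %N n x. F (%i. \<xi> (pos N n i) x)"
  assumes inj: "!!N j. j < ell ==> inj (%n. pos N n j)"
    and mean: "(%N. (\<Sum>n\<in>{1..N}. \<bar>expectation (X N n)\<bar>) / sqrt N) \<longlonglongrightarrow> 0"
    and cov: "!!t s. t \<in> {0..1} ==> s \<in> {0..1} ==>
       (%N. expectation (%w. (1 / sqrt N * (\<Sum>n\<in>{1..nat \<lfloor>real N * t\<rfloor>}. X N n w)) * (1 / sqrt N * (\<Sum>n\<in>{1..nat \<lfloor>real N * s\<rfloor>}. X N n w)))) \<longlonglongrightarrow> b t s"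
  shows "\<exists>Q. centered_gaussian_D_law Q b \<and> conv_distr_D M (%N w t. 1 / sqrt N * (\<Sum>n\<in>{1..nat \<lfloor>real N * t\<rfloor>}. X N n w)) Q"
proof -
  define C where "C = 2048 * c1 * sqrt (2 * KK) + 8 * c1"
  have C0: "C > 0" using c1 KK_pos by (simp add: C_def add_pos_pos)
  have w1: "w >= 1" using w4 by simp
  have trig: "(%N. expectation (%w. cos (\<Sum>i<m. u i * (1 / sqrt N * (\<Sum>n\<in>{1..nat \<lfloor>real N * ts i\<rfloor>}. X N n w - expectation (X N n)))))
         - exp (- expectation (%w. (\<Sum>i<m. u i * (1 / sqrt N * (\<Sum>n\<in>{1..nat \<lfloor>real N * ts i\<rfloor>}. X N n w - expectation (X N n))))\<^sup>2) / 2)) \<longlonglongrightarrow> 0 \<and>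
       (%N. expectation (%w. sin (\<Sum>i<m. u i * (1 / sqrt N * (\<Sum>n\<in>{1..nat \<lfloor>real N * ts i\<rfloor>}. X N n w - expectation (X N n)))))) \<longlonglongrightarrow> 0"
    if ts: "!!i. i < m ==> ts i \<in> {0..1}" for m :: nat and ts u
  proof -
    have U0: "0 <= (\<Sum>i<m. \<bar>u i\<bar>)" by (intro sum_nonneg) auto
    \<comment> \<open>A linear combination of partial sums at several times is one weighted sum over
      all \<open>n\<close>; each weight collects the coefficients of the times not yet passed by
      \<open>n\<close>.\<close>
    define a where "a = (%N n. \<Sum>i<m. u i * (1 / sqrt (real N)) * (if n <= nat \<lfloor>real N * ts i\<rfloor> then 1 else 0))"
    have e: "(\<Sum>i<m. u i * (1 / sqrt N * (\<Sum>n\<in>{1..nat \<lfloor>real N * ts i\<rfloor>}. c n))) = (\<Sum>n\<in>{1..N}. a N n * c n)" for N and c :: "nat => real"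
    proof -
      have "(\<Sum>n\<in>{1..nat \<lfloor>real N * ts i\<rfloor>}. c n) = (\<Sum>n\<in>{1..N}. (if n <= nat \<lfloor>real N * ts i\<rfloor> then 1 else 0) * c n)" if "i < m" for i
      proof (rule sum.mono_neutral_cong_left)
        have "nat \<lfloor>real N * ts i\<rfloor> <= N" using grid_index[OF ts[OF that], of "real N"] by simp
        then show "{1..nat \<lfloor>real N * ts i\<rfloor>} \<subseteq> {1..N}" by auto
      qed auto
      then have "(\<Sum>i<m. u i * (1 / sqrt N * (\<Sum>n\<in>{1..nat \<lfloor>real N * ts i\<rfloor>}. c n))) = (\<Sum>i<m. \<Sum>n\<in>{1..N}. u i * (1 / sqrt (real N)) * (if n <= nat \<lfloor>real N * ts i\<rfloor> then 1 else 0) * c n)"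
        by (intro sum.cong refl) (simp add: sum_distrib_left mult.assoc)
      also have "... = (\<Sum>n\<in>{1..N}. a N n * c n)" unfolding a_def sum_distrib_right by (rule sum.swap)
      finally show ?thesis .
    qed
    have ab: "\<bar>a N n\<bar> <= (\<Sum>i<m. \<bar>u i\<bar>) / sqrt N" for N n
      unfolding a_def sum_divide_distrib by (rule order_trans[OF sum_abs]) (intro sum_mono, simp add: abs_mult)
    obtain G :: "nat => real" where G0: "G \<longlonglongrightarrow> 0" and
      G: "\<forall>N a (pos :: nat => nat => nat). N >= 1 --> (\<forall>j<ell. inj (%n. pos n j)) --> (\<forall>n\<in>{1..N}. \<bar>a n\<bar> <= (\<Sum>i<m. \<bar>u i\<bar>) / sqrt N) -->
      \<bar>expectation (%x. cos (\<Sum>n\<in>{1..N}. a n * (F (%i. \<xi> (pos n i) x) - expectation (%x. F (%i. \<xi> (pos n i) x)))))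
        - exp (- expectation (%x. (\<Sum>n\<in>{1..N}. a n * (F (%i. \<xi> (pos n i) x) - expectation (%x. F (%i. \<xi> (pos n i) x))))\<^sup>2) / 2)\<bar> <= G N \<and>
      \<bar>expectation (%x. sin (\<Sum>n\<in>{1..N}. a n * (F (%i. \<xi> (pos n i) x) - expectation (%x. F (%i. \<xi> (pos n i) x)))))\<bar> <= G N"
      using trig_rate[OF U0] by blast
    have ev: "\<forall>\<^sub>F N in sequentially. N >= (1::nat)" by (rule eventually_ge_at_top)
    have GN: "\<bar>expectation (%x. cos (\<Sum>n\<in>{1..N}. a N n * (F (%i. \<xi> (pos N n i) x) - expectation (%x. F (%i. \<xi> (pos N n i) x)))))
        - exp (- expectation (%x. (\<Sum>n\<in>{1..N}. a N n * (F (%i. \<xi> (pos N n i) x) - expectation (%x. F (%i. \<xi> (pos N n i) x))))\<^sup>2) / 2)\<bar> <= G N \<and>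
      \<bar>expectation (%x. sin (\<Sum>n\<in>{1..N}. a N n * (F (%i. \<xi> (pos N n i) x) - expectation (%x. F (%i. \<xi> (pos N n i) x)))))\<bar> <= G N" if "N >= 1" for N
      by (rule G[rule_format, OF that inj ab])
    show ?thesis unfolding e X_def
      by (intro conjI Lim_null_comparison[OF eventually_mono[OF ev] G0]) (use GN in auto)
  qed
  interpret clt_array M X C b
  proof
    show "integrable M (X N n)" for N n unfolding X_def by (rule Lpb_1(1)[OF FL w1])
    show "Lpb 3 (C * sqrt (card I)) (%w. \<Sum>n\<in>I. (X N n w - expectation (X N n)))" if "finite I" for N I
      using third_moment_sum[where pos="pos N", OF inj that] unfolding X_def C_def by simp
  qed (use C0 mean cov trig in auto)
  show ?thesis using functional_clt unfolding U_def Q_def .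
qed

end

section \<open>Hoelder functionals of random vectors\<close>

lemma convex_abs_powr: assumes p: "p >= 1" shows "convex_on UNIV (%x::real. \<bar>x\<bar> powr p)"
proof (rule convex_onI)
  fix t x y :: real assume t: "0 < t" "t < 1"
  have small: "s powr p <= s" if "0 < s" "s < 1" for s :: real
    using powr_mono'[of 1 p s] that p by simp
  let ?a = "\<bar>x\<bar>" and ?b = "\<bar>y\<bar>"
  have "\<bar>(1 - t) *\<^sub>R x + t *\<^sub>R y\<bar> <= (1 - t) * ?a + t * ?b" using abs_triangle_ineq[of "(1 - t) * x" "t * y"] t by (simp add: abs_mult)
  then have "\<bar>(1 - t) *\<^sub>R x + t *\<^sub>R y\<bar> powr p <= ((1 - t) * ?a + t * ?b) powr p" using p by (intro powr_mono2) auto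
  also have "... <= (1 - t) * ?a powr p + t * ?b powr p"
  proof (cases "x = 0 \<or> y = 0")
    case False
    then show ?thesis using convex_onD[OF powr_convex[OF p], of t ?a ?b] t by simp
  next
    case True
    have "((1 - t) * ?a) powr p <= (1 - t) * ?a powr p" "(t * ?b) powr p <= t * ?b powr p"
      using small[of t] small[of "1 - t"] t by (auto simp: powr_mult intro!: mult_right_mono)
    then show ?thesis using True by auto
  qed
  finally show "\<bar>(1 - t) *\<^sub>R x + t *\<^sub>R y\<bar> powr p <= (1 - t) * \<bar>x\<bar> powr p + t * \<bar>y\<bar> powr p" .
qed simp

context prob_space begin

lemma Lpb_cond_exp:
  assumes X: "Lpb p A X" "p >= 1" and sub: "subalgebra M G" shows "Lpb p A (real_cond_exp M G X)"
proof -
  interpret finite_measure_subalgebra M G by standard (rule sub)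
  let ?q = "%x::real. \<bar>x\<bar> powr p"
  have iX: "integrable M X" and iq: "integrable M (%x. ?q (X x))" using Lpb_1(1)[OF X] X by (auto simp: Lpb_def)
  have J: "AE x in M. ?q (real_cond_exp M G X x) <= real_cond_exp M G (%x. ?q (X x)) x"
    by (rule real_cond_exp_jensens_inequality(2)[OF iX _ _ iq convex_abs_powr[OF X(2)]]) auto
  have i: "integrable M (%x. ?q (real_cond_exp M G X x))"
    by (rule Bochner_Integration.integrable_bound[OF real_cond_exp_int(1)[OF iq]]) (use J in \<open>auto elim!: eventually_mono\<close>)
  have "expectation (%x. ?q (real_cond_exp M G X x)) <= expectation (real_cond_exp M G (%x. ?q (X x)))"
    by (rule integral_mono_AE[OF i real_cond_exp_int(1)[OF iq] J])
  also have "... = expectation (%x. ?q (X x))" by (rule real_cond_exp_int(2)[OF iq])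
  finally show ?thesis using X i by (auto simp: Lpb_def)
qed

lemma Lpb_cond_exp_vec:
  fixes X :: "'a => 'b::euclidean_space"
  assumes X: "X \<in> borel_measurable M" "Lpb p A (%x. norm (X x))" "p >= 1" and sub: "subalgebra M G"
  shows "Lpb p (real DIM('b) ^ 2 * A) (%x. norm (cond_exp_vec M G X x))"
proof -
  have A: "A >= 0" using X by (simp add: Lpb_def)
  have c: "Lpb p A (%x. \<bar>real_cond_exp M G (%x. X x \<bullet> b) x\<bar>)" if b: "b \<in> Basis" for b
  proof -
    have "Lpb p A (%x. X x \<bullet> b)"
      by (rule Lpb_mono[OF X(2)]) (use X b Basis_le_norm in auto)
    from Lpb_cond_exp[OF this X(3) sub] show ?thesis by (simp add: Lpb_def)
  qed
  have s: "Lpb p (real DIM('b) ^ 2 * A) (%x. \<Sum>b\<in>Basis. \<bar>real_cond_exp M G (%x. X x \<bullet> b) x\<bar>)"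
    by (rule Lpb_sum) (use c X A in auto)
  show ?thesis
  proof (rule Lpb_mono[OF s])
    show "(%x. norm (cond_exp_vec M G X x)) \<in> borel_measurable M"
      unfolding cond_exp_vec_def by measurable
    fix x
    have "norm (cond_exp_vec M G X x) <= (\<Sum>b\<in>Basis. norm (real_cond_exp M G (%x. X x \<bullet> b) x *\<^sub>R b))"
      unfolding cond_exp_vec_def by (rule norm_sum)
    also have "... = (\<Sum>b\<in>Basis. \<bar>real_cond_exp M G (%x. X x \<bullet> b) x\<bar>)" by (intro sum.cong) auto
    finally show "\<bar>norm (cond_exp_vec M G X x)\<bar> <= \<bar>\<Sum>b\<in>Basis. \<bar>real_cond_exp M G (%x. X x \<bullet> b) x\<bar>\<bar>" by simp
  qed (use X in auto)
qed

lemma Lpb_of_Lp_norm: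
  fixes f :: "'a => 'b::euclidean_space"
  assumes f[measurable]: "f \<in> borel_measurable M" and fin: "Lp_norm M p f < \<infinity>" and p: "p > 0"
  shows "Lpb p (real_of_ereal (Lp_norm M p f)) (%x. norm (f x))"
proof -
  define I where "I = (\<integral>\<^sup>+ x. ennreal (norm (f x) powr p) \<partial>M)"
  have I: "I \<noteq> \<infinity>" and L: "Lp_norm M p f = ereal (enn2real I powr (1 / p))"
    using fin by (auto simp: Lp_norm_def I_def[symmetric] Let_def split: if_splits)
  have i: "integrable M (%x. norm (f x) powr p)"
    by (rule integrableI_nonneg) (use I in \<open>auto simp: I_def top.not_eq_extremum\<close>)
  have "expectation (%x. norm (f x) powr p) = enn2real I"
    unfolding I_def by (rule integral_eq_nn_integral) auto
  then show ?thesis using p i by (simp add: Lpb_def L powr_powr)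
qed

lemma Lpb_powr:
  assumes X: "Lpb p A X" and s: "s > 0" and p: "p > 0" shows "Lpb (p / s) (A powr s) (%x. \<bar>X x\<bar> powr s)"
  using assms by (auto simp: Lpb_def powr_powr)

lemma clip_tail_bound:
  assumes X: "Lpb w A X" and w: "w >= 1" and s: "s > 0"
  shows "expectation (%x. \<bar>X x - clip s (X x)\<bar>) <= A powr w * s powr (1 - w)"
proof -
  have i: "integrable M (%x. \<bar>X x\<bar> powr w)" "expectation (%x. \<bar>X x\<bar> powr w) <= A powr w" and [measurable]: "X \<in> borel_measurable M"
    using X by (auto simp: Lpb_def)
  have le: "\<bar>X x - clip s (X x)\<bar> <= s powr (1 - w) * \<bar>X x\<bar> powr w" for x
  proof (cases "\<bar>X x\<bar> <= s")
    case True then show ?thesis using clip_tail[of s "X x"] s by simp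
  next
    case False
    then have "\<bar>X x\<bar> = \<bar>X x\<bar> powr (1 - w) * \<bar>X x\<bar> powr w" using s by (simp flip: powr_add)
    also have "... <= s powr (1 - w) * \<bar>X x\<bar> powr w" using False s w by (intro mult_right_mono powr_mono2') auto
    finally show ?thesis using clip_tail[of s "X x"] False s by simp
  qed
  have "expectation (%x. \<bar>X x - clip s (X x)\<bar>) <= expectation (%x. s powr (1 - w) * \<bar>X x\<bar> powr w)"
    by (rule expectation_abs_mono) (use le i in auto)
  also have "... <= s powr (1 - w) * A powr w" using i by (simp add: mult_left_mono)
  finally show ?thesis by (simp add: mult.commute)
qed

end

section \<open>Moment bounds for functionals with the Hoelder and growth conditions\<close>

locale hoelder_functional =
  fixes F :: "(nat => 'b::euclidean_space) => real" and ell :: nat and K \<iota> \<kappa> w q v :: real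
  assumes F_hoelder: "!!x z. \<bar>F x - F z\<bar> <=
          K * (1 + (\<Sum>i<ell. npow (norm (x i)) \<iota> + npow (norm (z i)) \<iota>)) *
          (\<Sum>i<ell. norm (x i - z i) powr \<kappa>)"
    and F_growth: "!!x. \<bar>F x\<bar> <= K * (1 + (\<Sum>i<ell. npow (norm (x i)) \<iota>))"
    and K0: "K > 0" and iota0: "\<iota> >= 0" and kappa: "0 < \<kappa>" "\<kappa> <= 1"
    and w4: "w > 4" and q1: "q >= 1" and v1: "v >= 1" and expo: "1 / w > \<iota> / v + \<kappa> / q"
begin

lemma F_dep: "dep {..<ell} F"
  unfolding dep_def
proof (intro allI impI)
  fix x y :: "nat => 'b" assume "\<forall>k\<in>{..<ell}. x k = y k"
  then have "(\<Sum>i<ell. norm (x i - y i) powr \<kappa>) = 0" by simp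
  then show "F x = F y" using F_hoelder[of x y] by simp
qed

lemma F_cont: "continuous_on UNIV F"
proof (rule continuous_on_sequentiallyI)
  fix z :: "nat => nat => 'b" and a assume z: "z \<longlonglongrightarrow> a"
  have zi: "(%n. z n i) \<longlonglongrightarrow> a i" for i
    by (rule continuous_on_tendsto_compose[OF continuous_on_product_coordinates[of i] z]) auto
  have np: "(%n. npow (norm (z n i)) \<iota>) \<longlonglongrightarrow> npow (norm (a i)) \<iota>" for i
    using iota0 by (cases "\<iota> = 0") (auto simp: npow_def intro!: tendsto_powr2 tendsto_norm zi)
  have nd: "(%n. norm (z n i - a i) powr \<kappa>) \<longlonglongrightarrow> 0" for i
  proof -
    have "(%n. norm (z n i - a i) powr \<kappa>) \<longlonglongrightarrow> norm (a i - a i) powr \<kappa>"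
      by (intro tendsto_powr2 tendsto_norm tendsto_diff zi tendsto_const) (use kappa in auto)
    then show ?thesis using kappa by simp
  qed
  have "(%n. K * (1 + (\<Sum>i<ell. npow (norm (z n i)) \<iota> + npow (norm (a i)) \<iota>)) * (\<Sum>i<ell. norm (z n i - a i) powr \<kappa>)) \<longlonglongrightarrow>
     K * (1 + (\<Sum>i<ell. npow (norm (a i)) \<iota> + npow (norm (a i)) \<iota>)) * (\<Sum>i<ell. 0)"
    by (intro tendsto_intros np nd)
  then have l: "(%n. K * (1 + (\<Sum>i<ell. npow (norm (z n i)) \<iota> + npow (norm (a i)) \<iota>)) * (\<Sum>i<ell. norm (z n i - a i) powr \<kappa>)) \<longlonglongrightarrow> 0" by simp
  have "(%n. F (z n) - F a) \<longlonglongrightarrow> 0"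
    by (rule Lim_null_comparison[OF _ l]) (use F_hoelder in auto)
  then show "(%n. F (z n)) \<longlonglongrightarrow> F a" by (rule LIM_zero_cancel)
qed

text \<open>The moment left for the growth factor in the Hoelder condition: that factor in L^p1
  times increments to the power \<open>\<kappa>\<close> in L^(q/kappa) gives L^w. The exponent
  condition guarantees \<open>p1 <= v / \<iota>\<close>, so the available moments suffice.\<close>

definition "p1 = 1 / (1 / w - \<kappa> / q)"

lemma p1: "p1 > 0" "p1 >= w" "p1 >= 1" "1 / p1 + \<kappa> / q = 1 / w" "\<iota> > 0 ==> p1 <= v / \<iota>"
proof -
  have nn: "\<iota> / v >= 0" "\<kappa> / q > 0" using iota0 v1 kappa q1 by auto
  then have pp: "1 / w - \<kappa> / q > 0" using expo by linarith
  then show "p1 > 0" unfolding p1_def by simp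
  have "1 / (1 / w) <= p1" unfolding p1_def using pp nn w4 by (intro divide_left_mono) auto
  then show "p1 >= w" by simp
  then show "p1 >= 1" using w4 by simp
  show "1 / p1 + \<kappa> / q = 1 / w" by (simp add: p1_def)
  show "p1 <= v / \<iota>" if "\<iota> > 0"
  proof -
    have "p1 <= 1 / (\<iota> / v)" unfolding p1_def using expo nn that v1 pp by (intro divide_left_mono) auto
    then show ?thesis by simp
  qed
qed

text \<open>One constant for both the growth and the difference estimate; the last factor dominates
  1 as well as the squared number of arguments.\<close>

definition cst where "cst A = K * (2 * (1 + real ell ^ 2 * (4 * (1 + A powr \<iota>)))) * (real ell ^ 2 + 1)"

lemma npow_L:
  assumes P: "prob_space M" and X: "prob_space.Lpb M v A X" and X0: "!!x. X x >= 0"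
  shows "prob_space.Lpb M p1 (1 + A powr \<iota>) (%x. npow (X x) \<iota>)"
proof -
  interpret prob_space M by (rule P)
  show ?thesis
  proof (cases "\<iota> = 0")
    case True
    have "Lpb p1 (1 + A powr \<iota>) (%x. 1)" by (rule Lpb_weaken[OF Lpb_const[of p1 1]]) (use p1 in auto)
    then show ?thesis using True by (simp add: npow_def)
  next
    case False
    then have i: "\<iota> > 0" using iota0 by simp
    have "Lpb p1 (A powr \<iota>) (%x. \<bar>X x\<bar> powr \<iota>)"
      by (rule Lpb_lower[OF Lpb_powr[OF X i]]) (use v1 p1 i in auto)
    then have "Lpb p1 (1 + A powr \<iota>) (%x. \<bar>X x\<bar> powr \<iota>)" by (rule Lpb_weaken) (use p1 in auto)
    then show ?thesis using False X0 by (simp add: npow_def)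
  qed
qed

lemma F_meas:
  assumes "!!i. x i \<in> borel_measurable M" shows "(%w. F (%i. x i w)) \<in> borel_measurable M"
proof -
  have "(%w i. x i w) \<in> borel_measurable M" by (rule measurable_coordinatewise_then_product) (rule assms)
  from measurable_compose[OF this borel_measurable_continuous_onI[OF F_cont]] show ?thesis .
qed

lemma diff_L:
  assumes P: "prob_space M" and m: "!!i. x i \<in> borel_measurable M" "!!i. z i \<in> borel_measurable M"
    and x: "!!i. i < ell ==> prob_space.Lpb M v A (%w. norm (x i w))" and z: "!!i. i < ell ==> prob_space.Lpb M v A (%w. norm (z i w))"
    and d: "!!i. i < ell ==> prob_space.Lpb M q \<delta> (%w. norm (x i w - z i w))"
  shows "prob_space.Lpb M w (cst A * \<delta> powr \<kappa>) (%w. F (%i. x i w) - F (%i. z i w))"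
proof -
  interpret prob_space M by (rule P)
  let ?a = "1 + A powr \<iota>"
  have s: "Lpb p1 (real ell ^ 2 * (2 * (?a + ?a))) (%w. \<Sum>i<ell. npow (norm (x i w)) \<iota> + npow (norm (z i w)) \<iota>)"
    by (rule Lpb_sum) (use Lpb_add[OF npow_L[OF P x] npow_L[OF P z] p1(3)] p1 in auto)
  have "Lpb p1 (2 * (\<bar>1\<bar> + real ell ^ 2 * (2 * (?a + ?a)))) (%w. 1 + (\<Sum>i<ell. npow (norm (x i w)) \<iota> + npow (norm (z i w)) \<iota>))"
    by (rule Lpb_add[OF Lpb_const[OF p1(1)] s p1(3)])
  from Lpb_scale[OF this p1(1), of K]
  have V: "Lpb p1 (K * (2 * (1 + real ell ^ 2 * (4 * ?a)))) (%w. K * (1 + (\<Sum>i<ell. npow (norm (x i w)) \<iota> + npow (norm (z i w)) \<iota>)))"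
    using K0 by (simp add: mult_ac)
  have qk: "q / \<kappa> >= 1" using q1 kappa by simp
  have W: "Lpb (q / \<kappa>) (real ell ^ 2 * \<delta> powr \<kappa>) (%w. \<Sum>i<ell. norm (x i w - z i w) powr \<kappa>)"
    by (rule Lpb_sum) (use Lpb_powr[OF d kappa(1)] q1 qk in auto)
  have e: "1 / p1 + 1 / (q / \<kappa>) <= 1 / w" using p1(4) by simp
  have VW: "Lpb w (K * (2 * (1 + real ell ^ 2 * (4 * ?a))) * (real ell ^ 2 * \<delta> powr \<kappa>)) (%w. K * (1 + (\<Sum>i<ell. npow (norm (x i w)) \<iota> + npow (norm (z i w)) \<iota>)) * (\<Sum>i<ell. norm (x i w - z i w) powr \<kappa>))"
    by (rule Lpb_mult[OF V W _ _ _ e]) (use p1 q1 kappa w4 in auto)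
  show ?thesis
  proof (rule Lpb_mono[OF VW])
    show "(%w. F (%i. x i w) - F (%i. z i w)) \<in> borel_measurable M" by (intro borel_measurable_diff F_meas m)
    show "K * (2 * (1 + real ell ^ 2 * (4 * ?a))) * (real ell ^ 2 * \<delta> powr \<kappa>) <= cst A * \<delta> powr \<kappa>"
    proof -
      have "K * (2 * (1 + real ell ^ 2 * (4 * ?a))) * real ell ^ 2 <= K * (2 * (1 + real ell ^ 2 * (4 * ?a))) * (real ell ^ 2 + 1)"
        using K0 by (intro mult_left_mono) auto
      from mult_right_mono[OF this, of "\<delta> powr \<kappa>"] show ?thesis by (simp add: cst_def mult_ac)
    qed
  qed (use F_hoelder w4 in \<open>auto intro: order_trans[OF _ abs_ge_self]\<close>)
qed

lemma growth_L:
  assumes P: "prob_space M" and m: "!!i. x i \<in> borel_measurable M" and x: "!!i. i < ell ==> prob_space.Lpb M v A (%w. norm (x i w))"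
  shows "prob_space.Lpb M w (cst A) (%w. F (%i. x i w))"
proof -
  interpret prob_space M by (rule P)
  let ?a = "1 + A powr \<iota>"
  have s: "Lpb p1 (real ell ^ 2 * ?a) (%w. \<Sum>i<ell. npow (norm (x i w)) \<iota>)"
    by (rule Lpb_sum) (use npow_L[OF P x] p1 in auto)
  have "Lpb p1 (2 * (\<bar>1\<bar> + real ell ^ 2 * ?a)) (%w. 1 + (\<Sum>i<ell. npow (norm (x i w)) \<iota>))"
    by (rule Lpb_add[OF Lpb_const[OF p1(1)] s p1(3)])
  from Lpb_scale[OF this p1(1), of K]
  have V: "Lpb p1 (K * (2 * (1 + real ell ^ 2 * ?a))) (%w. K * (1 + (\<Sum>i<ell. npow (norm (x i w)) \<iota>)))"
    using K0 by simp
  have V': "Lpb w (K * (2 * (1 + real ell ^ 2 * ?a))) (%w. K * (1 + (\<Sum>i<ell. npow (norm (x i w)) \<iota>)))"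
    by (rule Lpb_lower[OF V]) (use p1 w4 in auto)
  show ?thesis
  proof (rule Lpb_mono[OF V'])
    show "(%w. F (%i. x i w)) \<in> borel_measurable M" by (intro F_meas m)
    have "real ell ^ 2 * ?a <= real ell ^ 2 * (4 * ?a)" by (intro mult_left_mono) auto
    then have "K * (2 * (1 + real ell ^ 2 * ?a)) * 1 <= K * (2 * (1 + real ell ^ 2 * (4 * ?a))) * (real ell ^ 2 + 1)"
      using K0 by (intro mult_mono mult_left_mono) auto
    then show "K * (2 * (1 + real ell ^ 2 * ?a)) <= cst A" by (simp add: cst_def)
  qed (use F_growth w4 in \<open>auto intro: order_trans[OF _ abs_ge_self]\<close>)
qed

end

section \<open>Independent copies indexed by positions\<close>

lemma (in prob_space) Lpb_component:
  assumes "finite A" "j \<in> A" "Lpb p B X" shows "prob_space.Lpb (PiM A (%_. M)) p B (%z. X (z j))"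
proof -
  interpret PP: prob_space "PiM A (%_. M)" by (rule prob_space_PiM) (rule prob_space_axioms)
  have d: "distr (PiM A (%_. M)) M (%z. z j) = M" by (rule distr_PiM_component) (use assms prob_space_axioms in auto)
  have m: "(%z. z j) \<in> measurable (PiM A (%_. M)) M" by (rule measurable_component_singleton) (use assms in auto)
  have X: "X \<in> borel_measurable M" "(%x. \<bar>X x\<bar> powr p) \<in> borel_measurable M" using assms(3) by (auto simp: Lpb_def)
  have "integrable M (%x. \<bar>X x\<bar> powr p) \<longleftrightarrow> integrable (PiM A (%_. M)) (%z. \<bar>X (z j)\<bar> powr p)"
    using integrable_distr_eq[OF m X(2)] unfolding d .
  moreover have "expectation (%x. \<bar>X x\<bar> powr p) = PP.expectation (%z. \<bar>X (z j)\<bar> powr p)"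
    using integral_distr[OF m X(2)] unfolding d .
  moreover have "(%z. X (z j)) \<in> borel_measurable (PiM A (%_. M))" by (rule measurable_compose[OF m X(1)])
  ultimately show ?thesis using assms(3) by (simp add: Lpb_def PP.Lpb_def)
qed

text \<open>\<open>independent_copies\<close> produces one copy per position, whereas the average of
  \<open>F\<close> is an integral over one coordinate per argument. For distinct positions
  reindexing by \<open>k\<close> matches the two; equal positions would share a copy.\<close>

lemma (in prob_space) distr_independent_copies:
  fixes \<xi> :: "nat => 'a => 'b::euclidean_space" and k :: "nat => nat" and ell :: nat
  assumes \<xi>[measurable]: "!!n. \<xi> n \<in> borel_measurable M" and \<mu>: "!!n. distr M borel (\<xi> n) = \<mu>"
    and inj: "inj_on k {..<ell}"
  shows "distr (PiM (k ` {..<ell}) (%_. M)) (PiM {..<ell} (%_. borel)) (%z. \<lambda>i\<in>{..<ell}. \<xi> (k i) (z (k i))) = PiM {..<ell} (%_. \<mu>)"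
proof -
  let ?A = "k ` {..<ell}"
  have pm: "prob_space \<mu>" unfolding \<mu>[of 0, symmetric] by (rule prob_space_distr) simp
  have smu: "sets \<mu> = sets borel" unfolding \<mu>[of 0, symmetric] by simp
  interpret L: product_prob_space "%_::nat. \<mu>" by (simp add: product_prob_space_def product_prob_space_axioms_def product_sigma_finite_def pm prob_space_imp_sigma_finite)
  interpret Mp: product_prob_space "%_::nat. M" by (simp add: product_prob_space_def product_prob_space_axioms_def product_sigma_finite_def prob_space_axioms prob_space_imp_sigma_finite)
  have Tm: "(%z. \<lambda>i\<in>{..<ell}. \<xi> (k i) (z (k i))) \<in> measurable (PiM ?A (%_. M)) (PiM {..<ell} (%_. borel))"
  proof (rule measurable_restrict)
    fix i assume "i \<in> {..<ell}"
    then have "(%z. z (k i)) \<in> measurable (PiM ?A (%_. M)) M" by (intro measurable_component_singleton) simp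
    then show "(%z. \<xi> (k i) (z (k i))) \<in> borel_measurable (PiM ?A (%_. M))" by (rule measurable_compose) simp
  qed
  show ?thesis
  proof (rule L.PiM_eqI)
    show "sets (distr (PiM ?A (%_. M)) (PiM {..<ell} (%_. borel)) (%z. \<lambda>i\<in>{..<ell}. \<xi> (k i) (z (k i)))) = sets (PiM {..<ell} (%_. \<mu>))"
      by (simp add: smu cong: sets_PiM_cong)
    fix B assume B: "!!i. i \<in> {..<ell} ==> B i \<in> sets \<mu>"
    define g where "g = the_inv_into {..<ell} k"
    have g: "g (k i) = i" if "i < ell" for i unfolding g_def by (rule the_inv_into_f_f[OF inj]) (use that in simp)
    let ?T = "%z. \<lambda>i\<in>{..<ell}. \<xi> (k i) (z (k i))"
    have e: "?T -` (Pi\<^sub>E {..<ell} B) \<inter> space (PiM ?A (%_. M)) = Pi\<^sub>E ?A (%j. \<xi> j -` B (g j) \<inter> space M)"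
      by (auto simp: space_PiM PiE_iff g restrict_def extensional_def)
    have Bs: "B i \<in> sets borel" if "i < ell" for i using B[of i] that smu by simp
    have "Pi\<^sub>E {..<ell} B \<in> sets (PiM {..<ell} (%_. borel))" by (rule sets_PiM_I_finite) (use Bs in auto)
    then have "emeasure (distr (PiM ?A (%_. M)) (PiM {..<ell} (%_. borel)) ?T) (Pi\<^sub>E {..<ell} B) = emeasure (PiM ?A (%_. M)) (Pi\<^sub>E ?A (%j. \<xi> j -` B (g j) \<inter> space M))"
      by (simp add: emeasure_distr[OF Tm] e)
    also have "... = (\<Prod>j\<in>?A. emeasure M (\<xi> j -` B (g j) \<inter> space M))"
      by (rule Mp.emeasure_PiM) (use Bs g in \<open>auto intro!: measurable_sets[OF \<xi>]\<close>)
    also have "... = (\<Prod>i<ell. emeasure M (\<xi> (k i) -` B i \<inter> space M))"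
      by (subst prod.reindex[OF inj]) (auto simp: g intro!: prod.cong)
    also have "... = (\<Prod>i<ell. emeasure \<mu> (B i))"
    proof (intro prod.cong refl)
      fix i assume "i \<in> {..<ell}"
      then show "emeasure M (\<xi> (k i) -` B i \<inter> space M) = emeasure \<mu> (B i)"
        using emeasure_distr[OF \<xi>[of "k i"] Bs[of i]] unfolding \<mu> by simp
    qed
    finally show "emeasure (distr (PiM ?A (%_. M)) (PiM {..<ell} (%_. borel)) ?T) (Pi\<^sub>E {..<ell} B) = (\<Prod>i\<in>{..<ell}. emeasure \<mu> (B i))" .
  qed simp
qed

section \<open>Approximation by conditional expectations\<close>

context prob_space begin

text \<open>The supremum is a genuine one: the set contains the value for
  \<open>\<Gamma> = space M\<close>, and both probabilities compared lie between 0 and 1.\<close>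

lemma phi_coef_bounds:
  assumes G: "subalgebra M G" and H: "subalgebra M H"
  shows "\<Gamma> \<in> sets G ==> \<Delta> \<in> sets H ==> prob \<Gamma> > 0 ==> \<bar>prob (\<Gamma> \<inter> \<Delta>) / prob \<Gamma> - prob \<Delta>\<bar> <= phi_coef M G H"
    "phi_coef M G H <= 1" "0 <= phi_coef M G H"
proof -
  let ?S = "{\<bar>prob (\<Gamma> \<inter> \<Delta>) / prob \<Gamma> - prob \<Delta>\<bar> | \<Gamma> \<Delta>. \<Gamma> \<in> sets G \<and> \<Delta> \<in> sets H \<and> prob \<Gamma> > 0}"
  have b: "x <= 1" if x: "x \<in> ?S" for x
  proof -
    from x obtain \<Gamma> \<Delta> where x: "x = \<bar>prob (\<Gamma> \<inter> \<Delta>) / prob \<Gamma> - prob \<Delta>\<bar>" and g: "\<Gamma> \<in> sets G" "\<Delta> \<in> sets H" "prob \<Gamma> > 0" by auto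
    have "\<Gamma> \<in> events" using g G unfolding subalgebra_def by blast
    then have "prob (\<Gamma> \<inter> \<Delta>) <= prob \<Gamma>" by (intro finite_measure_mono) auto
    then have "0 <= prob (\<Gamma> \<inter> \<Delta>) / prob \<Gamma>" "prob (\<Gamma> \<inter> \<Delta>) / prob \<Gamma> <= 1" using g by auto
    moreover have "0 <= prob \<Delta>" "prob \<Delta> <= 1" by auto
    ultimately show ?thesis unfolding x by linarith
  qed
  have bd: "bdd_above ?S" by (rule bdd_aboveI[of _ 1]) (rule b)
  show u: "\<bar>prob (\<Gamma> \<inter> \<Delta>) / prob \<Gamma> - prob \<Delta>\<bar> <= phi_coef M G H" if "\<Gamma> \<in> sets G" "\<Delta> \<in> sets H" "prob \<Gamma> > 0" for \<Gamma> \<Delta>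
    unfolding phi_coef_def by (rule cSup_upper[OF _ bd]) (use that in auto)
  have sp: "space M \<in> sets G" using G unfolding subalgebra_def by (metis sets.top)
  have ps: "prob (space M) > 0" by (simp add: prob_space)
  have "?S \<noteq> {}" using sp ps sets.empty_sets[of H] by blast
  then show "phi_coef M G H <= 1" unfolding phi_coef_def by (rule cSup_least) (rule b)
  show "0 <= phi_coef M G H" by (rule order_trans[OF abs_ge_zero u[OF sp sets.empty_sets ps]])
qed

lemma phi_mix_bounds:
  assumes sub: "!!k l. k <= l ==> subalgebra M (Fs k l)"
  shows "C \<in> sets (Fs (-\<infinity>) (ereal (real_of_int k))) ==> D \<in> sets (Fs (ereal (real_of_int k + real n)) \<infinity>) ==>
      \<bar>prob (C \<inter> D) - prob C * prob D\<bar> <= phi_mix M Fs n * prob C" "0 <= phi_mix M Fs n"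
proof -
  let ?c = "%k::int. phi_coef M (Fs (-\<infinity>) (ereal (real_of_int k))) (Fs (ereal (real_of_int k + real n)) \<infinity>)"
  have s: "subalgebra M (Fs (-\<infinity>) (ereal x))" "subalgebra M (Fs (ereal x) \<infinity>)" for x by (auto intro: sub)
  have bd: "bdd_above (range ?c)" by (rule bdd_aboveI2[of _ _ 1]) (rule phi_coef_bounds(2)[OF s])
  have le: "?c k <= phi_mix M Fs n" for k unfolding phi_mix_def by (rule cSup_upper[OF _ bd]) simp
  show "0 <= phi_mix M Fs n" by (rule order_trans[OF phi_coef_bounds(3)[OF s] le])
  assume C: "C \<in> sets (Fs (-\<infinity>) (ereal (real_of_int k)))" and D: "D \<in> sets (Fs (ereal (real_of_int k + real n)) \<infinity>)"
  show "\<bar>prob (C \<inter> D) - prob C * prob D\<bar> <= phi_mix M Fs n * prob C"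
  proof (cases "prob C > 0")
    case True
    have "\<bar>prob (C \<inter> D) / prob C - prob D\<bar> <= phi_mix M Fs n"
      by (rule order_trans[OF phi_coef_bounds(1)[OF s C D True] le])
    then have "\<bar>prob (C \<inter> D) / prob C - prob D\<bar> * prob C <= phi_mix M Fs n * prob C" by (rule mult_right_mono) simp
    also have "\<bar>prob (C \<inter> D) / prob C - prob D\<bar> * prob C = \<bar>(prob (C \<inter> D) / prob C - prob D) * prob C\<bar>" by (simp add: abs_mult)
    also have "(prob (C \<inter> D) / prob C - prob D) * prob C = prob (C \<inter> D) - prob C * prob D" using True by (simp add: algebra_simps)
    finally show ?thesis .
  next
    case False
    then have z: "prob C = 0" by (simp add: zero_less_measure_iff)
    have "C \<in> events" using C s(1) unfolding subalgebra_def by blast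
    then have "prob (C \<inter> D) <= prob C" by (intro finite_measure_mono) auto
    then show ?thesis using z measure_nonneg[of M "C \<inter> D"] by simp
  qed
qed

end

text \<open>The approximations are conditional expectations given the window, the enlarged past and
  future absorb the window radius, and the Hoelder condition turns the approximation rate of
  \<open>\<xi>\<close>, raised to the power \<open>\<kappa>\<close>, into one for
  \<open>F\<close>.\<close>

theorem nonconv_array_of_mixing:
  fixes M :: "'a measure" and \<xi> :: "nat => 'a => 'b::euclidean_space" and F :: "(nat => 'b) => real"
  assumes prob: "prob_space M"
    and meas[measurable]: "!!n. \<xi> n \<in> borel_measurable M"
    and subalg: "!!k l. k <= l ==> subalgebra M (Fs k l)"
    and mono_F: "!!k l k' l'. k <= l ==> k' <= l' ==> k' <= k ==> l <= l' ==>
                   sets (Fs k l) \<subseteq> sets (Fs k' l')"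
    and stat1: "!!n. distr M borel (\<xi> n) = distr M borel (\<xi> 0)"
    and hf: "hoelder_functional F ell K \<iota> \<kappa> w q v"
    and l_pos: "ell >= 1"
    and mom: "Lp_norm M v (\<xi> 0) < \<infinity>"
    and d1: "d >= 1"
    and Mix: "!!n::nat. n >= 1 ==> beta_approx M Fs \<xi> q n < \<infinity> \<and>
          phi_mix M Fs n + real_of_ereal (beta_approx M Fs \<xi> q n) powr \<kappa> <= d * real n powr (- \<theta>)"
    and theta_big: "\<theta> > 4 * w / (w - 2)"
    and Fbar0: "(\<integral>x. F x \<partial>(PiM {..<ell} (%_. distr M borel (\<xi> 0)))) = 0"
  shows "\<exists>xr Past Fut c1. nonconv_array M \<xi> xr Past Fut F ell d \<theta> w c1"
proof -
  interpret prob_space M by (rule prob)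
  interpret hoelder_functional F ell K \<iota> \<kappa> w q v by (rule hf)
  define xr where "xr = (%r k. cond_exp_vec M (Fs (ereal (real k - real r)) (ereal (real k + real r))) (\<xi> k))"
  \<comment> \<open>A window of radius \<open>r\<close> around a time up to \<open>a\<close> reaches
    up to \<open>a + r\<close>; the future is extended backwards in the same way.\<close>
  define Past where "Past = (%r a :: nat. Fs (-\<infinity>) (ereal (real a + real r)))"
  define Fut where "Fut = (%r a :: nat. Fs (ereal (real a - real r)) \<infinity>)"
  have sub: "subalgebra M (Fs (ereal (real k - real r)) (ereal (real k + real r)))" for k r :: nat by (rule subalg) simp
  have sP: "subalgebra M (Past r a)" "subalgebra M (Fut r a)" for r a by (auto simp: Past_def Fut_def intro: subalg)
  have xr0: "xr r k \<in> borel_measurable (Fs (ereal (real k - real r)) (ereal (real k + real r)))" for r k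
    unfolding xr_def cond_exp_vec_def by measurable
  have xrm[measurable]: "xr r k \<in> borel_measurable M" for r k by (rule measurable_from_subalg[OF sub xr0])
  have sF: "space (Fs k l) = space M" if "k <= l" for k l using subalg[OF that] by (simp add: subalgebra_def)
  have xP: "xr r' k \<in> borel_measurable (Past r a)" if "r' <= r" "k <= a" for r r' k a
  proof (rule measurable_from_subalg[OF _ xr0])
    show "subalgebra (Past r a) (Fs (ereal (real k - real r')) (ereal (real k + real r')))"
      unfolding Past_def subalgebra_def by (intro conjI mono_F) (use that sF in auto)
  qed
  have xF: "xr r' k \<in> borel_measurable (Fut r a)" if "r' <= r" "a <= k" for r r' k a
  proof (rule measurable_from_subalg[OF _ xr0])
    show "subalgebra (Fut r a) (Fs (ereal (real k - real r')) (ereal (real k + real r')))"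
      unfolding Fut_def subalgebra_def by (intro conjI mono_F) (use that sF in auto)
  qed
  have phi: "\<bar>prob (C \<inter> D) - prob C * prob D\<bar> <= d * (real l + 1 - 2 * real r) powr (- \<theta>) * prob C"
    if l: "2 * r <= l" and C: "C \<in> sets (Past r a)" and D: "D \<in> sets (Fut r (a + (l + 1)))" for C D r l a
  proof -
    \<comment> \<open>The enlarged past ends at \<open>a + r\<close> and the enlarged future starts
      at \<open>a + l + 1 - r\<close>. The true gap is therefore \<open>l + 1 - 2 * r\<close>, at
      least 1 because \<open>2 * r <= l\<close>.\<close>
    define n where "n = l + 1 - 2 * r"
    have n: "n >= 1" "real n = real l + 1 - 2 * real r" using l by (auto simp: n_def of_nat_diff)
    have "\<bar>prob (C \<inter> D) - prob C * prob D\<bar> <= phi_mix M Fs n * prob C"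
    proof (rule phi_mix_bounds(1)[where Fs=Fs and k="int (a + r)", OF subalg])
      show "C \<in> sets (Fs (-\<infinity>) (ereal (real_of_int (int (a + r)))))" using C by (simp add: Past_def)
      have "real (a + (l + 1)) - real r = real_of_int (int (a + r)) + real n" using n by simp
      then show "D \<in> sets (Fs (ereal (real_of_int (int (a + r)) + real n)) \<infinity>)" using D unfolding Fut_def by metis
    qed
    also have "... <= (d * real n powr (- \<theta>)) * prob C"
      using Mix[OF n(1)] powr_ge_zero[of "real_of_ereal (beta_approx M Fs \<xi> q n)" \<kappa>] by (intro mult_right_mono) (linarith, simp)
    finally show ?thesis unfolding n(2) .
  qed
  have fields: "decoupled_field M (%k x. (xr r k x, xr r' k x)) (Past r) (Fut r) (l + 1) (d * (real l + 1 - 2 * real r) powr (- \<theta>))"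
    if r: "r' <= r" and l: "2 * r <= l" for r r' l
  proof
    show "(%x. (xr r k x, xr r' k x)) \<in> borel_measurable (Past r a)" if "k <= a" for k a
      by (rule borel_measurable_Pair) (use xP that r in auto)
    show "(%x. (xr r k x, xr r' k x)) \<in> borel_measurable (Fut r a)" if "a <= k" for k a
      by (rule borel_measurable_Pair) (use xF that r in auto)
  qed (use sP phi[OF l] in auto)

  define A where "A = real_of_ereal (Lp_norm M v (\<xi> 0))"
  have Lst: "Lp_norm M v (\<xi> n) = Lp_norm M v (\<xi> 0)" for n
  proof -
    have "(\<integral>\<^sup>+ x. ennreal (norm (\<xi> n x) powr v) \<partial>M) = (\<integral>\<^sup>+ y. ennreal (norm y powr v) \<partial>distr M borel (\<xi> n))" for n
      by (subst nn_integral_distr) auto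
    then show ?thesis unfolding Lp_norm_def using stat1[of n] by metis
  qed
  have xL: "Lpb v A (%x. norm (\<xi> k x))" for k
    using Lpb_of_Lp_norm[OF meas[of k], of v] mom v1 unfolding A_def Lst[of k] by simp
  have A0: "A >= 0" using xL[of 0] by (simp add: Lpb_def)
  \<comment> \<open>A common moment bound for the variables and their approximations; the dimension
    enters because conditional expectations are taken coordinate by coordinate.\<close>
  define A' where "A' = A + real DIM('b) ^ 2 * A"
  have "0 <= real DIM('b) ^ 2 * A" using A0 by simp
  then have xL': "Lpb v A' (%x. norm (\<xi> k x))" and xrL: "Lpb v A' (%x. norm (xr r k x))" for k r
    using Lpb_weaken[OF xL[of k], of A'] Lpb_weaken[OF Lpb_cond_exp_vec[OF meas xL[of k] v1 sub[of k r]], of A'] A0 v1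
    by (auto simp: A'_def xr_def)
  define \<beta> where "\<beta> = (%r. real_of_ereal (beta_approx M Fs \<xi> q r))"
  have bL: "Lpb q (\<beta> r) (%x. norm (\<xi> k x - xr r k x))" if r: "r >= 1" for r k
  proof -
    let ?n = "Lp_norm M q (%x. \<xi> k x - xr r k x)"
    have le: "?n <= beta_approx M Fs \<xi> q r" unfolding beta_approx_def xr_def by (rule SUP_upper) simp
    have fin: "beta_approx M Fs \<xi> q r < \<infinity>" using Mix[OF r] by simp
    have L: "Lpb q (real_of_ereal ?n) (%x. norm (\<xi> k x - xr r k x))"
      by (rule Lpb_of_Lp_norm) (use le fin q1 in auto)
    have "0 <= ?n" by (simp add: Lp_norm_def Let_def)
    then have "real_of_ereal ?n <= \<beta> r" unfolding \<beta>_def by (rule real_of_ereal_positive_mono) (use le fin in auto)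
    then show ?thesis using L q1 by (auto elim: Lpb_weaken)
  qed
  have bk: "\<beta> r powr \<kappa> <= d * real r powr (- \<theta>)" if r: "r >= 1" for r
    using Mix[OF r] phi_mix_bounds(2)[where Fs=Fs and n=r, OF subalg] unfolding \<beta>_def by linarith
  have c0: "cst A' > 0"
  proof -
    have "0 < 1 + real ell ^ 2 * (4 * (1 + A' powr \<iota>))" by (intro add_pos_nonneg) auto
    moreover have "0 < real ell ^ 2 + 1" by (intro add_nonneg_pos) auto
    ultimately show ?thesis unfolding cst_def using K0 by simp
  qed
  define c1 where "c1 = cst A' * d + cst A' + cst A' powr w"
  have c1: "c1 > 0" "cst A' <= c1" "cst A' * d <= c1" "cst A' powr w <= c1"
    using c0 d1 by (auto simp: c1_def add_pos_pos add_pos_nonneg intro!: add_nonneg_nonneg)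
  have FA': "prob_space.Lpb P w (c1 * real r powr (- \<theta>)) (%x. F (%i. x1 i x) - F (%i. x2 i x))"
    if P: "prob_space P" and r: "r >= 1" and m: "!!i. x1 i \<in> borel_measurable P" "!!i. x2 i \<in> borel_measurable P"
      and L: "!!i. i < ell ==> prob_space.Lpb P v A' (%x. norm (x1 i x))" "!!i. i < ell ==> prob_space.Lpb P v A' (%x. norm (x2 i x))"
        "!!i. i < ell ==> prob_space.Lpb P q (\<beta> r) (%x. norm (x1 i x - x2 i x))" for P :: "'p measure" and r x1 x2
  proof (rule prob_space.Lpb_weaken[OF P diff_L[OF P m L]])
    have "cst A' * \<beta> r powr \<kappa> <= cst A' * (d * real r powr (- \<theta>))" using c0 bk[OF r] by (intro mult_left_mono) auto
    also have "... <= c1 * real r powr (- \<theta>)" using mult_right_mono[OF c1(3), of "real r powr (- \<theta>)"] by simp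
    finally show "cst A' * \<beta> r powr \<kappa> <= c1 * real r powr (- \<theta>)" .
  qed (use w4 in auto)
  have "nonconv_array M \<xi> xr Past Fut F ell d \<theta> w c1"
  proof (rule nonconv_array.intro[OF prob nonconv_array_axioms.intro], goal_cases)
    case (1 r r' l) then show ?case by (rule fields)
  next
    case 2 show ?case by (rule F_cont)
  next
    case 3 show ?case by (rule F_dep)
  next
    case 4 show ?case by (rule d1)
  next
    case 5 show ?case by (rule l_pos)
  next
    case 6 show ?case by (rule w4)
  next
    case 7 show ?case by (rule theta_big)
  next
    case 8 show ?case by (rule c1)
  next
    case (9 k)
    show ?case by (rule Lpb_weaken[OF growth_L[OF prob meas xL']]) (use c1 w4 in auto)
  next
    case (10 r k)
    show ?case by (rule FA'[OF prob 10 meas xrm xL' xrL bL[OF 10]])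
  next
    case (11 r k s)
    let ?A = "k ` {..<ell}"
    let ?P = "PiM ?A (%_. M)"
    have psP: "prob_space ?P" by (rule prob_space_PiM) (rule prob)
    interpret PP: prob_space ?P by (rule psP)
    \<comment> \<open>With copies of the original variables the mean of \<open>F\<close> is exactly
      the vanishing average. Passing to the approximations \<open>x2\<close> costs the approximation
      rate, and clipping costs a tail. The value 0 beyond \<open>ell\<close> only serves
      measurability.\<close>
    define x1 where "x1 = (%i z. if i < ell then \<xi> (k i) (z (k i)) else 0)"
    define x2 where "x2 = (%i z. if i < ell then xr r (k i) (z (k i)) else 0)"
    have cm: "(%z. z (k i)) \<in> measurable ?P M" if "i < ell" for i using that by (intro measurable_component_singleton) simp
    have m: "x1 i \<in> borel_measurable ?P" "x2 i \<in> borel_measurable ?P" for i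
      using measurable_compose[OF cm[of i] meas[of "k i"]] measurable_compose[OF cm[of i] xrm[of r "k i"]] by (cases "i < ell"; simp add: x1_def x2_def)+
    have fA: "finite ?A" by simp
    have L: "PP.Lpb v A' (%z. norm (x1 i z))" "PP.Lpb v A' (%z. norm (x2 i z))" "PP.Lpb q (\<beta> r) (%z. norm (x1 i z - x2 i z))" if i: "i < ell" for i
      using Lpb_component[OF fA _ xL', of "k i" "k i"] Lpb_component[OF fA _ xrL, of "k i" r "k i"] Lpb_component[OF fA _ bL[OF 11(1)], of "k i" "k i"] i
      by (auto simp: x1_def x2_def)
    have w1: "w >= 1" using w4 by simp
    have D: "PP.Lpb w (c1 * real r powr (- \<theta>)) (%z. F (%i. x1 i z) - F (%i. x2 i z))" by (rule FA'[OF psP 11(1) m L])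
    have G1: "PP.Lpb w (cst A') (%z. F (%i. x1 i z))" by (rule growth_L[OF psP m(1) L(1)])
    have G2: "PP.Lpb w (cst A') (%z. F (%i. x2 i z))" by (rule growth_L[OF psP m(2) L(2)])
    define T where "T = (%z. \<lambda>i\<in>{..<ell}. \<xi> (k i) (z (k i)))"
    have Tm: "T \<in> measurable ?P (PiM {..<ell} (%_. borel))" unfolding T_def
    proof (rule measurable_restrict)
      fix i assume "i \<in> {..<ell}"
      then show "(%z. \<xi> (k i) (z (k i))) \<in> borel_measurable ?P" using measurable_compose[OF cm[of i] meas[of "k i"]] by simp
    qed
    have dT: "distr ?P (PiM {..<ell} (%_. borel)) T = PiM {..<ell} (%_. distr M borel (\<xi> 0))"
      unfolding T_def by (rule distr_independent_copies[OF meas stat1 11(3)])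
    have Fr: "(%x. F (%i. if i < ell then x i else 0)) \<in> borel_measurable (PiM {..<ell} (%_. borel :: 'b measure))"
    proof (rule F_meas)
      fix i show "(%x. if i < ell then x i else 0) \<in> borel_measurable (PiM {..<ell} (%_. borel :: 'b measure))"
        by (cases "i < ell") (auto intro: measurable_component_singleton)
    qed
    have Fe: "F (%i. if i < ell then x i else 0) = F x" for x by (rule depD[OF F_dep]) simp
    have "0 = (\<integral>x. F (%i. if i < ell then x i else 0) \<partial>(PiM {..<ell} (%_. distr M borel (\<xi> 0))))" unfolding Fe Fbar0 ..
    also have "... = (\<integral>z. F (%i. if i < ell then T z i else 0) \<partial>?P)" unfolding dT[symmetric] by (rule integral_distr[OF Tm Fr])
    also have "... = (\<integral>z. F (%i. x1 i z) \<partial>?P)"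
      by (rule arg_cong[where f="integral\<^sup>L ?P"], rule ext, rule depD[OF F_dep]) (simp add: T_def x1_def)
    finally have E1: "PP.expectation (%z. F (%i. x1 i z)) = 0" by simp
    have cl: "integrable ?P (%z. clip s (F (%i. x2 i z)))"
      by (rule PP.integrable_bounded_by[where c=s]) (use 11(2) clip_abs PP.Lpb_meas[OF G2] in \<open>auto intro!: measurable_compose[OF _ clip_measurable]\<close>)
    have i1: "integrable ?P (%z. F (%i. x1 i z))" "integrable ?P (%z. F (%i. x2 i z))" "integrable ?P (%z. F (%i. x1 i z) - F (%i. x2 i z))"
      using PP.Lpb_1(1)[OF G1 w1] PP.Lpb_1(1)[OF G2 w1] by auto
    have a: "\<bar>PP.expectation (%z. F (%i. x1 i z) - F (%i. x2 i z))\<bar> <= c1 * real r powr (- \<theta>)" by (rule PP.Lpb_1(3)[OF D w1])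
    have "PP.expectation (%z. \<bar>F (%i. x2 i z) - clip s (F (%i. x2 i z))\<bar>) <= cst A' powr w * s powr (1 - w)"
      by (rule PP.clip_tail_bound[OF G2 w1 11(2)])
    also have "... <= c1 * s powr (1 - w)" using c1 by (intro mult_right_mono) auto
    finally have b: "\<bar>PP.expectation (%z. F (%i. x2 i z) - clip s (F (%i. x2 i z)))\<bar> <= c1 * s powr (1 - w)"
      by (rule order_trans[OF integral_abs_bound])
    have "PP.expectation (%z. clip s (F (%i. x2 i z))) = PP.expectation (%z. F (%i. x1 i z)) - PP.expectation (%z. F (%i. x1 i z) - F (%i. x2 i z)) - PP.expectation (%z. F (%i. x2 i z) - clip s (F (%i. x2 i z)))"
      using i1 cl by simp
    then have "\<bar>PP.expectation (%z. clip s (F (%i. x2 i z)))\<bar> <= c1 * (real r powr (- \<theta>) + s powr (1 - w))"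
      using E1 a b by (simp add: distrib_left)
    moreover have "F (%i. x2 i z) = F (%i. xr r (k i) (z (k i)))" for z by (rule depD[OF F_dep]) (simp add: x2_def)
    ultimately show ?case by simp
  qed
  then show ?thesis by blast
qed

section \<open>Separation of the polynomial positions\<close>

text \<open>With nonnegative coefficients no monomial decreases in \<open>n\<close>, and one that
  contains \<open>n\<close> increases strictly; \<open>N >= 1\<close> prevents its power of
  \<open>N\<close> from vanishing.\<close>

lemma poly2_less:
  assumes fin: "finite {p. c p \<noteq> 0}" and ex: "\<exists>p. c p \<noteq> 0 \<and> fst p >= 1" and N: "N >= 1" and nm: "n < m"
  shows "poly2 c n N < poly2 c m N"
  unfolding poly2_def
proof (rule sum_strict_mono_ex1[OF fin])
  show "\<forall>p\<in>{p. c p \<noteq> 0}. c p * n ^ fst p * N ^ snd p <= c p * m ^ fst p * N ^ snd p"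
    using nm by (auto intro!: mult_right_mono power_mono)
  from ex obtain p where p: "c p \<noteq> 0" "fst p >= 1" by blast
  have "n ^ fst p < m ^ fst p" using nm p by (intro power_strict_mono) auto
  then have "c p * n ^ fst p * N ^ snd p < c p * m ^ fst p * N ^ snd p" using p N by simp
  then show "\<exists>p\<in>{p. c p \<noteq> 0}. c p * n ^ fst p * N ^ snd p < c p * m ^ fst p * N ^ snd p" using p by blast
qed

lemma inj_poly2:
  assumes "finite {p. c p \<noteq> 0}" "\<exists>p. c p \<noteq> 0 \<and> fst p >= 1" "N >= 1" shows "inj (%n. poly2 c n N)"
  by (rule linorder_injI) (use poly2_less[OF assms] in \<open>auto dest: less_imp_neq\<close>)

lemma eventually_poly_nonzero:
  fixes p :: "int poly" assumes "p \<noteq> 0" shows "\<exists>N0. \<forall>N\<ge>N0. poly p (int N) \<noteq> 0"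
proof -
  have "finite {x. poly p x = 0}" by (rule poly_roots_finite[OF assms])
  then have "finite (int -` {x. poly p x = 0})" by (intro finite_vimageI) auto
  then obtain B where "\<forall>n\<in>int -` {x. poly p x = 0}. n < B" using finite_nat_set_iff_bounded by blast
  then show ?thesis by (intro exI[of _ B]) (auto simp: not_less[symmetric])
qed

text \<open>Positive degree keeps \<open>P - [:y:]\<close> different from 0 for every constant, so
  each of the \<open>2 * L + 1\<close> integers in the range is a value at no more than
  \<open>E\<close> points.\<close>

lemma card_close_values:
  fixes P :: "int poly" assumes P: "degree P >= 1" "degree P <= E"
  shows "card {n\<in>I. \<bar>poly P (int n)\<bar> <= int L} <= E * (2 * L + 1)"
proof -
  define R where "R = (%y. int -` {x. poly (P - [:y:]) x = 0})"
  have nz: "P - [:y:] \<noteq> 0" for y using P(1) by auto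
  have dg: "degree (P - [:y:]) <= E" for y by (rule degree_diff_le) (use P in auto)
  have fR: "finite (R y)" for y unfolding R_def by (intro finite_vimageI poly_roots_finite nz) auto
  have "card (R y) <= E" for y
  proof -
    have "card (R y) = card (int ` R y)" by (simp add: card_image inj_on_def)
    also have "... <= card {x. poly (P - [:y:]) x = 0}" by (rule card_mono[OF poly_roots_finite[OF nz]]) (auto simp: R_def)
    also have "... <= degree (P - [:y:])" by (rule card_poly_roots_bound[OF nz])
    finally show ?thesis using dg[of y] by simp
  qed
  note cR = this
  have "{n\<in>I. \<bar>poly P (int n)\<bar> <= int L} \<subseteq> (\<Union>y\<in>{- int L..int L}. R y)" by (auto simp: R_def abs_le_iff)
  then have "card {n\<in>I. \<bar>poly P (int n)\<bar> <= int L} <= card (\<Union>y\<in>{- int L..int L}. R y)" by (intro card_mono) (auto simp: fR)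
  also have "... <= (\<Sum>y\<in>{- int L..int L}. card (R y))" by (rule card_UN_le) simp
  also have "... <= (\<Sum>y\<in>{- int L..int L}. E)" by (rule sum_mono) (rule cR)
  also have "... = E * (2 * L + 1)"
  proof -
    have "nat (int L - (- int L) + 1) = 2 * L + 1" by linarith
    then show ?thesis by (simp only: sum_constant card_atLeastAtMost_int of_nat_id mult.commute)
  qed
  finally show ?thesis .
qed

text \<open>The difference of two positions is a polynomial in \<open>n\<close> with coefficients in \<open>\<int>[N]\<close>. If it involves
  \<open>n\<close>, it takes each value boundedly often; otherwise it is a nonconstant polynomial in \<open>N\<close>, hence grows linearly.\<close>
lemma card_near_positions:
  assumes fin: "finite {p. a p \<noteq> 0}" "finite {p. b p \<noteq> 0}"
    and nc: "\<not> (\<exists>C::int. \<forall>n N. int (poly2 a n N) - int (poly2 b n N) = C)"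
  shows "\<exists>E N0. \<forall>N\<ge>N0. \<forall>L. 2 * L <= N --> card {n\<in>{1..N}. \<bar>int (poly2 a n N) - int (poly2 b n N)\<bar> <= int L} <= E * (2 * L + 1)"
proof -
  define S where "S = {p. a p \<noteq> 0} \<union> {p. b p \<noteq> 0}"
  define e where "e = (%p. int (a p) - int (b p))"
  have fS: "finite S" using fin by (simp add: S_def)
  have pa: "int (poly2 f n N) = (\<Sum>p\<in>S. int (f p) * int n ^ fst p * int N ^ snd p)" if "{p. f p \<noteq> 0} \<subseteq> S" for f n N
    unfolding poly2_def of_nat_sum of_nat_mult of_nat_power by (rule sum.mono_neutral_left[OF fS that]) auto
  have \<Delta>: "int (poly2 a n N) - int (poly2 b n N) = (\<Sum>p\<in>S. e p * int n ^ fst p * int N ^ snd p)" for n N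
    by (subst (1 2) pa) (auto simp: S_def e_def sum_subtractf[symmetric] algebra_simps intro!: sum.cong)
  \<comment> \<open>The difference in two readings: \<open>P N\<close> is the polynomial in
    \<open>n\<close> for fixed \<open>N\<close>, and \<open>A k\<close> is its coefficient of degree
    \<open>k\<close> as a polynomial in \<open>N\<close>.\<close>
  define A where "A = (%k. \<Sum>p\<in>{p\<in>S. fst p = k}. monom (e p) (snd p))"
  define P where "P = (%N. \<Sum>p\<in>S. monom (e p * int N ^ snd p) (fst p))"
  have pP: "poly (P N) (int n) = int (poly2 a n N) - int (poly2 b n N)" for n N
    unfolding \<Delta> P_def by (simp add: poly_sum poly_monom mult_ac)
  have cA: "coeff (P N) k = poly (A k) (int N)" for N k
  proof -
    have "coeff (P N) k = (\<Sum>p\<in>S. if fst p = k then e p * int N ^ snd p else 0)" unfolding P_def by (simp add: coeff_sum)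
    also have "... = (\<Sum>p\<in>{p\<in>S. fst p = k}. e p * int N ^ snd p)" by (rule sum.inter_filter[OF fS, symmetric])
    finally show ?thesis by (simp add: A_def poly_sum poly_monom)
  qed
  show ?thesis
  proof (cases "\<exists>p\<in>S. e p \<noteq> 0 \<and> fst p >= 1")
    case True
    then obtain p where p: "p \<in> S" "e p \<noteq> 0" "fst p >= 1" by blast
    have "coeff (A (fst p)) (snd p) = (\<Sum>p'\<in>{p'\<in>S. fst p' = fst p}. if snd p' = snd p then e p' else 0)" by (simp add: A_def coeff_sum)
    also have "... = (\<Sum>p'\<in>{p'\<in>S. fst p' = fst p}. if p' = p then e p' else 0)" by (intro sum.cong) (auto simp: prod_eq_iff)
    also have "... = e p" using fS p by simp
    finally have "A (fst p) \<noteq> 0" using p by auto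
    then obtain N0 where N0: "\<forall>N\<ge>N0. poly (A (fst p)) (int N) \<noteq> 0" using eventually_poly_nonzero by blast
    have d1: "degree (P N) >= 1" if "N >= N0" for N
      using le_degree[of "P N" "fst p"] N0 that p(3) by (auto simp: cA)
    have d2: "degree (P N) <= (\<Sum>p\<in>S. fst p)" for N
      unfolding P_def by (rule degree_sum_le[OF fS]) (use fS in \<open>auto intro!: order_trans[OF degree_monom_le] member_le_sum\<close>)
    show ?thesis
      by (intro exI[of _ "\<Sum>p\<in>S. fst p"] exI[of _ N0] allI impI) (unfold pP[symmetric], rule card_close_values, use d1 d2 in auto)
  next
    \<comment> \<open>The difference is now \<open>x + N * B(N)\<close> with a nonzero integer
      polynomial \<open>B\<close>. For large \<open>N\<close> the value \<open>B(N)\<close> is a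
      nonzero integer, hence the difference is at least \<open>N - \<bar>x\<bar>\<close> in absolute
      value and exceeds \<open>N / 2\<close>.\<close>
    case False
    have z: "(\<Sum>p\<in>S. e p * int n ^ fst p * int N ^ snd p) = poly (A 0) (int N)" for n N
    proof -
      have "(\<Sum>p\<in>S. e p * int n ^ fst p * int N ^ snd p) = (\<Sum>p\<in>S. if fst p = 0 then e p * int N ^ snd p else 0)"
        using False by (intro sum.cong) (auto simp: Suc_le_eq)
      also have "... = (\<Sum>p\<in>{p\<in>S. fst p = 0}. e p * int N ^ snd p)" by (rule sum.inter_filter[OF fS, symmetric])
      finally show ?thesis by (simp add: A_def poly_sum poly_monom)
    qed
    obtain x B where AB: "A 0 = pCons x B" by (cases "A 0")
    have "B \<noteq> 0"
    proof
      assume "B = 0"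
      then have "int (poly2 a n N) - int (poly2 b n N) = x" for n N unfolding \<Delta> z AB by simp
      then show False using nc by blast
    qed
    then obtain N0 where N0: "\<forall>N\<ge>N0. poly B (int N) \<noteq> 0" using eventually_poly_nonzero by blast
    define N1 where "N1 = max N0 (nat (2 * \<bar>x\<bar>) + 1)"
    have big: "\<bar>int (poly2 a n N) - int (poly2 b n N)\<bar> > int L" if N: "N >= N1" and L: "2 * L <= N" for n N L
    proof -
      have "\<bar>poly B (int N)\<bar> >= 1" using N0 N by (force simp: N1_def)
      then have "int N * 1 <= int N * \<bar>poly B (int N)\<bar>" by (intro mult_left_mono) auto
      then have "int N <= \<bar>int N * poly B (int N)\<bar>" by (simp add: abs_mult)
      moreover have "nat (2 * \<bar>x\<bar>) < N" using N unfolding N1_def by linarith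
      then have "2 * \<bar>x\<bar> < int N" by (simp add: nat_less_iff)
      moreover have "2 * int L <= int N" using L by linarith
      ultimately show ?thesis unfolding \<Delta> z AB by simp
    qed
    have "{n\<in>{1..N}. \<bar>int (poly2 a n N) - int (poly2 b n N)\<bar> <= int L} = {}" if "N >= N1" "2 * L <= N" for N L
      using big[OF that] by (force simp: not_le)
    then show ?thesis by (intro exI[of _ 0] exI[of _ N1]) auto
  qed
qed

section \<open>Negligibility of the means\<close>

context nonconv_array begin

text \<open>Positions \<open>3 * r\<close> apart with windows of radius \<open>r\<close> leave a gap
  of size \<open>r\<close>. The clipped functional is then compared with independent copies, where
  \<open>F0\<close> applies. Decoupling needs a bounded functional, which is the reason for
  clipping.\<close>

lemma mean_bound:
  assumes r: "r >= 1" and sep: "!!i j. i < ell ==> j < ell ==> i \<noteq> j ==> k i + 3 * r <= k j \<or> k j + 3 * r <= k i"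
  shows "\<bar>expectation (%x. F (%i. \<xi> (k i) x))\<bar> <= (3 * c1 + (4 * c1) powr w + 2 * real ell * d) * real r powr (- 4)"
proof -
  define l where "l = 3 * r - 1"
  have l1: "l + 1 = 3 * r" using r unfolding l_def by linarith
  then have "real (l + 1) = real (3 * r)" by (rule arg_cong)
  then have "real l + 1 - 2 * real r = real r" by simp
  moreover have "2 * r <= l" using r l1 by linarith
  ultimately have l: "2 * r <= l" "l + 1 = 3 * r" "real l + 1 - 2 * real r = real r" using l1 by blast+
  define ph where "ph = d * (real l + 1 - 2 * real r) powr (- \<theta>)"
  interpret B: decoupled_field M "%k x. (xr r k x, xr r k x)" "Past r" "Fut r" "l + 1" ph
    unfolding ph_def by (rule fields[OF order_refl l(1)])
  \<comment> \<open>Balances decoupling against the tail: both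
    \<open>r powr (- \<theta>) * s\<close> and \<open>s powr (1 - w)\<close> become
    \<open>r powr (\<theta> / w - \<theta>)\<close>, which is at most
    \<open>r powr (- 4)\<close>.\<close>
  define s where "s = real r powr (\<theta> / w)"
  have s0: "s > 0" using r by (simp add: s_def)
  let ?A = "k ` {..<ell}"
  have inj: "inj_on k {..<ell}"
  proof (rule inj_onI)
    fix i j assume "i \<in> {..<ell}" "j \<in> {..<ell}" "k i = k j"
    then show "i = j" using sep[of i j] r by (cases "i = j") auto
  qed
  define u where "u = (%y::nat => 'b \<times> 'b. clip s (F (%i. fst (y (k i)))))"
  have c1': "continuous_on UNIV (%y::nat => 'b \<times> 'b. F (%i. fst (y (k i))))"
    by (rule continuous_on_compose2[OF F_cont], rule continuous_on_coordinatewise_then_product, intro continuous_intros continuous_on_product_coordinates) simp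
  have uc: "continuous_on UNIV u" unfolding u_def by (rule continuous_on_compose2[OF continuous_clip c1']) simp
  have ub: "\<bar>u y\<bar> <= s" for y unfolding u_def by (rule clip_abs) (use s0 in simp)
  have ud: "dep ?A u" unfolding dep_def u_def
  proof (intro allI impI)
    fix x y :: "nat => 'b \<times> 'b" assume "\<forall>j\<in>?A. x j = y j"
    then have "F (%i. fst (x (k i))) = F (%i. fst (y (k i)))" by (intro depD[OF F_dep]) auto
    then show "clip s (F (%i. fst (x (k i)))) = clip s (F (%i. fst (y (k i))))" by simp
  qed
  have sepA: "a + (l + 1) <= b" if ab: "a \<in> ?A" "b \<in> ?A" "a < b" for a b
  proof -
    obtain i j where ij: "i < ell" "j < ell" "a = k i" "b = k j" using ab by auto
    then have "i \<noteq> j" using ab by auto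
    then show ?thesis using sep[OF ij(1,2)] ij ab l(2) by auto
  qed
  have "\<bar>expectation (%x. u (B.path x)) - (\<integral>z. u (%j. if j \<in> ?A then (xr r j (z j), xr r j (z j)) else undefined) \<partial>PiM ?A (%_. M))\<bar> <= 2 * card ?A * ph * s"
    by (rule B.independent_copies[OF _ sepA uc ub ud]) auto
  moreover have "u (%j. if j \<in> ?A then (xr r j (z j), xr r j (z j)) else undefined) = clip s (F (%i. xr r (k i) (z (k i))))" for z
    unfolding u_def by (rule arg_cong[where f="clip s"], rule depD[OF F_dep]) auto
  moreover have "2 * card ?A * ph * s <= 2 * real ell * ph * s"
    using card_image[OF inj] s0 B.phi_nonneg by simp
  ultimately have a: "\<bar>expectation (%x. clip s (F (%i. xr r (k i) x))) - (\<integral>z. clip s (F (%i. xr r (k i) (z (k i)))) \<partial>PiM ?A (%_. M))\<bar> <= 2 * real ell * ph * s"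
    by (simp add: u_def)
  have b: "\<bar>\<integral>z. clip s (F (%i. xr r (k i) (z (k i)))) \<partial>PiM ?A (%_. M)\<bar> <= c1 * (real r powr (- \<theta>) + s powr (1 - w))"
    by (rule F0[OF r s0 inj])
  have w1: "w >= 1" using w4 by simp
  have e: "expectation (%x. \<bar>F (%i. xr r (k i) x) - clip s (F (%i. xr r (k i) x))\<bar>) <= (4 * c1) powr w * s powr (1 - w)"
    by (rule clip_tail_bound[OF approx_L[OF r] w1 s0])
  then have e': "\<bar>expectation (%x. F (%i. xr r (k i) x) - clip s (F (%i. xr r (k i) x)))\<bar> <= (4 * c1) powr w * s powr (1 - w)"
    by (rule order_trans[OF integral_abs_bound])
  have f: "\<bar>expectation (%x. F (%i. \<xi> (k i) x) - F (%i. xr r (k i) x))\<bar> <= c1 * real r powr (- \<theta>)" by (rule Lpb_1(3)[OF FA[OF r] w1])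
  have i1: "integrable M (%x. F (%i. \<xi> (k i) x))" "integrable M (%x. F (%i. xr r (k i) x))"
    using Lpb_1(1)[OF FL w1, of k] Lpb_1(1)[OF approx_L[OF r] w1, of k] by auto
  have i2: "integrable M (%x. clip s (F (%i. xr r (k i) x)))"
    by (rule integrable_bounded_by[where c=s]) (use s0 clip_abs i1 in \<open>auto intro!: measurable_compose[OF _ clip_measurable]\<close>)
  have "expectation (%x. F (%i. \<xi> (k i) x)) = expectation (%x. F (%i. \<xi> (k i) x) - F (%i. xr r (k i) x))
    + expectation (%x. F (%i. xr r (k i) x) - clip s (F (%i. xr r (k i) x))) + expectation (%x. clip s (F (%i. xr r (k i) x)))"
    using i1 i2 by simp
  then have tot: "\<bar>expectation (%x. F (%i. \<xi> (k i) x))\<bar> <= c1 * real r powr (- \<theta>) + (4 * c1) powr w * s powr (1 - w) + 2 * real ell * ph * s + c1 * (real r powr (- \<theta>) + s powr (1 - w))"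
    using a b e' f by linarith
  have r1: "real r >= 1" using r by simp
  have p1: "real r powr (- \<theta>) <= real r powr (- 4)" using theta_bounds(2) r1 by (intro powr_mono) auto
  have x: "\<theta> / w - \<theta> <= - 4" using theta_bounds(5) by (simp add: right_diff_distrib)
  have "s powr (1 - w) = real r powr (\<theta> / w - \<theta>)" unfolding s_def powr_powr using w4 by (simp add: field_simps)
  then have p2: "s powr (1 - w) <= real r powr (- 4)" using x r1 powr_mono[OF x r1] by simp
  have "ph * s = d * (real r powr (- \<theta>) * real r powr (\<theta> / w))" unfolding ph_def l(3) s_def by simp
  also have "... = d * real r powr (\<theta> / w - \<theta>)" by (simp flip: powr_add)
  also have "... <= d * real r powr (- 4)" using powr_mono[OF x r1] d1 by (intro mult_left_mono) auto
  finally have p3: "2 * real ell * (ph * s) <= 2 * real ell * (d * real r powr (- 4))" by (intro mult_left_mono) auto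
  have "c1 * real r powr (- \<theta>) <= c1 * real r powr (- 4)" "(4 * c1) powr w * s powr (1 - w) <= (4 * c1) powr w * real r powr (- 4)"
    "c1 * s powr (1 - w) <= c1 * real r powr (- 4)" using p1 p2 c1 by (auto intro!: mult_left_mono)
  then show ?thesis using tot p3 by (simp add: algebra_simps)
qed

text \<open>Indices with two positions within \<open>3 * r\<close> number at most a constant times
  \<open>r\<close> and contribute bounded means; all others contribute at most a constant times
  \<open>r powr (- 4)\<close> each.\<close>

lemma mean_negligible:
  fixes pos :: "nat => nat => nat => nat"
  assumes cnt: "!!i j. i < ell ==> j < ell ==> i \<noteq> j ==> \<exists>E N0. \<forall>N\<ge>N0. \<forall>L. 2 * L <= N -->
      card {n\<in>{1..N}. \<bar>int (pos N n i) - int (pos N n j)\<bar> <= int L} <= E * (2 * L + 1)"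
  shows "(%N. (\<Sum>n\<in>{1..N}. \<bar>expectation (%x. F (%i. \<xi> (pos N n i) x))\<bar>) / sqrt N) \<longlonglongrightarrow> 0"
proof -
  define I where "I = {p. fst p < ell \<and> snd p < ell \<and> fst p \<noteq> (snd p :: nat)}"
  have fI: "finite I" by (rule finite_subset[of _ "{..<ell} \<times> {..<ell}"]) (auto simp: I_def)
  define Q where "Q = (%p E N0. \<forall>N\<ge>N0. \<forall>L. 2 * L <= N -->
      card {n\<in>{1..N}. \<bar>int (pos N n (fst p)) - int (pos N n (snd p))\<bar> <= int L} <= E * (2 * L + 1))"
  have "\<exists>E N0. Q p E N0" if "p \<in> I" for p
    unfolding Q_def by (rule cnt) (use that in \<open>auto simp: I_def\<close>)
  then have "\<forall>p\<in>I. \<exists>z. Q p (fst z) (snd z)" by simp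
  from bchoice[OF this] obtain z where z: "\<forall>p\<in>I. Q p (fst (z p)) (snd (z p))" by blast
  define E where "E = (%p. fst (z p))"
  define N0 where "N0 = (%p. snd (z p))"
  have EN: "card {n\<in>{1..N}. \<bar>int (pos N n (fst p)) - int (pos N n (snd p))\<bar> <= int L} <= E p * (2 * L + 1)"
    if "p \<in> I" "N >= N0 p" "2 * L <= N" for p N L
    using bspec[OF z that(1)] that(2,3) unfolding Q_def E_def N0_def by simp
  define E' where "E' = (\<Sum>p\<in>I. E p)"
  define Cm where "Cm = 3 * c1 + (4 * c1) powr w + 2 * real ell * d"
  have Cm0: "Cm >= 0" using c1 d1 by (simp add: Cm_def)
  define X where "X = (%N n. \<bar>expectation (%x. F (%i. \<xi> (pos N n i) x))\<bar>)"
  have Xc: "X N n <= c1" for N n unfolding X_def by (rule Lpb_1(3)[OF FL]) (use w4 in simp)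
  have bound: "(\<Sum>n\<in>{1..N}. X N n) <= Cm * (real N * real r powr (- 4)) + c1 * (real E' * (6 * real r + 1))"
    if N: "!!p. p \<in> I ==> N >= N0 p" and r: "r >= 1" "6 * r <= N" for N r
  proof -
    define Bd where "Bd = (\<Union>p\<in>I. {n\<in>{1..N}. \<bar>int (pos N n (fst p)) - int (pos N n (snd p))\<bar> <= int (3 * r)})"
    have Bs: "Bd \<subseteq> {1..N}" by (auto simp: Bd_def)
    have "card Bd <= (\<Sum>p\<in>I. card {n\<in>{1..N}. \<bar>int (pos N n (fst p)) - int (pos N n (snd p))\<bar> <= int (3 * r)})"
      unfolding Bd_def by (rule card_UN_le[OF fI])
    also have "... <= (\<Sum>p\<in>I. E p * (2 * (3 * r) + 1))" by (rule sum_mono, rule EN) (use N r in auto)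
    also have "... = E' * (6 * r + 1)" unfolding E'_def sum_distrib_right by (rule sum.cong) simp_all
    finally have "real (card Bd) <= real (E' * (6 * r + 1))" by (simp only: of_nat_le_iff)
    then have cB: "real (card Bd) <= real E' * (6 * real r + 1)" unfolding of_nat_mult of_nat_add of_nat_1 of_nat_numeral .
    have good: "X N n <= Cm * real r powr (- 4)" if n: "n \<in> {1..N} - Bd" for n
      unfolding X_def Cm_def
    proof (rule mean_bound[OF r(1)])
      fix i j assume ij: "i < ell" "j < ell" "i \<noteq> j"
      then have "(i, j) \<in> I" by (simp add: I_def)
      then have "\<not> \<bar>int (pos N n i) - int (pos N n j)\<bar> <= int (3 * r)" using n by (force simp: Bd_def)
      then show "pos N n i + 3 * r <= pos N n j \<or> pos N n j + 3 * r <= pos N n i" by linarith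
    qed
    have "(\<Sum>n\<in>{1..N}. X N n) = (\<Sum>n\<in>{1..N} - Bd. X N n) + (\<Sum>n\<in>Bd. X N n)" by (rule sum.subset_diff[OF Bs]) simp
    also have "... <= (\<Sum>n\<in>{1..N} - Bd. Cm * real r powr (- 4)) + (\<Sum>n\<in>Bd. c1)" by (intro add_mono sum_mono good Xc) auto
    also have "... = real (card ({1..N} - Bd)) * (Cm * real r powr (- 4)) + real (card Bd) * c1" by simp
    also have "... <= real N * (Cm * real r powr (- 4)) + (real E' * (6 * real r + 1)) * c1"
    proof (intro add_mono mult_right_mono cB)
      have "card ({1..N} - Bd) <= card {1..N}" by (rule card_mono) auto
      then show "real (card ({1..N} - Bd)) <= real N" by simp
    qed (use Cm0 c1 in auto)
    finally show ?thesis by (simp add: mult_ac)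
  qed
  have big: "\<forall>\<^sub>F N in sequentially. \<forall>p\<in>I. N >= N0 p" by (rule eventually_ball_finite[OF fI]) (auto intro: eventually_ge_at_top)
  have p6: "\<forall>\<^sub>F N::nat in sequentially. 12 * real N powr (1/6) <= real N" by real_asymp
  have lim: "(%N::nat. Cm * real N powr (- 1/6) + c1 * real E' * 13 * real N powr (- 1/3)) \<longlonglongrightarrow> Cm * 0 + c1 * real E' * 13 * 0"
    by (intro tendsto_intros tendsto_neg_powr filterlim_real_sequentially) auto
  have le: "\<forall>\<^sub>F N in sequentially. norm ((\<Sum>n\<in>{1..N}. X N n) / sqrt N) <= Cm * real N powr (- 1/6) + c1 * real E' * 13 * real N powr (- 1/3)"
    using big p6 eventually_ge_at_top[of "1::nat"]
  proof eventually_elim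
    case (elim N)
    define x where "x = real N"
    have x1: "x >= 1" using elim by (simp add: x_def)
    have y1: "x powr (1/6) >= 1" using x1 by (simp add: ge_one_powr_ge_zero)
    \<comment> \<open>With \<open>r\<close> of the order of \<open>N powr (1/6)\<close> the two
      contributions, \<open>N * r powr (- 4)\<close> and \<open>r\<close>, are
      \<open>N powr (1/3)\<close> and \<open>N powr (1/6)\<close>, both below \<open>sqrt N\<close>;
      the exponents of the limit follow on division. The condition
      \<open>12 * N powr (1/6) <= N\<close> provides \<open>6 * r <= N\<close>, the range in which
      close positions are counted.\<close>
    define r where "r = nat \<lceil>x powr (1/6)\<rceil>"
    have rge: "x powr (1/6) <= real r" unfolding r_def by linarith
    have rle: "real r <= 2 * x powr (1/6)" unfolding r_def using y1 by linarith
    have r1: "r >= 1" using rge y1 by linarith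
    have "real (6 * r) <= real N" using rle elim(2) by (simp add: x_def)
    then have r6: "6 * r <= N" by linarith
    have "(\<Sum>n\<in>{1..N}. X N n) <= Cm * (x * real r powr (- 4)) + c1 * (real E' * (6 * real r + 1))"
      unfolding x_def by (rule bound) (use elim(1) r1 r6 in auto)
    also have "... <= Cm * (x * x powr (- 4/6)) + c1 * (real E' * (13 * x powr (1/6)))"
    proof (intro add_mono mult_left_mono)
      have "real r powr (- 4) <= (x powr (1/6)) powr (- 4)" by (rule powr_mono2') (use rge y1 in auto)
      then show "real r powr (- 4) <= x powr (- 4/6)" by (simp add: powr_powr)
      show "6 * real r + 1 <= 13 * x powr (1/6)" using rle y1 by linarith
    qed (use Cm0 c1 x1 in \<open>auto simp: x_def\<close>)
    finally have b: "(\<Sum>n\<in>{1..N}. X N n) <= Cm * (x * x powr (- 4/6)) + c1 * (real E' * (13 * x powr (1/6)))" .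
    have "(\<Sum>n\<in>{1..N}. X N n) / sqrt x <= (Cm * (x * x powr (- 4/6)) + c1 * (real E' * (13 * x powr (1/6)))) / sqrt x"
      using b x1 by (intro divide_right_mono) auto
    also have "... = Cm * (x powr (1 + - 4/6 - 1/2)) + c1 * real E' * 13 * x powr (1/6 - 1/2)"
      unfolding powr_diff powr_add using x1 by (simp add: powr_half_sqrt add_divide_distrib)
    finally have "(\<Sum>n\<in>{1..N}. X N n) / sqrt x <= Cm * x powr (- 1/6) + c1 * real E' * 13 * x powr (- 1/3)" by simp
    moreover have "0 <= (\<Sum>n\<in>{1..N}. X N n) / sqrt x" using x1 by (intro divide_nonneg_nonneg sum_nonneg) (auto simp: X_def)
    ultimately show ?case by (simp add: x_def)
  qed
  have "(%N. (\<Sum>n\<in>{1..N}. X N n) / sqrt N) \<longlonglongrightarrow> 0"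
    by (rule Lim_null_comparison[OF le]) (use lim in simp)
  then show ?thesis by (simp add: X_def)
qed

end

theorem mainTheorem3:
  fixes M :: "'a measure"
    and \<xi> :: "nat \<Rightarrow> 'a \<Rightarrow> 'b::euclidean_space"
    and Fs :: "ereal \<Rightarrow> ereal \<Rightarrow> 'a measure"
    and F :: "(nat \<Rightarrow> 'b) \<Rightarrow> real"
    and ell :: nat
    and c :: "nat \<Rightarrow> nat \<times> nat \<Rightarrow> nat"
    and K \<iota> \<kappa> w q v d \<theta> :: real
    and b :: "real \<Rightarrow> real \<Rightarrow> real"
  assumes prob: "prob_space M"
    and meas: "\<And>n. \<xi> n \<in> borel_measurable M"
    and subalg: "\<And>k l. k \<le> l \<Longrightarrow> subalgebra M (Fs k l)"
    and mono_F: "\<And>k l k' l'. k \<le> l \<Longrightarrow> k' \<le> l' \<Longrightarrow> k' \<le> k \<Longrightarrow> l \<le> l' \<Longrightarrow>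
                   sets (Fs k l) \<subseteq> sets (Fs k' l')"
    and stat1: "\<And>n. distr M borel (\<xi> n) = distr M borel (\<xi> 0)"
    and stat2: "\<And>n m k. distr M borel (\<lambda>\<omega>. (\<xi> n \<omega>, \<xi> (n + k) \<omega>)) =
                         distr M borel (\<lambda>\<omega>. (\<xi> m \<omega>, \<xi> (m + k) \<omega>))"
    and l_pos: "ell \<ge> 1"
    and K_pos: "K > 0" and iota_nonneg: "\<iota> \<ge> 0" and kappa: "0 < \<kappa>" "\<kappa> \<le> 1"
    and F_hoelder: "\<And>x z. \<bar>F x - F z\<bar> \<le>
          K * (1 + (\<Sum>i<ell. npow (norm (x i)) \<iota> + npow (norm (z i)) \<iota>)) *
          (\<Sum>i<ell. norm (x i - z i) powr \<kappa>)"
    and F_growth: "\<And>x. \<bar>F x\<bar> \<le> K * (1 + (\<Sum>i<ell. npow (norm (x i)) \<iota>))"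
    and M_w: "w > 4" and M_q: "q \<ge> 1" and M_v: "v > 0"
    and M_exp: "1 / w > \<iota> / v + \<kappa> / q"
    and M_mom: "Lp_norm M v (\<xi> 0) < \<infinity>" "Lp_norm M w (\<xi> 0) < \<infinity>" "Lp_norm M q (\<xi> 0) < \<infinity>"
    and Mix_d: "d \<ge> 1" and Mix_theta: "\<theta> > 2"
    and Mix: "\<And>n::nat. n \<ge> 1 \<Longrightarrow> beta_approx M Fs \<xi> q n < \<infinity> \<and>
          phi_mix M Fs n + real_of_ereal (beta_approx M Fs \<xi> q n) powr \<kappa> \<le> d * real n powr (- \<theta>)"
    and theta_big: "\<theta> > 4 * w / (w - 2)"
    and poly_fin: "\<And>i. i < ell \<Longrightarrow> finite {p. c i p \<noteq> 0}"
    and poly_n: "\<And>i. i < ell \<Longrightarrow> \<exists>p. c i p \<noteq> 0 \<and> fst p \<ge> 1"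
    and poly_deg: "\<And>i. i + 1 < ell \<Longrightarrow> deg2 (c i) \<le> deg2 (c (i + 1))"
    and poly_diff: "\<And>i j. i < ell \<Longrightarrow> j < ell \<Longrightarrow> i \<noteq> j \<Longrightarrow>
          \<not> (\<exists>C::int. \<forall>n N. int (poly2 (c i) n N) - int (poly2 (c j) n N) = C)"
    and poly_lin: "\<And>i. i < ell \<Longrightarrow> deg2 (c i) = 1 \<Longrightarrow>
          \<exists>a b::int. \<forall>n N. int (poly2 (c i) n N) = a * int n + b * int N"
    and Fbar0: "(\<integral>x. F x \<partial>(PiM {..<ell} (\<lambda>_. distr M borel (\<xi> 0)))) = 0"
    and cov_lim: "\<And>t s. t \<in> {0..1} \<Longrightarrow> s \<in> {0..1} \<Longrightarrow>
          (\<lambda>N. \<integral>\<omega>. S_N F \<xi> c N t \<omega> * S_N F \<xi> c N s \<omega> \<partial>M) \<longlonglongrightarrow> b t s"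
  shows "\<exists>Q. centered_gaussian_D_law Q b \<and>
           conv_distr_D M (\<lambda>N \<omega> t. S_N F \<xi> c N t \<omega>) Q"
proof -
  \<comment> \<open>The exponent \<open>v\<close> is only assumed positive, but conditional
    expectations need moments of order at least 1. Replacing it by \<open>max v w\<close> keeps the
    moment finite and only weakens the term \<open>\<iota> / v\<close>.\<close>
  have "hoelder_functional F ell K \<iota> \<kappa> w q (max v w)"
  proof
    have "\<iota> / max v w \<le> \<iota> / v" using iota_nonneg M_v by (intro divide_left_mono) (auto simp: max_def)
    then show "1 / w > \<iota> / max v w + \<kappa> / q" using M_exp by linarith
  qed (use F_hoelder F_growth K_pos iota_nonneg kappa M_w M_q in auto)
  moreover have "Lp_norm M (max v w) (\<xi> 0) < \<infinity>" using M_mom by (simp add: max_def)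
  ultimately obtain xr Past Fut c1 where "nonconv_array M \<xi> xr Past Fut F ell d \<theta> w c1"
    using nonconv_array_of_mixing[OF prob meas subalg mono_F stat1 _ l_pos _ Mix_d Mix theta_big Fbar0] by blast
  then interpret nonconv_array M \<xi> xr Past Fut F ell d \<theta> w c1 .
  \<comment> \<open>At \<open>N = 0\<close> a polynomial need not be injective in \<open>n\<close>,
    so the positions are redefined there; the normalised sum at \<open>N = 0\<close> is empty and
    does not notice.\<close>
  define pos where "pos = (\<lambda>N n i. if N = 0 then n else poly2 (c i) n N)"
  have S: "S_N F \<xi> c N t = (\<lambda>\<omega>. 1 / sqrt N * (\<Sum>n\<in>{1..nat \<lfloor>real N * t\<rfloor>}. F (\<lambda>i. \<xi> (pos N n i) \<omega>)))" for N t
    by (rule ext, cases "N = 0") (simp_all add: S_N_def pos_def)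
  have inj: "inj (\<lambda>n. pos N n j)" if "j < ell" for N j
    using inj_poly2[OF poly_fin[OF that] poly_n[OF that], of N] by (cases "N = 0") (auto simp: pos_def)
  have mean: "(\<lambda>N. (\<Sum>n\<in>{1..N}. \<bar>expectation (\<lambda>x. F (\<lambda>i. \<xi> (pos N n i) x))\<bar>) / sqrt N) \<longlonglongrightarrow> 0"
  proof (rule mean_negligible)
    fix i j assume ij: "i < ell" "j < ell" "i \<noteq> j"
    obtain E N0 where E: "\<forall>N\<ge>N0. \<forall>L. 2 * L \<le> N \<longrightarrow> card {n\<in>{1..N}. \<bar>int (poly2 (c i) n N) - int (poly2 (c j) n N)\<bar> \<le> int L} \<le> E * (2 * L + 1)"
      using card_near_positions[OF poly_fin[OF ij(1)] poly_fin[OF ij(2)] poly_diff[OF ij]] by blast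
    show "\<exists>E N0. \<forall>N\<ge>N0. \<forall>L. 2 * L \<le> N \<longrightarrow> card {n\<in>{1..N}. \<bar>int (pos N n i) - int (pos N n j)\<bar> \<le> int L} \<le> E * (2 * L + 1)"
      by (intro exI[of _ E] exI[of _ "max N0 1"]) (use E in \<open>simp add: pos_def\<close>)
  qed
  show ?thesis
    using fclt[of pos, OF inj mean] cov_lim unfolding S by simp
qed

end
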